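(* Let $k$, $\chi$, $U(\chi)$, $\tau$ be as in the context. For any $\mathbf c\in k^n$ the operation determined by $$f\star g=\sum_{\rho\in\mathbb N^n}(-1)^{|\rho|}\big(\overline\sigma(F_\rho)\triangleright f\big)\,K_\rho\,\big[g\triangleleft(S^{-1}(E_\rho)K_\rho)\big]\qquad\text{for all }f,g\in U^-,$$ extended to $H_\theta\ltimes U^-$ by $(K_\lambda f)\star(K_\mu g)=\chi(\alpha,\mu)K_{\lambda+\mu}(f\star g)$ for $\lambda,\mu\in\mathbb Z^n_\theta$, $f\in U^-_{-\alpha}$, $g\in U^-$, defines a $0$-equivariant star product on $H_\theta\ltimes U^-$. Moreover, whenever $\varphi:\operatorname{gr}(B_{\mathbf c})\to H_\theta\ltimes U^-$ is an isomorphism, so that the restriction $\psi:B_{\mathbf c}\to H_\theta\ltimes U^-$ is a linear isomorphism and the star product $a*b=\psi(\psi^{-1}(a)\psi^{-1}(b))$ on $H_\theta\ltimes U^-$ is defined, the star products $\star$ and $*$ coincide.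
   Context: Let $k$ be a field, $\mathbb N=\{0,1,2,\dots\}$, $I=\{1,\dots,n\}$, $\{\alpha_i\}_{i\in I}$ the standard basis of $\mathbb Z^n$, $|\lambda|=\sum_i\lambda_i$. Let $\chi:\mathbb Z^n\times\mathbb Z^n\to k^\times$ be a bicharacter with $q_{ij}:=\chi(\alpha_i,\alpha_j)=q_{ji}$ for all $i,j$. $H=k[K_i^{\pm1}\mid i\in I]$ is the group algebra of $\mathbb Z^n$ and $K_\lambda=K_1^{\lambda_1}\cdots K_n^{\lambda_n}$. $\widetilde U(\chi)$ is the Hopf algebra with generators $E_i,F_i,K_i^{\pm1}$, relations $K_iK_i^{-1}=1=K_i^{-1}K_i$, $K_iK_j=K_jK_i$, $K_iE_j=q_{ij}E_jK_i$, $K_iF_j=q_{ij}^{-1}F_jK_i$, $E_iF_j-F_jE_i=\delta_{ij}(K_i-K_i^{-1})$ and coproduct $\Delta(E_i)=E_i\otimes1+K_i\otimes E_i$, $\Delta(F_i)=F_i\otimes K_i^{-1}+1\otimes F_i$, $\Delta(K_i)=K_i\otimes K_i$. The subalgebras generated by the $E_i$, resp. the $F_i$, are the tensor algebras $T(V^+(\chi))$, $T(V^-(\chi))$ on $V^+(\chi)=\mathrm{span}\{E_i\}$, $V^-(\chi)=\mathrm{span}\{F_i\}$. $V^+(\chi)$ is a Yetter–Drinfeld module over $H$ with $K_i\cdot E_j=q_{ij}E_j$, $\delta(E_i)=K_i\otimes E_i$, so $T(V^+(\chi))$ is a $\mathbb Z^n$-graded braided Hopf algebra ($\deg E_i=\alpha_i$).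 $\omega$ is the algebra automorphism of $\widetilde U(\chi)$ with $\omega(E_i)=F_i$, $\omega(F_i)=E_i$, $\omega(K_i)=K_i^{-1}$. Fix a $\mathbb Z^n$-graded biideal $\mathcal I\subseteq\bigoplus_{m\ge2}T(V^+(\chi))_m$. Put $U(\chi)=\widetilde U(\chi)/(\mathcal I,\omega(\mathcal I))$, $U^+=T(V^+(\chi))/\mathcal I$ (a pre-Nichols algebra of diagonal type), $U^-=T(V^-(\chi))/\omega(\mathcal I)$. Multiplication $U^+\otimes H\otimes U^-\to U(\chi)$ is a linear isomorphism; $\deg E_i=\alpha_i$, $\deg F_i=-\alpha_i$. Let $\tau:I\to I$ be a bijection with $\tau^2=\mathrm{id}$, $q_{\tau(i)\tau(j)}=q_{ij}$, and assume $\tau(\mathcal I)=\mathcal I$ for the automorphism $E_i\mapsto E_{\tau(i)}$; extend $\tau$ to $\mathbb Z^n$ by $\tau(\alpha_i)=\alpha_{\tau(i)}$ and put $\mathbb Z^n_\theta=\{\lambda\mid\tau(\lambda)=-\lambda\}$. $H_\theta\subset H$ is the subalgebra generated by all $K_iK_{\tau(i)}^{-1}$ (the group algebra of $\mathbb Z^n_\theta$), and $H_\theta\ltimes U^-$ is the subalgebra of $U(\chi)$ generated by $H_\theta$ and $U^-$. For $\mathbf c\in k^n$, $B_{\mathbf c}\subset U(\chi)$ is the subalgebra generated by $H_\theta$ and $B_i=F_i+c_iE_{\tau(i)}K_i^{-1}$. It is filtered by $\deg(B_i)=1$, $\deg(h)=0$ for $h\in H_\theta$, and $\varphi:\operatorname{gr}(B_{\mathbf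 c})\to H_\theta\ltimes U^-$ is the surjective graded algebra homomorphism with $B_i\mapsto F_i$, $h\mapsto h$. $U(\chi)^{\mathrm{poly}}\supset B_{\mathbf c}$ is the subalgebra of $U(\chi)$ generated by $F_i$, $\widetilde E_i=E_iK_i^{-1}$, $K_i^{-1}$, $K_iK_{\tau(i)}^{-1}$, and $\psi$ is the linear projection onto the first summand of $U(\chi)^{\mathrm{poly}}=(H_\theta\ltimes U^-)\oplus U(\chi)^{\mathrm{poly}}\,\mathrm{span}_k\{\widetilde E_i,K_i^{-1}\mid i\in I\}$. Subscript $\max$: $U^+_{\max}=T(V^+(\chi))/\mathcal I_{\max}(\chi)$, $U^-_{\max}=T(V^-(\chi))/\omega(\mathcal I_{\max}(\chi))$ and $U(\chi)_{\max}=\widetilde U(\chi)/(\mathcal I_{\max}(\chi),\omega(\mathcal I_{\max}(\chi)))$, where $\mathcal I_{\max}(\chi)$ is the maximal $\mathbb Z^n$-graded biideal in $\bigoplus_{m\ge2}T(V^+(\chi))_m$ ($U^\pm_{\max}$ are Nichols algebras). $S$ is the antipode of $U(\chi)_{\max}$. $H\ltimes U^-_{\max}$ and $U^+_{\max}\rtimes H$ are the Hopf subalgebras of $U(\chi)_{\max}$ generated by $H$ and $U^\mp_{\max}$ respectively. There is a unique bilinear pairing $\langle\,,\rangle_{\max}:(H\ltimes U^-_{\max})\otimes(U^+_{\max}\rtimes H)\to k$ with $\langle F_i,E_j\rangle=\delta_{ij}$, $\langle K_i,K_j\rangle=q_{ij}^{-1}$, $\langle F_i,K_j\rangle=0=\langle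 K_i,E_j\rangle$, $\langle y,1\rangle=\varepsilon(y)$, $\langle1,x\rangle=\varepsilon(x)$, $\langle y,xx'\rangle=\langle y_{(1)},x'\rangle\langle y_{(2)},x\rangle$, $\langle yy',x\rangle=\langle y,x_{(1)}\rangle\langle y',x_{(2)}\rangle$ (Sweedler notation for $\Delta$ of $U(\chi)_{\max}$); it restricts to nondegenerate pairings of $(U^-_{\max})_{-\mu}$ with $(U^+_{\max})_\mu$. With $\pi_{\max}$ the canonical projection $H\ltimes U^-\to H\ltimes U^-_{\max}$, the algebra $U^+_{\max}\rtimes H$ acts on $H\ltimes U^-\subset U(\chi)$ from the left and right by $e\triangleright f=\langle\pi_{\max}(f_{(1)}),e\rangle_{\max}f_{(2)}$ and $f\triangleleft e=\langle\pi_{\max}(f_{(2)}),e\rangle_{\max}f_{(1)}$. For each $\mu\in\mathbb N^n$, $F_\mu\otimes E_\mu$ is shorthand for $\sum_jF_{\mu,j}\otimes E_{\mu,j}$ with dual bases $\{F_{\mu,j}\}$ of $(U^-_{\max})_{-\mu}$ and $\{E_{\mu,j}\}$ of $(U^+_{\max})_\mu$. $\overline\sigma:U^-_{\max}\to U^+_{\max}\rtimes H$ is the algebra homomorphism with $\overline\sigma(F_i)=c_{\tau(i)}K_iE_{\tau(i)}$. A star product on an $\mathbb N$-graded $k$-algebra $A=\bigoplus_jA_j$ is an associative bilinear operation $*$ on $A$ with $a*b-ab\in\bigoplus_{j<m+l}A_j$ for $a\in A_m$, $b\in A_l$; it is $0$-equivariant if $a*h=ah$, $h*a=ha$ for all $h\in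 A_0$, $a\in A$. Here $A=H_\theta\ltimes U^-$ with $\deg(h)=0$ ($h\in H_\theta$), $\deg(F_i)=1$. *)

theory Defs
  imports
    "HOL-Algebra.QuotRing"
    "HOL-Algebra.Module"
    "HOL-Algebra.Subrings"
    "HOL-Library.Poly_Mapping"
    "HOL-Library.Product_Plus"
    "HOL-Library.Function_Algebras"
begin

section \<open>Algebras over a field\<close>

text \<open>
  A \<open>k\<close>-algebra is a record of type \<open>('k, 'a) module\<close>: a HOL-Algebra ring together with a
  scalar multiplication by the type \<open>'k\<close>. The field itself is the algebra \<open>base_alg\<close>.
\<close>

definition base_alg :: "('k::field, 'k) module" where
  "base_alg = \<lparr>carrier = UNIV, mult = (*), one = 1, zero = 0, add = (+), smult = (*)\<rparr>"

definition linear_subspace :: "('k::field, 'a) module \<Rightarrow> 'a set \<Rightarrow> bool" where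
  "linear_subspace R V \<longleftrightarrow> submodule V (base_alg :: ('k, 'k) module) R"

definition lin_span :: "('k::field, 'a) module \<Rightarrow> 'a set \<Rightarrow> 'a set" where
  "lin_span R S = \<Inter>{V. linear_subspace R V \<and> S \<subseteq> V}"

definition gen_subalg :: "('k::field, 'a) module \<Rightarrow> 'a set \<Rightarrow> 'a set" where
  "gen_subalg R S = \<Inter>{B. subring B R \<and> linear_subspace R B \<and> S \<subseteq> B}"

definition linear_on :: "('k::field, 'a) module \<Rightarrow> 'a set \<Rightarrow> ('k, 'b) module \<Rightarrow> ('a \<Rightarrow> 'b) \<Rightarrow> bool" where
  "linear_on R V S f \<longleftrightarrow> f \<in> V \<rightarrow> carrier S \<and>
     (\<forall>x\<in>V. \<forall>y\<in>V. f (x \<oplus>\<^bsub>R\<^esub> y) = f x \<oplus>\<^bsub>S\<^esub> f y) \<and>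
     (\<forall>a. \<forall>x\<in>V. f (a \<odot>\<^bsub>R\<^esub> x) = a \<odot>\<^bsub>S\<^esub> f x)"

definition bilinear_on ::
  "('k::field, 'a) module \<Rightarrow> 'a set \<Rightarrow> ('k, 'b) module \<Rightarrow> 'b set \<Rightarrow> ('k, 'c) module \<Rightarrow> ('a \<Rightarrow> 'b \<Rightarrow> 'c) \<Rightarrow> bool" where
  "bilinear_on R V S W T f \<longleftrightarrow>
     (\<forall>y\<in>W. linear_on R V T (\<lambda>x. f x y)) \<and> (\<forall>x\<in>V. linear_on S W T (f x))"

definition alg_hom :: "('k::field, 'a) module \<Rightarrow> ('k, 'b) module \<Rightarrow> ('a \<Rightarrow> 'b) set" where
  "alg_hom R S = {f \<in> ring_hom R S. \<forall>a. \<forall>x\<in>carrier R. f (a \<odot>\<^bsub>R\<^esub> x) = a \<odot>\<^bsub>S\<^esub> f x}"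

definition quot_alg :: "('k::field, 'a) module \<Rightarrow> 'a set \<Rightarrow> ('k, 'a set) module" where
  "quot_alg R J = \<lparr>carrier = carrier (R Quot J), mult = mult (R Quot J), one = one (R Quot J),
     zero = zero (R Quot J), add = add (R Quot J),
     smult = (\<lambda>a A. \<Union>x\<in>A. J +>\<^bsub>R\<^esub> (a \<odot>\<^bsub>R\<^esub> x))\<rparr>"

definition is_basis :: "('k::field, 'a) module \<Rightarrow> 'a set \<Rightarrow> nat \<Rightarrow> (nat \<Rightarrow> 'a) \<Rightarrow> bool" where
  "is_basis R V d b \<longleftrightarrow> (\<forall>j<d. b j \<in> V) \<and>
     (\<forall>v\<in>V. \<exists>!a. (\<forall>j\<ge>d. a j = 0) \<and> v = (\<Oplus>\<^bsub>R\<^esub>j\<in>{..<d}. a j \<odot>\<^bsub>R\<^esub> b j))"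

text \<open>
  \<open>graded_products R H G m\<close>: products of elements of \<open>H\<close> (degree 0) and of exactly \<open>m\<close> elements
  of \<open>G\<close> (degree 1), in any order.
\<close>

inductive_set graded_products :: "('k, 'a) module \<Rightarrow> 'a set \<Rightarrow> 'a set \<Rightarrow> (nat \<times> 'a) set"
  for R :: "('k, 'a) module" and H G :: "'a set" where
  one: "(0, \<one>\<^bsub>R\<^esub>) \<in> graded_products R H G"
| deg0: "(m, x) \<in> graded_products R H G \<Longrightarrow> h \<in> H \<Longrightarrow> (m, x \<otimes>\<^bsub>R\<^esub> h) \<in> graded_products R H G"
| deg1: "(m, x) \<in> graded_products R H G \<Longrightarrow> g \<in> G \<Longrightarrow> (Suc m, x \<otimes>\<^bsub>R\<^esub> g) \<in> graded_products R H G"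

definition gen_component :: "('k::field, 'a) module \<Rightarrow> 'a set \<Rightarrow> 'a set \<Rightarrow> nat \<Rightarrow> 'a set" where
  "gen_component R H G m = lin_span R {x. (m, x) \<in> graded_products R H G}"

definition gen_filtration :: "('k::field, 'a) module \<Rightarrow> 'a set \<Rightarrow> 'a set \<Rightarrow> nat \<Rightarrow> 'a set" where
  "gen_filtration R H G m = lin_span R {x. \<exists>j\<le>m. (j, x) \<in> graded_products R H G}"

text \<open>
  The associated graded algebra of a filtered algebra: finitely supported families
  of elements of the quotients of consecutive filtration steps.
\<close>

definition fil_below :: "('k::field, 'a) module \<Rightarrow> (nat \<Rightarrow> 'a set) \<Rightarrow> nat \<Rightarrow> 'a set" where
  "fil_below R Fil m = (case m of 0 \<Rightarrow> {\<zero>\<^bsub>R\<^esub>} | Suc l \<Rightarrow> Fil l)"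

definition gr_symbol :: "('k::field, 'a) module \<Rightarrow> (nat \<Rightarrow> 'a set) \<Rightarrow> nat \<Rightarrow> 'a \<Rightarrow> (nat \<Rightarrow> 'a set)" where
  "gr_symbol R Fil m x =
     (\<lambda>j. if j = m then fil_below R Fil m +>\<^bsub>R\<^esub> x else fil_below R Fil j)"

definition gr_alg :: "('k::field, 'a) module \<Rightarrow> (nat \<Rightarrow> 'a set) \<Rightarrow> ('k, nat \<Rightarrow> 'a set) module" where
  "gr_alg R Fil =
    \<lparr>carrier = {g. (\<forall>m. \<exists>x\<in>Fil m. g m = fil_below R Fil m +>\<^bsub>R\<^esub> x) \<and> finite {m. g m \<noteq> fil_below R Fil m}},
     mult = (\<lambda>g h m. \<Union>{fil_below R Fil m +>\<^bsub>R\<^esub> (\<Oplus>\<^bsub>R\<^esub>i\<in>{..m}. x i \<otimes>\<^bsub>R\<^esub> y (m - i)) | x y.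
               \<forall>i. x i \<in> g i \<and> y i \<in> h i}),
     one = gr_symbol R Fil 0 \<one>\<^bsub>R\<^esub>,
     zero = fil_below R Fil,
     add = (\<lambda>g h m. g m <+>\<^bsub>R\<^esub> h m),
     smult = (\<lambda>a g m. \<Union>x\<in>g m. fil_below R Fil m +>\<^bsub>R\<^esub> (a \<odot>\<^bsub>R\<^esub> x))\<rparr>"

text \<open>
  Star products on the graded algebra \<open>A = \<Oplus>\<^sub>m gr m\<close>, given as a subalgebra \<open>A\<close> of \<open>R\<close>.
\<close>

definition star_product ::
  "('k::field, 'a) module \<Rightarrow> 'a set \<Rightarrow> (nat \<Rightarrow> 'a set) \<Rightarrow> ('a \<Rightarrow> 'a \<Rightarrow> 'a) \<Rightarrow> bool" where
  "star_product R A gr st \<longleftrightarrow>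
     (\<forall>a\<in>A. \<forall>b\<in>A. st a b \<in> A) \<and>
     bilinear_on R A R A R st \<and>
     (\<forall>a\<in>A. \<forall>b\<in>A. \<forall>c\<in>A. st (st a b) c = st a (st b c)) \<and>
     (\<forall>m l. \<forall>a\<in>gr m. \<forall>b\<in>gr l. st a b \<ominus>\<^bsub>R\<^esub> (a \<otimes>\<^bsub>R\<^esub> b) \<in> lin_span R (\<Union>j<m + l. gr j))"

definition zero_equivariant ::
  "('k::field, 'a) module \<Rightarrow> 'a set \<Rightarrow> (nat \<Rightarrow> 'a set) \<Rightarrow> ('a \<Rightarrow> 'a \<Rightarrow> 'a) \<Rightarrow> bool" where
  "zero_equivariant R A gr st \<longleftrightarrow>
     (\<forall>h\<in>gr 0. \<forall>a\<in>A. st a h = a \<otimes>\<^bsub>R\<^esub> h \<and> st h a = h \<otimes>\<^bsub>R\<^esub> a)"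


section \<open>Free algebras and their tensor squares\<close>

datatype 'g word = Word (letters: "'g list")

instantiation word :: (type) monoid_add
begin
definition zero_word :: "'a word" where "zero_word = Word []"
definition plus_word :: "'a word \<Rightarrow> 'a word \<Rightarrow> 'a word" where
  "plus_word u v = Word (letters u @ letters v)"
instance by standard (simp_all add: zero_word_def plus_word_def)
end

text \<open>
  For a monoid \<open>'w\<close>, \<open>'w \<Rightarrow>\<^sub>0 'k\<close> with convolution is the monoid algebra. For \<open>'w = 'g word\<close> it is the
  free algebra on \<open>'g\<close>, and for \<open>'w = 'g word \<times> 'g word\<close> its tensor square with the usual
  (unbraided) product.
\<close>

definition monoid_alg :: "('k::field, 'w::monoid_add \<Rightarrow>\<^sub>0 'k) module" where
  "monoid_alg = \<lparr>carrier = UNIV, mult = (*), one = 1, zero = 0, add = (+),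
     smult = (\<lambda>a x. Poly_Mapping.single 0 a * x)\<rparr>"

definition gen :: "'g \<Rightarrow> ('g word \<Rightarrow>\<^sub>0 'k::field)" where
  "gen g = Poly_Mapping.single (Word [g]) 1"

definition free_hom :: "('k::field, 'b) module \<Rightarrow> ('g \<Rightarrow> 'b) \<Rightarrow> ('g word \<Rightarrow>\<^sub>0 'k) \<Rightarrow> 'b" where
  "free_hom R f x = (\<Oplus>\<^bsub>R\<^esub>w\<in>Poly_Mapping.keys x.
     Poly_Mapping.lookup x w \<odot>\<^bsub>R\<^esub> foldr (\<lambda>g y. f g \<otimes>\<^bsub>R\<^esub> y) (letters w) \<one>\<^bsub>R\<^esub>)"

definition tens :: "('v \<Rightarrow>\<^sub>0 'k::field) \<Rightarrow> ('w \<Rightarrow>\<^sub>0 'k) \<Rightarrow> ('v \<times> 'w \<Rightarrow>\<^sub>0 'k)" where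
  "tens x y = (\<Sum>v\<in>Poly_Mapping.keys x. \<Sum>w\<in>Poly_Mapping.keys y.
     Poly_Mapping.single (v, w) (Poly_Mapping.lookup x v * Poly_Mapping.lookup y w))"

text \<open>\<open>J \<otimes> T + T \<otimes> J\<close> for a subspace \<open>J\<close> of a free algebra \<open>T\<close>.\<close>

definition tens_ideal :: "('g word \<Rightarrow>\<^sub>0 'k::field) set \<Rightarrow> ('g word \<times> 'g word \<Rightarrow>\<^sub>0 'k) set" where
  "tens_ideal J = lin_span monoid_alg {tens a b | a b. a \<in> J \<or> b \<in> J}"


section \<open>Bicharacters and the braided Hopf algebra \<open>T(V\<^sup>+(\<chi>))\<close>\<close>

text \<open>\<open>\<int>\<^sup>n\<close> is \<open>'i \<Rightarrow> int\<close> with pointwise addition, where \<open>'i\<close> is the index set \<open>I\<close>.\<close>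

definition \<alpha> :: "'i \<Rightarrow> ('i \<Rightarrow> int)" where
  "\<alpha> i = (\<lambda>j. if j = i then 1 else 0)"

definition int_vec :: "('i \<Rightarrow> nat) \<Rightarrow> ('i \<Rightarrow> int)" where
  "int_vec \<rho> = (\<lambda>i. int (\<rho> i))"

definition bicharacter :: "(('i \<Rightarrow> int) \<Rightarrow> ('i \<Rightarrow> int) \<Rightarrow> 'k::field) \<Rightarrow> bool" where
  "bicharacter \<chi> \<longleftrightarrow>
     (\<forall>x y. \<chi> x y \<noteq> 0) \<and>
     (\<forall>x y z. \<chi> (x + y) z = \<chi> x z * \<chi> y z) \<and>
     (\<forall>x y z. \<chi> x (y + z) = \<chi> x y * \<chi> x z)"

definition word_degree :: "('g \<Rightarrow> ('i \<Rightarrow> int)) \<Rightarrow> 'g word \<Rightarrow> ('i \<Rightarrow> int)" where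
  "word_degree dg w = sum_list (map dg (letters w))"

text \<open>
  The tensor square of \<open>T(V\<^sup>+(\<chi>))\<close> in the category of Yetter-Drinfeld modules:
  \<open>(a \<otimes> b) (a' \<otimes> b') = \<chi> (deg b) (deg a') (a a' \<otimes> b b')\<close>.
\<close>

definition braided_mult :: "(('i \<Rightarrow> int) \<Rightarrow> ('i \<Rightarrow> int) \<Rightarrow> 'k::field) \<Rightarrow>
    ('i word \<times> 'i word \<Rightarrow>\<^sub>0 'k) \<Rightarrow> ('i word \<times> 'i word \<Rightarrow>\<^sub>0 'k) \<Rightarrow> ('i word \<times> 'i word \<Rightarrow>\<^sub>0 'k)" where
  "braided_mult \<chi> x y = (\<Sum>p\<in>Poly_Mapping.keys x. \<Sum>p'\<in>Poly_Mapping.keys y.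
     Poly_Mapping.single (p + p')
       (\<chi> (word_degree \<alpha> (snd p)) (word_degree \<alpha> (fst p'))
         * Poly_Mapping.lookup x p * Poly_Mapping.lookup y p'))"

definition braided_square ::
  "(('i \<Rightarrow> int) \<Rightarrow> ('i \<Rightarrow> int) \<Rightarrow> 'k::field) \<Rightarrow> ('k, 'i word \<times> 'i word \<Rightarrow>\<^sub>0 'k) module" where
  "braided_square \<chi> = monoid_alg\<lparr>mult := braided_mult \<chi>\<rparr>"

definition braided_coproduct :: "(('i \<Rightarrow> int) \<Rightarrow> ('i \<Rightarrow> int) \<Rightarrow> 'k::field) \<Rightarrow>
    ('i word \<Rightarrow>\<^sub>0 'k) \<Rightarrow> ('i word \<times> 'i word \<Rightarrow>\<^sub>0 'k)" where
  "braided_coproduct \<chi> = free_hom (braided_square \<chi>) (\<lambda>i. tens (gen i) 1 + tens 1 (gen i))"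

definition braided_counit :: "('i word \<Rightarrow>\<^sub>0 'k::field) \<Rightarrow> 'k" where
  "braided_counit = free_hom base_alg (\<lambda>i. 0)"

definition hom_part :: "('i \<Rightarrow> int) \<Rightarrow> ('i word \<Rightarrow>\<^sub>0 'k::field) \<Rightarrow> ('i word \<Rightarrow>\<^sub>0 'k)" where
  "hom_part \<mu> x = (\<Sum>w\<in>{w \<in> Poly_Mapping.keys x. word_degree \<alpha> w = \<mu>}.
     Poly_Mapping.single w (Poly_Mapping.lookup x w))"

text \<open>\<open>\<int>\<^sup>n\<close>-graded biideals contained in \<open>\<Oplus>\<^bsub>m \<ge> 2\<^esub> T(V\<^sup>+(\<chi>))\<^sub>m\<close>.\<close>

definition graded_biideal ::
  "(('i \<Rightarrow> int) \<Rightarrow> ('i \<Rightarrow> int) \<Rightarrow> 'k::field) \<Rightarrow> ('i word \<Rightarrow>\<^sub>0 'k) set \<Rightarrow> bool" where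
  "graded_biideal \<chi> I \<longleftrightarrow>
     ideal I (monoid_alg :: ('k, 'i word \<Rightarrow>\<^sub>0 'k) module) \<and>
     (\<forall>x\<in>I. \<forall>\<mu>. hom_part \<mu> x \<in> I) \<and>
     (\<forall>x\<in>I. braided_coproduct \<chi> x \<in> tens_ideal I \<and> braided_counit x = 0) \<and>
     (\<forall>x\<in>I. \<forall>w\<in>Poly_Mapping.keys x. 2 \<le> length (letters w))"

definition I_max :: "(('i \<Rightarrow> int) \<Rightarrow> ('i \<Rightarrow> int) \<Rightarrow> 'k::field) \<Rightarrow> ('i word \<Rightarrow>\<^sub>0 'k) set" where
  "I_max \<chi> = (GREATEST I. graded_biideal \<chi> I)"


section \<open>The algebras \<open>U(\<chi>)\<close>\<close>

text \<open>\<open>GL i\<close> is the generator \<open>K\<^sub>i\<close> inverse.\<close>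

datatype 'i uq_gen = GE 'i | GF 'i | GK 'i | GL 'i

type_synonym ('i, 'k) free_uq = "'i uq_gen word \<Rightarrow>\<^sub>0 'k"

fun uq_degree :: "'i uq_gen \<Rightarrow> ('i \<Rightarrow> int)" where
  "uq_degree (GE i) = \<alpha> i"
| "uq_degree (GF i) = - \<alpha> i"
| "uq_degree (GK i) = 0"
| "uq_degree (GL i) = 0"

definition uq_relations ::
  "(('i \<Rightarrow> int) \<Rightarrow> ('i \<Rightarrow> int) \<Rightarrow> 'k::field) \<Rightarrow> ('i, 'k) free_uq set" where
  "uq_relations \<chi> =
     (\<Union>i. {gen (GK i) * gen (GL i) - 1, gen (GL i) * gen (GK i) - 1}) \<union>
     (\<Union>i j. {gen (GK i) * gen (GK j) - gen (GK j) * gen (GK i),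
       gen (GK i) * gen (GE j) - Poly_Mapping.single 0 (\<chi> (\<alpha> i) (\<alpha> j)) * gen (GE j) * gen (GK i),
       gen (GK i) * gen (GF j) - Poly_Mapping.single 0 (inverse (\<chi> (\<alpha> i) (\<alpha> j))) * gen (GF j) * gen (GK i),
       gen (GE i) * gen (GF j) - gen (GF j) * gen (GE i) - (if i = j then gen (GK i) - gen (GL i) else 0)})"

definition embed_pos :: "('i word \<Rightarrow>\<^sub>0 'k::field) \<Rightarrow> ('i, 'k) free_uq" where
  "embed_pos = free_hom monoid_alg (\<lambda>i. gen (GE i))"

fun \<omega>_gen :: "'i uq_gen \<Rightarrow> 'i uq_gen" where
  "\<omega>_gen (GE i) = GF i"
| "\<omega>_gen (GF i) = GE i"
| "\<omega>_gen (GK i) = GL i"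
| "\<omega>_gen (GL i) = GK i"

definition \<omega> :: "('i, 'k::field) free_uq \<Rightarrow> ('i, 'k) free_uq" where
  "\<omega> = free_hom monoid_alg (\<lambda>g. gen (\<omega>_gen g))"

definition uq_ideal :: "(('i \<Rightarrow> int) \<Rightarrow> ('i \<Rightarrow> int) \<Rightarrow> 'k::field) \<Rightarrow> ('i word \<Rightarrow>\<^sub>0 'k) set \<Rightarrow> ('i, 'k) free_uq set" where
  "uq_ideal \<chi> I = Idl\<^bsub>(monoid_alg :: ('k, ('i, 'k) free_uq) module)\<^esub>
     (uq_relations \<chi> \<union> embed_pos ` I \<union> \<omega> ` embed_pos ` I)"

definition U :: "(('i \<Rightarrow> int) \<Rightarrow> ('i \<Rightarrow> int) \<Rightarrow> 'k::field) \<Rightarrow> ('i word \<Rightarrow>\<^sub>0 'k) set \<Rightarrow> ('k, ('i, 'k) free_uq set) module" where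
  "U \<chi> I = quot_alg monoid_alg (uq_ideal \<chi> I)"

definition cls :: "(('i \<Rightarrow> int) \<Rightarrow> ('i \<Rightarrow> int) \<Rightarrow> 'k::field) \<Rightarrow> ('i word \<Rightarrow>\<^sub>0 'k) set \<Rightarrow> ('i, 'k) free_uq \<Rightarrow> ('i, 'k) free_uq set" where
  "cls \<chi> I x = uq_ideal \<chi> I +>\<^bsub>(monoid_alg :: ('k, ('i, 'k) free_uq) module)\<^esub> x"

abbreviation "uE \<chi> I i \<equiv> cls \<chi> I (gen (GE i))"
abbreviation "uF \<chi> I i \<equiv> cls \<chi> I (gen (GF i))"
abbreviation "uK \<chi> I i \<equiv> cls \<chi> I (gen (GK i))"
abbreviation "uL \<chi> I i \<equiv> cls \<chi> I (gen (GL i))"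

text \<open>The order on \<open>'i\<close> is only used to write \<open>K\<^sub>\<lambda>\<close> as a product.\<close>

definition uKK :: "(('i::{finite,linorder} \<Rightarrow> int) \<Rightarrow> ('i \<Rightarrow> int) \<Rightarrow> 'k::field) \<Rightarrow> ('i word \<Rightarrow>\<^sub>0 'k) set \<Rightarrow>
    ('i \<Rightarrow> int) \<Rightarrow> ('i, 'k) free_uq set" where
  "uKK \<chi> I \<nu> = cls \<chi> I (\<Prod>i\<leftarrow>sorted_list_of_set UNIV.
     if 0 \<le> \<nu> i then gen (GK i) ^ nat (\<nu> i) else gen (GL i) ^ nat (- \<nu> i))"

definition U_component :: "(('i \<Rightarrow> int) \<Rightarrow> ('i \<Rightarrow> int) \<Rightarrow> 'k::field) \<Rightarrow> ('i word \<Rightarrow>\<^sub>0 'k) set \<Rightarrow>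
    ('i \<Rightarrow> int) \<Rightarrow> ('i, 'k) free_uq set set" where
  "U_component \<chi> I \<mu> = cls \<chi> I ` {x. \<forall>w\<in>Poly_Mapping.keys x. word_degree uq_degree w = \<mu>}"

definition U_pos :: "(('i \<Rightarrow> int) \<Rightarrow> ('i \<Rightarrow> int) \<Rightarrow> 'k::field) \<Rightarrow> ('i word \<Rightarrow>\<^sub>0 'k) set \<Rightarrow> ('i, 'k) free_uq set set" where
  "U_pos \<chi> I = gen_subalg (U \<chi> I) (range (uE \<chi> I))"

definition U_neg :: "(('i \<Rightarrow> int) \<Rightarrow> ('i \<Rightarrow> int) \<Rightarrow> 'k::field) \<Rightarrow> ('i word \<Rightarrow>\<^sub>0 'k) set \<Rightarrow> ('i, 'k) free_uq set set" where
  "U_neg \<chi> I = gen_subalg (U \<chi> I) (range (uF \<chi> I))"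

definition U_pos_H :: "(('i \<Rightarrow> int) \<Rightarrow> ('i \<Rightarrow> int) \<Rightarrow> 'k::field) \<Rightarrow> ('i word \<Rightarrow>\<^sub>0 'k) set \<Rightarrow> ('i, 'k) free_uq set set" where
  "U_pos_H \<chi> I = gen_subalg (U \<chi> I) (range (uE \<chi> I) \<union> range (uK \<chi> I) \<union> range (uL \<chi> I))"

definition H_U_neg :: "(('i \<Rightarrow> int) \<Rightarrow> ('i \<Rightarrow> int) \<Rightarrow> 'k::field) \<Rightarrow> ('i word \<Rightarrow>\<^sub>0 'k) set \<Rightarrow> ('i, 'k) free_uq set set" where
  "H_U_neg \<chi> I = gen_subalg (U \<chi> I) (range (uF \<chi> I) \<union> range (uK \<chi> I) \<union> range (uL \<chi> I))"


subsection \<open>Hopf algebra structure\<close>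

fun coproduct_gen :: "'i uq_gen \<Rightarrow> ('i uq_gen word \<times> 'i uq_gen word \<Rightarrow>\<^sub>0 'k::field)" where
  "coproduct_gen (GE i) = tens (gen (GE i)) 1 + tens (gen (GK i)) (gen (GE i))"
| "coproduct_gen (GF i) = tens (gen (GF i)) (gen (GL i)) + tens 1 (gen (GF i))"
| "coproduct_gen (GK i) = tens (gen (GK i)) (gen (GK i))"
| "coproduct_gen (GL i) = tens (gen (GL i)) (gen (GL i))"

fun counit_gen :: "'i uq_gen \<Rightarrow> 'k::field" where
  "counit_gen (GE i) = 0"
| "counit_gen (GF i) = 0"
| "counit_gen (GK i) = 1"
| "counit_gen (GL i) = 1"

text \<open>\<open>U \<otimes> U\<close>, as the quotient of the tensor square of the free algebra.\<close>

definition UU :: "(('i \<Rightarrow> int) \<Rightarrow> ('i \<Rightarrow> int) \<Rightarrow> 'k::field) \<Rightarrow> ('i word \<Rightarrow>\<^sub>0 'k) set \<Rightarrow>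
    ('k, ('i uq_gen word \<times> 'i uq_gen word \<Rightarrow>\<^sub>0 'k) set) module" where
  "UU \<chi> I = quot_alg monoid_alg (tens_ideal (uq_ideal \<chi> I))"

definition cls2 :: "(('i \<Rightarrow> int) \<Rightarrow> ('i \<Rightarrow> int) \<Rightarrow> 'k::field) \<Rightarrow> ('i word \<Rightarrow>\<^sub>0 'k) set \<Rightarrow>
    ('i uq_gen word \<times> 'i uq_gen word \<Rightarrow>\<^sub>0 'k) \<Rightarrow> ('i uq_gen word \<times> 'i uq_gen word \<Rightarrow>\<^sub>0 'k) set" where
  "cls2 \<chi> I z = tens_ideal (uq_ideal \<chi> I)
     +>\<^bsub>(monoid_alg :: ('k, 'i uq_gen word \<times> 'i uq_gen word \<Rightarrow>\<^sub>0 'k) module)\<^esub> z"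

text \<open>
  Maps on cosets are written as unions over representatives, as in \<^const>\<open>rcoset_mult\<close>;
  each such union is a single coset.
\<close>

definition U_tens :: "(('i \<Rightarrow> int) \<Rightarrow> ('i \<Rightarrow> int) \<Rightarrow> 'k::field) \<Rightarrow> ('i word \<Rightarrow>\<^sub>0 'k) set \<Rightarrow>
    ('i, 'k) free_uq set \<Rightarrow> ('i, 'k) free_uq set \<Rightarrow> ('i uq_gen word \<times> 'i uq_gen word \<Rightarrow>\<^sub>0 'k) set" where
  "U_tens \<chi> I A B = (\<Union>a\<in>A. \<Union>b\<in>B. cls2 \<chi> I (tens a b))"

definition coproduct :: "(('i \<Rightarrow> int) \<Rightarrow> ('i \<Rightarrow> int) \<Rightarrow> 'k::field) \<Rightarrow> ('i word \<Rightarrow>\<^sub>0 'k) set \<Rightarrow>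
    ('i, 'k) free_uq set \<Rightarrow> ('i uq_gen word \<times> 'i uq_gen word \<Rightarrow>\<^sub>0 'k) set" where
  "coproduct \<chi> I A = (\<Union>a\<in>A. cls2 \<chi> I (free_hom monoid_alg coproduct_gen a))"

definition counit :: "('i, 'k::field) free_uq set \<Rightarrow> 'k" where
  "counit A = the_elem (free_hom base_alg counit_gen ` A)"

text \<open>
  \<open>sweedler \<chi> I D A s\<close>: the list \<open>s\<close> of pairs of elements of \<open>D\<close> is a choice of Sweedler
  notation \<open>\<Delta>(A) = A\<^sub>1 \<otimes> A\<^sub>2\<close>.
\<close>

definition sweedler :: "(('i \<Rightarrow> int) \<Rightarrow> ('i \<Rightarrow> int) \<Rightarrow> 'k::field) \<Rightarrow> ('i word \<Rightarrow>\<^sub>0 'k) set \<Rightarrow>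
    ('i, 'k) free_uq set set \<Rightarrow> ('i, 'k) free_uq set \<Rightarrow> (('i, 'k) free_uq set \<times> ('i, 'k) free_uq set) list \<Rightarrow> bool" where
  "sweedler \<chi> I D A s \<longleftrightarrow> set s \<subseteq> D \<times> D \<and>
     coproduct \<chi> I A = foldr (\<lambda>(B, C) z. U_tens \<chi> I B C \<oplus>\<^bsub>UU \<chi> I\<^esub> z) s \<zero>\<^bsub>UU \<chi> I\<^esub>"

definition sum_pairs :: "('k::field, 'b) module \<Rightarrow> ('a \<Rightarrow> 'a \<Rightarrow> 'b) \<Rightarrow> ('a \<times> 'a) list \<Rightarrow> 'b" where
  "sum_pairs R f s = foldr (\<lambda>(x, y) z. f x y \<oplus>\<^bsub>R\<^esub> z) s \<zero>\<^bsub>R\<^esub>"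

definition is_antipode :: "(('i \<Rightarrow> int) \<Rightarrow> ('i \<Rightarrow> int) \<Rightarrow> 'k::field) \<Rightarrow> ('i word \<Rightarrow>\<^sub>0 'k) set \<Rightarrow>
    (('i, 'k) free_uq set \<Rightarrow> ('i, 'k) free_uq set) \<Rightarrow> bool" where
  "is_antipode \<chi> I S \<longleftrightarrow>
     linear_on (U \<chi> I) (carrier (U \<chi> I)) (U \<chi> I) S \<and>
     (\<forall>x\<in>carrier (U \<chi> I). \<forall>s. sweedler \<chi> I (carrier (U \<chi> I)) x s \<longrightarrow>
        sum_pairs (U \<chi> I) (\<lambda>y z. S y \<otimes>\<^bsub>U \<chi> I\<^esub> z) s = counit x \<odot>\<^bsub>U \<chi> I\<^esub> \<one>\<^bsub>U \<chi> I\<^esub> \<and>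
        sum_pairs (U \<chi> I) (\<lambda>y z. y \<otimes>\<^bsub>U \<chi> I\<^esub> S z) s = counit x \<odot>\<^bsub>U \<chi> I\<^esub> \<one>\<^bsub>U \<chi> I\<^esub>)"


subsection \<open>The pairing and the actions\<close>

text \<open>The pairing and the homomorphism below are used with \<open>M = I_max \<chi>\<close>; \<open>I\<close> is the ideal defining \<open>U(\<chi>)\<close>.\<close>

definition is_pairing :: "(('i \<Rightarrow> int) \<Rightarrow> ('i \<Rightarrow> int) \<Rightarrow> 'k::field) \<Rightarrow> ('i word \<Rightarrow>\<^sub>0 'k) set \<Rightarrow>
    (('i, 'k) free_uq set \<Rightarrow> ('i, 'k) free_uq set \<Rightarrow> 'k) \<Rightarrow> bool" where
  "is_pairing \<chi> M pr \<longleftrightarrow>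
     bilinear_on (U \<chi> M) (H_U_neg \<chi> M) (U \<chi> M) (U_pos_H \<chi> M) base_alg pr \<and>
     (\<forall>i j. pr (uF \<chi> M i) (uE \<chi> M j) = (if i = j then 1 else 0) \<and>
            pr (uK \<chi> M i) (uK \<chi> M j) = inverse (\<chi> (\<alpha> i) (\<alpha> j)) \<and>
            pr (uF \<chi> M i) (uK \<chi> M j) = 0 \<and>
            pr (uK \<chi> M i) (uE \<chi> M j) = 0) \<and>
     (\<forall>y\<in>H_U_neg \<chi> M. pr y \<one>\<^bsub>U \<chi> M\<^esub> = counit y) \<and>
     (\<forall>x\<in>U_pos_H \<chi> M. pr \<one>\<^bsub>U \<chi> M\<^esub> x = counit x) \<and>
     (\<forall>y\<in>H_U_neg \<chi> M. \<forall>x\<in>U_pos_H \<chi> M. \<forall>x'\<in>U_pos_H \<chi> M. \<forall>s.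
        sweedler \<chi> M (H_U_neg \<chi> M) y s \<longrightarrow>
        pr y (x \<otimes>\<^bsub>U \<chi> M\<^esub> x') = sum_pairs base_alg (\<lambda>y1 y2. pr y1 x' * pr y2 x) s) \<and>
     (\<forall>y\<in>H_U_neg \<chi> M. \<forall>y'\<in>H_U_neg \<chi> M. \<forall>x\<in>U_pos_H \<chi> M. \<forall>s.
        sweedler \<chi> M (U_pos_H \<chi> M) x s \<longrightarrow>
        pr (y \<otimes>\<^bsub>U \<chi> M\<^esub> y') x = sum_pairs base_alg (\<lambda>x1 x2. pr y x1 * pr y' x2) s)"

definition \<pi>_max :: "(('i \<Rightarrow> int) \<Rightarrow> ('i \<Rightarrow> int) \<Rightarrow> 'k::field) \<Rightarrow> ('i, 'k) free_uq set \<Rightarrow> ('i, 'k) free_uq set" where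
  "\<pi>_max \<chi> A = (\<Union>a\<in>A. cls \<chi> (I_max \<chi>) a)"

definition left_act :: "(('i \<Rightarrow> int) \<Rightarrow> ('i \<Rightarrow> int) \<Rightarrow> 'k::field) \<Rightarrow> ('i word \<Rightarrow>\<^sub>0 'k) set \<Rightarrow>
    (('i, 'k) free_uq set \<Rightarrow> ('i, 'k) free_uq set \<Rightarrow> 'k) \<Rightarrow>
    ('i, 'k) free_uq set \<Rightarrow> ('i, 'k) free_uq set \<Rightarrow> ('i, 'k) free_uq set" where
  "left_act \<chi> I pr e f = (THE r. \<exists>s. sweedler \<chi> I (H_U_neg \<chi> I) f s \<and>
     r = sum_pairs (U \<chi> I) (\<lambda>f1 f2. pr (\<pi>_max \<chi> f1) e \<odot>\<^bsub>U \<chi> I\<^esub> f2) s)"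

definition right_act :: "(('i \<Rightarrow> int) \<Rightarrow> ('i \<Rightarrow> int) \<Rightarrow> 'k::field) \<Rightarrow> ('i word \<Rightarrow>\<^sub>0 'k) set \<Rightarrow>
    (('i, 'k) free_uq set \<Rightarrow> ('i, 'k) free_uq set \<Rightarrow> 'k) \<Rightarrow>
    ('i, 'k) free_uq set \<Rightarrow> ('i, 'k) free_uq set \<Rightarrow> ('i, 'k) free_uq set" where
  "right_act \<chi> I pr f e = (THE r. \<exists>s. sweedler \<chi> I (H_U_neg \<chi> I) f s \<and>
     r = sum_pairs (U \<chi> I) (\<lambda>f1 f2. pr (\<pi>_max \<chi> f2) e \<odot>\<^bsub>U \<chi> I\<^esub> f1) s)"

text \<open>
  \<open>Fb \<rho> 0, \<dots>, Fb \<rho> (d \<rho> - 1)\<close> and \<open>Eb \<rho> 0, \<dots>, Eb \<rho> (d \<rho> - 1)\<close> are dual bases of the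
  components of \<open>U\<^sup>-\<close> and \<open>U\<^sup>+\<close> of degrees \<open>-\<rho>\<close> and \<open>\<rho>\<close>, for all \<open>\<rho> \<in> \<nat>\<^sup>n\<close>.
\<close>

definition dual_bases :: "(('i \<Rightarrow> int) \<Rightarrow> ('i \<Rightarrow> int) \<Rightarrow> 'k::field) \<Rightarrow> ('i word \<Rightarrow>\<^sub>0 'k) set \<Rightarrow>
    (('i, 'k) free_uq set \<Rightarrow> ('i, 'k) free_uq set \<Rightarrow> 'k) \<Rightarrow> (('i \<Rightarrow> nat) \<Rightarrow> nat) \<Rightarrow>
    (('i \<Rightarrow> nat) \<Rightarrow> nat \<Rightarrow> ('i, 'k) free_uq set) \<Rightarrow> (('i \<Rightarrow> nat) \<Rightarrow> nat \<Rightarrow> ('i, 'k) free_uq set) \<Rightarrow> bool" where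
  "dual_bases \<chi> M pr d Fb Eb \<longleftrightarrow> (\<forall>\<rho>.
     is_basis (U \<chi> M) (U_neg \<chi> M \<inter> U_component \<chi> M (- int_vec \<rho>)) (d \<rho>) (Fb \<rho>) \<and>
     is_basis (U \<chi> M) (U_pos \<chi> M \<inter> U_component \<chi> M (int_vec \<rho>)) (d \<rho>) (Eb \<rho>) \<and>
     (\<forall>i<d \<rho>. \<forall>j<d \<rho>. pr (Fb \<rho> i) (Eb \<rho> j) = (if i = j then 1 else 0)))"

definition is_sigma_bar :: "(('i \<Rightarrow> int) \<Rightarrow> ('i \<Rightarrow> int) \<Rightarrow> 'k::field) \<Rightarrow> ('i word \<Rightarrow>\<^sub>0 'k) set \<Rightarrow>
    ('i \<Rightarrow> 'i) \<Rightarrow> ('i \<Rightarrow> 'k) \<Rightarrow> (('i, 'k) free_uq set \<Rightarrow> ('i, 'k) free_uq set) \<Rightarrow> bool" where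
  "is_sigma_bar \<chi> M \<tau> c \<sigma> \<longleftrightarrow>
     \<sigma> \<in> alg_hom ((U \<chi> M)\<lparr>carrier := U_neg \<chi> M\<rparr>) ((U \<chi> M)\<lparr>carrier := U_pos_H \<chi> M\<rparr>) \<and>
     (\<forall>i. \<sigma> (uF \<chi> M i) = c (\<tau> i) \<odot>\<^bsub>U \<chi> M\<^esub> (uK \<chi> M i \<otimes>\<^bsub>U \<chi> M\<^esub> uE \<chi> M (\<tau> i)))"


section \<open>The algebras attached to \<open>\<tau>\<close> and \<open>c\<close>\<close>

definition diagram_automorphism :: "(('i \<Rightarrow> int) \<Rightarrow> ('i \<Rightarrow> int) \<Rightarrow> 'k::field) \<Rightarrow> ('i word \<Rightarrow>\<^sub>0 'k) set \<Rightarrow>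
    ('i \<Rightarrow> 'i) \<Rightarrow> bool" where
  "diagram_automorphism \<chi> I \<tau> \<longleftrightarrow>
     bij \<tau> \<and> (\<forall>i. \<tau> (\<tau> i) = i) \<and>
     (\<forall>i j. \<chi> (\<alpha> (\<tau> i)) (\<alpha> (\<tau> j)) = \<chi> (\<alpha> i) (\<alpha> j)) \<and>
     free_hom monoid_alg (\<lambda>i. gen (\<tau> i)) ` I = I"

text \<open>
  The extension of \<open>\<tau>\<close> to \<open>\<int>\<^sup>n\<close> by \<open>\<alpha> i \<mapsto> \<alpha> (\<tau> i)\<close> sends \<open>\<lambda>\<close> to \<open>\<lambda> \<circ> \<tau>\<close>, because \<open>\<tau>\<close> is an involution.
\<close>

definition Z_theta :: "('i \<Rightarrow> 'i) \<Rightarrow> ('i \<Rightarrow> int) set" where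
  "Z_theta \<tau> = {\<nu>. \<nu> \<circ> \<tau> = - \<nu>}"

definition KK_theta :: "(('i \<Rightarrow> int) \<Rightarrow> ('i \<Rightarrow> int) \<Rightarrow> 'k::field) \<Rightarrow> ('i word \<Rightarrow>\<^sub>0 'k) set \<Rightarrow> ('i \<Rightarrow> 'i) \<Rightarrow>
    ('i, 'k) free_uq set set" where
  "KK_theta \<chi> I \<tau> = (\<lambda>i. uK \<chi> I i \<otimes>\<^bsub>U \<chi> I\<^esub> uL \<chi> I (\<tau> i)) ` UNIV"

definition H_theta :: "(('i \<Rightarrow> int) \<Rightarrow> ('i \<Rightarrow> int) \<Rightarrow> 'k::field) \<Rightarrow> ('i word \<Rightarrow>\<^sub>0 'k) set \<Rightarrow> ('i \<Rightarrow> 'i) \<Rightarrow>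
    ('i, 'k) free_uq set set" where
  "H_theta \<chi> I \<tau> = gen_subalg (U \<chi> I) (KK_theta \<chi> I \<tau>)"

definition H_theta_U_neg :: "(('i \<Rightarrow> int) \<Rightarrow> ('i \<Rightarrow> int) \<Rightarrow> 'k::field) \<Rightarrow> ('i word \<Rightarrow>\<^sub>0 'k) set \<Rightarrow> ('i \<Rightarrow> 'i) \<Rightarrow>
    ('i, 'k) free_uq set set" where
  "H_theta_U_neg \<chi> I \<tau> = gen_subalg (U \<chi> I) (H_theta \<chi> I \<tau> \<union> U_neg \<chi> I)"

definition H_theta_U_neg_component :: "(('i \<Rightarrow> int) \<Rightarrow> ('i \<Rightarrow> int) \<Rightarrow> 'k::field) \<Rightarrow> ('i word \<Rightarrow>\<^sub>0 'k) set \<Rightarrow>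
    ('i \<Rightarrow> 'i) \<Rightarrow> nat \<Rightarrow> ('i, 'k) free_uq set set" where
  "H_theta_U_neg_component \<chi> I \<tau> = gen_component (U \<chi> I) (H_theta \<chi> I \<tau>) (range (uF \<chi> I))"

definition B_gen :: "(('i \<Rightarrow> int) \<Rightarrow> ('i \<Rightarrow> int) \<Rightarrow> 'k::field) \<Rightarrow> ('i word \<Rightarrow>\<^sub>0 'k) set \<Rightarrow> ('i \<Rightarrow> 'i) \<Rightarrow>
    ('i \<Rightarrow> 'k) \<Rightarrow> 'i \<Rightarrow> ('i, 'k) free_uq set" where
  "B_gen \<chi> I \<tau> c i = uF \<chi> I i \<oplus>\<^bsub>U \<chi> I\<^esub> c i \<odot>\<^bsub>U \<chi> I\<^esub> (uE \<chi> I (\<tau> i) \<otimes>\<^bsub>U \<chi> I\<^esub> uL \<chi> I i)"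

definition B_alg :: "(('i \<Rightarrow> int) \<Rightarrow> ('i \<Rightarrow> int) \<Rightarrow> 'k::field) \<Rightarrow> ('i word \<Rightarrow>\<^sub>0 'k) set \<Rightarrow> ('i \<Rightarrow> 'i) \<Rightarrow>
    ('i \<Rightarrow> 'k) \<Rightarrow> ('i, 'k) free_uq set set" where
  "B_alg \<chi> I \<tau> c = gen_subalg (U \<chi> I) (H_theta \<chi> I \<tau> \<union> range (B_gen \<chi> I \<tau> c))"

definition B_filtration :: "(('i \<Rightarrow> int) \<Rightarrow> ('i \<Rightarrow> int) \<Rightarrow> 'k::field) \<Rightarrow> ('i word \<Rightarrow>\<^sub>0 'k) set \<Rightarrow> ('i \<Rightarrow> 'i) \<Rightarrow>
    ('i \<Rightarrow> 'k) \<Rightarrow> nat \<Rightarrow> ('i, 'k) free_uq set set" where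
  "B_filtration \<chi> I \<tau> c = gen_filtration (U \<chi> I) (H_theta \<chi> I \<tau>) (range (B_gen \<chi> I \<tau> c))"

definition gr_B :: "(('i \<Rightarrow> int) \<Rightarrow> ('i \<Rightarrow> int) \<Rightarrow> 'k::field) \<Rightarrow> ('i word \<Rightarrow>\<^sub>0 'k) set \<Rightarrow> ('i \<Rightarrow> 'i) \<Rightarrow>
    ('i \<Rightarrow> 'k) \<Rightarrow> ('k, nat \<Rightarrow> ('i, 'k) free_uq set set) module" where
  "gr_B \<chi> I \<tau> c = gr_alg (U \<chi> I) (B_filtration \<chi> I \<tau> c)"

definition is_phi :: "(('i \<Rightarrow> int) \<Rightarrow> ('i \<Rightarrow> int) \<Rightarrow> 'k::field) \<Rightarrow> ('i word \<Rightarrow>\<^sub>0 'k) set \<Rightarrow> ('i \<Rightarrow> 'i) \<Rightarrow>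
    ('i \<Rightarrow> 'k) \<Rightarrow> ((nat \<Rightarrow> ('i, 'k) free_uq set set) \<Rightarrow> ('i, 'k) free_uq set) \<Rightarrow> bool" where
  "is_phi \<chi> I \<tau> c \<phi> \<longleftrightarrow>
     \<phi> \<in> alg_hom (gr_B \<chi> I \<tau> c) ((U \<chi> I)\<lparr>carrier := H_theta_U_neg \<chi> I \<tau>\<rparr>) \<and>
     (\<forall>m. \<forall>x\<in>B_filtration \<chi> I \<tau> c m.
        \<phi> (gr_symbol (U \<chi> I) (B_filtration \<chi> I \<tau> c) m x) \<in> H_theta_U_neg_component \<chi> I \<tau> m) \<and>
     (\<forall>i. \<phi> (gr_symbol (U \<chi> I) (B_filtration \<chi> I \<tau> c) 1 (B_gen \<chi> I \<tau> c i)) = uF \<chi> I i) \<and>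
     (\<forall>h\<in>H_theta \<chi> I \<tau>. \<phi> (gr_symbol (U \<chi> I) (B_filtration \<chi> I \<tau> c) 0 h) = h)"

definition E_tilde :: "(('i \<Rightarrow> int) \<Rightarrow> ('i \<Rightarrow> int) \<Rightarrow> 'k::field) \<Rightarrow> ('i word \<Rightarrow>\<^sub>0 'k) set \<Rightarrow> 'i \<Rightarrow>
    ('i, 'k) free_uq set" where
  "E_tilde \<chi> I i = uE \<chi> I i \<otimes>\<^bsub>U \<chi> I\<^esub> uL \<chi> I i"

definition U_poly :: "(('i \<Rightarrow> int) \<Rightarrow> ('i \<Rightarrow> int) \<Rightarrow> 'k::field) \<Rightarrow> ('i word \<Rightarrow>\<^sub>0 'k) set \<Rightarrow> ('i \<Rightarrow> 'i) \<Rightarrow>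
    ('i, 'k) free_uq set set" where
  "U_poly \<chi> I \<tau> = gen_subalg (U \<chi> I)
     (range (uF \<chi> I) \<union> range (E_tilde \<chi> I) \<union> range (uL \<chi> I) \<union> KK_theta \<chi> I \<tau>)"

definition is_psi :: "(('i \<Rightarrow> int) \<Rightarrow> ('i \<Rightarrow> int) \<Rightarrow> 'k::field) \<Rightarrow> ('i word \<Rightarrow>\<^sub>0 'k) set \<Rightarrow> ('i \<Rightarrow> 'i) \<Rightarrow>
    (('i, 'k) free_uq set \<Rightarrow> ('i, 'k) free_uq set) \<Rightarrow> bool" where
  "is_psi \<chi> I \<tau> \<psi> \<longleftrightarrow>
     linear_on (U \<chi> I) (U_poly \<chi> I \<tau>) (U \<chi> I) \<psi> \<and>
     (\<forall>x\<in>U_poly \<chi> I \<tau>. \<psi> x \<in> H_theta_U_neg \<chi> I \<tau>) \<and>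
     (\<forall>a\<in>H_theta_U_neg \<chi> I \<tau>. \<psi> a = a) \<and>
     (\<forall>x\<in>lin_span (U \<chi> I) {u \<otimes>\<^bsub>U \<chi> I\<^esub> v | u v.
         u \<in> U_poly \<chi> I \<tau> \<and> v \<in> range (E_tilde \<chi> I) \<union> range (uL \<chi> I)}. \<psi> x = \<zero>\<^bsub>U \<chi> I\<^esub>)"


section \<open>The star product\<close>

text \<open>
  The summand for \<open>\<rho>\<close>:
  \<open>(-1)\<^bsup>|\<rho>|\<^esup> (\<sigma>(F\<^sub>\<rho>) \<triangleright> f) K\<^sub>\<rho> (g \<triangleleft> (S\<^sup>-\<^sup>1(E\<^sub>\<rho>) K\<^sub>\<rho>))\<close>.
\<close>

definition star_term :: "(('i::{finite,linorder} \<Rightarrow> int) \<Rightarrow> ('i \<Rightarrow> int) \<Rightarrow> 'k::field) \<Rightarrow> ('i word \<Rightarrow>\<^sub>0 'k) set \<Rightarrow>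
    (('i, 'k) free_uq set \<Rightarrow> ('i, 'k) free_uq set \<Rightarrow> 'k) \<Rightarrow>
    (('i, 'k) free_uq set \<Rightarrow> ('i, 'k) free_uq set) \<Rightarrow>
    (('i, 'k) free_uq set \<Rightarrow> ('i, 'k) free_uq set) \<Rightarrow>
    (('i \<Rightarrow> nat) \<Rightarrow> nat) \<Rightarrow> (('i \<Rightarrow> nat) \<Rightarrow> nat \<Rightarrow> ('i, 'k) free_uq set) \<Rightarrow>
    (('i \<Rightarrow> nat) \<Rightarrow> nat \<Rightarrow> ('i, 'k) free_uq set) \<Rightarrow>
    ('i, 'k) free_uq set \<Rightarrow> ('i, 'k) free_uq set \<Rightarrow> ('i \<Rightarrow> nat) \<Rightarrow> ('i, 'k) free_uq set" where
  "star_term \<chi> I pr S \<sigma> d Fb Eb f g \<rho> =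
     (- 1) ^ (\<Sum>i\<in>UNIV. \<rho> i) \<odot>\<^bsub>U \<chi> I\<^esub>
     (\<Oplus>\<^bsub>U \<chi> I\<^esub>j\<in>{..<d \<rho>}.
        left_act \<chi> I pr (\<sigma> (Fb \<rho> j)) f
        \<otimes>\<^bsub>U \<chi> I\<^esub> uKK \<chi> I (int_vec \<rho>)
        \<otimes>\<^bsub>U \<chi> I\<^esub> right_act \<chi> I pr g
          (inv_into (carrier (U \<chi> (I_max \<chi>))) S (Eb \<rho> j)
            \<otimes>\<^bsub>U \<chi> (I_max \<chi>)\<^esub> uKK \<chi> (I_max \<chi>) (int_vec \<rho>)))"

definition determined_star :: "(('i::{finite,linorder} \<Rightarrow> int) \<Rightarrow> ('i \<Rightarrow> int) \<Rightarrow> 'k::field) \<Rightarrow> ('i word \<Rightarrow>\<^sub>0 'k) set \<Rightarrow>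
    ('i \<Rightarrow> 'i) \<Rightarrow>
    (('i, 'k) free_uq set \<Rightarrow> ('i, 'k) free_uq set \<Rightarrow> 'k) \<Rightarrow>
    (('i, 'k) free_uq set \<Rightarrow> ('i, 'k) free_uq set) \<Rightarrow>
    (('i, 'k) free_uq set \<Rightarrow> ('i, 'k) free_uq set) \<Rightarrow>
    (('i \<Rightarrow> nat) \<Rightarrow> nat) \<Rightarrow> (('i \<Rightarrow> nat) \<Rightarrow> nat \<Rightarrow> ('i, 'k) free_uq set) \<Rightarrow>
    (('i \<Rightarrow> nat) \<Rightarrow> nat \<Rightarrow> ('i, 'k) free_uq set) \<Rightarrow>
    (('i, 'k) free_uq set \<Rightarrow> ('i, 'k) free_uq set \<Rightarrow> ('i, 'k) free_uq set) \<Rightarrow> bool" where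
  "determined_star \<chi> I \<tau> pr S \<sigma> d Fb Eb st \<longleftrightarrow>
     bilinear_on (U \<chi> I) (H_theta_U_neg \<chi> I \<tau>) (U \<chi> I) (H_theta_U_neg \<chi> I \<tau>) (U \<chi> I) st \<and>
     (\<forall>f\<in>U_neg \<chi> I. \<forall>g\<in>U_neg \<chi> I.
        finite {\<rho>. star_term \<chi> I pr S \<sigma> d Fb Eb f g \<rho> \<noteq> \<zero>\<^bsub>U \<chi> I\<^esub>} \<and>
        st f g = (\<Oplus>\<^bsub>U \<chi> I\<^esub>\<rho>\<in>{\<rho>. star_term \<chi> I pr S \<sigma> d Fb Eb f g \<rho> \<noteq> \<zero>\<^bsub>U \<chi> I\<^esub>}.
                    star_term \<chi> I pr S \<sigma> d Fb Eb f g \<rho>)) \<and>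
     (\<forall>\<nu>\<in>Z_theta \<tau>. \<forall>\<mu>\<in>Z_theta \<tau>. \<forall>a.
        \<forall>f\<in>U_neg \<chi> I \<inter> U_component \<chi> I (- a). \<forall>g\<in>U_neg \<chi> I.
        st (uKK \<chi> I \<nu> \<otimes>\<^bsub>U \<chi> I\<^esub> f) (uKK \<chi> I \<mu> \<otimes>\<^bsub>U \<chi> I\<^esub> g)
          = \<chi> a \<mu> \<odot>\<^bsub>U \<chi> I\<^esub> (uKK \<chi> I (\<nu> + \<mu>) \<otimes>\<^bsub>U \<chi> I\<^esub> st f g))"

end

theory Submission
  imports Defs "HOL.Vector_Spaces"
begin

text \<open>
  The formula for \<open>f \<star> g\<close> makes sense for all words in the \<open>F\<^sub>i\<close>, \<open>K\<^sub>i\<close> and \<open>K\<^sub>i\<^sup>-\<^sup>1\<close>, and there it commutes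
  with left multiplication by \<open>K\<^sub>\<lambda>\<close> for \<open>\<lambda> \<in> \<int>\<^sup>n\<^sub>\<theta>\<close>. Left star multiplication by \<open>F\<^sub>i\<close> is the operator
  \<open>\<beta>\<^sub>i(h) = F\<^sub>i h + c\<^sub>i \<chi>(\<alpha>\<^sub>i, \<alpha>\<^sub>j) K\<^sub>i\<^sup>-\<^sup>1 K\<^sub>j (h \<triangleleft> E\<^sub>j)\<close> with \<open>j = \<tau>(i)\<close>, and the main point is the identity
  \<open>\<beta>\<^sub>i(f) \<star> g = \<beta>\<^sub>i(f \<star> g)\<close>. It holds because \<open>\<sigma>(F\<^sub>\<rho>) \<triangleright> (F\<^sub>i f)\<close> differs from \<open>F\<^sub>i (\<sigma>(F\<^sub>\<rho>) \<triangleright> f)\<close> by a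
  term in which a skew derivation is applied to \<open>F\<^sub>\<rho>\<close>; in the dual bases this derivation is adjoint to
  left multiplication by \<open>E\<^sub>j\<close> on the \<open>E\<^sub>\<rho>\<close>, so that after the shift \<open>\<rho> \<mapsto> \<rho> + \<alpha>\<^sub>j\<close> one gets exactly the terms
  of \<open>f \<star> (g \<triangleleft> E\<^sub>j)\<close>. Since the \<open>\<beta>\<^sub>i\<close> and the \<open>K\<^sub>\<lambda>\<close> generate \<open>H\<^sub>\<theta> \<ltimes> U\<^sup>-\<close> from \<open>1\<close>, the identity implies associativity.

  Modulo the kernel of \<open>\<psi>\<close>, \<open>E\<^sub>j K\<^sub>j\<^sup>-\<^sup>1 a\<close> is \<open>\<chi>(\<alpha>\<^sub>j, \<alpha>\<^sub>j) (a \<triangleleft> E\<^sub>j)\<close> for \<open>a \<in> H\<^sub>\<theta> \<ltimes> U\<^sup>-\<close>. Hence \<open>\<psi>(B\<^sub>i x) = \<beta>\<^sub>i(\<psi>(x))\<close>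
  and \<open>\<psi>(x y) = \<psi>(x) \<star> \<psi>(y)\<close> on \<open>B\<^sub>c\<close>. The map \<open>\<psi>\<close> is always onto, and it is injective when \<open>\<phi>\<close> is, because
  \<open>\<phi>\<close> maps the symbol of \<open>x\<close> to the leading part of \<open>\<psi>(x)\<close>.
\<close>

section \<open>Monoid algebras\<close>

text \<open>Everything is computed with representatives in free algebras. There a word has a
  canonical coproduct, and coassociativity and the action axioms hold literally, whereas an element
  of the quotient has no preferred Sweedler sum. The price is well-definedness. The coproduct must
  respect the defining ideal, which is where the biideal condition on \<open>I\<close> enters, by
  bosonization. The pairing lives on the quotient by the ideal of \<open>I_max\<close>, and only on
  two subalgebras; its functionals are extended linearly to the free algebra, so that the actions on
  the larger algebra \<open>U \<chi> I\<close> do not depend on the Sweedler sum. \<open>S\<close>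
  is given by the antipode axioms alone, so it is computed on words; its square rescales every
  degree by a nonzero scalar, which makes it injective. Two weights meet in
  \<open>\<sigma>(F\<^sub>\<rho>)\<close>: its degree and its K-weight add up to
  \<open>\<rho> + \<tau>(\<rho>)\<close>. Against such vectors the bicharacter is trivial on
  \<open>Z_theta\<close>, and this is why the elements of \<open>H_theta\<close> can be taken out of
  the sum from the left.\<close>

definition sc :: "'k::field \<Rightarrow> ('w::monoid_add \<Rightarrow>\<^sub>0 'k) \<Rightarrow> ('w \<Rightarrow>\<^sub>0 'k)" where
  "sc a x = Poly_Mapping.single 0 a * x"

definition mon :: "'w \<Rightarrow> ('w \<Rightarrow>\<^sub>0 'k::field)" where
  "mon w = Poly_Mapping.single w 1"

lemma poly_mapping_sum_single: "x = (\<Sum>w\<in>Poly_Mapping.keys x. Poly_Mapping.single w (Poly_Mapping.lookup x w))"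
  by (rule poly_mapping_eqI)
    (auto simp: lookup_sum lookup_single when_def in_keys_iff intro!: sum.neutral)

lemma sc_single: "sc a (Poly_Mapping.single w b) = Poly_Mapping.single w (a * b)"
  by (simp add: sc_def mult_single)

lemma single_eq_sc: "Poly_Mapping.single w a = sc a (mon w)"
  by (simp add: sc_single mon_def)

lemma sc_add_right: "sc a (x + y) = sc a x + sc a y"
  by (simp add: sc_def algebra_simps)

lemma sc_add_left: "sc (a + b) x = sc a x + sc b x"
  by (simp add: sc_def single_add algebra_simps)

lemma sc_sc [simp]: "sc a (sc b x) = sc (a * b) x"
  by (simp add: sc_def mult.assoc[symmetric] mult_single)

lemma sc_one [simp]: "sc 1 x = x"
  by (simp add: sc_def)

lemma sc_mult_left [simp]: "sc a x * y = sc a (x * y)"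
  by (simp add: sc_def mult.assoc)

lemma sc_mult_right [simp]: "x * sc a y = sc a (x * y)"
proof -
  have "(\<Sum>w\<in>Poly_Mapping.keys x. Poly_Mapping.single w (Poly_Mapping.lookup x w)) * Poly_Mapping.single 0 a
      = Poly_Mapping.single 0 a * (\<Sum>w\<in>Poly_Mapping.keys x. Poly_Mapping.single w (Poly_Mapping.lookup x w))"
    by (simp add: sum_distrib_left sum_distrib_right mult_single mult.commute)
  then have "x * Poly_Mapping.single 0 a = Poly_Mapping.single 0 a * x"
    using poly_mapping_sum_single[of x] by simp
  then show ?thesis
    by (simp add: sc_def mult.assoc[symmetric])
qed

interpretation T: vector_space "sc :: 'k::field \<Rightarrow> ('w::monoid_add \<Rightarrow>\<^sub>0 'k) \<Rightarrow> _"
  by unfold_locales (simp_all add: sc_add_left sc_add_right)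

lemma lookup_sc [simp]: "Poly_Mapping.lookup (sc a x) w = a * Poly_Mapping.lookup x w"
proof -
  have "sc a x = (\<Sum>v\<in>Poly_Mapping.keys x. Poly_Mapping.single v (a * Poly_Mapping.lookup x v))"
    using arg_cong[OF poly_mapping_sum_single[of x], of "sc a"] by (simp add: T.scale_sum_right sc_single)
  then show ?thesis
    by (auto simp: lookup_sum lookup_single when_def in_keys_iff)
qed

lemma mon_add: "mon (u + v) = mon u * mon v"
  by (simp add: mon_def mult_single)

lemma mon_0 [simp]: "mon 0 = 1"
  by (simp add: mon_def)

lemma keys_mon [simp]: "Poly_Mapping.keys (mon w :: _ \<Rightarrow>\<^sub>0 'k::field) = {w}"
  by (simp add: mon_def)

lemma sum_mon: "x = (\<Sum>w\<in>Poly_Mapping.keys x. sc (Poly_Mapping.lookup x w) (mon w))"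
  using poly_mapping_sum_single[of x] by (simp add: single_eq_sc)

text \<open>Most subspaces of a free algebra used below, such as the elements in given letters or of
  given degree, are described by a set of words. Inclusions and products of subspaces then become
  statements about words, and \<open>supported_induct\<close> reduces linear identities to
  monomials.\<close>

definition supported :: "'w::monoid_add set \<Rightarrow> ('w \<Rightarrow>\<^sub>0 'k::field) set" where
  "supported S = {x. Poly_Mapping.keys x \<subseteq> S}"

lemma supported_eq_span: "(supported S :: ('a::monoid_add \<Rightarrow>\<^sub>0 'b::field) set) = T.span (mon ` S)"
proof
  show "(supported S :: ('a \<Rightarrow>\<^sub>0 'b) set) \<subseteq> T.span (mon ` S)"
  proof
    fix x :: "'a \<Rightarrow>\<^sub>0 'b" assume "x \<in> supported S"
    then have "(\<Sum>w\<in>Poly_Mapping.keys x. sc (Poly_Mapping.lookup x w) (mon w)) \<in> T.span (mon ` S)"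
      by (intro T.span_sum T.span_scale T.span_base) (auto simp: supported_def)
    then show "x \<in> T.span (mon ` S)"
      using sum_mon[of x] by simp
  qed
  have *: "T.subspace (supported S :: ('a \<Rightarrow>\<^sub>0 'b) set)"
    unfolding T.subspace_def supported_def
    by (auto simp: in_keys_iff dest: subsetD[OF keys_add])
  then show "T.span (mon ` S) \<subseteq> (supported S :: ('a \<Rightarrow>\<^sub>0 'b) set)"
    by (intro T.span_minimal) (auto simp: supported_def)
qed

lemma supported_induct [consumes 1, case_names zero add scale mon]:
  assumes "x \<in> supported S" "P 0" "\<And>x y. P x \<Longrightarrow> P y \<Longrightarrow> P (x + y)"
    "\<And>a x. P x \<Longrightarrow> P (sc a x)" "\<And>w. w \<in> S \<Longrightarrow> P (mon w)"
  shows "P x"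
proof -
  have "T.subspace (Collect P)"
    using assms(2-4) by (auto simp: T.subspace_def)
  then show ?thesis
    using assms(1,5) T.span_induct[of x "mon ` S" P] by (auto simp: supported_eq_span)
qed

lemma supported_UNIV [simp]: "x \<in> supported UNIV"
  by (simp add: supported_def)

lemma supported_mono: "S \<subseteq> S' \<Longrightarrow> supported S \<subseteq> supported S'"
  by (auto simp: supported_def)

lemma subspace_supported: "T.subspace (supported S)"
  by (simp add: supported_eq_span T.subspace_span)

lemma supported_0 [simp]: "0 \<in> supported S"
  by (simp add: supported_def)

lemma supported_mon [simp]: "mon w \<in> supported S \<longleftrightarrow> w \<in> S"
  by (simp add: supported_def)

lemma supported_add: "x \<in> supported S \<Longrightarrow> y \<in> supported S \<Longrightarrow> x + y \<in> supported S"
  using T.subspace_add[OF subspace_supported] .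

lemma supported_sc: "x \<in> supported S \<Longrightarrow> sc a x \<in> supported S"
  using T.subspace_scale[OF subspace_supported] .

lemma supported_sum: "(\<And>i. i \<in> A \<Longrightarrow> f i \<in> supported S) \<Longrightarrow> sum f A \<in> supported S"
  using T.subspace_sum[OF subspace_supported] .

lemma supported_diff: "x \<in> supported S \<Longrightarrow> y \<in> supported S \<Longrightarrow> x - y \<in> supported S"
  using T.subspace_diff[OF subspace_supported] .

lemma supported_mult:
  assumes "x \<in> supported S" "y \<in> supported S'" "\<And>u v. u \<in> S \<Longrightarrow> v \<in> S' \<Longrightarrow> u + v \<in> S''"
  shows "x * y \<in> supported S''"
  using assms(1)
proof (induction rule: supported_induct)
  case (mon u)
  show ?case using assms(2)
    by (induction rule: supported_induct)
      (auto simp: algebra_simps supported_add supported_sc mon_add[symmetric] assms(3) mon)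
qed (auto simp: algebra_simps supported_add supported_sc)

text \<open>The scalar multiplication \<open>s\<close> is a parameter because the same extension is
  used with values in monoid algebras and in the field itself.\<close>

definition lext :: "('k::field \<Rightarrow> 'b \<Rightarrow> 'b::ab_group_add) \<Rightarrow> ('w \<Rightarrow> 'b) \<Rightarrow> ('w \<Rightarrow>\<^sub>0 'k) \<Rightarrow> 'b" where
  "lext s f x = (\<Sum>w\<in>Poly_Mapping.keys x. s (Poly_Mapping.lookup x w) (f w))"

context vector_space
begin

lemma lext_superset:
  assumes "finite A" "Poly_Mapping.keys x \<subseteq> A"
  shows "lext scale f x = (\<Sum>w\<in>A. scale (Poly_Mapping.lookup x w) (f w))"
  unfolding lext_def using assms by (intro sum.mono_neutral_left) (auto simp: in_keys_iff)

lemma lext_add: "lext scale f (x + y) = lext scale f x + lext scale f y"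
  using keys_add[of x y]
  by (simp add: lext_superset[of "Poly_Mapping.keys x \<union> Poly_Mapping.keys y"]
      lookup_add scale_left_distrib sum.distrib)

lemma lext_sc: "lext scale f (sc a x) = scale a (lext scale f x)"
  by (simp add: lext_superset[of "Poly_Mapping.keys x"] in_keys_iff subset_iff scale_sum_right)

lemma lext_mon [simp]: "lext scale f (mon w) = f w"
  by (simp add: lext_def mon_def)

lemma lext_0 [simp]: "lext scale f 0 = 0"
  by (simp add: lext_def)

lemma lext_sum: "lext scale f (sum x A) = (\<Sum>i\<in>A. lext scale f (x i))"
  by (induction A rule: infinite_finite_induct) (auto simp: lext_add)

lemma lext_minus: "lext scale f (- x) = - lext scale f x"
  using lext_add[of f x "- x"] by (simp add: minus_unique)

lemma lext_diff: "lext scale f (x - y) = lext scale f x - lext scale f y"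
  using lext_add[of f x "- y"] by (simp add: lext_minus)

lemma lext_fun_add: "lext scale (\<lambda>w. f w + g w) x = lext scale f x + lext scale g x"
  by (simp add: lext_def scale_right_distrib sum.distrib)

lemma lext_fun_scale: "lext scale (\<lambda>w. scale a (f w)) x = scale a (lext scale f x)"
  by (simp add: lext_def scale_sum_right mult.commute)

lemma lext_cong: "x \<in> supported S \<Longrightarrow> (\<And>w. w \<in> S \<Longrightarrow> f w = g w) \<Longrightarrow> lext scale f x = lext scale g x"
  by (auto simp: lext_def supported_def intro!: sum.cong)

lemma lext_in_subspace:
  "x \<in> supported S \<Longrightarrow> subspace V \<Longrightarrow> (\<And>w. w \<in> S \<Longrightarrow> f w \<in> V) \<Longrightarrow> lext scale f x \<in> V"
  by (auto simp: lext_def supported_def intro!: subspace_sum subspace_scale)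

end

interpretation K: vector_space "(*) :: 'k::field \<Rightarrow> 'k \<Rightarrow> 'k"
  by unfold_locales (auto simp: algebra_simps)

lemma monoid_alg_simps [simp]:
  "carrier monoid_alg = UNIV" "x \<otimes>\<^bsub>monoid_alg\<^esub> y = x * y" "\<one>\<^bsub>monoid_alg\<^esub> = 1"
  "\<zero>\<^bsub>monoid_alg\<^esub> = 0" "x \<oplus>\<^bsub>monoid_alg\<^esub> y = x + y" "a \<odot>\<^bsub>monoid_alg\<^esub> x = sc a x"
  by (simp_all add: monoid_alg_def sc_def)

lemma base_alg_simps [simp]:
  "carrier base_alg = UNIV" "x \<otimes>\<^bsub>base_alg\<^esub> y = x * y" "\<one>\<^bsub>base_alg\<^esub> = 1"
  "\<zero>\<^bsub>base_alg\<^esub> = 0" "x \<oplus>\<^bsub>base_alg\<^esub> y = x + y" "a \<odot>\<^bsub>base_alg\<^esub> x = a * x"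
  by (simp_all add: base_alg_def)

lemma finsum_eq_sum:
  fixes R :: "('a::comm_monoid_add, 'm) ring_scheme"
  assumes "carrier R = UNIV" "\<And>x y. x \<oplus>\<^bsub>R\<^esub> y = x + y" "\<zero>\<^bsub>R\<^esub> = 0"
  shows "finsum R f A = sum f A"
proof -
  interpret abelian_monoid R
    by (rule abelian_monoidI) (auto simp: assms algebra_simps)
  show ?thesis
    by (induction A rule: infinite_finite_induct) (auto simp: assms finsum_infinite)
qed

lemma ring_monoid_alg: "ring (monoid_alg :: ('k::field, 'w::monoid_add \<Rightarrow>\<^sub>0 'k) module)"
proof (intro ringI abelian_groupI monoidI)
  fix x :: "'w \<Rightarrow>\<^sub>0 'k"
  show "\<exists>y\<in>carrier monoid_alg. y \<oplus>\<^bsub>monoid_alg\<^esub> x = \<zero>\<^bsub>monoid_alg\<^esub>"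
    by (rule bexI[of _ "- x"]) auto
qed (auto simp: algebra_simps)

lemma uminus_eq_sc: "- x = sc (- 1) x"
  by simp

lemma a_inv_monoid_alg: "inv\<^bsub>add_monoid monoid_alg\<^esub> x = - x"
proof -
  interpret ring "monoid_alg :: ('b, 'a \<Rightarrow>\<^sub>0 'b) module" by (rule ring_monoid_alg)
  show ?thesis using minus_equality[of "- x" x] by (simp add: a_inv_def)
qed

lemmas a_inv_monoid_alg_simps = a_inv_monoid_alg a_inv_monoid_alg[simplified]

lemma linear_subspace_monoid_alg_iff: "linear_subspace monoid_alg V \<longleftrightarrow> T.subspace V"
proof
  assume "linear_subspace monoid_alg V"
  then interpret submodule V base_alg monoid_alg
    by (simp add: linear_subspace_def)
  show "T.subspace V"
    using one_closed m_closed smult_closed by (auto simp: T.subspace_def)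
next
  assume "T.subspace V"
  then show "linear_subspace monoid_alg V"
    unfolding linear_subspace_def
    by unfold_locales (auto simp: T.subspace_def a_inv_monoid_alg_simps uminus_eq_sc simp del: T.scale_minus_left)
qed

lemma lin_span_monoid_alg: "lin_span monoid_alg S = T.span S"
  unfolding lin_span_def linear_subspace_monoid_alg_iff
  by (auto simp: T.span_def hull_def)

lemma ideal_monoid_algI:
  assumes "T.subspace V" "\<And>x y. y \<in> V \<Longrightarrow> x * y \<in> V" "\<And>x y. y \<in> V \<Longrightarrow> y * x \<in> V"
  shows "ideal V monoid_alg"
proof (rule idealI)
  show "subgroup V (add_monoid monoid_alg)"
    using assms(1) by unfold_locales
      (auto simp: T.subspace_def a_inv_monoid_alg_simps uminus_eq_sc simp del: T.scale_minus_left)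
qed (use assms ring_monoid_alg in auto)

section \<open>Quotients of monoid algebras by two-sided ideals\<close>

locale quotient_algebra =
  fixes J :: "('w::monoid_add \<Rightarrow>\<^sub>0 'k::field) set"
  assumes ideal_J: "ideal J monoid_alg"
begin

interpretation ideal J monoid_alg by (rule ideal_J)

lemma J_0: "0 \<in> J" and J_add: "x \<in> J \<Longrightarrow> y \<in> J \<Longrightarrow> x + y \<in> J"
  and J_left: "y \<in> J \<Longrightarrow> x * y \<in> J" and J_right: "y \<in> J \<Longrightarrow> y * x \<in> J"
  using additive_subgroup.zero_closed[OF ideal.axioms(1)[OF ideal_J]]
    additive_subgroup.a_closed[OF ideal.axioms(1)[OF ideal_J], of x y]
    I_l_closed[of y x] I_r_closed[of y x] by simp_all

lemma J_sc: "x \<in> J \<Longrightarrow> sc a x \<in> J"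
  by (simp add: sc_def J_left)

lemma subspace_J: "T.subspace J"
  by (auto simp: T.subspace_def J_0 J_add J_sc)

lemmas J_diff = T.subspace_diff[OF subspace_J]
lemmas J_neg = T.subspace_neg[OF subspace_J]
lemmas J_sum = T.subspace_sum[OF subspace_J]

abbreviation "Q \<equiv> quot_alg monoid_alg J"

definition cl :: "('w \<Rightarrow>\<^sub>0 'k) \<Rightarrow> ('w \<Rightarrow>\<^sub>0 'k) set" where
  "cl x = J +>\<^bsub>(monoid_alg :: ('k, 'w \<Rightarrow>\<^sub>0 'k) module)\<^esub> x"

lemma cl_altdef: "cl x = {y. y - x \<in> J}"
proof -
  have "cl x = {j + x | j. j \<in> J}"
    by (auto simp: cl_def a_r_coset_def r_coset_def)
  also have "\<dots> = {y. y - x \<in> J}"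
    by (auto intro: exI[of _ "_ - x"])
  finally show ?thesis .
qed

lemma mem_cl: "y \<in> cl x \<longleftrightarrow> y - x \<in> J"
  by (simp add: cl_altdef)

lemma cl_eq_iff: "cl x = cl y \<longleftrightarrow> x - y \<in> J"
proof
  assume "cl x = cl y"
  moreover have "x \<in> cl x" by (simp add: mem_cl J_0)
  ultimately have "x \<in> cl y" by simp
  then show "x - y \<in> J" by (simp add: mem_cl)
next
  assume *: "x - y \<in> J"
  have "z - x \<in> J \<longleftrightarrow> z - y \<in> J" for z
    using J_add[OF * , of "z - x"] J_diff[OF _ *, of "z - y"] by (auto simp: algebra_simps)
  then show "cl x = cl y" by (simp add: cl_altdef)
qed

lemma cl_eqI: "x - y \<in> J \<Longrightarrow> cl x = cl y"
  by (simp add: cl_eq_iff)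

text \<open>Maps out of a quotient are defined as unions over all representatives. Such a union is a
  single value once the map is constant on the coset, which is what each well-definedness proof
  below supplies.\<close>

lemma UN_cl_const:
  assumes "\<And>y. y - x \<in> J \<Longrightarrow> f y = f x"
  shows "(\<Union>y\<in>cl x. f y) = f x"
proof -
  have "x \<in> cl x" by (simp add: mem_cl J_0)
  moreover have "f y = f x" if "y \<in> cl x" for y
    using that by (intro assms) (simp add: mem_cl)
  ultimately show ?thesis by blast
qed

lemma mult_diff_in_J: "a - x \<in> J \<Longrightarrow> b - y \<in> J \<Longrightarrow> a * b - x * y \<in> J"
  using J_add[OF J_right[of "a - x" b] J_left[of "b - y" x]] by (simp add: algebra_simps)

lemma carrier_Q: "carrier Q = range cl"
  by (auto simp: quot_alg_def FactRing_def A_RCOSETS_defs a_r_coset_def cl_def)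

lemma zero_Q: "\<zero>\<^bsub>Q\<^esub> = cl 0"
  by (simp add: quot_alg_def FactRing_simps cl_altdef)

lemma one_Q: "\<one>\<^bsub>Q\<^esub> = cl 1"
  by (simp add: quot_alg_def FactRing_simps cl_def)

lemma add_Q: "cl x \<oplus>\<^bsub>Q\<^esub> cl y = cl (x + y)"
proof -
  have "cl x \<oplus>\<^bsub>Q\<^esub> cl y = {a + b | a b. a \<in> cl x \<and> b \<in> cl y}"
    by (auto simp: quot_alg_def FactRing_simps set_add_def set_mult_def)
  also have "\<dots> = cl (x + y)"
  proof (auto simp: mem_cl)
    fix a b assume "a - x \<in> J" "b - y \<in> J"
    from J_add[OF this] show "a + b - (x + y) \<in> J" by (simp add: algebra_simps)
  next
    fix z assume "z - (x + y) \<in> J"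
    then show "\<exists>a b. z = a + b \<and> a - x \<in> J \<and> b - y \<in> J"
      by (intro exI[of _ "z - y"] exI[of _ y]) (auto simp: algebra_simps J_0)
  qed
  finally show ?thesis .
qed

lemma mult_Q: "cl x \<otimes>\<^bsub>Q\<^esub> cl y = cl (x * y)"
proof -
  have "cl x \<otimes>\<^bsub>Q\<^esub> cl y = (\<Union>a\<in>cl x. \<Union>b\<in>cl y. cl (a * b))"
    by (simp add: quot_alg_def FactRing_simps rcoset_mult_def cl_def)
  also have "\<dots> = (\<Union>a\<in>cl x. cl (a * y))"
    by (intro SUP_cong refl UN_cl_const cl_eqI mult_diff_in_J) (auto simp: J_0)
  also have "\<dots> = cl (x * y)"
    by (intro UN_cl_const cl_eqI mult_diff_in_J) (auto simp: J_0)
  finally show ?thesis .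
qed

lemma smult_Q: "a \<odot>\<^bsub>Q\<^esub> cl x = cl (sc a x)"
proof -
  have "a \<odot>\<^bsub>Q\<^esub> cl x = (\<Union>y\<in>cl x. cl (sc a y))"
    by (simp add: quot_alg_def cl_def)
  also have "\<dots> = cl (sc a x)"
    by (intro UN_cl_const cl_eqI) (use J_sc in \<open>auto simp: T.scale_right_diff_distrib[symmetric]\<close>)
  finally show ?thesis .
qed

lemmas cl_simps = carrier_Q zero_Q one_Q add_Q mult_Q smult_Q

lemma ring_Q: "ring Q"
proof (intro ringI abelian_groupI monoidI)
  fix x assume "x \<in> carrier Q"
  then obtain y where "x = cl y" by (auto simp: carrier_Q)
  then show "\<exists>y\<in>carrier Q. y \<oplus>\<^bsub>Q\<^esub> x = \<zero>\<^bsub>Q\<^esub>"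
    by (intro bexI[of _ "cl (- y)"]) (auto simp: cl_simps)
qed (auto simp: cl_simps algebra_simps)

lemma a_inv_Q: "inv\<^bsub>add_monoid Q\<^esub> cl x = cl (- x)"
proof -
  interpret Q: ring Q by (rule ring_Q)
  show ?thesis using Q.minus_equality[of "cl (- x)" "cl x"] by (simp add: a_inv_def cl_simps)
qed

lemmas a_inv_Q_simps = a_inv_Q a_inv_Q[simplified cl_simps]

lemma minus_Q: "cl x \<ominus>\<^bsub>Q\<^esub> cl y = cl (x - y)"
  by (simp add: a_minus_def a_inv_def a_inv_Q add_Q)

lemma finsum_Q: "(\<Oplus>\<^bsub>Q\<^esub>i\<in>A. cl (f i)) = cl (sum f A)"
proof -
  interpret Q: ring Q by (rule ring_Q)
  show ?thesis
    by (induction A rule: infinite_finite_induct)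
      (auto simp: Q.finsum_infinite cl_simps)
qed

lemma linear_subspace_Q_imp: "linear_subspace Q V \<Longrightarrow> T.subspace {x. cl x \<in> V}"
proof -
  assume "linear_subspace Q V"
  then interpret submodule V base_alg Q
    by (simp add: linear_subspace_def)
  show ?thesis
    using one_closed m_closed[of "cl _" "cl _"] smult_closed[of _ "cl _"] by (auto simp: T.subspace_def cl_simps)
qed

lemma linear_subspace_cl_image: "T.subspace V \<Longrightarrow> linear_subspace Q (cl ` V)"
  unfolding linear_subspace_def
  by unfold_locales
    (auto simp: cl_simps a_inv_Q_simps T.subspace_add T.subspace_neg T.subspace_0 T.subspace_scale)

lemma subring_cl_image:
  assumes "T.subspace V" "1 \<in> V" "\<And>x y. x \<in> V \<Longrightarrow> y \<in> V \<Longrightarrow> x * y \<in> V"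
  shows "subring (cl ` V) Q"
proof -
  interpret submodule "cl ` V" base_alg Q
    using linear_subspace_cl_image[OF assms(1)] by (simp add: linear_subspace_def)
  show ?thesis
    by unfold_locales (use assms in \<open>auto simp: cl_simps\<close>)
qed

text \<open>The products of generators already span a subalgebra: the empty product is 1, and
  products of two lists belong to the concatenated list. This explicit form later turns the
  subalgebras generated by classes of letters into images of spaces
  \<open>supported (words_in G)\<close>.\<close>

lemma gen_subalg_Q:
  "gen_subalg Q (cl ` S) = cl ` T.span (prod_list ` lists S)" (is "_ = cl ` ?V")
proof
  have mult: "x * y \<in> ?V" if "x \<in> ?V" "y \<in> ?V" for x y
  proof -
    have 1: "x * prod_list ys \<in> ?V" if "ys \<in> lists S" "x \<in> ?V" for x ys
      using that(2)
    proof (induction rule: T.span_induct_alt)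
      case (step c z w)
      then obtain xs where "z = prod_list xs" "xs \<in> lists S" by auto
      moreover have "prod_list (xs @ ys) \<in> ?V"
        using that(1) calculation by (intro T.span_base imageI) auto
      ultimately show ?case
        using step by (auto simp: algebra_simps intro: T.span_add T.span_scale)
    qed (auto intro: T.span_zero)
    show ?thesis using that(2)
    proof (induction rule: T.span_induct_alt)
      case (step c z w)
      then show ?case
        using 1[OF _ \<open>x \<in> ?V\<close>] by (auto simp: algebra_simps intro: T.span_add T.span_scale)
    qed (auto intro: T.span_zero)
  qed
  have "1 \<in> ?V"
    by (rule T.span_base) (auto intro!: image_eqI[of _ _ "[]"])
  then have "subring (cl ` ?V) Q" using mult by (intro subring_cl_image) auto
  moreover have "S \<subseteq> ?V"
  proof
    fix x assume "x \<in> S"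
    then show "x \<in> ?V" by (intro T.span_base) (auto intro!: image_eqI[of _ _ "[x]"])
  qed
  ultimately show "gen_subalg Q (cl ` S) \<subseteq> cl ` ?V"
    using linear_subspace_cl_image[OF T.subspace_span[of "prod_list ` lists S"]]
    unfolding gen_subalg_def by (intro Inter_lower) auto
  show "cl ` ?V \<subseteq> gen_subalg Q (cl ` S)"
  proof (clarsimp simp: gen_subalg_def)
    fix x B assume x: "x \<in> ?V" and B: "subring B Q" "linear_subspace Q B" "cl ` S \<subseteq> B"
    interpret subring B Q by fact
    have "cl (prod_list xs) \<in> B" if "xs \<in> lists S" for xs
      using that B(3)
    proof (induction xs)
      case (Cons a xs)
      then have "cl a \<otimes>\<^bsub>Q\<^esub> cl (prod_list xs) \<in> B" by auto
      then show ?case by (simp add: mult_Q)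
    qed (use submonoid.one_closed[OF submonoid_axioms] in \<open>simp add: one_Q\<close>)
    then show "cl x \<in> B"
      using x T.span_minimal[of "prod_list ` lists S" "{x. cl x \<in> B}"] linear_subspace_Q_imp[OF B(2)] by auto
  qed
qed

end

section \<open>Words, coproducts of words and degrees\<close>

text \<open>
  Induction rules produce eta-expanded degrees; the pointwise rules would rewrite under the
  abstraction and leave terms to which the bicharacter laws no longer apply.
\<close>

lemmas fun_apply_simps = plus_fun_apply zero_fun_apply minus_apply uminus_apply

declare fun_apply_simps [simp del]

lemma letters_plus [simp]: "letters (u + v) = letters u @ letters v"
  and letters_zero [simp]: "letters 0 = []"
  by (simp_all add: plus_word_def zero_word_def)

lemma Word_Nil [simp]: "Word [] = 0"
  by (simp add: zero_word_def)

lemma Word_Cons: "Word (g # gs) = Word [g] + Word gs"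
  by (simp add: plus_word_def)

lemma Word_append: "Word (gs @ hs) = Word gs + Word hs"
  by (simp add: plus_word_def)

lemma word_induct [case_names zero Cons]:
  assumes "P 0" "\<And>g w. P w \<Longrightarrow> P (Word [g] + w)"
  shows "P w"
proof (cases w)
  case (Word gs)
  have "P (Word gs)"
  proof (induction gs)
    case (Cons g gs)
    then show ?case using assms(2)[of "Word gs" g] by (simp only: Word_Cons[of g gs])
  qed (simp add: assms(1))
  with Word show ?thesis by simp
qed

lemma word_rev_induct [case_names zero snoc]:
  assumes "P 0" "\<And>g w. P w \<Longrightarrow> P (w + Word [g])"
  shows "P w"
proof (cases w)
  case (Word gs)
  have "P (Word gs)"
    by (induction gs rule: rev_induct) (use assms in \<open>auto simp: Word_append\<close>)
  with Word show ?thesis by simp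
qed

definition words_in :: "'g set \<Rightarrow> 'g word set" where
  "words_in G = {w. set (letters w) \<subseteq> G}"

lemma words_in_simps [simp]:
  "0 \<in> words_in G" "u + v \<in> words_in G \<longleftrightarrow> u \<in> words_in G \<and> v \<in> words_in G"
  "Word gs \<in> words_in G \<longleftrightarrow> set gs \<subseteq> G"
  by (auto simp: words_in_def)

lemma words_in_mono: "G \<subseteq> G' \<Longrightarrow> words_in G \<subseteq> words_in G'"
  by (auto simp: words_in_def)

lemma words_in_induct [consumes 1, case_names zero Cons]:
  assumes "w \<in> words_in G" "P 0" "\<And>g w. g \<in> G \<Longrightarrow> w \<in> words_in G \<Longrightarrow> P w \<Longrightarrow> P (Word [g] + w)"
  shows "P w"
  using assms(1) by (induction w rule: word_induct) (use assms(2,3) in auto)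

lemma words_in_rev_induct [consumes 1, case_names zero snoc]:
  assumes "w \<in> words_in G" "P 0" "\<And>g w. g \<in> G \<Longrightarrow> w \<in> words_in G \<Longrightarrow> P w \<Longrightarrow> P (w + Word [g])"
  shows "P w"
  using assms(1) by (induction w rule: word_rev_induct) (use assms(2,3) in auto)

lemma gen_eq_mon: "gen g = mon (Word [g])"
  by (simp add: gen_def mon_def)

lemma mon_Word_Cons: "mon (Word (g # gs)) = mon (Word [g]) * mon (Word gs)"
  by (subst Word_Cons) (rule mon_add)

lemma prod_list_mon: "prod_list (map (\<lambda>g. mon (Word [f g])) gs) = mon (Word (map f gs))"
  by (induction gs) (auto simp: mon_Word_Cons[of _ "map f _"])

lemma mult_monoid_alg [simp]: "(\<otimes>\<^bsub>monoid_alg\<^esub>) = (*)" "(\<otimes>\<^bsub>base_alg\<^esub>) = (*)"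
  by (simp_all add: monoid_alg_def base_alg_def)

section \<open>Homomorphisms out of free algebras, and tensor products\<close>

lemma free_hom_monoid_alg:
  "free_hom monoid_alg f = lext sc (\<lambda>w. prod_list (map f (letters w)))"
proof
  fix x
  have "foldr (\<lambda>g y. f g * y) gs 1 = prod_list (map f gs)" for gs
    by (induction gs) auto
  then show "free_hom monoid_alg f x = lext sc (\<lambda>w. prod_list (map f (letters w))) x"
    unfolding free_hom_def lext_def by (subst finsum_eq_sum) auto
qed

lemma free_hom_base_alg:
  "free_hom base_alg f = lext (*) (\<lambda>w. prod_list (map f (letters w)))"
proof
  fix x
  have "foldr (\<lambda>g y. f g * y) gs 1 = prod_list (map f gs)" for gs
    by (induction gs) auto
  then show "free_hom base_alg f x = lext (*) (\<lambda>w. prod_list (map f (letters w))) x"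
    unfolding free_hom_def lext_def by (subst finsum_eq_sum) auto
qed

lemma free_hom_monoid_alg_simps [simp]:
  "free_hom monoid_alg f (x + y) = free_hom monoid_alg f x + free_hom monoid_alg f y"
  "free_hom monoid_alg f (x - y) = free_hom monoid_alg f x - free_hom monoid_alg f y"
  "free_hom monoid_alg f (sc a x) = sc a (free_hom monoid_alg f x)"
  "free_hom monoid_alg f 0 = 0"
  "free_hom monoid_alg f 1 = 1"
  "free_hom monoid_alg f (mon w) = prod_list (map f (letters w))"
proof -
  show "free_hom monoid_alg f 1 = 1"
    using T.lext_mon[of "\<lambda>w. prod_list (map f (letters w))" 0] by (simp add: free_hom_monoid_alg)
qed (simp_all add: free_hom_monoid_alg T.lext_add T.lext_sc T.lext_diff)

lemma free_hom_monoid_alg_mult [simp]: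
  "free_hom monoid_alg f (x * y) = free_hom monoid_alg f x * free_hom monoid_alg f y"
proof -
  have *: "free_hom monoid_alg f (mon u * y) = free_hom monoid_alg f (mon u) * free_hom monoid_alg f y" for u
    using supported_UNIV[of y]
    by (induction rule: supported_induct) (simp_all add: algebra_simps mon_add[symmetric])
  show ?thesis
    using supported_UNIV[of x] by (induction rule: supported_induct) (simp_all add: algebra_simps *)
qed

lemma tens_eq_lext:
  fixes x :: "'v::monoid_add \<Rightarrow>\<^sub>0 'k::field" and y :: "'w::monoid_add \<Rightarrow>\<^sub>0 'k"
  shows "tens x y = lext sc (\<lambda>u. lext sc (\<lambda>v. mon (u, v)) y) x"
  by (simp add: tens_def lext_def T.scale_sum_right single_eq_sc)

lemma tens_simps [simp]:
  fixes x x' :: "'v::monoid_add \<Rightarrow>\<^sub>0 'k::field" and y y' :: "'w::monoid_add \<Rightarrow>\<^sub>0 'k"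
  shows
  "tens (x + x') y = tens x y + tens x' y" "tens x (y + y') = tens x y + tens x y'"
  "tens (x - x') y = tens x y - tens x' y" "tens x (y - y') = tens x y - tens x y'"
  "tens (sc a x) y = sc a (tens x y)" "tens x (sc a y) = sc a (tens x y)"
  "tens (0 :: 'v \<Rightarrow>\<^sub>0 'k) y = 0" "tens x (0 :: 'w \<Rightarrow>\<^sub>0 'k) = 0"
  "tens (mon u :: 'v \<Rightarrow>\<^sub>0 'k) (mon v :: 'w \<Rightarrow>\<^sub>0 'k) = mon (u, v)"
proof -
  have "lext sc (\<lambda>u. lext sc (\<lambda>v. mon (u, v)) y - lext sc (\<lambda>v. mon (u, v)) y') x
    = lext sc (\<lambda>u. lext sc (\<lambda>v. mon (u, v)) y) x - lext sc (\<lambda>u. lext sc (\<lambda>v. mon (u, v)) y') x"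
    by (simp add: lext_def T.scale_right_diff_distrib sum_subtractf)
  then show "tens x (y - y') = tens x y - tens x y'"
    by (simp add: tens_eq_lext T.lext_diff)
  show "tens x (0 :: 'w \<Rightarrow>\<^sub>0 'k) = 0"
    by (simp add: tens_eq_lext) (simp add: lext_def)
qed (simp_all add: tens_eq_lext T.lext_add T.lext_diff T.lext_sc T.lext_fun_add T.lext_fun_scale)

lemma tens_mon_1:
  "tens (mon u :: 'v::monoid_add \<Rightarrow>\<^sub>0 'k::field) (1 :: 'w::monoid_add \<Rightarrow>\<^sub>0 'k) = mon (u, 0)"
  "tens (1 :: 'v \<Rightarrow>\<^sub>0 'k) (mon v :: 'w \<Rightarrow>\<^sub>0 'k) = mon (0, v)"
  using tens_simps(9)[of u 0, where 'k = 'k] tens_simps(9)[of 0 v, where 'k = 'k] by simp_all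

lemma tens_mult:
  fixes x x' :: "'v::monoid_add \<Rightarrow>\<^sub>0 'k::field" and y y' :: "'w::monoid_add \<Rightarrow>\<^sub>0 'k"
  shows "tens x y * tens x' y' = tens (x * x') (y * y')"
proof -
  have 1: "(mon (u, v) :: 'v \<times> 'w \<Rightarrow>\<^sub>0 'k) * mon (u', v') = tens (mon u * mon u') (mon v * mon v')" for u v u' v'
    by (simp add: mon_add[symmetric])
  have 2: "(mon (u, v) :: 'v \<times> 'w \<Rightarrow>\<^sub>0 'k) * tens (mon u') y' = tens (mon u * mon u') (mon v * y')" for u v u'
    using supported_UNIV[of y']
    by (induction rule: supported_induct) (simp_all add: algebra_simps 1)
  have 3: "(mon (u, v) :: 'v \<times> 'w \<Rightarrow>\<^sub>0 'k) * tens x' y' = tens (mon u * x') (mon v * y')" for u v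
    using supported_UNIV[of x']
    by (induction rule: supported_induct) (simp_all add: algebra_simps 2)
  have 4: "tens (mon u :: 'v \<Rightarrow>\<^sub>0 'k) y * tens x' y' = tens (mon u * x') (y * y')" for u
    using supported_UNIV[of y]
    by (induction rule: supported_induct) (simp_all add: algebra_simps 3)
  show ?thesis
    using supported_UNIV[of x]
    by (induction rule: supported_induct) (simp_all add: algebra_simps 4)
qed

section \<open>The coproduct of words\<close>

fun cop_letter :: "'i uq_gen \<Rightarrow> ('i uq_gen word \<times> 'i uq_gen word) list" where
  "cop_letter (GE i) = [(Word [GE i], 0), (Word [GK i], Word [GE i])]"
| "cop_letter (GF i) = [(Word [GF i], Word [GL i]), (0, Word [GF i])]"
| "cop_letter (GK i) = [(Word [GK i], Word [GK i])]"
| "cop_letter (GL i) = [(Word [GL i], Word [GL i])]"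

fun cop_list :: "'i uq_gen list \<Rightarrow> ('i uq_gen word \<times> 'i uq_gen word) list" where
  "cop_list [] = [(0, 0)]"
| "cop_list (g # gs) = concat (map (\<lambda>p. map (\<lambda>q. p + q) (cop_list gs)) (cop_letter g))"

text \<open>Every coefficient in the coproduct of a word is \<open>1\<close>, so that it is a list of pairs of words.\<close>

definition cop :: "'i uq_gen word \<Rightarrow> ('i uq_gen word \<times> 'i uq_gen word) list" where
  "cop w = cop_list (letters w)"

text \<open>Sweedler sums as plain finite sums. The values lie in an arbitrary commutative monoid,
  so that scalars, algebra elements and nested sums are treated alike.\<close>

definition cop_sum :: "'i uq_gen word \<Rightarrow> ('i uq_gen word \<Rightarrow> 'i uq_gen word \<Rightarrow> 'b::comm_monoid_add) \<Rightarrow> 'b" where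
  "cop_sum w f = (\<Sum>(u, v)\<leftarrow>cop w. f u v)"

lemma cop_sum_zero [simp]: "cop_sum 0 f = f 0 0"
  by (simp add: cop_sum_def cop_def)

lemma sum_list_map_add: "(\<Sum>q\<leftarrow>map (\<lambda>q. p + q) qs. case q of (u, v) \<Rightarrow> f u v)
    = (\<Sum>(u, v)\<leftarrow>qs. f (fst p + u) (snd p + v))"
  for f :: "'a::plus \<Rightarrow> 'b::plus \<Rightarrow> 'c::comm_monoid_add"
  by (induction qs) (auto simp: plus_prod_def)

lemma cop_sum_Cons [simp]:
  "cop_sum (Word [GE i] + w) f
    = cop_sum w (\<lambda>u v. f (Word [GE i] + u) v) + cop_sum w (\<lambda>u v. f (Word [GK i] + u) (Word [GE i] + v))"
  "cop_sum (Word [GF i] + w) f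
    = cop_sum w (\<lambda>u v. f (Word [GF i] + u) (Word [GL i] + v)) + cop_sum w (\<lambda>u v. f u (Word [GF i] + v))"
  "cop_sum (Word [GK i] + w) f = cop_sum w (\<lambda>u v. f (Word [GK i] + u) (Word [GK i] + v))"
  "cop_sum (Word [GL i] + w) f = cop_sum w (\<lambda>u v. f (Word [GL i] + u) (Word [GL i] + v))"
  using sum_list_map_add[where p = "(Word [GE i], 0)" and qs = "cop w" and f = f]
    sum_list_map_add[where p = "(Word [GK i], Word [GE i])" and qs = "cop w" and f = f]
    sum_list_map_add[where p = "(Word [GF i], Word [GL i])" and qs = "cop w" and f = f]
    sum_list_map_add[where p = "(0, Word [GF i])" and qs = "cop w" and f = f]
    sum_list_map_add[where p = "(Word [GK i], Word [GK i])" and qs = "cop w" and f = f]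
    sum_list_map_add[where p = "(Word [GL i], Word [GL i])" and qs = "cop w" and f = f]
  by (simp_all add: cop_sum_def cop_def)

lemma cop_sum_letter [simp]:
  "cop_sum (Word [GE i]) f = f (Word [GE i]) 0 + f (Word [GK i]) (Word [GE i])"
  "cop_sum (Word [GF i]) f = f (Word [GF i]) (Word [GL i]) + f 0 (Word [GF i])"
  "cop_sum (Word [GK i]) f = f (Word [GK i]) (Word [GK i])"
  "cop_sum (Word [GL i]) f = f (Word [GL i]) (Word [GL i])"
  using cop_sum_Cons(1)[of i 0 f] cop_sum_Cons(2)[of i 0 f] cop_sum_Cons(3)[of i 0 f] cop_sum_Cons(4)[of i 0 f]
  by simp_all

lemma cop_sum_add: "cop_sum w (\<lambda>u v. f u v + g u v) = cop_sum w f + cop_sum w g"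
  unfolding cop_sum_def case_prod_beta by (rule sum_list_addf)

lemma cop_sum_hom:
  assumes "h 0 = 0" "\<And>x y. h (x + y) = h x + h y"
  shows "h (cop_sum w f) = cop_sum w (\<lambda>u v. h (f u v))"
proof -
  have "h (\<Sum>(u, v)\<leftarrow>l. f u v) = (\<Sum>(u, v)\<leftarrow>l. h (f u v))" for l
    by (induction l) (auto simp: assms)
  then show ?thesis by (simp add: cop_sum_def)
qed

lemma cop_sum_sc: "cop_sum w (\<lambda>u v. sc a (f u v)) = sc a (cop_sum w f)"
  by (rule cop_sum_hom[symmetric]) (auto simp: sc_add_right)

lemma cop_sum_mult_left: "x * cop_sum w f = cop_sum w (\<lambda>u v. x * f u v)"
  and cop_sum_mult_right: "cop_sum w f * x = cop_sum w (\<lambda>u v. f u v * x)"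
  for x :: "'a::semiring_0"
  by (rule cop_sum_hom; simp add: algebra_simps)+

lemma cop_sum_0 [simp]: "cop_sum w (\<lambda>u v. 0) = 0"
proof -
  have "(\<Sum>(u, v)\<leftarrow>l. 0) = 0" for l :: "('x \<times> 'y) list"
    by (induction l) auto
  then show ?thesis by (simp add: cop_sum_def)
qed

lemma cop_sum_cong:
  "(\<And>u v. (u, v) \<in> set (cop w) \<Longrightarrow> f u v = g u v) \<Longrightarrow> cop_sum w f = cop_sum w g"
  unfolding cop_sum_def by (intro arg_cong[of _ _ sum_list] map_cong) auto

lemma cop_sum_in:
  assumes "0 \<in> V" "\<And>x y. x \<in> V \<Longrightarrow> y \<in> V \<Longrightarrow> x + y \<in> V"
    "\<And>u v. (u, v) \<in> set (cop w) \<Longrightarrow> f u v \<in> V"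
  shows "cop_sum w f \<in> V"
proof -
  have "(\<Sum>(u, v)\<leftarrow>l. f u v) \<in> V" if "set l \<subseteq> set (cop w)" for l
    using that by (induction l) (auto simp: assms)
  then show ?thesis by (simp add: cop_sum_def)
qed

lemma cop_sum_plus:
  "cop_sum (w + w') f = cop_sum w (\<lambda>u v. cop_sum w' (\<lambda>u' v'. f (u + u') (v + v')))"
proof (induction w arbitrary: f rule: word_induct)
  case (Cons g w)
  show ?case
    by (cases g) (simp_all add: Cons add.assoc)
qed simp

text \<open>Coassociativity holds for lists of words without passing to the quotient, because it
  holds for each of the four kinds of generators and the coproduct is built letter by
  letter.\<close>

lemma cop_sum_coassoc:
  "cop_sum w (\<lambda>u v. cop_sum u (\<lambda>a b. f a b v)) = cop_sum w (\<lambda>u v. cop_sum v (\<lambda>b c. f u b c))"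
proof (induction w arbitrary: f rule: word_induct)
  case (Cons g w)
  show ?case
    by (cases g) (simp_all add: Cons cop_sum_add add.assoc)
qed simp

definition cou :: "'i uq_gen word \<Rightarrow> 'k::field" where
  "cou w = prod_list (map counit_gen (letters w))"

lemma cou_simps [simp]: "cou 0 = 1" "cou (u + v) = cou u * cou v" "cou (Word [g]) = counit_gen g"
  by (simp_all add: cou_def)

lemma cop_sum_counit:
  "cop_sum w (\<lambda>u v. sc (cou u) (f v)) = f w" "cop_sum w (\<lambda>u v. sc (cou v) (f u)) = f w"
proof (induction w arbitrary: f rule: word_induct)
  case (Cons g w)
  {
    case 1 show ?case using Cons(1) by (cases g) simp_all
  next
    case 2 show ?case using Cons(2) by (cases g) simp_all
  }
qed simp_all

definition Delta :: "('i uq_gen word \<Rightarrow>\<^sub>0 'k::field) \<Rightarrow> ('i uq_gen word \<times> 'i uq_gen word \<Rightarrow>\<^sub>0 'k)" where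
  "Delta = free_hom monoid_alg coproduct_gen"

lemma Delta_simps [simp]:
  "Delta (x + y) = Delta x + Delta y" "Delta (x - y) = Delta x - Delta y" "Delta 0 = 0"
  "Delta (sc a x) = sc a (Delta x)" "Delta 1 = 1" "Delta (x * y) = Delta x * Delta y"
  by (simp_all add: Delta_def)

lemma mon_pair_0 [simp]: "mon (0, 0) = 1"
  using mon_0[where 'a = "'a \<times> 'b"] by (simp only: zero_prod_def)

lemma coproduct_gen_eq: "coproduct_gen g = cop_sum (Word [g]) (\<lambda>u v. mon (u, v))"
  by (cases g) (simp_all add: gen_eq_mon tens_mon_1)

lemma Delta_mon:
  "(Delta (mon w) :: ('i uq_gen word \<times> 'i uq_gen word \<Rightarrow>\<^sub>0 'k::field)) = cop_sum w (\<lambda>u v. mon (u, v))"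
proof (induction w rule: word_induct)
  case (Cons g w)
  have "(mon (a, b) :: 'i uq_gen word \<times> 'i uq_gen word \<Rightarrow>\<^sub>0 'k) * mon (u, v) = mon (a + u, b + v)"
    for a b u v :: "'i uq_gen word"
    by (simp add: mon_add[symmetric])
  moreover have "(Delta (mon (Word [g])) :: 'i uq_gen word \<times> 'i uq_gen word \<Rightarrow>\<^sub>0 'k)
      = cop_sum (Word [g]) (\<lambda>u v. mon (u, v))"
    by (simp add: Delta_def coproduct_gen_eq)
  moreover have "(cop_sum (Word [g]) (\<lambda>u v. mon (u, v)) :: 'i uq_gen word \<times> 'i uq_gen word \<Rightarrow>\<^sub>0 'k)
      * cop_sum w (\<lambda>u v. mon (u, v))
    = cop_sum (Word [g]) (\<lambda>u v. cop_sum w (\<lambda>u' v'. mon (u, v) * mon (u', v')))"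
    by (subst cop_sum_mult_right) (simp only: cop_sum_mult_left)
  ultimately show ?case
    by (simp only: mon_add Delta_simps Cons cop_sum_plus)
qed simp

section \<open>Degrees and K-weights of words\<close>

lemma word_degree_simps:
  "word_degree dg 0 = 0" "word_degree dg (u + v) = word_degree dg u + word_degree dg v"
  by (simp_all add: word_degree_def)

lemma word_degree_letter: "word_degree dg (Word [g]) = dg g"
  by (simp add: word_degree_def)

abbreviation deg :: "'i uq_gen word \<Rightarrow> 'i \<Rightarrow> int" where
  "deg \<equiv> word_degree uq_degree"

text \<open>The exponent of the group-like part of a word. Degree and K-weight together determine
  the scalars that arise when factors are interchanged.\<close>

fun K_weight :: "'i uq_gen \<Rightarrow> 'i \<Rightarrow> int" where
  "K_weight (GE i) = 0"
| "K_weight (GF i) = 0"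
| "K_weight (GK i) = \<alpha> i"
| "K_weight (GL i) = - \<alpha> i"

abbreviation kw :: "'i uq_gen word \<Rightarrow> 'i \<Rightarrow> int" where
  "kw \<equiv> word_degree K_weight"

lemma degree_letter [simp]:
  "deg (Word [g]) = uq_degree g" "kw (Word [g]) = K_weight g" "word_degree \<alpha> (Word [i]) = \<alpha> i"
  by (rule word_degree_letter)+

lemma degree_0 [simp]: "deg 0 = 0" "kw 0 = 0" "word_degree \<alpha> 0 = 0"
  by (rule word_degree_simps)+

lemma degree_add [simp]:
  "deg (u + v) = deg u + deg v" "kw (u + v) = kw u + kw v"
  "word_degree \<alpha> (u' + v') = word_degree \<alpha> u' + word_degree \<alpha> v'"
  by (rule word_degree_simps)+

definition neg_letters :: "'i uq_gen set" where
  "neg_letters = range GF \<union> range GK \<union> range GL"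

definition pos_letters :: "'i uq_gen set" where
  "pos_letters = range GE \<union> range GK \<union> range GL"

lemma neg_letters_simps [simp]:
  "GF i \<in> neg_letters" "GK i \<in> neg_letters" "GL i \<in> neg_letters" "GE i \<notin> neg_letters"
  by (auto simp: neg_letters_def)

lemma pos_letters_simps [simp]:
  "GE i \<in> pos_letters" "GK i \<in> pos_letters" "GL i \<in> pos_letters" "GF i \<notin> pos_letters"
  by (auto simp: pos_letters_def)

lemma cop_Cons: "set (cop (Word [g] + w)) = (\<Union>p\<in>set (cop_letter g). \<Union>q\<in>set (cop w). {p + q})"
  by (auto simp: cop_def)

lemma cop_0 [simp]: "cop 0 = [(0, 0)]"
  by (simp add: cop_def)

lemma cop_ConsE:
  assumes "(u, v) \<in> set (cop (Word [g] + w))"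
  obtains a b a' b' where "(a, b) \<in> set (cop_letter g)" "(a', b') \<in> set (cop w)" "u = a + a'" "v = b + b'"
  using assms by (auto simp: cop_Cons)

lemma cop_deg: "(u, v) \<in> set (cop w) \<Longrightarrow> deg u + deg v = deg w"
proof
  show "(u, v) \<in> set (cop w) \<Longrightarrow> (deg u + deg v) j = deg w j" for j
  proof (induction w arbitrary: u v rule: word_induct)
    case (Cons g w)
    from Cons.prems obtain a b a' b' where
      "(a, b) \<in> set (cop_letter g)" "(a', b') \<in> set (cop w)" "u = a + a'" "v = b + b'"
      by (rule cop_ConsE)
    with Cons.IH[of a' b'] show ?case by (cases g) (auto simp: fun_apply_simps)
  qed (auto simp: fun_apply_simps)
qed

lemma cop_words_in:
  assumes "\<And>i. GE i \<in> G \<Longrightarrow> GK i \<in> G" "\<And>i. GF i \<in> G \<Longrightarrow> GL i \<in> G"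
  shows "w \<in> words_in G \<Longrightarrow> (u, v) \<in> set (cop w) \<Longrightarrow> u \<in> words_in G \<and> v \<in> words_in G"
proof (induction w arbitrary: u v rule: word_induct)
  case (Cons g w)
  from Cons.prems(2) obtain a b a' b' where
    "(a, b) \<in> set (cop_letter g)" "(a', b') \<in> set (cop w)" "u = a + a'" "v = b + b'"
    by (rule cop_ConsE)
  with Cons.IH[of a' b'] Cons.prems(1) assms show ?case by (cases g) auto
qed auto

text \<open>In the coproduct of \<open>F_i\<close> the factor \<open>K_i^{-1}\<close> stands to the
  right of \<open>F_i\<close>, so every \<open>F\<close> letter placed in the left leg adds its
  degree to the weight of the right leg, while the left leg receives no additional \<open>K\<close>
  letters.\<close>

lemma cop_neg:
  assumes "w \<in> words_in neg_letters" "(u, v) \<in> set (cop w)"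
  shows "u \<in> words_in neg_letters" "v \<in> words_in neg_letters" "kw u = kw w" "kw v = kw w + deg u"
proof -
  show "u \<in> words_in neg_letters" "v \<in> words_in neg_letters"
    using cop_words_in[OF _ _ assms] by auto
  have "kw u j = kw w j \<and> kw v j = kw w j + deg u j" for j
    using assms
  proof (induction w arbitrary: u v rule: words_in_induct)
    case (Cons g w)
    from Cons.prems obtain a b a' b' where
      "(a, b) \<in> set (cop_letter g)" "(a', b') \<in> set (cop w)" "u = a + a'" "v = b + b'"
      by (rule cop_ConsE)
    with Cons.IH[of a' b'] Cons.hyps(1) show ?case by (cases g) (auto simp: fun_apply_simps)
  qed (auto simp: fun_apply_simps)
  then show "kw u = kw w" "kw v = kw w + deg u" by (auto simp: fun_apply_simps)
qed

lemma cop_pos: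
  assumes "w \<in> words_in pos_letters" "(u, v) \<in> set (cop w)"
  shows "u \<in> words_in pos_letters" "v \<in> words_in pos_letters"
  using cop_words_in[OF _ _ assms] by auto

section \<open>Homogeneous components\<close>

definition hcomp :: "('g \<Rightarrow> 'i \<Rightarrow> int) \<Rightarrow> ('i \<Rightarrow> int) \<Rightarrow> ('g word \<Rightarrow>\<^sub>0 'k::field) \<Rightarrow> ('g word \<Rightarrow>\<^sub>0 'k)" where
  "hcomp dg \<mu> = lext sc (\<lambda>w. if word_degree dg w = \<mu> then mon w else 0)"

lemma hcomp_simps [simp]:
  "hcomp dg \<mu> (x + y) = hcomp dg \<mu> x + hcomp dg \<mu> y"
  "hcomp dg \<mu> (x - y) = hcomp dg \<mu> x - hcomp dg \<mu> y"
  "hcomp dg \<mu> (- x) = - hcomp dg \<mu> x"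
  "hcomp dg \<mu> (sc a x) = sc a (hcomp dg \<mu> x)" "hcomp dg \<mu> 0 = 0"
  "hcomp dg \<mu> (mon w) = (if word_degree dg w = \<mu> then mon w else 0)"
  "hcomp dg \<mu> 1 = (if 0 = \<mu> then 1 else 0)"
proof -
  show "hcomp dg \<mu> 1 = (if 0 = \<mu> then 1 else 0)"
    using T.lext_mon[of "\<lambda>w. if word_degree dg w = \<mu> then mon w else 0" 0]
    by (auto simp: hcomp_def word_degree_simps split: if_splits)
qed (simp_all add: hcomp_def T.lext_add T.lext_sc T.lext_diff T.lext_minus)

lemma hcomp_mon_mult_left: "hcomp dg \<mu> (mon w * x) = mon w * hcomp dg (\<mu> - word_degree dg w) x"
  using supported_UNIV[of x]
  by (induction rule: supported_induct)
    (auto simp: word_degree_simps algebra_simps mon_add[symmetric])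

lemma hcomp_mon_mult_right: "hcomp dg \<mu> (x * mon w) = hcomp dg (\<mu> - word_degree dg w) x * mon w"
  using supported_UNIV[of x]
  by (induction rule: supported_induct)
    (auto simp: word_degree_simps algebra_simps mon_add[symmetric])

lemma hcomp_sum_keys: "x = (\<Sum>\<mu>\<in>word_degree dg ` Poly_Mapping.keys x. hcomp dg \<mu> x)"
proof -
  have "(\<Sum>\<mu>\<in>word_degree dg ` Poly_Mapping.keys x. hcomp dg \<mu> x)
    = (\<Sum>\<mu>\<in>word_degree dg ` Poly_Mapping.keys x. \<Sum>w\<in>{w\<in>Poly_Mapping.keys x. word_degree dg w = \<mu>}.
        sc (Poly_Mapping.lookup x w) (mon w))"
    by (simp add: hcomp_def lext_def if_distrib sum.If_cases Int_def cong: if_cong)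
  also have "\<dots> = (\<Sum>w\<in>Poly_Mapping.keys x. sc (Poly_Mapping.lookup x w) (mon w))"
    by (rule sum.group) auto
  finally show ?thesis using sum_mon[of x] by simp
qed

lemma hcomp_supported:
  "x \<in> supported S \<Longrightarrow> hcomp dg \<mu> x \<in> supported (S \<inter> {w. word_degree dg w = \<mu>})"
  unfolding hcomp_def by (rule T.lext_in_subspace[OF _ subspace_supported]) auto

lemma hcomp_homogeneous:
  "x \<in> supported {w. word_degree dg w = \<mu>} \<Longrightarrow> hcomp dg \<nu> x = (if \<mu> = \<nu> then x else 0)"
  by (induction rule: supported_induct) auto

lemma hom_part_eq: "hom_part \<mu> x = hcomp \<alpha> \<mu> x"
  by (simp add: hom_part_def hcomp_def lext_def if_distrib sum.If_cases Int_def single_eq_sc cong: if_cong)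

text \<open>The vectors \<open>\<alpha> i\<close> and their negatives generate the integer vectors.
  This carries identities of bicharacters from generators to all degrees.\<close>

lemma int_fun_induct [case_names zero add pos neg]:
  fixes \<nu> :: "'i::finite \<Rightarrow> int"
  assumes "P 0" "\<And>x y. P x \<Longrightarrow> P y \<Longrightarrow> P (x + y)" "\<And>i. P (\<alpha> i)" "\<And>i. P (- \<alpha> i)"
  shows "P \<nu>"
proof -
  have nat: "P (\<lambda>j. if j = i then int n else 0)" "P (\<lambda>j. if j = i then - int n else 0)" for i n
  proof (induction n)
    case (Suc n)
    have "(\<lambda>j. if j = i then int (Suc n) else 0) = (\<lambda>j. if j = i then int n else 0) + \<alpha> i"
      "(\<lambda>j. if j = i then - int (Suc n) else 0) = (\<lambda>j. if j = i then - int n else 0) + - \<alpha> i"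
      by (auto simp: \<alpha>_def fun_apply_simps)
    then show "P (\<lambda>j. if j = i then int (Suc n) else 0)" "P (\<lambda>j. if j = i then - int (Suc n) else 0)"
      using assms(2)[OF Suc(1) assms(3)] assms(2)[OF Suc(2) assms(4)] by simp_all
  qed (use assms(1) in \<open>auto simp: zero_fun_def cong: if_cong\<close>)
  have single: "P (\<lambda>j. if j = i then m else 0)" for i m
    using nat(1)[of i "nat m"] nat(2)[of i "nat (- m)"] by (cases "m \<ge> 0") (simp_all cong: if_cong)
  have "P (\<lambda>j. if j \<in> A then \<nu> j else 0)" if "finite A" for A
    using that
  proof induction
    case (insert i A)
    have "(\<lambda>j. if j \<in> insert i A then \<nu> j else 0)
        = (\<lambda>j. if j \<in> A then \<nu> j else 0) + (\<lambda>j. if j = i then \<nu> i else 0)"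
      using insert by (auto simp: fun_apply_simps)
    then show ?case using insert.IH single assms(2) by simp
  qed (use assms(1) in \<open>auto simp: zero_fun_def\<close>)
  from this[of UNIV] show ?thesis by simp
qed

section \<open>Symmetric bicharacters\<close>

locale sym_bicharacter =
  fixes \<chi> :: "('i::{finite,linorder} \<Rightarrow> int) \<Rightarrow> ('i \<Rightarrow> int) \<Rightarrow> 'k::field"
  assumes bicharacter_chi: "bicharacter \<chi>"
    and sym_chi: "\<chi> (\<alpha> i) (\<alpha> j) = \<chi> (\<alpha> j) (\<alpha> i)"
begin

lemma chi_nz [simp]: "\<chi> x y \<noteq> 0"
  and chi_add_left: "\<chi> (x + y) z = \<chi> x z * \<chi> y z"
  and chi_add_right: "\<chi> x (y + z) = \<chi> x y * \<chi> x z"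
  using bicharacter_chi by (auto simp: bicharacter_def)

lemma chi_0_left [simp]: "\<chi> 0 y = 1"
  using chi_add_left[of 0 0 y] by simp

lemma chi_0_right [simp]: "\<chi> x 0 = 1"
  using chi_add_right[of x 0 0] by simp

lemma chi_minus_left: "\<chi> (- x) y = inverse (\<chi> x y)"
  using chi_add_left[of x "- x" y] by (simp add: inverse_unique)

lemma chi_minus_right: "\<chi> x (- y) = inverse (\<chi> x y)"
  using chi_add_right[of x y "- y"] by (simp add: inverse_unique)

lemma chi_diff_left: "\<chi> (x - y) z = \<chi> x z / \<chi> y z"
  using chi_add_left[of x "- y" z] by (simp add: chi_minus_left field_simps)

lemma chi_diff_right: "\<chi> x (y - z) = \<chi> x y / \<chi> x z"
  using chi_add_right[of x y "- z"] by (simp add: chi_minus_right field_simps)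

lemmas chi_simps = chi_add_left chi_add_right chi_minus_left chi_minus_right chi_diff_left chi_diff_right

lemma chi_alpha_sym: "\<chi> (\<alpha> i) y = \<chi> y (\<alpha> i)"
proof (rule int_fun_induct[of "\<lambda>y. \<chi> (\<alpha> i) y = \<chi> y (\<alpha> i)" y])
qed (simp_all only: chi_simps sym_chi chi_0_left chi_0_right)

lemma chi_sym: "\<chi> x y = \<chi> y x"
proof (rule int_fun_induct[of "\<lambda>x. \<chi> x y = \<chi> y x" x])
qed (simp_all only: chi_simps chi_alpha_sym chi_0_left chi_0_right)

end

section \<open>Graded biideals\<close>

lemma span_Union_induct [consumes 1, case_names zero add scale mem]:
  assumes "x \<in> T.span (\<Union>\<A>)" "P 0" "\<And>x y. P x \<Longrightarrow> P y \<Longrightarrow> P (x + y)"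
    "\<And>a x. P x \<Longrightarrow> P (sc a x)" "\<And>A x. A \<in> \<A> \<Longrightarrow> x \<in> A \<Longrightarrow> P x"
  shows "P x"
proof -
  have "T.subspace (Collect P)"
    using assms(2-4) by (auto simp: T.subspace_def)
  then show ?thesis
    using assms(1,5) T.span_induct[of x "\<Union>\<A>" P] by auto
qed

lemma braided_mult_eq_lext: "braided_mult \<chi> x y
  = lext sc (\<lambda>p. lext sc (\<lambda>p'. sc (\<chi> (word_degree \<alpha> (snd p)) (word_degree \<alpha> (fst p'))) (mon (p + p'))) y) x"
  unfolding braided_mult_def lext_def T.scale_sum_right single_eq_sc sc_sc
  by (intro sum.cong refl arg_cong2[of _ _ _ _ sc]) (simp only: mult_ac)

lemma braided_coproduct_eq_lext: "braided_coproduct \<chi>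
  = lext sc (\<lambda>w. foldr (\<lambda>i y. braided_mult \<chi> (tens (gen i) 1 + tens 1 (gen i)) y) (letters w) 1)"
proof
  fix x :: "'a word \<Rightarrow>\<^sub>0 'b"
  have [simp]: "mult (braided_square \<chi>) = braided_mult \<chi>" "smult (braided_square \<chi>) = sc"
    "one (braided_square \<chi>) = 1"
    by (auto simp: braided_square_def monoid_alg_def sc_def fun_eq_iff)
  show "braided_coproduct \<chi> x = lext sc (\<lambda>w. foldr
      (\<lambda>i y. braided_mult \<chi> (tens (gen i) 1 + tens 1 (gen i)) y) (letters w) 1) x"
    unfolding braided_coproduct_def free_hom_def lext_def
    by (subst finsum_eq_sum) (auto simp: braided_square_def)
qed

lemma braided_coproduct_simps [simp]:
  "braided_coproduct \<chi> (x + y) = braided_coproduct \<chi> x + braided_coproduct \<chi> y"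
  "braided_coproduct \<chi> (sc a x) = sc a (braided_coproduct \<chi> x)"
  "braided_coproduct \<chi> 0 = 0"
  by (simp_all add: braided_coproduct_eq_lext T.lext_add T.lext_sc)

lemma braided_coproduct_Cons: "braided_coproduct \<chi> (mon (Word [i] + w))
  = braided_mult \<chi> (tens (gen i) 1 + tens 1 (gen i)) (braided_coproduct \<chi> (mon w))"
  by (simp add: braided_coproduct_eq_lext)

lemma braided_coproduct_1: "braided_coproduct \<chi> 1 = 1"
  using T.lext_mon[of "\<lambda>w. foldr (\<lambda>i y. braided_mult \<chi> (tens (gen i) 1 + tens 1 (gen i)) y) (letters w) 1" 0]
  by (simp add: braided_coproduct_eq_lext)

lemma braided_counit_simps [simp]:
  "braided_counit (x + y) = braided_counit x + braided_counit y"
  "braided_counit (sc a x) = a * braided_counit x" "braided_counit 0 = 0"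
  by (simp_all add: braided_counit_def free_hom_base_alg K.lext_add K.lext_sc)

lemma tens_ideal_eq: "tens_ideal J = T.span {tens a b | a b. a \<in> J \<or> b \<in> J}"
  by (simp add: tens_ideal_def lin_span_monoid_alg)

lemma tens_ideal_mono: "J \<subseteq> J' \<Longrightarrow> tens_ideal J \<subseteq> tens_ideal J'"
  unfolding tens_ideal_eq by (rule T.span_mono) auto

text \<open>Every axiom of a graded biideal is linear in the element, and \<open>tens_ideal\<close>
  is monotone, so the axioms pass to the sum of all graded biideals. Hence the greatest one exists
  and \<open>I_max\<close> is not an empty description.\<close>

lemma graded_biideal_span_Union: "graded_biideal \<chi> (T.span (\<Union>{I. graded_biideal \<chi> I}))"
    (is "graded_biideal \<chi> ?M")
proof -
  have sub: "I \<subseteq> ?M" if "graded_biideal \<chi> I" for I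
    using that T.span_superset[of "\<Union>{I. graded_biideal \<chi> I}"] by auto
  have Q: "quotient_algebra I" if "graded_biideal \<chi> I" for I
    using that by (simp add: graded_biideal_def quotient_algebra_def)
  have tens: "tens_ideal I \<subseteq> tens_ideal ?M" if "graded_biideal \<chi> I" for I
    using sub[OF that] by (rule tens_ideal_mono)
  have "ideal ?M monoid_alg"
  proof (rule ideal_monoid_algI)
    fix x y assume "y \<in> ?M"
    then have "x * y \<in> ?M \<and> y * x \<in> ?M"
    proof (induction rule: span_Union_induct)
      case (mem I y)
      then show ?case
        using sub quotient_algebra.J_left[OF Q] quotient_algebra.J_right[OF Q] by blast
    qed (simp_all add: algebra_simps T.span_add T.span_scale T.span_zero)
    then show "x * y \<in> ?M" "y * x \<in> ?M" by auto
  qed (rule T.subspace_span)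
  moreover have "\<forall>\<mu>. hom_part \<mu> x \<in> ?M" if "x \<in> ?M" for x
    using that
  proof (induction rule: span_Union_induct)
    case (mem I y)
    then show ?case using sub by (auto simp: graded_biideal_def)
  qed (simp_all add: hom_part_eq T.span_add T.span_scale T.span_zero)
  moreover have "braided_coproduct \<chi> x \<in> tens_ideal ?M \<and> braided_counit x = 0" if "x \<in> ?M" for x
    using that
  proof (induction rule: span_Union_induct)
    case (mem I y)
    then show ?case using tens[of I] unfolding graded_biideal_def by blast
  qed (simp_all add: tens_ideal_eq T.span_add T.span_scale T.span_zero)
  moreover have "\<forall>w\<in>Poly_Mapping.keys x. 2 \<le> length (letters w)" if "x \<in> ?M" for x
    using that
  proof (induction rule: span_Union_induct)
    case (add x y)
    then show ?case using keys_add[of x y] by auto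
  next
    case (mem I y)
    then show ?case by (auto simp: graded_biideal_def)
  qed (auto simp: in_keys_iff)
  ultimately show ?thesis
    unfolding graded_biideal_def by blast
qed

lemma I_max_eq: "I_max \<chi> = T.span (\<Union>{I. graded_biideal \<chi> I})"
  unfolding I_max_def
proof (rule Greatest_equality)
  show "graded_biideal \<chi> (T.span (\<Union>{I. graded_biideal \<chi> I}))"
    by (rule graded_biideal_span_Union)
  show "I \<subseteq> T.span (\<Union>{I. graded_biideal \<chi> I})" if "graded_biideal \<chi> I" for I
    using that T.span_superset[of "\<Union>{I. graded_biideal \<chi> I}"] by blast
qed

lemma graded_biideal_I_max: "graded_biideal \<chi> (I_max \<chi>)"
  by (simp add: I_max_eq graded_biideal_span_Union)

lemma subset_I_max: "graded_biideal \<chi> I \<Longrightarrow> I \<subseteq> I_max \<chi>"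
  using T.span_superset[of "\<Union>{I. graded_biideal \<chi> I}"] by (auto simp: I_max_eq)

section \<open>The algebras \<open>U(\<chi>)\<close>\<close>

lemma uq_ideal_ideal: "ideal (uq_ideal \<chi> I) monoid_alg"
  unfolding uq_ideal_def by (rule ring.genideal_ideal[OF ring_monoid_alg]) simp

lemma uq_ideal_mono: "I \<subseteq> I' \<Longrightarrow> uq_ideal \<chi> I \<subseteq> uq_ideal \<chi> I'"
  unfolding uq_ideal_def
  by (rule ring.genideal_minimal[OF ring_monoid_alg ring.genideal_ideal[OF ring_monoid_alg]])
    (use ring.genideal_self[OF ring_monoid_alg, of "uq_relations \<chi> \<union> embed_pos ` I' \<union> \<omega> ` embed_pos ` I'"] in \<open>auto 0 3\<close>)

text \<open>Words are products of letters, so a property stable under linear combinations and under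
  multiplication by single letters from both sides describes an ideal. It then suffices to check the
  generators of the ideal.\<close>

lemma uq_ideal_induct [consumes 1, case_names zero add scale left right rel pos neg]:
  assumes "x \<in> uq_ideal \<chi> I" "P 0" "\<And>x y. P x \<Longrightarrow> P y \<Longrightarrow> P (x + y)" "\<And>a x. P x \<Longrightarrow> P (sc a x)"
    "\<And>g x. P x \<Longrightarrow> P (mon (Word [g]) * x)" "\<And>g x. P x \<Longrightarrow> P (x * mon (Word [g]))"
    "\<And>r. r \<in> uq_relations \<chi> \<Longrightarrow> P r"
    "\<And>y. y \<in> I \<Longrightarrow> P (embed_pos y)" "\<And>y. y \<in> I \<Longrightarrow> P (\<omega> (embed_pos y))"
  shows "P x"
proof -
  have l: "P (mon w * x)" if "P x" for w x
    by (induction w rule: word_induct) (simp_all add: that mon_add mult.assoc assms(5))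
  have r: "P (x * mon w)" if "P x" for w x
    by (induction w rule: word_rev_induct) (simp_all add: that mon_add mult.assoc[symmetric] assms(6))
  have "ideal (Collect P) monoid_alg"
  proof (rule ideal_monoid_algI)
    fix x y :: "('a, 'b) free_uq" assume "y \<in> Collect P"
    then have y: "P y" by simp
    have "P (x * y) \<and> P (y * x)"
      using supported_UNIV[of x]
      by (induction rule: supported_induct) (auto simp: algebra_simps assms(2-4) l[OF y] r[OF y])
    then show "x * y \<in> Collect P" "y * x \<in> Collect P" by auto
  qed (use assms(2-4) in \<open>auto simp: T.subspace_def\<close>)
  then have "uq_ideal \<chi> I \<subseteq> Collect P"
    unfolding uq_ideal_def by (rule ring.genideal_minimal[OF ring_monoid_alg]) (use assms(7-9) in auto)
  with assms(1) show ?thesis by auto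
qed

lemma omega_simps [simp]:
  "\<omega> (x + y) = \<omega> x + \<omega> y" "\<omega> (x - y) = \<omega> x - \<omega> y" "\<omega> (sc a x) = sc a (\<omega> x)" "\<omega> 0 = 0" "\<omega> 1 = 1"
  "\<omega> (x * y) = \<omega> x * \<omega> y"
  "\<omega> (mon w) = mon (Word (map \<omega>_gen (letters w)))"
  by (simp_all add: \<omega>_def gen_eq_mon prod_list_mon)

lemma embed_pos_simps [simp]:
  "embed_pos (x + y) = embed_pos x + embed_pos y" "embed_pos (x - y) = embed_pos x - embed_pos y"
  "embed_pos (sc a x) = sc a (embed_pos x)"
  "embed_pos 0 = 0" "embed_pos 1 = 1" "embed_pos (x * y) = embed_pos x * embed_pos y"
  "embed_pos (mon w) = mon (Word (map GE (letters w)))"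
  by (simp_all add: embed_pos_def gen_eq_mon prod_list_mon)

lemma omega_omega [simp]: "\<omega> (\<omega> x) = x"
proof -
  have [simp]: "\<omega>_gen (\<omega>_gen g) = g" for g :: "'a uq_gen"
    by (cases g) auto
  have [simp]: "map (\<omega>_gen \<circ> \<omega>_gen) l = l" for l :: "'a uq_gen list"
    by (induction l) auto
  have [simp]: "Word (letters w) = w" for w :: "'a uq_gen word"
    by (cases w) auto
  show ?thesis
    using supported_UNIV[of x] by (induction rule: supported_induct) simp_all
qed

locale free_quotient = quotient_algebra J for J :: "('g word \<Rightarrow>\<^sub>0 'k::field) set"
begin

lemma tens_in_tens_ideal: "a \<in> J \<or> b \<in> J \<Longrightarrow> tens a b \<in> tens_ideal J"
  unfolding tens_ideal_eq by (rule T.span_base) auto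

lemma tens_ideal_induct [consumes 1, case_names zero add scale tens]:
  assumes "x \<in> tens_ideal J" "P 0" "\<And>x y. P x \<Longrightarrow> P y \<Longrightarrow> P (x + y)" "\<And>a x. P x \<Longrightarrow> P (sc a x)"
    "\<And>a b. a \<in> J \<or> b \<in> J \<Longrightarrow> P (tens a b)"
  shows "P x"
proof -
  have "T.subspace (Collect P)"
    using assms(2-4) by (auto simp: T.subspace_def)
  then show ?thesis
    using assms(1,5) T.span_induct[of x "{tens a b | a b. a \<in> J \<or> b \<in> J}" P]
    by (auto simp: tens_ideal_eq)
qed

lemma tens_ideal_ideal: "ideal (tens_ideal J) monoid_alg"
proof (rule ideal_monoid_algI)
  show "T.subspace (tens_ideal J)" by (simp add: tens_ideal_eq T.subspace_span)
  note closed = T.subspace_0[OF this] T.subspace_add[OF this] T.subspace_scale[OF this]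
  have l: "mon p * y \<in> tens_ideal J \<and> y * mon p \<in> tens_ideal J" if "y \<in> tens_ideal J" for p y
    using that
  proof (induction rule: tens_ideal_induct)
    case (tens a b)
    obtain u v where p: "p = (u, v)" by (cases p) auto
    have "mon p = tens (mon u :: 'g word \<Rightarrow>\<^sub>0 'k) (mon v :: 'g word \<Rightarrow>\<^sub>0 'k)" by (simp add: p)
    then have "mon p * tens a b = tens (mon u * a) (mon v * b)" "tens a b * mon p = tens (a * mon u) (b * mon v)"
      by (simp_all only: tens_mult)
    with tens show ?case
      by (auto intro!: tens_in_tens_ideal intro: J_left J_right)
  qed (simp_all add: algebra_simps closed)
  fix x y :: "'g word \<times> 'g word \<Rightarrow>\<^sub>0 'k" assume y: "y \<in> tens_ideal J"
  have "x * y \<in> tens_ideal J \<and> y * x \<in> tens_ideal J"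
    using supported_UNIV[of x]
    by (induction rule: supported_induct) (auto simp: algebra_simps closed l[OF y])
  then show "x * y \<in> tens_ideal J" "y * x \<in> tens_ideal J" by auto
qed

end

text \<open>The word behind the product that defines \<open>uKK\<close>, which gives
  \<open>K\<^sub>\<nu>\<close> one fixed representative.\<close>

definition kword :: "('i::{finite,linorder} \<Rightarrow> int) \<Rightarrow> 'i uq_gen word" where
  "kword \<nu> = Word (concat (map (\<lambda>i. if 0 \<le> \<nu> i then replicate (nat (\<nu> i)) (GK i) else replicate (nat (- \<nu> i)) (GL i))
     (sorted_list_of_set UNIV)))"

section \<open>Commutation relations and the normal form of the group-like part\<close>

locale uq = sym_bicharacter \<chi> for \<chi> :: "('i::{finite,linorder} \<Rightarrow> int) \<Rightarrow> ('i \<Rightarrow> int) \<Rightarrow> 'k::field" +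
  fixes I :: "('i word \<Rightarrow>\<^sub>0 'k) set"
  assumes biideal: "graded_biideal \<chi> I"
begin

abbreviation "J \<equiv> uq_ideal \<chi> I"
abbreviation "q \<equiv> cls \<chi> I"
abbreviation Em :: "'i \<Rightarrow> ('i, 'k) free_uq" where "Em i \<equiv> mon (Word [GE i])"
abbreviation Fm :: "'i \<Rightarrow> ('i, 'k) free_uq" where "Fm i \<equiv> mon (Word [GF i])"
abbreviation Km :: "'i \<Rightarrow> ('i, 'k) free_uq" where "Km i \<equiv> mon (Word [GK i])"
abbreviation Lm :: "'i \<Rightarrow> ('i, 'k) free_uq" where "Lm i \<equiv> mon (Word [GL i])"

sublocale free_quotient J
  unfolding free_quotient_def quotient_algebra_def by (rule uq_ideal_ideal)

sublocale N: quotient_algebra "tens_ideal J"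
  unfolding quotient_algebra_def by (rule tens_ideal_ideal)

lemma cl_eq_q: "cl = q"
  by (simp add: fun_eq_iff cl_def cls_def)

lemmas q_simps = cl_simps[unfolded cl_eq_q, folded U_def]
lemmas ring_U = ring_Q[folded U_def]
lemmas minus_U = minus_Q[unfolded cl_eq_q, folded U_def]
lemmas finsum_U = finsum_Q[unfolded cl_eq_q, folded U_def]
lemmas q_eq_iff = cl_eq_iff[unfolded cl_eq_q]
lemmas gen_subalg_U = gen_subalg_Q[unfolded cl_eq_q, folded U_def]
lemmas UN_q_const = UN_cl_const[unfolded cl_eq_q]

lemma q_eqI: "x - y \<in> J \<Longrightarrow> q x = q y"
  by (simp add: q_eq_iff)

lemma q_mult: "q x = q x' \<Longrightarrow> q y = q y' \<Longrightarrow> q (x * y) = q (x' * y')"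
  by (simp add: q_eq_iff mult_diff_in_J)

lemma q_mult_left: "q y = q y' \<Longrightarrow> q (x * y) = q (x * y')"
  and q_mult_right: "q x = q x' \<Longrightarrow> q (x * y) = q (x' * y)"
  by (rule q_mult[OF refl], assumption) (rule q_mult[OF _ refl], assumption)

lemma q_add: "q x = q x' \<Longrightarrow> q y = q y' \<Longrightarrow> q (x + y) = q (x' + y')"
  using J_add[of "x - x'" "y - y'"] by (simp add: q_eq_iff algebra_simps)

lemma q_diff: "q x = q x' \<Longrightarrow> q y = q y' \<Longrightarrow> q (x - y) = q (x' - y')"
  using J_diff[of "x - x'" "y - y'"] by (simp add: q_eq_iff algebra_simps)

lemma q_sc: "q x = q x' \<Longrightarrow> q (sc a x) = q (sc a x')"
  using J_sc[of "x - x'" a] by (simp add: q_eq_iff T.scale_right_diff_distrib)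

lemma q_sum: "(\<And>i. i \<in> A \<Longrightarrow> q (f i) = q (g i)) \<Longrightarrow> q (sum f A) = q (sum g A)"
  using J_sum[of A "\<lambda>i. f i - g i"] by (simp add: q_eq_iff sum_subtractf)

lemma q_cop_sum:
  "(\<And>u v. (u, v) \<in> set (cop w) \<Longrightarrow> q (f u v) = q (g u v)) \<Longrightarrow> q (cop_sum w f) = q (cop_sum w g)"
proof (rule q_eqI)
  assume *: "\<And>u v. (u, v) \<in> set (cop w) \<Longrightarrow> q (f u v) = q (g u v)"
  have "cop_sum w (\<lambda>u v. f u v + sc (- 1) (g u v)) \<in> J"
    by (rule cop_sum_in) (use * in \<open>auto simp: J_0 J_add q_eq_iff\<close>)
  then show "cop_sum w f - cop_sum w g \<in> J"
    unfolding cop_sum_add cop_sum_sc by simp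
qed

lemma relations_subset: "uq_relations \<chi> \<subseteq> J"
  unfolding uq_ideal_def using ring.genideal_self[OF ring_monoid_alg] by fastforce

lemma embed_in_J: "y \<in> I \<Longrightarrow> embed_pos y \<in> J" "y \<in> I \<Longrightarrow> \<omega> (embed_pos y) \<in> J"
  unfolding uq_ideal_def
  using ring.genideal_self[OF ring_monoid_alg, of "uq_relations \<chi> \<union> embed_pos ` I \<union> \<omega> ` embed_pos ` I"] by auto

lemma rel_KL: "q (Km i * Lm i) = q 1" "q (Lm i * Km i) = q 1"
  and rel_KK: "q (Km i * Km j) = q (Km j * Km i)"
  and rel_KE: "q (Km i * Em j) = q (sc (\<chi> (\<alpha> i) (\<alpha> j)) (Em j * Km i))"
  and rel_KF: "q (Km i * Fm j) = q (sc (inverse (\<chi> (\<alpha> i) (\<alpha> j))) (Fm j * Km i))"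
proof -
  have *: "r \<in> uq_relations \<chi> \<Longrightarrow> r \<in> J" for r using relations_subset by auto
  show "q (Km i * Lm i) = q 1" "q (Lm i * Km i) = q 1" "q (Km i * Km j) = q (Km j * Km i)"
    "q (Km i * Em j) = q (sc (\<chi> (\<alpha> i) (\<alpha> j)) (Em j * Km i))"
    "q (Km i * Fm j) = q (sc (inverse (\<chi> (\<alpha> i) (\<alpha> j))) (Fm j * Km i))"
    by (rule q_eqI; rule *; force simp: uq_relations_def gen_eq_mon sc_def[symmetric])+
qed

lemma rel_EF: "q (Em i * Fm j) = q (Fm j * Em i + (if i = j then Km i - Lm i else 0))"
proof -
  have "Em i * Fm j - Fm j * Em i - (if i = j then Km i - Lm i else 0) \<in> J"
    by (rule subsetD[OF relations_subset]) (auto simp: uq_relations_def gen_eq_mon)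
  then show ?thesis by (simp add: q_eq_iff algebra_simps)
qed

lemma K_cancel: "q (Km i * (Lm i * x)) = q x" "q (Lm i * (Km i * x)) = q x"
  "q (x * Km i * Lm i) = q x" "q (x * Lm i * Km i) = q x"
  using q_mult[OF rel_KL(1), of x x] q_mult[OF rel_KL(2), of x x]
    q_mult[OF _ rel_KL(1), of x x] q_mult[OF _ rel_KL(2), of x x]
  by (simp_all add: mult.assoc)

text \<open>Multiplying the relation for \<open>Km i\<close> by \<open>Lm i\<close> from both sides
  inverts the scalar.\<close>

lemma L_commute:
  assumes "q (Km i * x) = q (sc c (x * Km i))" "c \<noteq> 0"
  shows "q (Lm i * x) = q (sc (inverse c) (x * Lm i))"
proof -
  have "q (Lm i * x) = q (Lm i * x * Km i * Lm i)"
    using K_cancel(3)[of "Lm i * x" i] by simp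
  also have "\<dots> = q (sc (inverse c) (Lm i * sc c (x * Km i) * Lm i))"
    using assms(2) by (simp add: mult.assoc)
  also have "\<dots> = q (sc (inverse c) (Lm i * (Km i * x) * Lm i))"
    by (intro q_sc q_mult refl assms(1)[symmetric])
  also have "\<dots> = q (sc (inverse c) (x * Lm i))"
    using K_cancel(2)[of i "x * Lm i"] by (intro q_sc) (simp add: mult.assoc)
  finally show ?thesis .
qed

lemma K_commute: "q (Km i * mon w) = q (sc (\<chi> (\<alpha> i) (deg w)) (mon w * Km i))"
proof (induction w rule: word_induct)
  case (Cons g w)
  have KL: "q (Km i * Lm j) = q (Lm j * Km i)" for j
    using L_commute[of j "Km i" 1] by (simp add: rel_KK)
  have g: "q (Km i * mon (Word [g])) = q (sc (\<chi> (\<alpha> i) (deg (Word [g]))) (mon (Word [g]) * Km i))"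
    by (cases g) (simp_all add: rel_KK rel_KE rel_KF KL chi_simps)
  have "q (Km i * mon (Word [g] + w)) = q ((Km i * mon (Word [g])) * mon w)"
    by (simp add: mon_add mult.assoc)
  also have "\<dots> = q (sc (\<chi> (\<alpha> i) (deg (Word [g]))) (mon (Word [g]) * (Km i * mon w)))"
    using q_mult[OF g, of "mon w" "mon w"] by (simp add: mult.assoc)
  also have "\<dots> = q (sc (\<chi> (\<alpha> i) (deg (Word [g]))) (mon (Word [g]) * sc (\<chi> (\<alpha> i) (deg w)) (mon w * Km i)))"
    by (intro q_sc q_mult refl Cons)
  finally show ?case by (simp add: mon_add mult.assoc chi_simps)
qed simp

lemma L_commute_word: "q (Lm i * mon w) = q (sc (inverse (\<chi> (\<alpha> i) (deg w))) (mon w * Lm i))"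
  by (rule L_commute[OF K_commute]) simp

abbreviation (input) "K_letters \<equiv> range GK \<union> range GL"

lemma deg_K_word: "k \<in> words_in K_letters \<Longrightarrow> deg k = 0"
  by (induction rule: words_in_induct) auto

lemma K_word_commute:
  assumes "k \<in> words_in K_letters"
  shows "q (mon k * mon w) = q (sc (\<chi> (kw k) (deg w)) (mon w * mon k))"
  using assms
proof (induction rule: words_in_induct)
  case (Cons g k)
  have g: "q (mon (Word [g]) * mon w) = q (sc (\<chi> (K_weight g) (deg w)) (mon w * mon (Word [g])))"
    using Cons.hyps(1) K_commute L_commute_word by (auto simp: chi_simps)
  have "q (mon (Word [g] + k) * mon w) = q (mon (Word [g]) * (mon k * mon w))"
    by (simp add: mon_add mult.assoc)
  also have "\<dots> = q (mon (Word [g]) * sc (\<chi> (kw k) (deg w)) (mon w * mon k))"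
    by (intro q_mult refl Cons.IH)
  also have "\<dots> = q (sc (\<chi> (kw k) (deg w)) ((mon (Word [g]) * mon w) * mon k))"
    by (simp add: mult.assoc)
  also have "\<dots> = q (sc (\<chi> (kw k) (deg w)) (sc (\<chi> (K_weight g) (deg w)) (mon w * mon (Word [g])) * mon k))"
    by (intro q_sc q_mult refl g)
  finally show ?case by (simp add: mon_add mult.assoc chi_simps mult.commute)
qed simp

definition kblock :: "('i \<Rightarrow> int) \<Rightarrow> 'i \<Rightarrow> 'i uq_gen list" where
  "kblock \<nu> i = (if 0 \<le> \<nu> i then replicate (nat (\<nu> i)) (GK i) else replicate (nat (- \<nu> i)) (GL i))"

lemma kblocks_in: "Word (concat (map (kblock \<nu>) xs)) \<in> words_in K_letters"
  by (auto simp: kblock_def split: if_splits)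

lemma kblock_add: "q (mon (Word (kblock (\<nu> + \<alpha> i) i))) = q (mon (Word (kblock \<nu> i)) * Km i)"
proof (cases "0 \<le> \<nu> i")
  case True
  then have "kblock (\<nu> + \<alpha> i) i = kblock \<nu> i @ [GK i]"
    by (simp add: kblock_def \<alpha>_def fun_apply_simps nat_add_distrib replicate_append_same)
  then show ?thesis by (simp add: Word_append mon_add)
next
  case False
  then have "nat (- \<nu> i) = Suc (nat (- \<nu> i - 1))" by simp
  then have "kblock \<nu> i = replicate (nat (- \<nu> i - 1)) (GL i) @ [GL i]"
    using False by (simp add: kblock_def replicate_append_same)
  moreover have "kblock (\<nu> + \<alpha> i) i = replicate (nat (- \<nu> i - 1)) (GL i)"
    using False by (auto simp: kblock_def \<alpha>_def fun_apply_simps)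
  ultimately have "kblock \<nu> i = kblock (\<nu> + \<alpha> i) i @ [GL i]" by simp
  then show ?thesis using K_cancel(4) by (simp add: Word_append mon_add)
qed

text \<open>Raising \<open>\<nu>\<close> by \<open>\<alpha> i\<close> changes block \<open>i\<close>
  alone, by one more letter \<open>GK i\<close> or by cancelling one \<open>GL i\<close>. The blocks
  behind it have degree 0, so the new letter moves past them without a scalar.\<close>

lemma kblocks_add:
  "distinct xs \<Longrightarrow> q (mon (Word (concat (map (kblock (\<nu> + \<alpha> i)) xs))))
    = q (mon (Word (concat (map (kblock \<nu>) xs))) * (if i \<in> set xs then Km i else 1))"
proof (induction xs)
  case (Cons x xs)
  let ?w = "\<lambda>\<nu>. mon (Word (concat (map (kblock \<nu>) xs))) :: ('i, 'k) free_uq"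
  show ?case
  proof (cases "x = i")
    case True
    have "deg (Word (concat (map (kblock \<nu>) xs))) = 0"
      using kblocks_in deg_K_word by blast
    have "q (?w (\<nu> + \<alpha> i)) = q (?w \<nu>)"
      using Cons.IH Cons.prems True by simp
    then have "q (mon (Word (kblock (\<nu> + \<alpha> i) i)) * ?w (\<nu> + \<alpha> i))
        = q (mon (Word (kblock \<nu> i)) * Km i * ?w \<nu>)"
      by (rule q_mult[OF kblock_add])
    also have "\<dots> = q (mon (Word (kblock \<nu> i)) * (?w \<nu> * Km i))"
      using K_commute[of i "Word (concat (map (kblock \<nu>) xs))"] \<open>deg _ = 0\<close>
      unfolding mult.assoc by (intro q_mult_left) simp
    finally show ?thesis using True by (simp add: Word_append mon_add mult.assoc)
  next
    case False
    then have "kblock (\<nu> + \<alpha> i) x = kblock \<nu> x"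
      by (auto simp: kblock_def \<alpha>_def fun_apply_simps)
    then show ?thesis
      using q_mult[OF refl Cons.IH, of "mon (Word (kblock \<nu> x))"] Cons.prems False
      by (simp add: Word_append mon_add mult.assoc)
  qed
qed simp

lemma kword_altdef: "kword (\<nu> :: 'i \<Rightarrow> int) = Word (concat (map (kblock \<nu>) (sorted_list_of_set UNIV)))"
  unfolding kword_def kblock_def ..

lemma kword_in: "kword (\<nu> :: 'i \<Rightarrow> int) \<in> words_in K_letters"
  unfolding kword_altdef by (rule kblocks_in)

lemma kword_0 [simp]: "kword (0 :: 'i \<Rightarrow> int) = 0"
proof -
  have "concat (map (kblock 0) xs) = []" for xs
    by (induction xs) (auto simp: kblock_def fun_apply_simps)
  then show ?thesis by (simp only: kword_altdef Word_Nil)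
qed

lemma kword_add_alpha: "q (mon (kword (\<nu> + \<alpha> i))) = q (mon (kword \<nu>) * Km i)"
  using kblocks_add[of "sorted_list_of_set UNIV" \<nu> i] by (simp add: kword_altdef)

lemma kword_diff_alpha: "q (mon (kword (\<nu> - \<alpha> i))) = q (mon (kword \<nu>) * Lm i)"
proof -
  have "q (mon (kword (\<nu> - \<alpha> i))) = q (mon (kword (\<nu> - \<alpha> i)) * Km i * Lm i)"
    by (simp add: K_cancel)
  also have "\<dots> = q (mon (kword \<nu>) * Lm i)"
    using kword_add_alpha[of "\<nu> - \<alpha> i" i] by (intro q_mult refl) simp
  finally show ?thesis .
qed

text \<open>Appending a letter shifts the weight by a basis vector up to sign, so in the quotient a
  word in the \<open>K\<close> letters depends on its weight only.\<close>

lemma K_word_eq_kword: "k \<in> words_in K_letters \<Longrightarrow> q (mon k) = q (mon (kword (kw k)))"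
proof (induction rule: words_in_rev_induct)
  case (snoc g k)
  have "q (mon (k + Word [g])) = q (mon (kword (kw k)) * mon (Word [g]))"
    unfolding mon_add by (intro q_mult snoc refl)
  also have "\<dots> = q (mon (kword (kw (k + Word [g]))))"
    using snoc.hyps(1) kword_add_alpha[of "kw k"] kword_diff_alpha[of "kw k"] by auto
  finally show ?case .
qed simp

lemma kw_kword [simp]: "kw (kword (\<nu> :: 'i \<Rightarrow> int)) = \<nu>"
proof
  fix i
  have block: "kw (Word (kblock \<nu> j)) i = (if i = j then \<nu> j else 0)" for j
  proof -
    have "kw (Word (replicate n (GK j))) i = (if i = j then int n else 0)"
      "kw (Word (replicate n (GL j))) i = (if i = j then - int n else 0)" for n
      by (induction n) (auto simp: Word_Cons[of _ "replicate _ _"] \<alpha>_def fun_apply_simps)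
    then show ?thesis by (auto simp: kblock_def fun_apply_simps)
  qed
  have "distinct xs \<Longrightarrow> kw (Word (concat (map (kblock \<nu>) xs))) i = (if i \<in> set xs then \<nu> i else 0)" for xs
    by (induction xs) (auto simp: Word_append block fun_apply_simps)
  then show "kw (kword \<nu>) i = \<nu> i" by (simp add: kword_altdef)
qed

lemma deg_kword [simp]: "deg (kword (\<nu> :: 'i \<Rightarrow> int)) = 0"
  using kword_in by (rule deg_K_word)

lemma kword_add: "q (mon (kword \<nu>) * mon (kword \<mu>)) = q (mon (kword (\<nu> + \<mu>)))"
  using K_word_eq_kword[of "kword \<nu> + kword \<mu>"] kword_in[of \<nu>] kword_in[of \<mu>] by (simp add: mon_add)

lemma uKK_eq: "uKK \<chi> I \<nu> = q (mon (kword \<nu>))"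
proof -
  have pow: "gen g ^ n = (mon (Word (replicate n g)) :: ('i, 'k) free_uq)" for g n
    by (induction n) (auto simp: gen_eq_mon mon_Word_Cons[of _ "replicate _ _"])
  have block: "(if 0 \<le> \<nu> i then gen (GK i) ^ nat (\<nu> i) else gen (GL i) ^ nat (- \<nu> i)) = (mon (Word (kblock \<nu> i)) :: ('i, 'k) free_uq)" for i
    by (simp add: kblock_def pow)
  have "(\<Prod>i\<leftarrow>xs. mon (Word (kblock \<nu> i))) = (mon (Word (concat (map (kblock \<nu>) xs))) :: ('i, 'k) free_uq)" for xs
    by (induction xs) (auto simp: Word_append mon_add)
  then show ?thesis by (simp add: uKK_def block kword_altdef)
qed

end

section \<open>Counit, grading and coproduct on the defining ideal\<close>

definition eps :: "('i, 'k::field) free_uq \<Rightarrow> 'k" where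
  "eps = free_hom base_alg counit_gen"

lemma eps_eq: "(eps :: ('i, 'k::field) free_uq \<Rightarrow> 'k) = lext (*) cou"
proof -
  have "(\<lambda>w. prod_list (map counit_gen (letters w))) = (cou :: 'i uq_gen word \<Rightarrow> 'k)"
    by (simp add: cou_def fun_eq_iff)
  then show ?thesis by (simp only: eps_def free_hom_base_alg)
qed

lemma eps_simps [simp]:
  "eps (x + y) = eps x + eps y" "eps (x - y) = eps x - eps y" "eps (sc a x) = a * eps x"
  "eps 0 = 0" "eps (mon w) = cou w" "eps 1 = 1"
proof -
  have "eps (mon 0) = 1" unfolding eps_eq K.lext_mon by simp
  then show "eps 1 = 1" by simp
qed (simp_all add: eps_eq K.lext_add K.lext_diff K.lext_sc)

lemma eps_mult [simp]: "eps (x * y) = eps x * eps y"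
proof -
  have *: "eps (mon u * y) = cou u * eps y" for u
    using supported_UNIV[of y]
    by (induction rule: supported_induct) (simp_all add: distrib_left mon_add[symmetric])
  show ?thesis
    using supported_UNIV[of x] by (induction rule: supported_induct) (simp_all add: distrib_right *)
qed

definition omega_word :: "'i uq_gen word \<Rightarrow> 'i uq_gen word" where
  "omega_word w = Word (map \<omega>_gen (letters w))"

lemma omega_word_simps [simp]:
  "omega_word 0 = 0" "omega_word (u + v) = omega_word u + omega_word v"
  "omega_word (Word [g]) = Word [\<omega>_gen g]"
  by (simp_all add: omega_word_def Word_append)

lemma omega_mon: "\<omega> (mon w) = mon (omega_word w)"
  by (simp add: omega_word_def)

lemma cop_sum_omega_word:
  "cop_sum (omega_word w) f = cop_sum w (\<lambda>u v. f (omega_word v) (omega_word u))"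
proof (induction w arbitrary: f rule: word_induct)
  case (Cons g w)
  show ?case by (cases g) (simp_all add: Cons add.commute)
qed simp

text \<open>\<open>\<omega>\<close> reverses the coproduct, so the map induced on the tensor square
  applies \<open>\<omega>\<close> to both factors and exchanges them.\<close>

definition flip :: "('i uq_gen word \<times> 'i uq_gen word \<Rightarrow>\<^sub>0 'k::field) \<Rightarrow> ('i uq_gen word \<times> 'i uq_gen word \<Rightarrow>\<^sub>0 'k)" where
  "flip = lext sc (\<lambda>p. mon (omega_word (snd p), omega_word (fst p)))"

lemma flip_simps [simp]:
  "flip (x + y) = flip x + flip y" "flip (sc a x) = sc a (flip x)" "flip 0 = 0"
  "flip (mon (u, v)) = mon (omega_word v, omega_word u)"
  by (simp_all add: flip_def T.lext_add T.lext_sc)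

lemma flip_tens: "flip (tens a b) = tens (\<omega> b) (\<omega> a)"
proof -
  have *: "flip (tens (mon u) b) = tens (\<omega> b) (\<omega> (mon u))" for u
    using supported_UNIV[of b]
    by (induction rule: supported_induct) (simp_all add: omega_mon del: omega_simps(7))
  show ?thesis
    using supported_UNIV[of a]
    by (induction rule: supported_induct) (simp_all add: *)
qed

lemma Delta_omega:
  fixes x :: "('i, 'k::field) free_uq"
  shows "Delta (\<omega> x) = flip (Delta x)"
  using supported_UNIV[of x]
proof (induction rule: supported_induct)
  case (mon w)
  have "flip (Delta (mon w :: ('i, 'k) free_uq)) = cop_sum w (\<lambda>u v. flip (mon (u, v)))"
    unfolding Delta_mon by (rule cop_sum_hom) simp_all
  moreover have "Delta (\<omega> (mon w :: ('i, 'k) free_uq)) = cop_sum w (\<lambda>u v. mon (omega_word v, omega_word u))"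
    by (simp only: omega_mon Delta_mon cop_sum_omega_word)
  ultimately show ?case by simp
qed simp_all

text \<open>
  Bosonization: \<open>a \<otimes> b \<mapsto> a K\<^bsub>deg b\<^esub> \<otimes> b\<close> turns the braided coproduct of the tensor algebra
  into the coproduct of \<open>U(\<chi>)\<close>.
\<close>

definition boson :: "('i word \<times> 'i word \<Rightarrow>\<^sub>0 'k::field) \<Rightarrow> ('i uq_gen word \<times> 'i uq_gen word \<Rightarrow>\<^sub>0 'k)" where
  "boson = lext sc (\<lambda>(u, v). mon (Word (map GE (letters u)) + Word (map GK (letters v)), Word (map GE (letters v))))"

lemma boson_simps [simp]:
  "boson (x + y) = boson x + boson y" "boson (x - y) = boson x - boson y" "boson (sc a x) = sc a (boson x)" "boson 0 = 0"
  "boson (mon (u, v)) = mon (Word (map GE (letters u)) + Word (map GK (letters v)), Word (map GE (letters v)))"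
  by (simp_all add: boson_def T.lext_add T.lext_diff T.lext_sc)

lemma braided_mult_primitive:
  "braided_mult \<chi> (tens (gen i) 1 + tens 1 (gen i)) y
    = lext sc (\<lambda>p'. sc (\<chi> 0 (word_degree \<alpha> (fst p'))) (mon ((Word [i], 0) + p'))) y
      + lext sc (\<lambda>p'. sc (\<chi> (\<alpha> i) (word_degree \<alpha> (fst p'))) (mon ((0, Word [i]) + p'))) y"
  by (simp add: braided_mult_eq_lext gen_eq_mon tens_mon_1 T.lext_add)

lemma tens_1_1: "tens 1 1 = (1 :: 'v::monoid_add \<times> 'w::monoid_add \<Rightarrow>\<^sub>0 'k::field)"
proof -
  have "tens (mon 0 :: 'v \<Rightarrow>\<^sub>0 'k) (mon 0 :: 'w \<Rightarrow>\<^sub>0 'k) = mon (0, 0)" by (rule tens_simps)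
  then show ?thesis by simp
qed

lemma braided_mult_right_simps [simp]:
  "braided_mult \<chi> x (y + z) = braided_mult \<chi> x y + braided_mult \<chi> x z"
  "braided_mult \<chi> x (sc a y) = sc a (braided_mult \<chi> x y)"
  by (simp_all add: braided_mult_eq_lext T.lext_add T.lext_fun_add T.lext_sc T.lext_fun_scale)

context uq
begin

lemma relation_cases [consumes 1, case_names KL LK KK KE KF EF]:
  assumes "r \<in> uq_relations \<chi>"
  obtains i where "r = Km i * Lm i - 1" | i where "r = Lm i * Km i - 1"
    | i j where "r = Km i * Km j - Km j * Km i"
    | i j where "r = Km i * Em j - sc (\<chi> (\<alpha> i) (\<alpha> j)) (Em j * Km i)"
    | i j where "r = Km i * Fm j - sc (inverse (\<chi> (\<alpha> i) (\<alpha> j))) (Fm j * Km i)"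
    | i j where "r = Em i * Fm j - Fm j * Em i - (if i = j then Km i - Lm i else 0)"
  using assms unfolding uq_relations_def gen_eq_mon sc_def[symmetric] sc_mult_left by blast

lemma rel_LE: "q (Lm i * Em j) = q (sc (inverse (\<chi> (\<alpha> i) (\<alpha> j))) (Em j * Lm i))"
  and rel_LF: "q (Lm i * Fm j) = q (sc (\<chi> (\<alpha> i) (\<alpha> j)) (Fm j * Lm i))"
  using L_commute_word[of i "Word [GE j]"] L_commute_word[of i "Word [GF j]"]
  by (simp_all add: chi_simps)

lemma rel_LL: "q (Lm i * Lm j) = q (Lm j * Lm i)"
  using L_commute_word[of i "Word [GL j]"] by simp

text \<open>\<open>\<omega>\<close> sends each relation to a consequence of the relations, with
  \<open>K_i\<close> replaced by its inverse, and exchanges the two families of generators that come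
  from \<open>I\<close>.\<close>

lemma omega_J: "x \<in> J \<Longrightarrow> \<omega> x \<in> J"
proof (induction rule: uq_ideal_induct)
  case (rel r)
  then show ?case
  proof (cases rule: relation_cases)
    case (EF i j)
    have "Em j * Fm i - (Fm i * Em j + (if j = i then Km j - Lm j else 0)) \<in> J"
      using rel_EF[of j i] by (simp add: q_eq_iff)
    from J_neg[OF this] show ?thesis
      unfolding EF by (auto simp: omega_mon algebra_simps simp del: omega_simps(7))
  qed (use rel_KL rel_LL rel_LE rel_LF in \<open>auto simp: q_eq_iff omega_mon simp del: omega_simps(7)\<close>)
qed (auto simp: J_0 J_add J_sc J_left J_right embed_in_J)

lemma hcomp_embed_pos:
  fixes x :: "'i word \<Rightarrow>\<^sub>0 'k"
  shows "hcomp uq_degree \<mu> (embed_pos x) = embed_pos (hcomp \<alpha> \<mu> x)"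
proof -
  have [simp]: "deg (Word (map GE (letters w))) = word_degree \<alpha> w" for w :: "'i word"
    by (simp add: word_degree_def comp_def)
  show ?thesis
    using supported_UNIV[of x] by (induction rule: supported_induct) simp_all
qed

lemma hcomp_omega: "hcomp uq_degree (\<mu> :: 'i \<Rightarrow> int) (\<omega> x) = \<omega> (hcomp uq_degree (- \<mu>) x)"
proof -
  have [simp]: "deg (omega_word w) = - deg w" for w :: "'i uq_gen word"
  proof (induction w rule: word_induct)
    case (Cons g w)
    then show ?case by (cases g) simp_all
  qed simp
  have [simp]: "- deg w = \<mu> \<longleftrightarrow> deg w = - \<mu>" for w :: "'i uq_gen word"
    by (metis minus_minus)
  show ?thesis
    using supported_UNIV[of x]
    by (induction rule: supported_induct) (simp_all add: omega_mon del: omega_simps(7))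
qed

text \<open>The relations are homogeneous and \<open>I\<close> is graded, hence \<open>J\<close> is
  graded. This is what later separates parts of different degree inside the quotient.\<close>

lemma hcomp_J: "x \<in> J \<Longrightarrow> hcomp uq_degree \<mu> x \<in> J"
proof (induction arbitrary: \<mu> rule: uq_ideal_induct)
  case (rel r)
  then have r: "r \<in> J" using relations_subset by auto
  have "hcomp uq_degree \<mu> r = r \<or> hcomp uq_degree \<mu> r = 0"
    using rel
    by (cases rule: relation_cases) (auto simp: mon_add[symmetric])
  then show ?case using r J_0 by auto
next
  case (pos y)
  have "hcomp \<alpha> \<mu> y \<in> I" using biideal pos by (auto simp: graded_biideal_def hom_part_eq)
  then show ?case by (simp add: hcomp_embed_pos embed_in_J)
next
  case (neg y)
  have "hcomp \<alpha> (- \<mu>) y \<in> I" using biideal neg by (auto simp: graded_biideal_def hom_part_eq)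
  then show ?case by (simp add: hcomp_embed_pos hcomp_omega embed_in_J)
qed (auto simp: hcomp_mon_mult_left hcomp_mon_mult_right J_0 J_add J_sc J_left J_right)

lemma eps_J: "x \<in> J \<Longrightarrow> eps x = 0"
proof (induction rule: uq_ideal_induct)
  case (rel r)
  then show ?case by (cases rule: relation_cases) auto
next
  case (pos y)
  then have "y \<in> supported {w. 2 \<le> length (letters w)}"
    using biideal by (auto simp: graded_biideal_def supported_def)
  then show ?case
  proof (induction rule: supported_induct)
    case (mon w)
    then show ?case by (cases "letters w") (auto simp: cou_def)
  qed auto
next
  case (neg y)
  then have "y \<in> supported {w. 2 \<le> length (letters w)}"
    using biideal by (auto simp: graded_biideal_def supported_def)
  then show ?case
  proof (induction rule: supported_induct)
    case (mon w)
    then show ?case by (cases "letters w") (auto simp: cou_def)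
  qed auto
qed auto

lemma counit_q: "counit (q x) = eps x"
proof -
  have "free_hom base_alg counit_gen ` q x = (\<Union>y\<in>q x. {eps y})"
    by (auto simp: eps_def)
  also have "\<dots> = {eps x}"
    by (rule UN_q_const) (use eps_J in fastforce)
  finally show ?thesis by (simp add: counit_def)
qed

lemma tens_diff: "q a = q a' \<Longrightarrow> q b = q b' \<Longrightarrow> tens a b - tens a' b' \<in> tens_ideal J"
proof -
  assume "q a = q a'" "q b = q b'"
  then have "tens (a - a') b + tens a' (b - b') \<in> tens_ideal J"
    by (intro N.J_add tens_in_tens_ideal) (auto simp: q_eq_iff)
  then show ?thesis by simp
qed

lemma Delta_letter:
  "Delta (Em i) = tens (Em i) 1 + tens (Km i) (Em i)"
  "Delta (Fm i) = tens (Fm i) (Lm i) + tens 1 (Fm i)"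
  "Delta (Km i) = tens (Km i) (Km i)" "Delta (Lm i) = tens (Lm i) (Lm i)"
  by (simp_all add: Delta_mon tens_mon_1)

lemma Delta_relation:
  assumes "r \<in> uq_relations \<chi>"
  shows "Delta r \<in> tens_ideal J"
  using assms
proof (cases rule: relation_cases)
  case (KL i)
  have "tens (Km i * Lm i) (Km i * Lm i) - tens 1 1 \<in> tens_ideal J"
    by (rule tens_diff) (simp_all add: rel_KL)
  with KL show ?thesis by (simp only: Delta_simps Delta_letter tens_mult tens_1_1)
next
  case (LK i)
  have "tens (Lm i * Km i) (Lm i * Km i) - tens 1 1 \<in> tens_ideal J"
    by (rule tens_diff) (simp_all add: rel_KL)
  with LK show ?thesis by (simp only: Delta_simps Delta_letter tens_mult tens_1_1)
next
  case (KK i j)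
  have "tens (Km i * Km j) (Km i * Km j) - tens (Km j * Km i) (Km j * Km i) \<in> tens_ideal J"
    by (rule tens_diff) (simp_all add: rel_KK[of i j])
  with KK show ?thesis by (simp only: Delta_simps Delta_letter tens_mult)
next
  case (KE i j)
  have "tens (Km i * Em j) (Km i) - tens (sc (\<chi> (\<alpha> i) (\<alpha> j)) (Em j * Km i)) (Km i)
      + (tens (Km i * Km j) (Km i * Em j) - tens (Km j * Km i) (sc (\<chi> (\<alpha> i) (\<alpha> j)) (Em j * Km i))) \<in> tens_ideal J"
    by (intro N.J_add tens_diff rel_KE rel_KK refl)
  then show ?thesis unfolding KE Delta_simps Delta_letter
    by (simp add: tens_mult algebra_simps sc_add_right del: tens_simps(9))
next
  case (KF i j)
  have "tens (Km i * Fm j) (Km i * Lm j) - tens (sc (inverse (\<chi> (\<alpha> i) (\<alpha> j))) (Fm j * Km i)) (Lm j * Km i)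
      + (tens (Km i) (Km i * Fm j) - tens (Km i) (sc (inverse (\<chi> (\<alpha> i) (\<alpha> j))) (Fm j * Km i))) \<in> tens_ideal J"
    using K_commute[of i "Word [GL j]"] by (intro N.J_add tens_diff rel_KF refl) simp
  then show ?thesis unfolding KF Delta_simps Delta_letter
    by (simp add: tens_mult algebra_simps sc_add_right del: tens_simps(9))
next
  case (EF i j)
  define D where "D = (if i = j then Km i - Lm i else 0)"
  \<comment> \<open>This is for the cross term with legs \<open>K_i F_j\<close> and
    \<open>E_i K_j^{-1}\<close>. By symmetry of \<chi> the scalars from the two legs are inverse to
    each other, so the cross terms cancel in the commutator.\<close>
  have "q (Em i * Lm j) = q (sc (\<chi> (\<alpha> i) (\<alpha> j)) (Lm j * Em i))"
    using q_sc[OF rel_LE[of j i], of "\<chi> (\<alpha> i) (\<alpha> j)"] sym_chi[of i j] by simp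
  then have "tens (Km i * Fm j) (Em i * Lm j)
      - tens (sc (inverse (\<chi> (\<alpha> i) (\<alpha> j))) (Fm j * Km i)) (sc (\<chi> (\<alpha> i) (\<alpha> j)) (Lm j * Em i)) \<in> tens_ideal J"
    by (intro tens_diff rel_KF)
  moreover have "tens (Em i * Fm j) (Lm j) - tens (Fm j * Em i + D) (Lm j) \<in> tens_ideal J"
    "tens (Km i) (Em i * Fm j) - tens (Km i) (Fm j * Em i + D) \<in> tens_ideal J"
    unfolding D_def by (intro tens_diff rel_EF refl)+
  ultimately have "tens (Km i * Fm j) (Em i * Lm j)
      - tens (sc (inverse (\<chi> (\<alpha> i) (\<alpha> j))) (Fm j * Km i)) (sc (\<chi> (\<alpha> i) (\<alpha> j)) (Lm j * Em i))
      + ((tens (Em i * Fm j) (Lm j) - tens (Fm j * Em i + D) (Lm j))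
      + (tens (Km i) (Em i * Fm j) - tens (Km i) (Fm j * Em i + D))) \<in> tens_ideal J"
    by (intro N.J_add)
  moreover have "Delta D = tens D (Lm j) + tens (Km i) D"
    by (simp add: D_def Delta_letter del: tens_simps(9))
  ultimately show ?thesis unfolding EF D_def[symmetric] Delta_simps Delta_letter
    by (simp add: tens_mult algebra_simps del: tens_simps(9))
qed

interpretation Iq: free_quotient I
  using biideal by (simp add: free_quotient_def quotient_algebra_def graded_biideal_def)

text \<open>Multiplication by the coproduct of \<open>E_i\<close> puts a letter \<open>K_i\<close>
  in front of the \<open>E\<close> letters of the first leg. Moving it behind them costs exactly the
  scalar by which the braided product differs from the ordinary one.\<close>

lemma boson_primitive:
  "boson (braided_mult \<chi> (tens (gen i) 1 + tens 1 (gen i)) z) - Delta (Em i) * boson z \<in> tens_ideal J"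
  using supported_UNIV[of z]
proof (induction rule: supported_induct)
  case (add x y)
  from N.J_add[OF this] show ?case
    by (simp add: algebra_simps)
next
  case (scale a x)
  from N.J_sc[OF this, of a] show ?case
    by (simp add: T.scale_right_diff_distrib)
next
  case (mon p)
  obtain u v where p: "p = (u, v)" by (cases p)
  let ?e = "\<lambda>u. Word (map GE (letters u))" and ?k = "\<lambda>u. Word (map GK (letters u))"
  let ?c = "\<chi> (\<alpha> i) (word_degree \<alpha> u)"
  have "deg (?e u) = word_degree \<alpha> u"
    by (simp add: word_degree_def comp_def)
  then have "q (Km i * mon (?e u)) = q (sc ?c (mon (?e u) * Km i))"
    using K_commute[of i "?e u"] by simp
  then have "tens (sc ?c (mon (?e u) * Km i) * mon (?k v)) (Em i * mon (?e v))
    - tens (Km i * mon (?e u) * mon (?k v)) (Em i * mon (?e v)) \<in> tens_ideal J"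
    by (intro tens_diff q_mult refl) simp
  then have "sc ?c (mon (?e u + (Word [GK i] + ?k v), Word [GE i] + ?e v))
    - mon (Word [GK i] + (?e u + ?k v), Word [GE i] + ?e v) \<in> tens_ideal J"
    by (simp add: mon_add[symmetric] add.assoc)
  then show ?case
    unfolding p braided_mult_primitive
    by (simp add: Delta_mon algebra_simps mon_add[symmetric] Word_append
        Word_Cons[of _ "map _ _"])
qed (simp add: braided_mult_primitive N.J_0)

lemma Delta_embed_pos: "Delta (embed_pos x) - boson (braided_coproduct \<chi> x) \<in> tens_ideal J"
  using supported_UNIV[of x]
proof (induction rule: supported_induct)
  case (add x y)
  from N.J_add[OF this] show ?case by (simp add: algebra_simps)
next
  case (scale a x)
  from N.J_sc[OF this, of a] show ?case by (simp add: T.scale_right_diff_distrib)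
next
  case (mon w)
  show ?case
  proof (induction w rule: word_induct)
    case zero
    have "boson (mon (0, 0)) = (1 :: 'i uq_gen word \<times> 'i uq_gen word \<Rightarrow>\<^sub>0 'k)"
      by (subst boson_simps) simp
    then show ?case by (simp add: braided_coproduct_1 N.J_0)
  next
    case (Cons i w)
    have "Delta (embed_pos (mon (Word [i] + w))) = Delta (Em i) * Delta (embed_pos (mon w))"
      by (simp only: mon_add embed_pos_simps Delta_simps) simp
    with N.J_diff[OF N.J_left[OF Cons, of "Delta (Em i)"]
        boson_primitive[of i "braided_coproduct \<chi> (mon w)"]]
    show ?case by (simp add: braided_coproduct_Cons algebra_simps)
  qed
qed (simp add: N.J_0)

text \<open>If the second factor lies in \<open>I\<close>, the first leg acquires a word in the
  \<open>K\<close> letters that depends on the term of the second factor. On a homogeneous component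
  this word has a fixed weight and can be replaced by one \<open>kword\<close>; so the gradedness of
  \<open>I\<close> is what makes this case work.\<close>

lemma boson_tens_ideal: "z \<in> tens_ideal I \<Longrightarrow> boson z \<in> tens_ideal J"
proof (induction rule: Iq.tens_ideal_induct)
  case (tens a b)
  let ?e = "\<lambda>u. Word (map GE (letters u))" and ?k = "\<lambda>u. Word (map GK (letters u))"
  from tens show ?case
  proof
    assume a: "a \<in> I"
    have "boson (tens a (mon v)) = tens (embed_pos a * mon (?k v)) (mon (?e v))" for v
      using supported_UNIV[of a]
      by (induction rule: supported_induct) (simp_all add: algebra_simps mon_add[symmetric])
    then have *: "boson (tens a (mon v)) \<in> tens_ideal J" for v
      using embed_in_J(1)[OF a] by (auto intro!: tens_in_tens_ideal J_right)
    show ?thesis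
      using supported_UNIV[of b]
      by (induction rule: supported_induct) (auto simp: N.J_0 N.J_add N.J_sc *)
  next
    assume b: "b \<in> I"
    have hom: "boson (tens (mon u) y) - tens (mon (?e u) * mon (kword \<mu>)) (embed_pos y) \<in> tens_ideal J"
      if "y \<in> supported {v. word_degree \<alpha> v = \<mu>}" for u y \<mu>
      using that
    proof (induction rule: supported_induct)
      case (add x y)
      from N.J_add[OF this] show ?case by (simp add: algebra_simps)
    next
      case (scale a x)
      from N.J_sc[OF this, of a] show ?case by (simp add: T.scale_right_diff_distrib)
    next
      case (mon v)
      have "?k v \<in> words_in K_letters" by auto
      moreover have "kw (?k v) = word_degree \<alpha> v"
        by (simp add: word_degree_def comp_def)
      ultimately have "q (mon (?k v)) = q (mon (kword \<mu>))"
        using K_word_eq_kword[of "?k v"] mon by simp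
      then have "tens (mon (?e u) * mon (?k v)) (mon (?e v)) - tens (mon (?e u) * mon (kword \<mu>)) (mon (?e v)) \<in> tens_ideal J"
        by (intro tens_diff q_mult refl)
      then show ?case by (simp add: mon_add[symmetric])
    qed (simp add: N.J_0)
    have *: "boson (tens (mon u) b) \<in> tens_ideal J" for u
    proof -
      have "boson (tens (mon u) (hcomp \<alpha> \<mu> b)) \<in> tens_ideal J" for \<mu>
      proof -
        have "hcomp \<alpha> \<mu> b \<in> I" using biideal b by (auto simp: graded_biideal_def hom_part_eq)
        then have "tens (mon (?e u) * mon (kword \<mu>)) (embed_pos (hcomp \<alpha> \<mu> b)) \<in> tens_ideal J"
          by (intro tens_in_tens_ideal) (simp add: embed_in_J)
        moreover have "hcomp \<alpha> \<mu> b \<in> supported {v. word_degree \<alpha> v = \<mu>}"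
          using hcomp_supported[of b UNIV] by simp
        ultimately show ?thesis
          using N.J_add[OF hom[of "hcomp \<alpha> \<mu> b" \<mu> u], of "tens (mon (?e u) * mon (kword \<mu>)) (embed_pos (hcomp \<alpha> \<mu> b))"]
          by simp
      qed
      then have "(\<Sum>\<mu>\<in>A. boson (tens (mon u) (hcomp \<alpha> \<mu> b))) \<in> tens_ideal J" for A
        by (intro N.J_sum)
      moreover have "(\<Sum>\<mu>\<in>A. boson (tens (mon u) (y \<mu>))) = boson (tens (mon u) (sum y A))"
        if "finite A" for A and y :: "('i \<Rightarrow> int) \<Rightarrow> 'i word \<Rightarrow>\<^sub>0 'k"
        using that by induction simp_all
      ultimately show ?thesis
        using hcomp_sum_keys[of b \<alpha>] by (metis finite_imageI finite_keys)
    qed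
    show ?thesis
      using supported_UNIV[of a]
      by (induction rule: supported_induct) (auto simp: N.J_0 N.J_add N.J_sc *)
  qed
qed (auto simp: N.J_0 N.J_add N.J_sc)

lemma Delta_embed_pos_in: "y \<in> I \<Longrightarrow> Delta (embed_pos y) \<in> tens_ideal J"
proof -
  assume "y \<in> I"
  then have "braided_coproduct \<chi> y \<in> tens_ideal I"
    using biideal by (auto simp: graded_biideal_def)
  from N.J_add[OF Delta_embed_pos[of y] boson_tens_ideal[OF this]] show ?thesis by simp
qed

lemma flip_tens_ideal: "z \<in> tens_ideal J \<Longrightarrow> flip z \<in> tens_ideal J"
  by (induction rule: tens_ideal_induct)
    (auto simp: flip_tens N.J_0 N.J_add N.J_sc intro!: tens_in_tens_ideal intro: omega_J)

text \<open>For the relations this is a computation, for \<open>I\<close> it follows by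
  bosonization, and for the image of \<open>I\<close> under \<open>\<omega>\<close> from the fact
  that \<open>\<omega>\<close> reverses the coproduct.\<close>

theorem Delta_J: "x \<in> J \<Longrightarrow> Delta x \<in> tens_ideal J"
  by (induction rule: uq_ideal_induct)
    (auto simp: N.J_0 N.J_add N.J_sc N.J_left N.J_right Delta_relation Delta_embed_pos_in Delta_omega flip_tens_ideal)

end

section \<open>Sweedler notation, the pairing and the actions\<close>

lemma sum_list_map_prod:
  "(\<Sum>(a, b)\<leftarrow>map (map_prod g h) l. f a b) = (\<Sum>(u, v)\<leftarrow>l. f (g u) (h v))"
  by (induction l) auto

lemma span_prod_list_gen:
  "T.span (prod_list ` lists (gen ` G)) = (supported (words_in G) :: ('a word \<Rightarrow>\<^sub>0 'b::field) set)"
proof -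
  have "prod_list (map gen gs) = (mon (Word gs) :: 'a word \<Rightarrow>\<^sub>0 'b)" for gs :: "'a list"
  proof (induction gs)
    case (Cons g gs)
    then show ?case by (simp add: mon_Word_Cons[of g gs] gen_eq_mon)
  qed simp
  then have "(prod_list ` lists (gen ` G) :: ('a word \<Rightarrow>\<^sub>0 'b) set) = (\<lambda>gs. mon (Word gs)) ` lists G"
    by (simp add: lists_image image_image)
  also have "\<dots> = mon ` words_in G"
  proof -
    have "words_in G = Word ` lists G"
      by (auto simp: words_in_def image_iff intro!: bexI[of _ "letters _"])
    then show ?thesis by (simp add: image_image)
  qed
  finally show ?thesis by (simp add: supported_eq_span)
qed

text \<open>The pairing with a fixed element is defined on a subspace only, while the factors of a
  Sweedler sum are compared through arbitrary elements of the free algebra. A basis of the subspace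
  is extended in order to have a functional everywhere.\<close>

lemma linear_functional_extend:
  fixes f :: "('w::monoid_add \<Rightarrow>\<^sub>0 'k::field) \<Rightarrow> 'k"
  assumes V: "T.subspace V" and add: "\<And>x y. x \<in> V \<Longrightarrow> y \<in> V \<Longrightarrow> f (x + y) = f x + f y"
    and scale: "\<And>a x. x \<in> V \<Longrightarrow> f (sc a x) = a * f x"
  obtains g where "\<And>x y. g (x + y) = g x + g y" "\<And>a x. g (sc a x) = a * g x" "\<And>x. x \<in> V \<Longrightarrow> g x = f x"
proof -
  interpret TK: vector_space_pair "sc :: 'k \<Rightarrow> ('w \<Rightarrow>\<^sub>0 'k) \<Rightarrow> _" "(*) :: 'k \<Rightarrow> 'k \<Rightarrow> 'k" ..
  obtain B where B: "B \<subseteq> V" "T.independent B" "V \<subseteq> T.span B"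
    using T.basis_exists by metis
  from TK.linear_independent_extend[OF B(2), of f]
  obtain g where g: "Vector_Spaces.linear sc (*) g" "\<forall>x\<in>B. g x = f x" by blast
  interpret g: Vector_Spaces.linear sc "(*)" g by fact
  have "f 0 = 0" using scale[of 0 0] T.subspace_0[OF V] by simp
  have "T.subspace {x \<in> V. g x = f x}"
    using T.subspace_0[OF V] T.subspace_add[OF V] T.subspace_scale[OF V] \<open>f 0 = 0\<close>
    by (auto simp: T.subspace_def g.add g.scale g.zero add scale)
  then have "T.span B \<subseteq> {x \<in> V. g x = f x}"
    by (rule T.span_minimal[rotated]) (use B(1) g(2) in auto)
  with B(3) have "g x = f x" if "x \<in> V" for x using that by auto
  then show thesis using that g.add g.scale by blast
qed

section \<open>Sweedler sums in the quotient\<close>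

context uq
begin

lemma U_neg_eq: "U_neg \<chi> I = q ` supported (words_in (range GF))"
  and U_pos_eq: "U_pos \<chi> I = q ` supported (words_in (range GE))"
  and U_pos_H_eq: "U_pos_H \<chi> I = q ` supported (words_in pos_letters)"
  and H_U_neg_eq: "H_U_neg \<chi> I = q ` supported (words_in neg_letters)"
proof -
  have "gen_subalg (U \<chi> I) ((\<lambda>g. q (gen g)) ` G) = q ` supported (words_in G)" for G
    using gen_subalg_U[of "gen ` G"] by (simp add: span_prod_list_gen image_image)
  from this[of "range GF"] this[of "range GE"] this[of pos_letters] this[of neg_letters]
  show "U_neg \<chi> I = q ` supported (words_in (range GF))" "U_pos \<chi> I = q ` supported (words_in (range GE))"
    "U_pos_H \<chi> I = q ` supported (words_in pos_letters)" "H_U_neg \<chi> I = q ` supported (words_in neg_letters)"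
    by (simp_all add: U_neg_def U_pos_def U_pos_H_def H_U_neg_def image_image neg_letters_def pos_letters_def image_Un)
qed

lemma coproduct_q: "coproduct \<chi> I (q x) = N.cl (Delta x)"
proof -
  have "(\<Union>a\<in>q x. N.cl (Delta a)) = N.cl (Delta x)"
    by (rule UN_q_const) (use Delta_J in \<open>auto simp: N.cl_eq_iff simp flip: Delta_simps(2)\<close>)
  then show ?thesis
    by (simp add: coproduct_def Delta_def cls2_def N.cl_def)
qed

lemma U_tens_q: "U_tens \<chi> I (q a) (q b) = N.cl (tens a b)"
proof -
  have "U_tens \<chi> I (q a) (q b) = (\<Union>a'\<in>q a. \<Union>b'\<in>q b. N.cl (tens a' b'))"
    by (simp add: U_tens_def cls2_def N.cl_def)
  also have "\<dots> = (\<Union>a'\<in>q a. N.cl (tens a' b))"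
    by (intro SUP_cong refl UN_q_const) (auto simp: N.cl_eq_iff intro!: tens_in_tens_ideal simp flip: tens_simps(4))
  also have "\<dots> = N.cl (tens a b)"
    by (intro UN_q_const) (auto simp: N.cl_eq_iff intro!: tens_in_tens_ideal simp flip: tens_simps(3))
  finally show ?thesis .
qed

lemma sweedler_q_iff:
  "sweedler \<chi> I D (q x) (map (map_prod q q) s) \<longleftrightarrow>
     (\<forall>(a, b)\<in>set s. q a \<in> D \<and> q b \<in> D) \<and> Delta x - (\<Sum>(a, b)\<leftarrow>s. tens a b) \<in> tens_ideal J"
proof -
  have "foldr (\<lambda>(B, C) z. U_tens \<chi> I B C \<oplus>\<^bsub>UU \<chi> I\<^esub> z) (map (map_prod q q) s) \<zero>\<^bsub>UU \<chi> I\<^esub>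
      = N.cl (\<Sum>(a, b)\<leftarrow>s. tens a b)"
    by (induction s) (auto simp: UU_def N.zero_Q N.add_Q U_tens_q)
  then show ?thesis
    by (auto simp: sweedler_def coproduct_q N.cl_eq_iff)
qed

lemma sweedler_cases:
  assumes "sweedler \<chi> I D A s" "D \<subseteq> carrier (U \<chi> I)"
  obtains s' where "s = map (map_prod q q) s'"
proof -
  have "\<exists>s'. s = map (map_prod q q) s'" if "set s \<subseteq> D \<times> D"
    using that
  proof (induction s)
    case (Cons p s)
    then obtain s' where s': "s = map (map_prod q q) s'" by auto
    obtain A B where p: "p = (A, B)" by (cases p)
    have "D \<subseteq> range q" using assms(2) by (simp add: q_simps)
    with Cons.prems p have "A \<in> range q" "B \<in> range q" by auto
    then obtain a b where "A = q a" "B = q b" by blast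
    with s' p show ?case by (intro exI[of _ "(a, b) # s'"]) simp
  qed simp
  with assms(1) that show thesis by (auto simp: sweedler_def)
qed

lemma sum_pairs_q:
  "(\<And>a b. (a, b) \<in> set s \<Longrightarrow> f (q a) (q b) = q (h a b)) \<Longrightarrow>
    sum_pairs (U \<chi> I) f (map (map_prod q q) s) = q (\<Sum>(a, b)\<leftarrow>s. h a b)"
  by (induction s) (auto simp: sum_pairs_def q_simps)

lemma sum_pairs_base:
  "sum_pairs base_alg f (map (map_prod q q) s) = (\<Sum>(a, b)\<leftarrow>s. f (q a) (q b))"
  by (induction s) (auto simp: sum_pairs_def)

lemma sweedler_word:
  assumes "w \<in> words_in G" "\<And>i. GE i \<in> G \<Longrightarrow> GK i \<in> G" "\<And>i. GF i \<in> G \<Longrightarrow> GL i \<in> G"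
  shows "sweedler \<chi> I (q ` supported (words_in G)) (q (mon w)) (map (map_prod q q) (map (map_prod mon mon) (cop w)))"
proof -
  have "(\<Sum>(a, b)\<leftarrow>map (map_prod mon mon) (cop w). tens a b) = Delta (mon w :: ('i, 'k) free_uq)"
    by (simp only: sum_list_map_prod Delta_mon cop_sum_def tens_simps)
  then show ?thesis
    using cop_words_in[OF assms(2,3,1)]
    unfolding sweedler_q_iff by (auto simp: N.J_0 simp del: map_map)
qed

lemma sweedler_exists:
  assumes "x \<in> supported (words_in G)" "\<And>i. GE i \<in> G \<Longrightarrow> GK i \<in> G" "\<And>i. GF i \<in> G \<Longrightarrow> GL i \<in> G"
  shows "\<exists>s. sweedler \<chi> I (q ` supported (words_in G)) (q x) (map (map_prod q q) s)"
proof -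
  let ?S = "supported (words_in G) :: ('i, 'k) free_uq set"
  have "\<exists>s. set s \<subseteq> ?S \<times> ?S \<and> Delta x = (\<Sum>(a, b)\<leftarrow>s. tens a b)"
    using assms(1)
  proof (induction rule: supported_induct)
    case (add x y)
    then obtain s t where "set s \<subseteq> ?S \<times> ?S" "Delta x = (\<Sum>(a, b)\<leftarrow>s. tens a b)"
      "set t \<subseteq> ?S \<times> ?S" "Delta y = (\<Sum>(a, b)\<leftarrow>t. tens a b)" by blast
    then show ?case by (intro exI[of _ "s @ t"]) auto
  next
    case (scale c x)
    then obtain s where s: "set s \<subseteq> ?S \<times> ?S" "Delta x = (\<Sum>(a, b)\<leftarrow>s. tens a b)" by blast
    have "sc c (\<Sum>(a, b)\<leftarrow>s. tens a b) = (\<Sum>(a, b)\<leftarrow>map (map_prod (sc c) id) s. tens a b)"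
      for s :: "(('i, 'k) free_uq \<times> ('i, 'k) free_uq) list"
      by (induction s) (auto simp: sc_add_right)
    with s show ?case by (intro exI[of _ "map (map_prod (sc c) id) s"]) (auto intro: supported_sc)
  next
    case (mon w)
    have "(\<Sum>(a, b)\<leftarrow>map (map_prod mon mon) l. tens a b) = (\<Sum>(u, v)\<leftarrow>l. mon (u, v) :: 'i uq_gen word \<times> 'i uq_gen word \<Rightarrow>\<^sub>0 'k)"
      for l by (induction l) auto
    with cop_words_in[OF assms(2,3) mon] show ?case
      by (intro exI[of _ "map (map_prod mon mon) (cop w)"]) (auto simp: Delta_mon cop_sum_def)
  qed (auto intro: exI[of _ "[]"])
  then obtain s where s: "set s \<subseteq> ?S \<times> ?S" "Delta x = (\<Sum>(a, b)\<leftarrow>s. tens a b)" by blast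
  then show ?thesis by (intro exI[of _ s]) (auto simp: sweedler_q_iff N.J_0)
qed

text \<open>A functional that vanishes on \<open>J\<close>, applied to one tensor factor, maps \<open>J \<otimes> T + T \<otimes> J\<close> to \<open>J\<close>.\<close>

lemma contraction:
  fixes g :: "('i, 'k) free_uq \<Rightarrow> 'k"
  assumes g: "\<And>x y. g (x + y) = g x + g y" "\<And>a x. g (sc a x) = a * g x" "\<And>x. x \<in> J \<Longrightarrow> g x = 0"
    and z: "Delta x - (\<Sum>(a, b)\<leftarrow>s. tens a b) \<in> tens_ideal J"
  shows "q (\<Sum>(a, b)\<leftarrow>s. sc (g a) b) = q (lext sc (\<lambda>w. cop_sum w (\<lambda>u v. sc (g (mon u)) (mon v))) x)" (is ?A)
    and "q (\<Sum>(a, b)\<leftarrow>s. sc (g b) a) = q (lext sc (\<lambda>w. cop_sum w (\<lambda>u v. sc (g (mon v)) (mon u))) x)" (is ?B)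
proof -
  define C1 :: "('i uq_gen word \<times> 'i uq_gen word \<Rightarrow>\<^sub>0 'k) \<Rightarrow> ('i, 'k) free_uq"
    where "C1 = lext sc (\<lambda>p. sc (g (mon (fst p))) (mon (snd p)))"
  define C2 :: "('i uq_gen word \<times> 'i uq_gen word \<Rightarrow>\<^sub>0 'k) \<Rightarrow> ('i, 'k) free_uq"
    where "C2 = lext sc (\<lambda>p. sc (g (mon (snd p))) (mon (fst p)))"
  have lin: "C1 (z + z') = C1 z + C1 z'" "C1 (sc a z) = sc a (C1 z)" "C1 0 = 0" "C1 (z - z') = C1 z - C1 z'"
    "C1 (mon (u, v)) = sc (g (mon u)) (mon v)"
    "C2 (z + z') = C2 z + C2 z'" "C2 (sc a z) = sc a (C2 z)" "C2 0 = 0" "C2 (z - z') = C2 z - C2 z'"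
    "C2 (mon (u, v)) = sc (g (mon v)) (mon u)" for a z z' u v
    by (simp_all add: C1_def C2_def T.lext_add T.lext_sc T.lext_diff)
  have g0: "g 0 = 0" using g(2)[of 0 0] by simp
  have tens1: "C1 (tens (mon u) b) = sc (g (mon u)) b \<and> C2 (tens (mon u) b) = sc (g b) (mon u)" for u b
    using supported_UNIV[of b]
    by (induction rule: supported_induct) (simp_all add: lin g g0 sc_add_right sc_add_left mult.commute)
  have tens: "C1 (tens a b) = sc (g a) b \<and> C2 (tens a b) = sc (g b) a" for a b
    using supported_UNIV[of a]
    by (induction rule: supported_induct) (simp_all add: lin g g0 sc_add_right sc_add_left tens1 mult.commute)
  have J: "C1 z \<in> J \<and> C2 z \<in> J" if "z \<in> tens_ideal J" for z
    using that
  proof (induction rule: tens_ideal_induct)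
    case (tens a b)
    then show ?case using g(3) \<open>C1 (tens a b) = _ \<and> _\<close> by (auto simp: J_0 J_sc)
  qed (auto simp: lin J_0 J_add J_sc)
  have Delta: "C1 (Delta x) = lext sc (\<lambda>w. cop_sum w (\<lambda>u v. sc (g (mon u)) (mon v))) x
    \<and> C2 (Delta x) = lext sc (\<lambda>w. cop_sum w (\<lambda>u v. sc (g (mon v)) (mon u))) x" for x
    using supported_UNIV[of x]
  proof (induction rule: supported_induct)
    case (mon w)
    show ?case unfolding Delta_mon T.lext_mon
      by (subst (1 2) cop_sum_hom[of _ w]) (simp_all add: lin)
  qed (simp_all add: lin T.lext_add T.lext_sc)
  have "C1 (\<Sum>(a, b)\<leftarrow>s. tens a b) = (\<Sum>(a, b)\<leftarrow>s. sc (g a) b) \<and>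
    C2 (\<Sum>(a, b)\<leftarrow>s. tens a b) = (\<Sum>(a, b)\<leftarrow>s. sc (g b) a)"
    by (induction s) (auto simp: lin tens)
  with J[OF z] Delta[of x] have
    "lext sc (\<lambda>w. cop_sum w (\<lambda>u v. sc (g (mon u)) (mon v))) x - (\<Sum>(a, b)\<leftarrow>s. sc (g a) b) \<in> J"
    "lext sc (\<lambda>w. cop_sum w (\<lambda>u v. sc (g (mon v)) (mon u))) x - (\<Sum>(a, b)\<leftarrow>s. sc (g b) a) \<in> J"
    by (simp_all add: lin)
  then show ?A ?B by (simp_all add: q_eqI[symmetric])
qed

end

section \<open>The pairing on words\<close>

locale uq_pairing = sym_bicharacter \<chi> for \<chi> :: "('i::{finite,linorder} \<Rightarrow> int) \<Rightarrow> ('i \<Rightarrow> int) \<Rightarrow> 'k::field" +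
  fixes pr :: "('i, 'k) free_uq set \<Rightarrow> ('i, 'k) free_uq set \<Rightarrow> 'k"
  assumes pairing: "is_pairing \<chi> (I_max \<chi>) pr"
begin

sublocale M: uq \<chi> "I_max \<chi>"
  by unfold_locales (rule graded_biideal_I_max)

abbreviation "negw \<equiv> words_in neg_letters"
abbreviation "posw \<equiv> words_in pos_letters"

text \<open>The pairing of a word with an element, extended linearly from words on the right. It
  carries the meaning of \<open>pr\<close> for words in \<open>negw\<close> and elements supported
  on \<open>posw\<close>, as stated in \<open>pw_eq\<close>.\<close>

definition pw :: "'i uq_gen word \<Rightarrow> ('i, 'k) free_uq \<Rightarrow> 'k" where
  "pw w = lext (*) (\<lambda>v. pr (M.q (mon w)) (M.q (mon v)))"

lemma pw_simps [simp]:
  "pw w (x + y) = pw w x + pw w y" "pw w (x - y) = pw w x - pw w y" "pw w (sc a x) = a * pw w x" "pw w 0 = 0"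
  by (simp_all add: pw_def K.lext_add K.lext_diff K.lext_sc)

lemma pr_bilinear: "bilinear_on (U \<chi> (I_max \<chi>)) (M.q ` supported negw) (U \<chi> (I_max \<chi>)) (M.q ` supported posw) base_alg pr"
  using pairing by (simp add: is_pairing_def M.H_U_neg_eq M.U_pos_H_eq)

lemma pr_left:
  assumes "x \<in> supported negw" "e \<in> M.q ` supported posw"
  shows "x' \<in> supported negw \<Longrightarrow> pr (M.q (x + x')) e = pr (M.q x) e + pr (M.q x') e"
    and "pr (M.q (sc a x)) e = a * pr (M.q x) e"
proof -
  have *: "linear_on (U \<chi> (I_max \<chi>)) (M.q ` supported negw) base_alg (\<lambda>x. pr x e)"
    using pr_bilinear assms(2) unfolding bilinear_on_def by blast
  show "x' \<in> supported negw \<Longrightarrow> pr (M.q (x + x')) e = pr (M.q x) e + pr (M.q x') e"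
    "pr (M.q (sc a x)) e = a * pr (M.q x) e"
    using * assms(1) by (auto simp: linear_on_def M.q_simps)
qed

lemma pr_right:
  assumes "y \<in> supported posw" "f \<in> M.q ` supported negw"
  shows "y' \<in> supported posw \<Longrightarrow> pr f (M.q (y + y')) = pr f (M.q y) + pr f (M.q y')"
    and "pr f (M.q (sc a y)) = a * pr f (M.q y)"
proof -
  have *: "linear_on (U \<chi> (I_max \<chi>)) (M.q ` supported posw) base_alg (pr f)"
    using pr_bilinear assms(2) unfolding bilinear_on_def by blast
  show "y' \<in> supported posw \<Longrightarrow> pr f (M.q (y + y')) = pr f (M.q y) + pr f (M.q y')"
    "pr f (M.q (sc a y)) = a * pr f (M.q y)"
    using * assms(1) by (auto simp: linear_on_def M.q_simps)
qed

lemma pw_eq: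
  assumes "w \<in> negw" "y \<in> supported posw"
  shows "pw w y = pr (M.q (mon w)) (M.q y)"
proof -
  have f: "M.q (mon w) \<in> M.q ` supported negw" using assms(1) by simp
  have "y \<in> supported posw \<and> pw w y = pr (M.q (mon w)) (M.q y)"
    using assms(2)
  proof (induction rule: supported_induct)
    case zero
    show ?case using pr_right(2)[OF _ f, of 0 0] by simp
  next
    case (mon v)
    then show ?case by (simp add: pw_def)
  qed (simp_all add: pr_right[OF _ f] supported_add supported_sc)
  then show ?thesis ..
qed

lemma pw_cong_right: "w \<in> negw \<Longrightarrow> y \<in> supported posw \<Longrightarrow> y' \<in> supported posw \<Longrightarrow> M.q y = M.q y' \<Longrightarrow> pw w y = pw w y'"
  by (simp add: pw_eq)

lemma pw_cong_left: "u \<in> negw \<Longrightarrow> u' \<in> negw \<Longrightarrow> y \<in> supported posw \<Longrightarrow> M.q (mon u) = M.q (mon u') \<Longrightarrow> pw u y = pw u' y"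
  by (simp add: pw_eq)

lemma supported_posw_mult: "y \<in> supported posw \<Longrightarrow> y' \<in> supported posw \<Longrightarrow> y * y' \<in> supported posw"
  by (rule supported_mult) auto

lemma supported_1 [simp]: "(1 :: ('i, 'k) free_uq) \<in> supported (words_in G)"
  using supported_mon[of 0 "words_in G"] by simp

lemma pr_mult_right:
  assumes "y \<in> M.q ` supported negw" "x \<in> M.q ` supported posw" "x' \<in> M.q ` supported posw"
    "sweedler \<chi> (I_max \<chi>) (M.q ` supported negw) y s"
  shows "pr y (x \<otimes>\<^bsub>U \<chi> (I_max \<chi>)\<^esub> x') = sum_pairs base_alg (\<lambda>y1 y2. pr y1 x' * pr y2 x) s"
  using pairing assms unfolding is_pairing_def M.H_U_neg_eq M.U_pos_H_eq by blast

lemma pr_mult_left: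
  assumes "y \<in> M.q ` supported negw" "y' \<in> M.q ` supported negw" "x \<in> M.q ` supported posw"
    "sweedler \<chi> (I_max \<chi>) (M.q ` supported posw) x s"
  shows "pr (y \<otimes>\<^bsub>U \<chi> (I_max \<chi>)\<^esub> y') x = sum_pairs base_alg (\<lambda>x1 x2. pr y x1 * pr y' x2) s"
  using pairing assms unfolding is_pairing_def M.H_U_neg_eq M.U_pos_H_eq by blast

lemma pw_mult:
  assumes "w \<in> negw" "y \<in> supported posw" "y' \<in> supported posw"
  shows "pw w (y * y') = cop_sum w (\<lambda>u v. pw u y' * pw v y)"
proof -
  have "pw w (y * y') = pr (M.q (mon w)) (M.q y \<otimes>\<^bsub>U \<chi> (I_max \<chi>)\<^esub> M.q y')"
    using assms by (simp add: pw_eq supported_posw_mult M.q_simps)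
  also have "\<dots> = sum_pairs base_alg (\<lambda>y1 y2. pr y1 (M.q y') * pr y2 (M.q y))
      (map (map_prod M.q M.q) (map (map_prod mon mon) (cop w)))"
    by (rule pr_mult_right[OF _ _ _ M.sweedler_word]) (use assms in simp_all)
  also have "\<dots> = cop_sum w (\<lambda>u v. pr (M.q (mon u)) (M.q y') * pr (M.q (mon v)) (M.q y))"
    by (simp only: M.sum_pairs_base cop_sum_def sum_list_map_prod)
  also have "\<dots> = cop_sum w (\<lambda>u v. pw u y' * pw v y)"
  proof (rule cop_sum_cong)
    fix u v assume "(u, v) \<in> set (cop w)"
    from cop_neg(1,2)[OF assms(1) this] assms(2,3)
    show "pr (M.q (mon u)) (M.q y') * pr (M.q (mon v)) (M.q y) = pw u y' * pw v y"
      by (simp add: pw_eq)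
  qed
  finally show ?thesis .
qed

lemma pw_add_left:
  assumes "u \<in> negw" "u' \<in> negw" "v \<in> posw"
  shows "pw (u + u') (mon v) = cop_sum v (\<lambda>a b. pw u (mon a) * pw u' (mon b))"
proof -
  have "pw (u + u') (mon v) = pr (M.q (mon u) \<otimes>\<^bsub>U \<chi> (I_max \<chi>)\<^esub> M.q (mon u')) (M.q (mon v))"
    using assms by (simp add: pw_eq M.q_simps mon_add)
  also have "\<dots> = sum_pairs base_alg (\<lambda>x1 x2. pr (M.q (mon u)) x1 * pr (M.q (mon u')) x2)
      (map (map_prod M.q M.q) (map (map_prod mon mon) (cop v)))"
    by (rule pr_mult_left[OF _ _ _ M.sweedler_word]) (use assms in simp_all)
  also have "\<dots> = cop_sum v (\<lambda>a b. pr (M.q (mon u)) (M.q (mon a)) * pr (M.q (mon u')) (M.q (mon b)))"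
    by (simp only: M.sum_pairs_base cop_sum_def sum_list_map_prod)
  also have "\<dots> = cop_sum v (\<lambda>a b. pw u (mon a) * pw u' (mon b))"
  proof (rule cop_sum_cong)
    fix a b assume "(a, b) \<in> set (cop v)"
    from cop_pos[OF assms(3) this] assms(1,2)
    show "pr (M.q (mon u)) (M.q (mon a)) * pr (M.q (mon u')) (M.q (mon b)) = pw u (mon a) * pw u' (mon b)"
      by (simp add: pw_eq)
  qed
  finally show ?thesis .
qed

lemma pw_1 [simp]: "w \<in> negw \<Longrightarrow> pw w 1 = cou w"
  using pairing by (simp add: pw_eq is_pairing_def M.H_U_neg_eq M.U_pos_H_eq M.q_simps M.counit_q)

lemma pw_0_left: "v \<in> posw \<Longrightarrow> pw 0 (mon v) = cou v"
  using pairing by (simp add: pw_eq is_pairing_def M.H_U_neg_eq M.U_pos_H_eq M.q_simps M.counit_q)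

lemma pw_letters_FK [simp]:
  "pw (Word [GF i]) (M.Em j) = (if i = j then 1 else 0)" "pw (Word [GF i]) (M.Km j) = 0"
  "pw (Word [GK i]) (M.Em j) = 0" "pw (Word [GK i]) (M.Km j) = inverse (\<chi> (\<alpha> i) (\<alpha> j))"
  using pairing by (simp_all add: pw_eq is_pairing_def gen_eq_mon)

text \<open>The pairing axioms prescribe values at \<open>E_i\<close>, \<open>F_i\<close> and
  \<open>K_i\<close>. The values at inverses follow by pairing with \<open>K_j K_j^{-1} = 1\<close>
  on the right and with \<open>K_i^{-1} K_i = 1\<close> on the left.\<close>

lemma pw_letters_L [simp]:
  "pw (Word [GK i]) (M.Lm j) = \<chi> (\<alpha> i) (\<alpha> j)" "pw (Word [GL i]) (M.Km j) = \<chi> (\<alpha> i) (\<alpha> j)"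
  "pw (Word [GF i]) (M.Lm j) = 0" "pw (Word [GL i]) (M.Em j) = 0"
  "pw (Word [GL i]) (M.Lm j) = inverse (\<chi> (\<alpha> i) (\<alpha> j))"
proof -
  have right: "pw w (M.Km j * M.Lm j) = cou w" if "w \<in> negw" for w
    using pw_cong_right[OF that _ _ M.rel_KL(1), of j] that by (simp add: supported_posw_mult)
  have left: "pw (Word [GL i] + Word [GK i]) y = pw 0 y" if "y \<in> supported posw" for y
    using M.rel_KL(2)[of i] that by (intro pw_cong_left) (simp_all add: mon_add)
  show KL: "pw (Word [GK i]) (M.Lm j) = \<chi> (\<alpha> i) (\<alpha> j)"
    using right[of "Word [GK i]"] by (simp add: pw_mult field_simps)
  show LK: "pw (Word [GL i]) (M.Km j) = \<chi> (\<alpha> i) (\<alpha> j)"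
    using left[of "M.Km j"] by (simp add: pw_add_left pw_0_left field_simps)
  show "pw (Word [GL i]) (M.Em j) = 0"
    using left[of "M.Em j"] LK pw_add_left[of "Word [GL i]" "Word [GK i]" "Word [GE j]"] by (simp add: pw_0_left)
  show "pw (Word [GL i]) (M.Lm j) = inverse (\<chi> (\<alpha> i) (\<alpha> j))"
    using right[of "Word [GL i]"] LK by (simp add: pw_mult field_simps)
  show "pw (Word [GF i]) (M.Lm j) = 0"
    using right[of "Word [GF i]"] LK by (simp add: pw_mult)
qed

lemma neg_deg_le: "w \<in> negw \<Longrightarrow> deg w i \<le> 0"
  by (induction rule: words_in_induct) (auto simp: neg_letters_def \<alpha>_def fun_apply_simps)

lemma deg_zero_F:
  assumes "w \<in> negw"
  shows "deg (Word [GF i] + w) \<noteq> 0"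
proof
  assume "deg (Word [GF i] + w) = 0"
  then have "deg (Word [GF i] + w) i = 0" by (simp only: zero_fun_apply)
  then show False using neg_deg_le[OF assms, of i] by (simp add: fun_apply_simps \<alpha>_def)
qed

lemma neg_letter_cases:
  assumes "g \<in> neg_letters"
  obtains i where "g = GF i" | i where "g = GK i" | i where "g = GL i"
  using assms by (auto simp: neg_letters_def)

lemma pos_letter_cases:
  assumes "g \<in> pos_letters"
  obtains i where "g = GE i" | i where "g = GK i" | i where "g = GL i"
  using assms by (auto simp: pos_letters_def)

lemma cou_neg: "w \<in> negw \<Longrightarrow> cou w = (if deg w = 0 then 1 else 0)"
proof (induction rule: words_in_induct)
  case (Cons g w)
  from Cons.hyps(1) show ?case
    by (cases rule: neg_letter_cases) (use Cons deg_zero_F[of w] in auto)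
qed simp

lemma pw_K: "w \<in> negw \<Longrightarrow> pw w (M.Km j) = (if deg w = 0 then inverse (\<chi> (kw w) (\<alpha> j)) else 0)"
  and pw_L: "w \<in> negw \<Longrightarrow> pw w (M.Lm j) = (if deg w = 0 then \<chi> (kw w) (\<alpha> j) else 0)"
proof (induction rule: words_in_induct)
  case (Cons g w)
  {
    case 1
    from Cons.hyps(1) show ?case
      by (cases rule: neg_letter_cases)
        (use Cons deg_zero_F[of w] in \<open>auto simp: pw_add_left chi_simps field_simps\<close>)
  next
    case 2
    from Cons.hyps(1) show ?case
      by (cases rule: neg_letter_cases)
        (use Cons deg_zero_F[of w] in \<open>auto simp: pw_add_left chi_simps field_simps\<close>)
  }
qed (simp_all add: pw_0_left)

lemma pw_E: "w \<in> negw \<Longrightarrow> deg w \<noteq> - \<alpha> j \<Longrightarrow> pw w (M.Em j) = 0"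
proof (induction rule: words_in_induct)
  case (Cons g w)
  from Cons.hyps(1) show ?case
    by (cases rule: neg_letter_cases)
      (use Cons cou_neg[of w] in \<open>auto simp: pw_add_left\<close>)
qed (simp add: pw_0_left)

text \<open>In the pairing with a product the degrees of the Sweedler factors add up. If the total
  degree is nonzero, then in every term one of the two pairings has nonzero total degree; the one
  with the shorter word vanishes by induction, the one with a letter by direct computation.\<close>

lemma pw_degree:
  assumes "w \<in> negw" "v \<in> posw" "deg w + deg v \<noteq> 0"
  shows "pw w (mon v) = 0"
  using assms(2,1,3)
proof (induction arbitrary: w rule: words_in_induct)
  case zero
  then show ?case by (simp add: cou_neg)
next
  case (Cons g v)
  have "pw a (mon v) * pw b (mon (Word [g])) = 0" if ab: "(a, b) \<in> set (cop w)" for a b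
  proof (cases "deg a + deg v = 0 \<and> deg b + uq_degree g = 0")
    case True
    have "deg w + deg (Word [g] + v) = (deg a + deg v) + (deg b + uq_degree g)"
      using cop_deg[OF ab] by (simp add: algebra_simps)
    then show ?thesis using True Cons.prems by simp
  next
    case False
    note ab' = cop_neg[OF Cons.prems(1) ab]
    have "pw b (mon (Word [g])) = 0" if "deg b + uq_degree g \<noteq> 0"
      using Cons.hyps(1) pw_E[of b] pw_K[of b] pw_L[of b] that ab'(2)
      by (cases rule: pos_letter_cases) (auto simp: eq_neg_iff_add_eq_0)
    with False Cons.IH[OF ab'(1)] show ?thesis by auto
  qed
  then have "cop_sum w (\<lambda>a b. pw a (mon v) * pw b (mon (Word [g]))) = cop_sum w (\<lambda>a b. 0)"
    by (intro cop_sum_cong)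
  then show ?case
    using Cons by (simp add: mon_add pw_mult)
qed

section \<open>The left and right actions on words\<close>

definition lact :: "('i, 'k) free_uq \<Rightarrow> ('i, 'k) free_uq \<Rightarrow> ('i, 'k) free_uq" where
  "lact y = lext sc (\<lambda>w. cop_sum w (\<lambda>u v. sc (pw u y) (mon v)))"

text \<open>For both actions the acting element is the first argument: \<open>lact y x\<close>
  represents \<open>y \<triangleright> x\<close>, and \<open>ract y x\<close> represents
  \<open>x \<triangleleft> y\<close>.\<close>

definition ract :: "('i, 'k) free_uq \<Rightarrow> ('i, 'k) free_uq \<Rightarrow> ('i, 'k) free_uq" where
  "ract y = lext sc (\<lambda>w. cop_sum w (\<lambda>u v. sc (pw v y) (mon u)))"

lemma act_simps [simp]:
  "lact y (x + x') = lact y x + lact y x'" "lact y (x - x') = lact y x - lact y x'" "lact y (sc a x) = sc a (lact y x)" "lact y 0 = 0"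
  "ract y (x + x') = ract y x + ract y x'" "ract y (x - x') = ract y x - ract y x'" "ract y (sc a x) = sc a (ract y x)" "ract y 0 = 0"
  by (simp_all add: lact_def ract_def T.lext_add T.lext_diff T.lext_sc)

lemma act_sum: "lact y (sum x A) = (\<Sum>i\<in>A. lact y (x i))" "ract y (sum x A) = (\<Sum>i\<in>A. ract y (x i))"
  by (simp_all add: lact_def ract_def T.lext_sum)

lemma lact_mon: "lact y (mon w) = cop_sum w (\<lambda>u v. sc (pw u y) (mon v))"
  and ract_mon: "ract y (mon w) = cop_sum w (\<lambda>u v. sc (pw v y) (mon u))"
  by (simp_all add: lact_def ract_def)

lemma act_cop_sum: "lact y (cop_sum w f) = cop_sum w (\<lambda>u v. lact y (f u v))"
  "ract y (cop_sum w f) = cop_sum w (\<lambda>u v. ract y (f u v))"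
  by (rule cop_sum_hom; simp)+

lemma act_linear_left:
  "lact (y + y') x = lact y x + lact y' x" "lact (sc a y) x = sc a (lact y x)"
  "ract (y + y') x = ract y x + ract y' x" "ract (sc a y) x = sc a (ract y x)"
  unfolding lact_def ract_def
  by (simp_all only: pw_simps sc_add_left cop_sum_add T.lext_fun_add)
    (simp_all only: sc_sc[symmetric] cop_sum_sc T.lext_fun_scale)

lemma act_neg:
  assumes "x \<in> supported negw"
  shows "lact y x \<in> supported negw" "ract y x \<in> supported negw"
  using assms
proof (induction rule: supported_induct)
  case (mon w)
  { case 1 show ?case unfolding lact_mon
      by (rule cop_sum_in) (use cop_neg[OF mon] in \<open>auto intro: supported_add supported_sc\<close>) }
  { case 2 show ?case unfolding ract_mon
      by (rule cop_sum_in) (use cop_neg[OF mon] in \<open>auto intro: supported_add supported_sc\<close>) }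
qed (simp_all add: supported_add supported_sc)

text \<open>A product in the second argument of the pairing is evaluated with the Sweedler factors
  in reversed order. By coassociativity this makes pairing off the left leg a left action, and
  pairing off the right leg a right action.\<close>

lemma lact_lact:
  assumes "x \<in> supported negw" "y \<in> supported posw" "y' \<in> supported posw"
  shows "lact y (lact y' x) = lact (y * y') x"
  using assms(1)
proof (induction rule: supported_induct)
  case (mon w)
  have "lact y (lact y' (mon w)) = cop_sum w (\<lambda>u v. cop_sum v (\<lambda>a b. sc (pw u y' * pw a y) (mon b)))"
    by (simp add: lact_mon act_cop_sum flip: cop_sum_sc)
  also have "\<dots> = cop_sum w (\<lambda>u v. cop_sum u (\<lambda>a b. sc (pw a y' * pw b y) (mon v)))"
    by (rule cop_sum_coassoc[symmetric])
  also have "\<dots> = cop_sum w (\<lambda>u v. sc (pw u (y * y')) (mon v))"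
    using cop_neg(1)[OF mon] assms(2,3)
    by (intro cop_sum_cong) (simp add: pw_mult, rule cop_sum_hom[symmetric], simp_all add: sc_add_left)
  finally show ?case by (simp add: lact_mon)
qed simp_all

lemma ract_ract:
  assumes "x \<in> supported negw" "y \<in> supported posw" "y' \<in> supported posw"
  shows "ract y' (ract y x) = ract (y * y') x"
  using assms(1)
proof (induction rule: supported_induct)
  case (mon w)
  have "ract y' (ract y (mon w)) = cop_sum w (\<lambda>u v. cop_sum u (\<lambda>a b. sc (pw v y * pw b y') (mon a)))"
    by (simp add: ract_mon act_cop_sum flip: cop_sum_sc)
  also have "\<dots> = cop_sum w (\<lambda>u v. cop_sum v (\<lambda>a b. sc (pw b y * pw a y') (mon u)))"
    by (rule cop_sum_coassoc)
  also have "\<dots> = cop_sum w (\<lambda>u v. sc (pw v (y * y')) (mon u))"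
    using cop_neg(2)[OF mon] assms(2,3)
    by (intro cop_sum_cong) (simp add: pw_mult mult.commute, rule cop_sum_hom[symmetric], simp_all add: sc_add_left)
  finally show ?case by (simp add: ract_mon)
qed simp_all

lemma lact_ract: "lact y (ract y' x) = ract y' (lact y x)"
  using supported_UNIV[of x]
proof (induction rule: supported_induct)
  case (mon w)
  have "ract y' (lact y (mon w)) = cop_sum w (\<lambda>u v. cop_sum v (\<lambda>a b. sc (pw u y * pw b y') (mon a)))"
    by (simp add: lact_mon ract_mon act_cop_sum flip: cop_sum_sc)
  also have "\<dots> = cop_sum w (\<lambda>u v. cop_sum u (\<lambda>a b. sc (pw a y * pw v y') (mon b)))"
    by (rule cop_sum_coassoc[symmetric])
  also have "\<dots> = lact y (ract y' (mon w))"
    by (simp add: lact_mon ract_mon act_cop_sum mult.commute flip: cop_sum_sc)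
  finally show ?case ..
qed simp_all

end

locale uq_action = uq \<chi> I + uq_pairing \<chi> pr
  for \<chi> :: "('i::{finite,linorder} \<Rightarrow> int) \<Rightarrow> ('i \<Rightarrow> int) \<Rightarrow> 'k::field" and I pr
begin

lemma J_subset: "J \<subseteq> M.J"
  by (rule uq_ideal_mono[OF subset_I_max[OF biideal]])

lemma pi_max_q: "\<pi>_max \<chi> (q x) = M.q x"
  unfolding \<pi>_max_def
  by (rule UN_q_const) (use J_subset in \<open>auto simp: M.q_eq_iff\<close>)

text \<open>\<open>J\<close> is contained in the ideal belonging to \<open>I_max\<close>, so the
  pairing with \<open>y\<close> is well defined on representatives of elements of
  \<open>H_U_neg\<close>. Its linear extension to the free algebra is then in the form that
  \<open>contraction\<close> requires.\<close>

lemma pairing_functional: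
  assumes "y \<in> supported posw"
  obtains g where "\<And>x x'. g (x + x') = g x + g x'" "\<And>a x. g (sc a x) = a * g x" "\<And>x. x \<in> J \<Longrightarrow> g x = 0"
    "\<And>x. q x \<in> H_U_neg \<chi> I \<Longrightarrow> g x = pr (\<pi>_max \<chi> (q x)) (M.q y)" "\<And>w. w \<in> negw \<Longrightarrow> g (mon w) = pw w y"
proof -
  let ?V = "{x. q x \<in> H_U_neg \<chi> I}"
  have V: "\<exists>n\<in>supported negw. M.q x = M.q n \<and> q x = q n" if "x \<in> ?V" for x
  proof -
    from that obtain n where "n \<in> supported negw" "q x = q n" by (auto simp: H_U_neg_eq)
    then show ?thesis using J_subset by (auto simp: q_eq_iff M.q_eq_iff)
  qed
  have y: "M.q y \<in> M.q ` supported posw" using assms by simp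
  have sub: "T.subspace ?V"
    unfolding T.subspace_def
  proof (intro conjI ballI allI)
    show "0 \<in> ?V" by (simp add: H_U_neg_eq)
    fix x x' c assume "x \<in> ?V" "x' \<in> ?V"
    then obtain n n' where n: "n \<in> supported negw" "q x = q n" "n' \<in> supported negw" "q x' = q n'"
      by (auto simp: H_U_neg_eq)
    from q_add[OF n(2,4)] show "x + x' \<in> ?V" using n by (auto simp: H_U_neg_eq intro: supported_add)
    from q_sc[OF n(2), of c] show "sc c x \<in> ?V" using n by (auto simp: H_U_neg_eq intro: supported_sc)
  qed
  have "pr (M.q (x + x')) (M.q y) = pr (M.q x) (M.q y) + pr (M.q x') (M.q y)" if x: "x \<in> ?V" "x' \<in> ?V" for x x'
  proof -
    from V[OF x(1)] V[OF x(2)] obtain n n' where n: "n \<in> supported negw" "n' \<in> supported negw"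
      "M.q x = M.q n" "M.q x' = M.q n'" by blast
    have "M.q (x + x') = M.q (n + n')" using n(3,4) by (rule M.q_add)
    then show ?thesis by (simp add: n pr_left[OF _ y])
  qed
  moreover have "pr (M.q (sc a x)) (M.q y) = a * pr (M.q x) (M.q y)" if "x \<in> ?V" for a x
  proof -
    from V[OF that] obtain n where n: "n \<in> supported negw" "M.q x = M.q n" by blast
    have "M.q (sc a x) = M.q (sc a n)" using n(2) by (rule M.q_sc)
    then show ?thesis by (simp add: n pr_left[OF _ y])
  qed
  ultimately obtain g where g: "\<And>x y. g (x + y) = g x + g y" "\<And>a x. g (sc a x) = a * g x"
    "\<And>x. x \<in> ?V \<Longrightarrow> g x = pr (M.q x) (M.q y)"
    using linear_functional_extend[OF sub, of "\<lambda>x. pr (M.q x) (M.q y)"] by blast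
  have "g x = 0" if "x \<in> J" for x
  proof -
    have "q x = q 0" "M.q x = M.q 0" using that J_subset by (auto simp: q_eq_iff M.q_eq_iff)
    then have "g x = pr (M.q (sc 0 0)) (M.q y)" using g(3)[of x] by (simp add: H_U_neg_eq)
    then show ?thesis by (simp only: pr_left(2)[OF supported_0 y] mult_zero_left)
  qed
  moreover have "g (mon w) = pw w y" if "w \<in> negw" for w
    using g(3)[of "mon w"] that assms by (auto simp: H_U_neg_eq pw_eq)
  ultimately show thesis using that[of g] g by (simp add: pi_max_q)
qed

text \<open>The two actions are definite descriptions over all Sweedler sums. By
  \<open>contraction\<close> each Sweedler sum yields the class of \<open>lact\<close> or
  \<open>ract\<close>, and \<open>sweedler_exists\<close> provides one.\<close>

lemma act_q:
  assumes "x \<in> supported negw" "y \<in> supported posw"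
  shows left_act_q: "left_act \<chi> I pr (M.q y) (q x) = q (lact y x)"
    and right_act_q: "right_act \<chi> I pr (q x) (M.q y) = q (ract y x)"
proof -
  from assms(2) obtain g where g: "\<And>x x'. g (x + x') = g x + g x'" "\<And>a x. g (sc a x) = a * g x" "\<And>x. x \<in> J \<Longrightarrow> g x = 0"
    "\<And>x. q x \<in> H_U_neg \<chi> I \<Longrightarrow> g x = pr (\<pi>_max \<chi> (q x)) (M.q y)" "\<And>w. w \<in> negw \<Longrightarrow> g (mon w) = pw w y"
    using pairing_functional by blast
  have eq: "lext sc (\<lambda>w. cop_sum w (\<lambda>u v. sc (g (mon u)) (mon v))) x = lact y x"
    "lext sc (\<lambda>w. cop_sum w (\<lambda>u v. sc (g (mon v)) (mon u))) x = ract y x"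
    unfolding lact_def ract_def
    by (rule T.lext_cong[OF assms(1)], rule cop_sum_cong, use g(5) cop_neg(1,2) in metis)+
  have H: "H_U_neg \<chi> I \<subseteq> carrier (U \<chi> I)" by (auto simp: H_U_neg_eq q_simps)
  have 1: "sum_pairs (U \<chi> I) (\<lambda>f1 f2. pr (\<pi>_max \<chi> f1) (M.q y) \<odot>\<^bsub>U \<chi> I\<^esub> f2) s = q (lact y x)"
    and 2: "sum_pairs (U \<chi> I) (\<lambda>f1 f2. pr (\<pi>_max \<chi> f2) (M.q y) \<odot>\<^bsub>U \<chi> I\<^esub> f1) s = q (ract y x)"
    if s: "sweedler \<chi> I (H_U_neg \<chi> I) (q x) s" for s
  proof -
    from sweedler_cases[OF s H] obtain t where t: "s = map (map_prod q q) t" .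
    from s have *: "\<forall>(a, b)\<in>set t. q a \<in> H_U_neg \<chi> I \<and> q b \<in> H_U_neg \<chi> I"
      and z: "Delta x - (\<Sum>(a, b)\<leftarrow>t. tens a b) \<in> tens_ideal J"
      unfolding t sweedler_q_iff by auto
    show "sum_pairs (U \<chi> I) (\<lambda>f1 f2. pr (\<pi>_max \<chi> f1) (M.q y) \<odot>\<^bsub>U \<chi> I\<^esub> f2) s = q (lact y x)"
      unfolding t using * contraction(1)[OF g(1-3) z] eq
      by (subst sum_pairs_q[where h = "\<lambda>a b. sc (g a) b"]) (auto simp: q_simps g(4))
    show "sum_pairs (U \<chi> I) (\<lambda>f1 f2. pr (\<pi>_max \<chi> f2) (M.q y) \<odot>\<^bsub>U \<chi> I\<^esub> f1) s = q (ract y x)"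
      unfolding t using * contraction(2)[OF g(1-3) z] eq
      by (subst sum_pairs_q[where h = "\<lambda>a b. sc (g b) a"]) (auto simp: q_simps g(4))
  qed
  from sweedler_exists[OF assms(1)] obtain s where "sweedler \<chi> I (H_U_neg \<chi> I) (q x) s"
    by (auto simp: H_U_neg_eq)
  then show "left_act \<chi> I pr (M.q y) (q x) = q (lact y x)" "right_act \<chi> I pr (q x) (M.q y) = q (ract y x)"
    unfolding left_act_def right_act_def using 1 2 by (auto intro!: the_equality)
qed

lemma lact_cong: "x \<in> supported negw \<Longrightarrow> x' \<in> supported negw \<Longrightarrow> y \<in> supported posw \<Longrightarrow> q x = q x' \<Longrightarrow> q (lact y x) = q (lact y x')"
  and ract_cong: "x \<in> supported negw \<Longrightarrow> x' \<in> supported negw \<Longrightarrow> y \<in> supported posw \<Longrightarrow> q x = q x' \<Longrightarrow> q (ract y x) = q (ract y x')"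
  by (metis left_act_q) (metis right_act_q)

end

section \<open>The antipode\<close>

fun anti_letter :: "'i uq_gen \<Rightarrow> ('i, 'k::field) free_uq" where
  "anti_letter (GE i) = - (mon (Word [GL i]) * mon (Word [GE i]))"
| "anti_letter (GF i) = - (mon (Word [GF i]) * mon (Word [GK i]))"
| "anti_letter (GK i) = mon (Word [GL i])"
| "anti_letter (GL i) = mon (Word [GK i])"

definition rev_ext :: "('g \<Rightarrow> ('h word \<Rightarrow>\<^sub>0 'k::field)) \<Rightarrow> ('g word \<Rightarrow>\<^sub>0 'k) \<Rightarrow> ('h word \<Rightarrow>\<^sub>0 'k)" where
  "rev_ext f = lext sc (\<lambda>w. prod_list (map f (rev (letters w))))"

lemma rev_ext_simps [simp]:
  "rev_ext f (x + y) = rev_ext f x + rev_ext f y" "rev_ext f (x - y) = rev_ext f x - rev_ext f y" "rev_ext f (- x) = - rev_ext f x"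
  "rev_ext f (sc a x) = sc a (rev_ext f x)" "rev_ext f 0 = 0" "rev_ext f 1 = 1" "rev_ext f (mon (Word [g])) = f g"
proof -
  have "rev_ext f (mon 0) = 1" unfolding rev_ext_def T.lext_mon by simp
  then show "rev_ext f 1 = 1" by simp
qed (simp_all add: rev_ext_def T.lext_add T.lext_diff T.lext_minus T.lext_sc)

lemma rev_ext_mult [simp]: "rev_ext f (x * y) = rev_ext f y * rev_ext f x"
proof -
  have mon: "rev_ext f (mon u * mon v) = rev_ext f (mon v) * rev_ext f (mon u)" for u v
    by (simp add: rev_ext_def flip: mon_add)
  have *: "rev_ext f (mon u * y) = rev_ext f y * rev_ext f (mon u)" for u
    using supported_UNIV[of y]
    by (induction rule: supported_induct) (simp_all add: distrib_left distrib_right mon)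
  show ?thesis
    using supported_UNIV[of x] by (induction rule: supported_induct) (simp_all add: distrib_left distrib_right *)
qed

abbreviation anti :: "('i, 'k::field) free_uq \<Rightarrow> ('i, 'k) free_uq" where
  "anti \<equiv> rev_ext anti_letter"

lemma one_supported_iff: "(1 :: 'w::monoid_add \<Rightarrow>\<^sub>0 'k::field) \<in> supported S \<longleftrightarrow> 0 \<in> S"
  by (simp add: supported_mon flip: mon_0)

lemma (in uq) q_linear_eqI:
  assumes "x \<in> supported S" "\<And>x y. f (x + y) = f x + f y" "\<And>a x. f (sc a x) = sc a (f x)"
    "\<And>x y. g (x + y) = g x + g y" "\<And>a x. g (sc a x) = sc a (g x)"
    "\<And>w. w \<in> S \<Longrightarrow> q (f (mon w)) = q (g (mon w))"
  shows "q (f x) = q (g x)"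
  using assms(1)
proof (induction rule: supported_induct)
  case zero
  show ?case using assms(3)[of 0 0] assms(5)[of 0 0] by simp
next
  case (add x y)
  then show ?case unfolding assms(2,4) by (rule q_add)
next
  case (scale a x)
  then show ?case unfolding assms(3,5) by (rule q_sc)
qed (rule assms(6))

section \<open>The antipode on words and its injectivity\<close>

locale uq_antipode = uq \<chi> I for \<chi> :: "('i::{finite,linorder} \<Rightarrow> int) \<Rightarrow> ('i \<Rightarrow> int) \<Rightarrow> 'k::field" and I +
  fixes S :: "('i, 'k) free_uq set \<Rightarrow> ('i, 'k) free_uq set"
  assumes antipode: "is_antipode \<chi> I S"
begin

lemma S_linear: "S (q x) \<in> range q" "S (q (x + y)) = S (q x) \<oplus>\<^bsub>U \<chi> I\<^esub> S (q y)" "S (q (sc a x)) = a \<odot>\<^bsub>U \<chi> I\<^esub> S (q x)"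
  using antipode by (auto simp: is_antipode_def linear_on_def q_simps)

text \<open>A linear lift of \<open>S\<close>, chosen word by word. How it behaves on products is
  derived from the antipode axioms.\<close>

definition antipode_rep :: "('i, 'k) free_uq \<Rightarrow> ('i, 'k) free_uq" where
  "antipode_rep = lext sc (\<lambda>w. SOME x. q x = S (q (mon w)))"

lemma antipode_rep: "q (antipode_rep x) = S (q x)"
  using supported_UNIV[of x]
proof (induction rule: supported_induct)
  case zero
  from S_linear(1)[of 0] obtain y where "S (q 0) = q y" by auto
  with S_linear(3)[of 0 0] show ?case by (simp add: antipode_rep_def q_simps)
next
  case (mon w)
  from S_linear(1)[of "mon w"] have "\<exists>y. q y = S (q (mon w))" by auto
  then show ?case unfolding antipode_rep_def T.lext_mon by (rule someI_ex)
next
  case (add x y)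
  then show ?case
    by (simp add: antipode_rep_def T.lext_add S_linear(2) q_simps flip: add)
next
  case (scale a x)
  then show ?case
    by (simp add: antipode_rep_def T.lext_sc S_linear(3) q_simps flip: scale)
qed

lemma antipode_identities:
  "q (cop_sum w (\<lambda>u v. antipode_rep (mon u) * mon v)) = q (sc (cou w) 1)"
  "q (cop_sum w (\<lambda>u v. mon u * antipode_rep (mon v))) = q (sc (cou w) 1)"
proof -
  have "sweedler \<chi> I (range q) (q (mon w)) (map (map_prod q q) (map (map_prod mon mon) (cop w)))"
    using sweedler_word[of w UNIV] by (simp add: words_in_def supported_def)
  with antipode have
    "sum_pairs (U \<chi> I) (\<lambda>y z. S y \<otimes>\<^bsub>U \<chi> I\<^esub> z) (map (map_prod q q) (map (map_prod mon mon) (cop w))) = counit (q (mon w)) \<odot>\<^bsub>U \<chi> I\<^esub> \<one>\<^bsub>U \<chi> I\<^esub>"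
    "sum_pairs (U \<chi> I) (\<lambda>y z. y \<otimes>\<^bsub>U \<chi> I\<^esub> S z) (map (map_prod q q) (map (map_prod mon mon) (cop w))) = counit (q (mon w)) \<odot>\<^bsub>U \<chi> I\<^esub> \<one>\<^bsub>U \<chi> I\<^esub>"
    unfolding is_antipode_def by (simp_all only: q_simps) blast+
  moreover have
    "sum_pairs (U \<chi> I) (\<lambda>y z. S y \<otimes>\<^bsub>U \<chi> I\<^esub> z) (map (map_prod q q) (map (map_prod mon mon) (cop w)))
      = q (cop_sum w (\<lambda>u v. antipode_rep (mon u) * mon v))"
    "sum_pairs (U \<chi> I) (\<lambda>y z. y \<otimes>\<^bsub>U \<chi> I\<^esub> S z) (map (map_prod q q) (map (map_prod mon mon) (cop w)))
      = q (cop_sum w (\<lambda>u v. mon u * antipode_rep (mon v)))"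
    using sum_pairs_q[of "map (map_prod mon mon) (cop w)" "\<lambda>y z. S y \<otimes>\<^bsub>U \<chi> I\<^esub> z" "\<lambda>a b. antipode_rep a * b"]
      sum_pairs_q[of "map (map_prod mon mon) (cop w)" "\<lambda>y z. y \<otimes>\<^bsub>U \<chi> I\<^esub> S z" "\<lambda>a b. a * antipode_rep b"]
    by (simp_all only: sum_list_map_prod cop_sum_def antipode_rep[symmetric] mult_Q[unfolded cl_eq_q, folded U_def])
  ultimately show "q (cop_sum w (\<lambda>u v. antipode_rep (mon u) * mon v)) = q (sc (cou w) 1)"
    "q (cop_sum w (\<lambda>u v. mon u * antipode_rep (mon v))) = q (sc (cou w) 1)"
    by (simp_all add: counit_q q_simps)
qed

text \<open>Uniqueness of convolution inverses.\<close>

lemma antipode_unique: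
  assumes "\<And>w. q (cop_sum w (\<lambda>u v. mon u * t v)) = q (sc (cou w) c)"
  shows "q (t w) = q (antipode_rep (mon w) * c)"
proof -
  \<comment> \<open>The double sum of \<open>S(w\<^sub>1) w\<^sub>2 t(w\<^sub>3)\<close>, evaluated
    below by bracketing it in two ways.\<close>
  let ?X = "cop_sum w (\<lambda>u v. cop_sum u (\<lambda>a b. antipode_rep (mon a) * mon b * t v))"
  have "q ?X = q (cop_sum w (\<lambda>u v. sc (cou u) 1 * t v))"
    unfolding cop_sum_mult_right[symmetric]
    by (intro q_cop_sum q_mult_right antipode_identities)
  also have "\<dots> = q (t w)"
    by (simp add: cop_sum_counit)
  finally have 1: "q ?X = q (t w)" .
  have "?X = cop_sum w (\<lambda>u v. antipode_rep (mon u) * cop_sum v (\<lambda>b c. mon b * t c))"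
    by (subst cop_sum_coassoc) (simp add: cop_sum_mult_left mult.assoc)
  also have "q \<dots> = q (cop_sum w (\<lambda>u v. antipode_rep (mon u) * sc (cou v) c))"
    by (intro q_cop_sum q_mult_left assms)
  also have "\<dots> = q (antipode_rep (mon w) * c)"
    by (simp add: cop_sum_counit(2)[where f = "\<lambda>u. antipode_rep (mon u) * c"])
  finally show ?thesis using 1 by simp
qed

text \<open>The antipode identity for a word ending in \<open>g\<close>, with the coproduct of the
  last letter split off, has the form required by \<open>antipode_unique\<close>, with
  \<open>c\<close> the counit of \<open>g\<close>. This gives an equation for the antipode of the
  longer word: \<open>c\<close> is 1 for the group-like letters and 0 for \<open>E_i\<close> and
  \<open>F_i\<close>.\<close>

lemma antipode_snoc: "q (antipode_rep (mon (w + Word [g]))) = q (anti_letter g * antipode_rep (mon w))"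
proof (cases g)
  case (GK i)
  have "q (Km i * antipode_rep (mon (w + Word [GK i]))) = q (antipode_rep (mon w) * 1)"
    by (rule antipode_unique)
      (use antipode_identities(2)[of "_ + Word [GK i]"] in \<open>simp add: cop_sum_plus mon_add mult.assoc\<close>)
  from q_mult_left[OF this, of "Lm i"] show ?thesis
    by (simp add: GK K_cancel)
next
  case (GL i)
  have "q (Lm i * antipode_rep (mon (w + Word [GL i]))) = q (antipode_rep (mon w) * 1)"
    by (rule antipode_unique)
      (use antipode_identities(2)[of "_ + Word [GL i]"] in \<open>simp add: cop_sum_plus mon_add mult.assoc\<close>)
  from q_mult_left[OF this, of "Km i"] show ?thesis
    by (simp add: GL K_cancel)
next
  case (GE i)
  have "q (Em i * antipode_rep (mon w) + Km i * antipode_rep (mon (w + Word [GE i]))) = q (antipode_rep (mon w) * 0)"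
    by (rule antipode_unique)
      (use antipode_identities(2)[of "_ + Word [GE i]"] in \<open>simp add: cop_sum_plus mon_add distrib_left mult.assoc\<close>)
  then have "q (Lm i * (Em i * antipode_rep (mon w) + Km i * antipode_rep (mon (w + Word [GE i]))) - Lm i * (Em i * antipode_rep (mon w)))
    = q (Lm i * (antipode_rep (mon w) * 0) - Lm i * (Em i * antipode_rep (mon w)))"
    by (intro q_diff q_mult_left refl)
  then show ?thesis
    by (simp add: GE K_cancel algebra_simps)
next
  case (GF i)
  have "q (Fm i * antipode_rep (mon (w + Word [GL i])) + antipode_rep (mon (w + Word [GF i]))) = q (antipode_rep (mon w) * 0)"
    by (rule antipode_unique)
      (use antipode_identities(2)[of "_ + Word [GF i]"] in \<open>simp add: cop_sum_plus mon_add distrib_left mult.assoc\<close>)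
  then have *: "q (Fm i * antipode_rep (mon (w + Word [GL i])) + antipode_rep (mon (w + Word [GF i])) - Fm i * antipode_rep (mon (w + Word [GL i])))
    = q (antipode_rep (mon w) * 0 - Fm i * antipode_rep (mon (w + Word [GL i])))"
    by (intro q_diff refl)
  \<comment> \<open>The coproduct of \<open>F_i\<close> has \<open>K_i^{-1}\<close> in one of its
    right legs, so the antipode of \<open>w K_i^{-1}\<close> enters; it is found as in the case
    \<open>GL\<close>.\<close>
  have "q (Lm i * antipode_rep (mon (w + Word [GL i]))) = q (antipode_rep (mon w) * 1)"
    by (rule antipode_unique)
      (use antipode_identities(2)[of "_ + Word [GL i]"] in \<open>simp add: cop_sum_plus mon_add mult.assoc\<close>)
  from q_mult_left[OF this, of "Km i"]
  have "q (antipode_rep (mon (w + Word [GL i]))) = q (Km i * antipode_rep (mon w))"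
    by (simp add: K_cancel)
  from q_diff[OF refl q_mult_left[OF this], of 0 "Fm i"] * show ?thesis
    by (simp add: GF mult.assoc)
qed

lemma S_eq_anti: "S (q x) = q (anti x)"
proof -
  have words: "q (antipode_rep (mon w)) = q (anti (mon w))" for w
  proof (induction w rule: word_rev_induct)
    case zero
    show ?case using antipode_identities(1)[of 0] by simp
  next
    case (snoc g w)
    have "q (antipode_rep (mon (w + Word [g]))) = q (anti_letter g * anti (mon w))"
      using q_mult_left[OF snoc] by (simp add: antipode_snoc)
    then show ?case by (simp add: mon_add)
  qed
  have "q (antipode_rep x) = q (anti x)"
    by (rule q_linear_eqI[OF supported_UNIV])
      (simp_all only: words, simp_all add: antipode_rep_def T.lext_add T.lext_sc)
  then show ?thesis by (simp add: antipode_rep)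
qed

text \<open>The eigenvalue of the square of the antipode in degree \<open>\<mu>\<close>. The square
  multiplies \<open>E_i\<close> by the inverse of \<open>\<chi> (\<alpha> i) (\<alpha> i)\<close>
  and \<open>F_i\<close> by this scalar itself.\<close>

definition anti_scalar :: "('i \<Rightarrow> int) \<Rightarrow> 'k" where
  "anti_scalar \<mu> = (\<Prod>i\<in>UNIV. \<chi> (\<alpha> i) (\<alpha> i) powi (- \<mu> i))"

lemma anti_scalar_simps [simp]:
  "anti_scalar 0 = 1" "anti_scalar (\<mu> + \<nu>) = anti_scalar \<mu> * anti_scalar \<nu>" "anti_scalar \<mu> \<noteq> 0"
  "anti_scalar (\<alpha> i) = inverse (\<chi> (\<alpha> i) (\<alpha> i))" "anti_scalar (- \<alpha> i) = \<chi> (\<alpha> i) (\<alpha> i)"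
proof -
  have "(\<Prod>j\<in>UNIV. \<chi> (\<alpha> j) (\<alpha> j) powi (- (\<alpha> i j))) = (\<Prod>j\<in>UNIV. if j = i then inverse (\<chi> (\<alpha> i) (\<alpha> i)) else 1)"
    by (rule prod.cong) (auto simp: \<alpha>_def power_int_minus)
  then show "anti_scalar (\<alpha> i) = inverse (\<chi> (\<alpha> i) (\<alpha> i))" by (simp add: anti_scalar_def)
  have "(\<Prod>j\<in>UNIV. \<chi> (\<alpha> j) (\<alpha> j) powi (\<alpha> i j)) = (\<Prod>j\<in>UNIV. if j = i then \<chi> (\<alpha> i) (\<alpha> i) else 1)"
    by (rule prod.cong) (auto simp: \<alpha>_def)
  then show "anti_scalar (- \<alpha> i) = \<chi> (\<alpha> i) (\<alpha> i)" by (simp add: anti_scalar_def fun_apply_simps)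
  show "anti_scalar (\<mu> + \<nu>) = anti_scalar \<mu> * anti_scalar \<nu>"
    unfolding anti_scalar_def prod.distrib[symmetric]
    by (rule prod.cong) (auto simp: fun_apply_simps power_int_add[symmetric])
qed (simp_all add: anti_scalar_def fun_apply_simps power_int_not_zero)

lemma anti_anti: "q (anti (anti (mon w))) = q (sc (anti_scalar (deg w)) (mon w))"
proof (induction w rule: word_induct)
  case (Cons g w)
  have g: "q (anti (anti_letter g)) = q (sc (anti_scalar (deg (Word [g]))) (mon (Word [g])))"
  proof (cases g)
    case (GE i)
    have "q (Lm i * Em i * Km i) = q (sc (inverse (\<chi> (\<alpha> i) (\<alpha> i))) (Em i * Lm i) * Km i)"
      by (intro q_mult_right rel_LE)
    also have "\<dots> = q (sc (inverse (\<chi> (\<alpha> i) (\<alpha> i))) (Em i))"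
      using q_sc[OF K_cancel(4)[of "Em i" i]] by simp
    finally show ?thesis by (simp add: GE)
  next
    case (GF i)
    have "q (Lm i * Fm i * Km i) = q (sc (\<chi> (\<alpha> i) (\<alpha> i)) (Fm i * Lm i) * Km i)"
      by (intro q_mult_right rel_LF)
    also have "\<dots> = q (sc (\<chi> (\<alpha> i) (\<alpha> i)) (Fm i))"
      using q_sc[OF K_cancel(4)[of "Fm i" i]] by simp
    finally show ?thesis by (simp add: GF mult.assoc)
  qed simp_all
  from q_mult[OF this Cons] show ?case
    by (simp add: mon_add mult.commute)
qed simp

text \<open>The square of \<open>S\<close> multiplies degree \<open>\<mu>\<close> by the nonzero
  \<open>anti_scalar \<mu>\<close>. As \<open>J\<close> is graded, an element killed by the square
  has all its components in \<open>J\<close>. Injectivity is what makes \<open>inv_into\<close> in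
  the star product the inverse of the antipode.\<close>

lemma S_inj: "inj_on S (carrier (U \<chi> I))"
proof (rule inj_onI)
  fix a b assume "a \<in> carrier (U \<chi> I)" "b \<in> carrier (U \<chi> I)" and eq: "S a = S b"
  then obtain x y where ab: "a = q x" "b = q y" by (auto simp: q_simps)
  define z where "z = x - y"
  have "q (anti x) = q (anti y)" using eq by (simp add: ab S_eq_anti)
  then have "q (anti z) = q 0" by (simp add: q_eq_iff z_def)
  then have "S (q (anti z)) = S (q 0)" by simp
  then have "q (anti (anti z)) = q 0" by (simp add: S_eq_anti)
  moreover have "q (anti (anti z)) = q (lext sc (\<lambda>w. sc (anti_scalar (deg w)) (mon w)) z)" for z
    by (rule q_linear_eqI[OF supported_UNIV]) (simp_all add: T.lext_add T.lext_sc anti_anti)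
  ultimately have "lext sc (\<lambda>w. sc (anti_scalar (deg w)) (mon w)) z \<in> J" by (simp add: q_eq_iff)
  moreover have "hcomp uq_degree \<mu> (lext sc (\<lambda>w. sc (anti_scalar (deg w)) (mon w)) z)
      = sc (anti_scalar \<mu>) (hcomp uq_degree \<mu> z)" for \<mu>
    using supported_UNIV[of z]
    by (induction rule: supported_induct) (auto simp: T.lext_add T.lext_sc sc_add_right mult.commute)
  ultimately have *: "sc (anti_scalar \<mu>) (hcomp uq_degree \<mu> z) \<in> J" for \<mu>
    using hcomp_J by fastforce
  have "hcomp uq_degree \<mu> z \<in> J" for \<mu>
    using J_sc[OF *[of \<mu>], of "inverse (anti_scalar \<mu>)"] by simp
  then have "z \<in> J"
    by (subst hcomp_sum_keys[of z uq_degree]) (rule J_sum)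
  then show "a = b" by (simp add: ab q_eq_iff z_def)
qed

lemma inv_S: "S (q z) = q x \<Longrightarrow> inv_into (carrier (U \<chi> I)) S (q x) = q z"
  by (rule inv_into_f_eq[OF S_inj]) (auto simp: q_simps)

text \<open>The inverse antipode sends \<open>E_j\<close> to \<open>- E_j K_j^{-1}\<close>. The
  value 0 on other letters is a default: the map is applied to words in the \<open>E\<close>
  letters.\<close>

abbreviation inv_anti :: "('i, 'k) free_uq \<Rightarrow> ('i, 'k) free_uq" where
  "inv_anti \<equiv> rev_ext (\<lambda>g. case g of GE j \<Rightarrow> - (Em j * Lm j) | _ \<Rightarrow> 0)"

lemma S_inv_anti:
  assumes "x \<in> supported (words_in (range GE))"
  shows "inv_into (carrier (U \<chi> I)) S (q x) = q (inv_anti x)"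
proof (rule inv_S)
  have words: "q (anti (inv_anti (mon w))) = q (mon w)" if "w \<in> words_in (range GE)" for w
    using that
  proof (induction rule: words_in_induct)
    case (Cons g w)
    then obtain j where g: "g = GE j" by auto
    from Cons.IH have "q (Km j * (Lm j * Em j * anti (inv_anti (mon w)))) = q (Km j * (Lm j * Em j * mon w))"
      by (intro q_mult_left)
    then show ?case by (simp add: g mon_add mult.assoc K_cancel)
  qed simp
  have "q (anti (inv_anti x)) = q x"
    by (rule q_linear_eqI[OF assms]) (simp_all add: words)
  then show "S (q (inv_anti x)) = q x" by (simp add: S_eq_anti)
qed

end

text \<open>
  \<open>twist\<close> is the map \<open>x \<mapsto> (-1)\<^bsup>|x|\<^esup> S\<^sup>-\<^sup>1(x) K\<^bsub>deg x\<^esub>\<close>: a reversal of words up to scalars.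
\<close>

context sym_bicharacter
begin

fun twist_list :: "'i uq_gen list \<Rightarrow> ('i, 'k) free_uq" where
  "twist_list [] = 1"
| "twist_list (g # gs) = sc (inverse (\<chi> (uq_degree g) (deg (Word gs)))) (twist_list gs * mon (Word [g]))"

definition twist :: "('i, 'k) free_uq \<Rightarrow> ('i, 'k) free_uq" where
  "twist = lext sc (\<lambda>w. twist_list (letters w))"

lemma twist_simps [simp]:
  "twist (x + y) = twist x + twist y" "twist (sc a x) = sc a (twist x)" "twist 0 = 0" "twist 1 = 1"
proof -
  have "twist (mon 0) = 1" unfolding twist_def T.lext_mon by simp
  then show "twist 1 = 1" by simp
qed (simp_all add: twist_def T.lext_add T.lext_sc)

lemma twist_Cons: "twist (mon (Word [g] + w)) = sc (inverse (\<chi> (uq_degree g) (deg w))) (twist (mon w) * mon (Word [g]))"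
  by (cases w) (simp add: twist_def)

lemma twist_mult_left:
  assumes "x \<in> supported {w. deg w = \<mu>}"
  shows "twist (mon (Word [g]) * x) = sc (inverse (\<chi> (uq_degree g) \<mu>)) (twist x * mon (Word [g]))"
  using assms
  by (induction rule: supported_induct) (auto simp: mon_add[symmetric] twist_Cons distrib_left distrib_right sc_add_right mult.commute)

lemma twist_supported:
  assumes "x \<in> supported (words_in G \<inter> {w. deg w = \<mu>})"
  shows "twist x \<in> supported (words_in G \<inter> {w. deg w = \<mu>})"
proof -
  have "twist (mon w) \<in> supported (words_in G \<inter> {v. deg v = deg w})" if "w \<in> words_in G" for w
    using that
  proof (induction rule: words_in_induct)
    case zero
    then show ?case by (simp add: one_supported_iff)
  next
    case (Cons g w)
    have "twist (mon w) * mon (Word [g]) \<in> supported (words_in G \<inter> {v. deg v = deg (Word [g] + w)})"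
      by (rule supported_mult[OF Cons.IH, of _ "{Word [g]}"]) (use Cons.hyps in \<open>auto simp: add.commute\<close>)
    then show ?case unfolding twist_Cons by (rule supported_sc)
  qed
  with assms show ?thesis
    by (induction rule: supported_induct) (auto intro: supported_add supported_sc)
qed

end

context uq_antipode
begin

text \<open>The \<open>K_j^{-1}\<close> from the new letter cancels one \<open>K_j\<close> in the
  group-like factor of weight \<open>\<alpha> j + deg w\<close>. Exchanging what remains of that
  factor with \<open>E_j\<close> produces the inverse scalar in \<open>twist_list\<close>.\<close>

lemma inv_anti_twist_word:
  assumes "w \<in> words_in (range GE)"
  shows "q (inv_anti (mon w) * mon (kword (deg w))) = q (sc ((- 1) ^ length (letters w)) (twist (mon w)))"
  using assms
proof (induction rule: words_in_induct)
  case (Cons g w)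
  then obtain j where g: "g = GE j" by auto
  let ?k = "mon (kword (deg w)) :: ('i, 'k) free_uq"
  have "kword (\<alpha> j + deg w) = kword (deg w + \<alpha> j)" by (simp add: add.commute)
  then have "q (Lm j * mon (kword (\<alpha> j + deg w))) = q (Lm j * (Km j * ?k))"
    using kword_add_alpha[of "deg w" j] K_commute[of j "kword (deg w)"]
    by (intro q_mult_left) simp
  then have "q (Lm j * mon (kword (\<alpha> j + deg w))) = q ?k" by (simp add: K_cancel)
  then have "q (inv_anti (mon w) * (Em j * (Lm j * mon (kword (\<alpha> j + deg w))))) = q (inv_anti (mon w) * (Em j * ?k))"
    by (intro q_mult_left)
  also have "\<dots> = q (inv_anti (mon w) * sc (inverse (\<chi> (deg w) (\<alpha> j))) (sc (\<chi> (deg w) (\<alpha> j)) (Em j * ?k)))"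
    by simp
  also have "\<dots> = q (inv_anti (mon w) * sc (inverse (\<chi> (deg w) (\<alpha> j))) (?k * Em j))"
    using K_word_commute[OF kword_in, of "deg w" "Word [GE j]"] by (intro q_mult_left q_sc) simp
  also have "\<dots> = q (sc (inverse (\<chi> (deg w) (\<alpha> j))) ((inv_anti (mon w) * ?k) * Em j))"
    by (simp add: mult.assoc)
  also have "\<dots> = q (sc (inverse (\<chi> (deg w) (\<alpha> j))) (sc ((- 1) ^ length (letters w)) (twist (mon w)) * Em j))"
    by (intro q_sc q_mult_right Cons.IH)
  finally have "q (sc (- 1) (inv_anti (mon w) * (Em j * (Lm j * mon (kword (\<alpha> j + deg w))))))
    = q (sc (- 1) (sc (inverse (\<chi> (deg w) (\<alpha> j))) (sc ((- 1) ^ length (letters w)) (twist (mon w)) * Em j)))"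
    by (rule q_sc)
  then show ?case
    by (simp add: g mon_add[of _ w] twist_Cons[unfolded mon_add] chi_sym[of "\<alpha> j"] mult_ac)
qed simp

lemma length_pos_word:
  fixes w :: "'i uq_gen word"
  assumes "w \<in> words_in (range GE)" "deg w = int_vec \<rho>"
  shows "length (letters w) = (\<Sum>i\<in>UNIV. \<rho> i)"
proof -
  have "int (length (letters w)) = (\<Sum>i\<in>UNIV. deg w i)"
    using assms(1)
  proof (induction rule: words_in_induct)
    case (Cons g w)
    then show ?case by (auto simp: fun_apply_simps \<alpha>_def sum.distrib)
  qed (simp add: fun_apply_simps)
  then have "int (length (letters w)) = int (\<Sum>i\<in>UNIV. \<rho> i)"
    using assms(2) by (simp add: int_vec_def)
  then show ?thesis by linarith
qed

lemma inv_S_twist: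
  assumes "x \<in> supported (words_in (range GE) \<inter> {w. deg w = int_vec \<rho>})"
  shows "q (sc ((- 1) ^ (\<Sum>i\<in>UNIV. \<rho> i)) (inv_anti x * mon (kword (int_vec \<rho>)))) = q (twist x)"
  using assms
proof (induction rule: supported_induct)
  case (add x y)
  from q_add[OF this] show ?case by (simp add: distrib_right sc_add_right)
next
  case (scale a x)
  from q_sc[OF this] show ?case by (simp add: mult.commute)
next
  case (mon w)
  then have w: "w \<in> words_in (range GE)" "deg w = int_vec \<rho>" by auto
  from q_sc[OF inv_anti_twist_word[OF w(1)], of "(- 1) ^ (\<Sum>i\<in>UNIV. \<rho> i)"]
  show ?case by (simp add: w length_pos_word[OF w] flip: power_add)
qed simp_all

end

section \<open>The fundamental identity\<close>

lemma cop_sum_counit_field: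
  fixes f :: "'i uq_gen word \<Rightarrow> 'k::field"
  shows "cop_sum w (\<lambda>u v. cou u * f v) = f w" "cop_sum w (\<lambda>u v. f u * cou v) = f w"
proof (induction w arbitrary: f rule: word_induct)
  case (Cons g w)
  {
    case 1 show ?case using Cons(1) by (cases g) simp_all
  next
    case 2 show ?case using Cons(2) by (cases g) simp_all
  }
qed simp_all

lemma cop_sum_swap: "cop_sum w (\<lambda>a b. cop_sum v (\<lambda>s t. f a b s t)) = cop_sum v (\<lambda>s t. cop_sum w (\<lambda>a b. f a b s t))"
proof -
  have "(\<Sum>(a, b)\<leftarrow>l. cop_sum v (\<lambda>s t. f a b s t)) = cop_sum v (\<lambda>s t. \<Sum>(a, b)\<leftarrow>l. f a b s t)" for l
    by (induction l) (auto simp: cop_sum_add)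
  then show ?thesis unfolding cop_sum_def[of w] .
qed

lemma cop_sum_K_word: "k \<in> words_in (range GK \<union> range GL) \<Longrightarrow> cop_sum k f = f k k"
  by (induction arbitrary: f rule: words_in_induct) auto

lemma alpha_nz [simp]: "\<alpha> i \<noteq> 0" "- \<alpha> i \<noteq> 0"
proof -
  show "\<alpha> i \<noteq> 0" by (auto simp: \<alpha>_def fun_eq_iff zero_fun_apply)
  then show "- \<alpha> i \<noteq> 0" by (simp only: neg_equal_0_iff_equal not_False_eq_True)
qed

context uq_pairing
begin

abbreviation "Fw \<equiv> words_in (range GF)"
abbreviation "Ew \<equiv> words_in (range GE)"
abbreviation "Kw \<equiv> words_in (range GK \<union> range GL)"

lemma words_subset: "Fw \<subseteq> negw" "Ew \<subseteq> posw" "Kw \<subseteq> negw" "Kw \<subseteq> posw"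
  by (rule words_in_mono; auto)+

lemma supported_words_subset:
  "x \<in> supported (Fw \<inter> P) \<Longrightarrow> x \<in> supported negw" "x \<in> supported (Ew \<inter> P) \<Longrightarrow> x \<in> supported posw"
  using words_subset supported_mono by (fastforce simp: supported_def)+

text \<open>In its coproduct each letter \<open>E_j\<close> of \<open>v\<close> also offers a
  \<open>K_j\<close> to the left leg, so a group-like element on the left sees \<open>E_j\<close> in
  the same way as \<open>K_j\<close>. This is why the scalar involves the sum of degree and
  K-weight.\<close>

lemma pw_K_word:
  assumes "v \<in> posw" "k \<in> Kw" "b \<in> negw"
  shows "pw (k + b) (mon v) = inverse (\<chi> (kw k) (deg v + kw v)) * pw b (mon v)"
  using assms(1,3)
proof (induction arbitrary: b rule: words_in_induct)
  case zero
  then show ?case using assms(2) words_subset M.deg_K_word[OF assms(2)] by (auto simp: cou_neg subset_iff)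
next
  case (Cons g v)
  have k: "k \<in> negw" "deg k = 0" using assms(2) words_subset M.deg_K_word by auto
  have g: "pw (k + b) (mon (Word [g])) = inverse (\<chi> (kw k) (uq_degree g + K_weight g)) * pw b (mon (Word [g]))"
    if "b \<in> negw" for b
    using Cons.hyps(1)
  proof (cases rule: pos_letter_cases)
    case (1 i)
    then show ?thesis
      using that k pw_E[of k i] by (simp add: pw_add_left pw_K)
  qed (use that k in \<open>simp_all add: pw_K pw_L chi_simps field_simps\<close>)
  have "pw (k + b) (mon (Word [g] + v)) = cop_sum b (\<lambda>a b. pw (k + a) (mon v) * pw (k + b) (mon (Word [g])))"
    using Cons k by (simp add: mon_add pw_mult cop_sum_plus cop_sum_K_word[OF assms(2)])
  also have "\<dots> = cop_sum b (\<lambda>a b. inverse (\<chi> (kw k) (deg v + kw v)) * inverse (\<chi> (kw k) (uq_degree g + K_weight g))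
      * (pw a (mon v) * pw b (mon (Word [g]))))"
  proof (rule cop_sum_cong)
    fix a b' assume ab: "(a, b') \<in> set (cop b)"
    show "pw (k + a) (mon v) * pw (k + b') (mon (Word [g])) = inverse (\<chi> (kw k) (deg v + kw v)) * inverse (\<chi> (kw k) (uq_degree g + K_weight g))
      * (pw a (mon v) * pw b' (mon (Word [g])))"
      using cop_neg(1,2)[OF Cons.prems ab] by (simp add: Cons.IH g)
  qed
  also have "\<dots> = inverse (\<chi> (kw k) (deg v + kw v)) * inverse (\<chi> (kw k) (uq_degree g + K_weight g)) * pw b (mon (Word [g] + v))"
    using Cons by (simp add: mon_add pw_mult cop_sum_mult_left)
  also have "inverse (\<chi> (kw k) (deg v + kw v)) * inverse (\<chi> (kw k) (uq_degree g + K_weight g))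
      = inverse (\<chi> (kw k) ((deg v + kw v) + (uq_degree g + K_weight g)))"
    by (simp only: chi_add_right[of _ "deg v + kw v"] inverse_mult_distrib)
  also have "(deg v + kw v) + (uq_degree g + K_weight g) = deg (Word [g] + v) + kw (Word [g] + v)"
    by (simp add: algebra_simps)
  finally show ?case .
qed

lemma pw_K_word_supported:
  assumes "y \<in> supported (posw \<inter> {v. deg v + kw v = \<mu>})" "k \<in> Kw" "b \<in> negw"
  shows "pw (k + b) y = inverse (\<chi> (kw k) \<mu>) * pw b y"
  using assms(1)
proof (induction rule: supported_induct)
  case (mon v)
  then show ?case using pw_K_word[OF _ assms(2,3)] by auto
qed (simp_all add: distrib_left)

lemma pw_degree_supported:
  assumes "y \<in> supported (posw \<inter> {v. deg v = \<mu>})" "u \<in> negw" "deg u + \<mu> \<noteq> 0"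
  shows "pw u y = 0"
  using assms(1) by (induction rule: supported_induct) (use pw_degree[OF assms(2)] assms(3) in auto)

lemma act_K_word:
  assumes "y \<in> supported (posw \<inter> {v. deg v + kw v = \<mu>})" "k \<in> Kw" "x \<in> supported negw"
  shows "lact y (mon k * x) = sc (inverse (\<chi> (kw k) \<mu>)) (mon k * lact y x)"
    and "ract y (mon k * x) = sc (inverse (\<chi> (kw k) \<mu>)) (mon k * ract y x)"
proof -
  have "lact y (mon k * x) = sc (inverse (\<chi> (kw k) \<mu>)) (mon k * lact y x)
    \<and> ract y (mon k * x) = sc (inverse (\<chi> (kw k) \<mu>)) (mon k * ract y x)"
    using assms(3)
  proof (induction rule: supported_induct)
    case (mon w)
    have "lact y (mon (k + w)) = cop_sum w (\<lambda>u v. sc (inverse (\<chi> (kw k) \<mu>)) (mon k * sc (pw u y) (mon v)))"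
      unfolding lact_mon cop_sum_plus cop_sum_K_word[OF assms(2)]
    proof (rule cop_sum_cong)
      fix u v assume "(u, v) \<in> set (cop w)"
      from cop_neg(1)[OF mon this]
      show "sc (pw (k + u) y) (mon (k + v)) = sc (inverse (\<chi> (kw k) \<mu>)) (mon k * sc (pw u y) (mon v))"
        by (simp add: pw_K_word_supported[OF assms(1,2)] mon_add)
    qed
    moreover have "ract y (mon (k + w)) = cop_sum w (\<lambda>u v. sc (inverse (\<chi> (kw k) \<mu>)) (mon k * sc (pw v y) (mon u)))"
      unfolding ract_mon cop_sum_plus cop_sum_K_word[OF assms(2)]
    proof (rule cop_sum_cong)
      fix u v assume "(u, v) \<in> set (cop w)"
      from cop_neg(2)[OF mon this]
      show "sc (pw (k + v) y) (mon (k + u)) = sc (inverse (\<chi> (kw k) \<mu>)) (mon k * sc (pw v y) (mon u))"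
        by (simp add: pw_K_word_supported[OF assms(1,2)] mon_add)
    qed
    ultimately show ?case
      by (simp only: mon_add[symmetric] lact_mon[of y w] ract_mon[of y w] cop_sum_mult_left cop_sum_sc)
  qed (simp_all add: distrib_left sc_add_right mult.commute)
  then show "lact y (mon k * x) = sc (inverse (\<chi> (kw k) \<mu>)) (mon k * lact y x)"
    "ract y (mon k * x) = sc (inverse (\<chi> (kw k) \<mu>)) (mon k * ract y x)" by auto
qed

lemma act_1: "x \<in> supported negw \<Longrightarrow> lact 1 x = x" "x \<in> supported negw \<Longrightarrow> ract 1 x = x"
proof -
  assume x: "x \<in> supported negw"
  have "lact 1 x = x \<and> ract 1 x = x"
    using x
  proof (induction rule: supported_induct)
    case (mon w)
    have "lact 1 (mon w) = cop_sum w (\<lambda>u v. sc (cou u) (mon v))" "ract 1 (mon w) = cop_sum w (\<lambda>u v. sc (cou v) (mon u))"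
      unfolding lact_mon ract_mon by (rule cop_sum_cong, simp add: cop_neg(1,2)[OF mon])+
    then show ?case by (simp add: cop_sum_counit cop_sum_counit(2)[where f = mon])
  qed auto
  then show "lact 1 x = x" "ract 1 x = x" by auto
qed

lemma lact_Km: "w \<in> negw \<Longrightarrow> lact (M.Km j) (mon w) = sc (inverse (\<chi> (kw w) (\<alpha> j))) (mon w)"
proof -
  assume w: "w \<in> negw"
  have "lact (M.Km j) (mon w) = cop_sum w (\<lambda>u v. sc (cou u) (sc (inverse (\<chi> (kw w) (\<alpha> j))) (mon v)))"
    unfolding lact_mon
  proof (rule cop_sum_cong)
    fix u v assume "(u, v) \<in> set (cop w)"
    from cop_neg[OF w this] show "sc (pw u (M.Km j)) (mon v) = sc (cou u) (sc (inverse (\<chi> (kw w) (\<alpha> j))) (mon v))"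
      by (simp add: pw_K cou_neg)
  qed
  then show ?thesis by (simp only: cop_sum_counit)
qed

text \<open>Only terms whose right leg has degree 0 survive. Their left leg has the full degree, so
  by \<open>cop_neg\<close> the right leg has weight \<open>kw w + deg w\<close>.\<close>

lemma ract_Km: "w \<in> negw \<Longrightarrow> ract (M.Km j) (mon w) = sc (inverse (\<chi> (kw w + deg w) (\<alpha> j))) (mon w)"
proof -
  assume w: "w \<in> negw"
  have "ract (M.Km j) (mon w) = cop_sum w (\<lambda>u v. sc (cou v) (sc (inverse (\<chi> (kw w + deg w) (\<alpha> j))) (mon u)))"
    unfolding ract_mon
  proof (rule cop_sum_cong)
    fix u v assume uv: "(u, v) \<in> set (cop w)"
    show "sc (pw v (M.Km j)) (mon u) = sc (cou v) (sc (inverse (\<chi> (kw w + deg w) (\<alpha> j))) (mon u))"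
    proof (cases "deg v = 0")
      case True
      then have "deg u = deg w" using cop_deg[OF uv] by simp
      with True cop_neg[OF w uv] show ?thesis by (simp add: pw_K cou_neg)
    next
      case False
      with cop_neg[OF w uv] show ?thesis by (simp add: pw_K cou_neg)
    qed
  qed
  then show ?thesis by (simp only: cop_sum_counit(2)[where f = "\<lambda>u. sc _ (mon u)"])
qed

lemma ract_Km_supported:
  assumes "x \<in> supported (negw \<inter> {w. kw w + deg w = \<mu>})"
  shows "ract (M.Km j) x = sc (inverse (\<chi> \<mu> (\<alpha> j))) x"
  using assms by (induction rule: supported_induct) (auto simp: ract_Km sc_add_right mult.commute)

text \<open>The pairing of a product with \<open>E_j\<close> splits along the coproduct of
  \<open>E_j\<close>, which makes the right action of \<open>E_j\<close> a skew derivation, twisted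
  by the action of \<open>K_j\<close>.\<close>

lemma ract_Em_mult:
  assumes "x \<in> supported negw" "y \<in> supported negw"
  shows "ract (M.Em j) (x * y) = ract (M.Em j) x * y + ract (M.Km j) x * ract (M.Em j) y"
proof -
  have 1: "ract (M.Em j) (mon a * mon b) = ract (M.Em j) (mon a) * mon b + ract (M.Km j) (mon a) * ract (M.Em j) (mon b)"
    if ab: "a \<in> negw" "b \<in> negw" for a b
  proof -
    have "ract (M.Em j) (mon (a + b)) = cop_sum a (\<lambda>u v. cop_sum b (\<lambda>u' v'.
        sc (pw v (M.Em j)) (mon u) * sc (cou v') (mon u') + sc (pw v (M.Km j)) (mon u) * sc (pw v' (M.Em j)) (mon u')))"
      unfolding ract_mon cop_sum_plus
    proof (intro cop_sum_cong)
      fix u v u' v' assume "(u, v) \<in> set (cop a)" "(u', v') \<in> set (cop b)"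
      from cop_neg(2)[OF ab(1) this(1)] cop_neg(2)[OF ab(2) this(2)]
      show "sc (pw (v + v') (M.Em j)) (mon (u + u')) =
        sc (pw v (M.Em j)) (mon u) * sc (cou v') (mon u') + sc (pw v (M.Km j)) (mon u) * sc (pw v' (M.Em j)) (mon u')"
        by (simp add: pw_add_left mon_add sc_add_left mult.commute)
    qed
    also have "\<dots> = ract (M.Em j) (mon a) * cop_sum b (\<lambda>u' v'. sc (cou v') (mon u')) + ract (M.Km j) (mon a) * ract (M.Em j) (mon b)"
      by (simp only: ract_mon cop_sum_add cop_sum_mult_left[symmetric] cop_sum_mult_right)
    finally show ?thesis by (simp only: mon_add cop_sum_counit(2)[where f = mon])
  qed
  have 2: "ract (M.Em j) (mon a * y) = ract (M.Em j) (mon a) * y + ract (M.Km j) (mon a) * ract (M.Em j) y" if "a \<in> negw" for a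
    using assms(2)
    by (induction rule: supported_induct) (auto simp: distrib_left 1[OF that] sc_add_right add_ac)
  show ?thesis
    using assms(1)
    by (induction rule: supported_induct) (auto simp: distrib_right 2 sc_add_right add_ac)
qed

lemma ract_Em_K: "k \<in> Kw \<Longrightarrow> ract (M.Em j) (mon k) = 0"
proof -
  assume k: "k \<in> Kw"
  then have "k \<in> negw" using words_subset by auto
  then show ?thesis
    using pw_E[of k j] M.deg_K_word[OF k] by (simp add: ract_mon cop_sum_K_word[OF k])
qed

section \<open>A skew derivation adjoint to left multiplication by \<open>E_j\<close>\<close>

definition PT :: "('i, 'k) free_uq \<Rightarrow> ('i, 'k) free_uq \<Rightarrow> 'k" where
  "PT x y = lext (*) (\<lambda>w. pw w y) x"

lemma PT_simps [simp]:
  "PT (x + x') y = PT x y + PT x' y" "PT (sc a x) y = a * PT x y" "PT 0 y = 0" "PT (mon w) y = pw w y"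
  by (simp_all add: PT_def K.lext_add K.lext_sc)

lemma PT_right_simps [simp]:
  "PT x (y + y') = PT x y + PT x y'" "PT x (sc a y) = a * PT x y" "PT x 0 = 0"
  using K.lext_fun_add[of "\<lambda>w. pw w y" "\<lambda>w. pw w y'" x] K.lext_fun_scale[of a "\<lambda>w. pw w y" x]
  by (simp_all add: PT_def) (simp add: lext_def)

lemma PT_eq: "x \<in> supported negw \<Longrightarrow> y \<in> supported posw \<Longrightarrow> PT x y = pr (M.q x) (M.q y)"
proof -
  assume x: "x \<in> supported negw" and y: "y \<in> supported posw"
  have e: "M.q y \<in> M.q ` supported posw" using y by simp
  have "x \<in> supported negw \<and> PT x y = pr (M.q x) (M.q y)"
    using x
  proof (induction rule: supported_induct)
    case zero
    show ?case using pr_left(2)[OF supported_0 e, of 0] by simp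
  qed (use y in \<open>simp_all add: pr_left[OF _ e] supported_add supported_sc pw_eq\<close>)
  then show ?thesis ..
qed

lemma PT_Fm_mult:
  assumes "v \<in> posw" "z \<in> supported negw"
  shows "PT (M.Fm l * z) (mon v) = cop_sum v (\<lambda>s t. pw (Word [GF l]) (mon s) * PT z (mon t))"
  using assms(2)
proof (induction rule: supported_induct)
  case (scale a x)
  then have "PT (M.Fm l * sc a x) (mon v) = cop_sum v (\<lambda>s t. a * (pw (Word [GF l]) (mon s) * PT x (mon t)))"
    by (simp add: cop_sum_mult_left)
  also have "\<dots> = cop_sum v (\<lambda>s t. pw (Word [GF l]) (mon s) * PT (sc a x) (mon t))"
    by (rule cop_sum_cong) simp
  finally show ?case .
qed (simp_all add: distrib_left cop_sum_add assms(1) pw_add_left flip: mon_add)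

text \<open>The skew derivation of the tensor algebra on the \<open>F\<^sub>i\<close> that is dual to left multiplication by \<open>E\<^sub>j\<close>.\<close>

fun dl :: "'i \<Rightarrow> 'i uq_gen list \<Rightarrow> ('i, 'k) free_uq" where
  "dl j [] = 0"
| "dl j (g # gs) = (if g = GF j then mon (Word gs) else 0) + sc (\<chi> (\<alpha> j) (- uq_degree g)) (mon (Word [g]) * dl j gs)"

definition dj :: "'i \<Rightarrow> ('i, 'k) free_uq \<Rightarrow> ('i, 'k) free_uq" where
  "dj j = lext sc (\<lambda>w. dl j (letters w))"

lemma dj_simps [simp]:
  "dj j (x + y) = dj j x + dj j y" "dj j (sc a x) = sc a (dj j x)" "dj j 0 = 0" "dj j (mon 0) = 0" "dj j 1 = 0"
  "dj j (mon (Word [g] + w)) = (if g = GF j then mon w else 0) + sc (\<chi> (\<alpha> j) (- uq_degree g)) (mon (Word [g]) * dj j (mon w))"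
proof -
  show 0: "dj j (mon 0) = 0" unfolding dj_def T.lext_mon by simp
  then show "dj j 1 = 0" by simp
  show "dj j (mon (Word [g] + w)) = (if g = GF j then mon w else 0) + sc (\<chi> (\<alpha> j) (- uq_degree g)) (mon (Word [g]) * dj j (mon w))"
    unfolding dj_def T.lext_mon by (cases w) simp
qed (simp_all add: dj_def T.lext_add T.lext_sc)

lemma dj_supported_word:
  "w \<in> Fw \<Longrightarrow> dj j (mon w) \<in> supported (Fw \<inter> {v. deg v = deg w + \<alpha> j})"
proof (induction rule: words_in_induct)
  case (Cons g w)
  have "mon (Word [g]) * dj j (mon w) \<in> supported (Fw \<inter> {v. deg v = deg (Word [g] + w) + \<alpha> j})"
    by (rule supported_mult[OF _ Cons.IH, of _ "{Word [g]}"]) (use Cons.hyps in \<open>auto simp: add_ac\<close>)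
  moreover have "(if g = GF j then mon w else 0) \<in> supported (Fw \<inter> {v. deg v = deg (Word [g] + w) + \<alpha> j})"
    using Cons.hyps by simp
  ultimately show ?case
    unfolding dj_simps(6) by (intro supported_add supported_sc)
qed simp

lemma dj_supported:
  assumes "x \<in> supported (Fw \<inter> {w. deg w = \<mu>})"
  shows "dj j x \<in> supported (Fw \<inter> {w. deg w = \<mu> + \<alpha> j})"
  using assms by (induction rule: supported_induct) (use dj_supported_word in \<open>auto intro: supported_add supported_sc\<close>)

text \<open>Pairing \<open>F_l w\<close> with \<open>E_j v\<close>, either \<open>E_j\<close> meets
  the letter \<open>F_l\<close>, which leaves \<open>w\<close> if \<open>l = j\<close>, or it meets
  \<open>w\<close>, while the \<open>K_l^{-1}\<close> from the coproduct of \<open>F_l\<close>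
  contributes \<open>\<chi> (\<alpha> j) (\<alpha> l)\<close>. These are the two summands in the
  recursion of \<open>dl\<close>.\<close>

lemma dj_dual_word:
  assumes "w \<in> Fw" "v \<in> posw"
  shows "PT (dj j (mon w)) (mon v) = pw w (M.Em j * mon v)"
  using assms
proof (induction arbitrary: v rule: words_in_induct)
  case zero
  have "pw 0 (mon (Word [GE j] + v)) = 0" using zero by (simp add: pw_0_left del: mon_0)
  then show ?case by (simp add: mon_add)
next
  case (Cons g w)
  then obtain l where g: "g = GF l" by auto
  have w: "w \<in> negw" using Cons.hyps(2) words_subset by auto
  have Lb: "pw (Word [GL l] + b) (M.Em j) = \<chi> (\<alpha> j) (\<alpha> l) * pw b (M.Em j)" if "b \<in> negw" for b
    using pw_K_word[of "Word [GE j]" "Word [GL l]" b] that by (simp add: chi_simps chi_sym)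
  have Fb: "pw (Word [GF l] + b) (M.Em j) = (if l = j then 1 else 0) * cou b" if "b \<in> negw" for b
    using that by (simp add: pw_add_left)
  have "pw (Word [GF l] + w) (M.Em j * mon v)
    = cop_sum w (\<lambda>a b. pw (Word [GF l] + a) (mon v) * pw (Word [GL l] + b) (M.Em j))
      + cop_sum w (\<lambda>a b. pw a (mon v) * pw (Word [GF l] + b) (M.Em j))"
    using w Cons.prems by (simp add: pw_mult)
  also have "cop_sum w (\<lambda>a b. pw a (mon v) * pw (Word [GF l] + b) (M.Em j))
    = cop_sum w (\<lambda>a b. ((if l = j then 1 else 0) * pw a (mon v)) * cou b)"
    by (rule cop_sum_cong) (simp only: Fb[OF cop_neg(2)[OF w]] mult_ac)
  also have "\<dots> = (if l = j then 1 else 0) * pw w (mon v)"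
    by (rule cop_sum_counit_field)
  also have "cop_sum w (\<lambda>a b. pw (Word [GF l] + a) (mon v) * pw (Word [GL l] + b) (M.Em j))
    = cop_sum w (\<lambda>a b. cop_sum v (\<lambda>s t. \<chi> (\<alpha> j) (\<alpha> l) * (pw (Word [GF l]) (mon s) * (pw a (mon t) * pw b (M.Em j)))))"
  proof (rule cop_sum_cong)
    fix a b assume "(a, b) \<in> set (cop w)"
    note ab = cop_neg(1,2)[OF w this]
    have "pw (Word [GF l] + a) (mon v) = cop_sum v (\<lambda>s t. pw (Word [GF l]) (mon s) * pw a (mon t))"
      using ab Cons.prems by (intro pw_add_left) auto
    then show "pw (Word [GF l] + a) (mon v) * pw (Word [GL l] + b) (M.Em j)
      = cop_sum v (\<lambda>s t. \<chi> (\<alpha> j) (\<alpha> l) * (pw (Word [GF l]) (mon s) * (pw a (mon t) * pw b (M.Em j))))"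
      unfolding Lb[OF ab(2)]
      by (simp only: cop_sum_mult_right) (rule cop_sum_cong, simp only: mult_ac)
  qed
  \<comment> \<open>Once the sums over the coproducts of \<open>w\<close> and \<open>v\<close> are
    exchanged, the inner one is the pairing of \<open>w\<close> with \<open>E_j\<close> times the
    right leg of \<open>v\<close>, to which the induction hypothesis applies.\<close>
  also have "\<dots> = cop_sum v (\<lambda>s t. \<chi> (\<alpha> j) (\<alpha> l) * (pw (Word [GF l]) (mon s) * cop_sum w (\<lambda>a b. pw a (mon t) * pw b (M.Em j))))"
    by (subst cop_sum_swap) (simp add: cop_sum_mult_left)
  also have "\<dots> = cop_sum v (\<lambda>s t. \<chi> (\<alpha> j) (\<alpha> l) * (pw (Word [GF l]) (mon s) * PT (dj j (mon w)) (mon t)))"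
  proof (rule cop_sum_cong)
    fix s t assume "(s, t) \<in> set (cop v)"
    from cop_pos(2)[OF Cons.prems this] Cons.IH[of t] w
    show "\<chi> (\<alpha> j) (\<alpha> l) * (pw (Word [GF l]) (mon s) * cop_sum w (\<lambda>a b. pw a (mon t) * pw b (M.Em j)))
      = \<chi> (\<alpha> j) (\<alpha> l) * (pw (Word [GF l]) (mon s) * PT (dj j (mon w)) (mon t))"
      by (simp add: pw_mult)
  qed
  also have "\<dots> = \<chi> (\<alpha> j) (\<alpha> l) * PT (M.Fm l * dj j (mon w)) (mon v)"
    using Cons.prems supported_words_subset(1)[OF dj_supported_word[OF Cons.hyps(2)]]
    by (simp add: PT_Fm_mult cop_sum_mult_left)
  finally show ?case by (simp add: g)
qed

lemma dj_dual:
  assumes "x \<in> supported Fw" "y \<in> supported posw"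
  shows "PT (dj j x) y = PT x (M.Em j * y)"
proof -
  have "PT (dj j (mon w)) y = pw w (M.Em j * y)" if "w \<in> Fw" for w
    using assms(2) by (induction rule: supported_induct) (simp_all add: distrib_left dj_dual_word[OF that])
  with assms(1) show ?thesis
    by (induction rule: supported_induct) simp_all
qed

end

definition tau_vec :: "('i \<Rightarrow> 'i) \<Rightarrow> ('i \<Rightarrow> int) \<Rightarrow> ('i \<Rightarrow> int)" where
  "tau_vec t x = x \<circ> t"

lemma tau_vec_simps [simp]:
  "tau_vec t 0 = 0" "tau_vec t (x + y) = tau_vec t x + tau_vec t y" "tau_vec t (- x) = - tau_vec t x"
  "tau_vec t (x - y) = tau_vec t x - tau_vec t y"
  by (simp_all add: tau_vec_def fun_eq_iff fun_apply_simps)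

section \<open>The data of the star product and the lift of \<open>\<sigma>\<close>\<close>

locale star_data = uq_action \<chi> I pr
  for \<chi> :: "('i::{finite,linorder} \<Rightarrow> int) \<Rightarrow> ('i \<Rightarrow> int) \<Rightarrow> 'k::field" and I pr +
  fixes \<tau> :: "'i \<Rightarrow> 'i" and c :: "'i \<Rightarrow> 'k" and S \<sigma> :: "('i, 'k) free_uq set \<Rightarrow> ('i, 'k) free_uq set"
    and d :: "('i \<Rightarrow> nat) \<Rightarrow> nat" and Fb Eb :: "('i \<Rightarrow> nat) \<Rightarrow> nat \<Rightarrow> ('i, 'k) free_uq set"
  assumes diagram: "diagram_automorphism \<chi> I \<tau>" and antipode_S: "is_antipode \<chi> (I_max \<chi>) S"
    and dual: "dual_bases \<chi> (I_max \<chi>) pr d Fb Eb" and sigma: "is_sigma_bar \<chi> (I_max \<chi>) \<tau> c \<sigma>"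
begin

sublocale A: uq_antipode \<chi> "I_max \<chi>" S
  by unfold_locales (rule antipode_S)

lemma tau_tau [simp]: "\<tau> (\<tau> i) = i"
  and chi_tau: "\<chi> (\<alpha> (\<tau> i)) (\<alpha> (\<tau> j)) = \<chi> (\<alpha> i) (\<alpha> j)"
  using diagram by (auto simp: diagram_automorphism_def)

abbreviation "tv \<equiv> tau_vec \<tau>"

lemma tv_alpha [simp]: "tv (\<alpha> i) = \<alpha> (\<tau> i)"
  by (auto simp: tau_vec_def \<alpha>_def fun_eq_iff)

lemma tv_tv [simp]: "tv (tv x) = x"
  by (simp add: tau_vec_def fun_eq_iff)

lemma chi_tv: "\<chi> (tv x) (tv y) = \<chi> x y"
proof -
  have *: "\<chi> (tv (\<alpha> i)) (tv y) = \<chi> (\<alpha> i) y" for i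
  proof (rule int_fun_induct[of "\<lambda>y. \<chi> (tv (\<alpha> i)) (tv y) = \<chi> (\<alpha> i) y" y])
  qed (simp_all add: chi_simps chi_tau)
  show ?thesis
  proof (rule int_fun_induct[of "\<lambda>x. \<chi> (tv x) (tv y) = \<chi> x y" x])
  qed (simp_all add: chi_simps * del: tv_alpha)
qed

lemma chi_tv_move: "\<chi> (tv x) y = \<chi> x (tv y)"
  using chi_tv[of x "tv y"] by simp

text \<open>Since \<tau> sends \<open>\<nu>\<close> to \<open>- \<nu>\<close> and leaves \<chi>
  invariant, the factors for \<open>x\<close> and \<open>tv x\<close> are inverse to each other. The
  vectors \<open>x + tv x\<close> are the total weights of the elements
  \<open>\<sigma>(F\<^sub>\<rho>)\<close>.\<close>

lemma Z_theta_chi: "\<nu> \<in> Z_theta \<tau> \<Longrightarrow> \<chi> \<nu> (x + tv x) = 1"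
proof -
  assume "\<nu> \<in> Z_theta \<tau>"
  then have "tv \<nu> = - \<nu>" by (simp add: Z_theta_def tau_vec_def)
  then show ?thesis by (simp add: chi_add_right chi_tv_move[symmetric] chi_minus_left)
qed

text \<open>A lift of \<open>\<sigma>\<close> to the free algebra. It is used on words in the
  \<open>F\<close> letters; the value 0 on other letters is a default.\<close>

definition sg :: "('i, 'k) free_uq \<Rightarrow> ('i, 'k) free_uq" where
  "sg = free_hom monoid_alg (\<lambda>g. case g of GF l \<Rightarrow> sc (c (\<tau> l)) (M.Km l * M.Em (\<tau> l)) | _ \<Rightarrow> 0)"

lemma sg_simps [simp]:
  "sg (x + y) = sg x + sg y" "sg (sc a x) = sc a (sg x)" "sg 0 = 0" "sg 1 = 1" "sg (x * y) = sg x * sg y"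
  "sg (M.Fm l) = sc (c (\<tau> l)) (M.Km l * M.Em (\<tau> l))"
  by (simp_all add: sg_def)

text \<open>Two gradings are tracked at once: the degree decides when a pairing vanishes, and the
  sum of degree and K-weight is the weight seen by group-like elements.\<close>

lemma sg_word_supported:
  "w \<in> Fw \<Longrightarrow> sg (mon w) \<in> supported (posw \<inter> ({v. deg v = tv (- deg w)} \<inter> {v. deg v + kw v = - deg w + tv (- deg w)}))"
proof (induction rule: words_in_induct)
  case zero
  show ?case by (simp add: one_supported_iff)
next
  case (Cons g w)
  then obtain l where g: "g = GF l" by auto
  have "M.Km l * M.Em (\<tau> l) * sg (mon w) \<in> supported (posw \<inter> ({v. deg v = tv (- deg (Word [g] + w))}
      \<inter> {v. deg v + kw v = - deg (Word [g] + w) + tv (- deg (Word [g] + w))}))"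
    unfolding mon_add[symmetric]
    by (rule supported_mult[OF _ Cons.IH, of _ "{Word [GK l] + Word [GE (\<tau> l)]}"]) (auto simp: g algebra_simps)
  then show ?case by (auto simp: g mon_add intro: supported_sc)
qed

lemma sg_supported:
  assumes "x \<in> supported (Fw \<inter> {w. deg w = - \<mu>})"
  shows "sg x \<in> supported (posw \<inter> ({v. deg v = tv \<mu>} \<inter> {v. deg v + kw v = \<mu> + tv \<mu>}))"
  using assms
proof (induction rule: supported_induct)
  case (mon w)
  then show ?case using sg_word_supported[of w] by simp
qed (auto intro: supported_add supported_sc)

lemma sg_supported_weaken:
  assumes "x \<in> supported (Fw \<inter> {w. deg w = - \<mu>})"
  shows "sg x \<in> supported (posw \<inter> {v. deg v = tv \<mu>})"
    "sg x \<in> supported (posw \<inter> {v. deg v + kw v = \<mu> + tv \<mu>})"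
  using sg_supported[OF assms] by (auto simp: supported_def)

lemma sg_Fw_supported: "x \<in> supported Fw \<Longrightarrow> sg x \<in> supported posw"
proof (induction rule: supported_induct)
  case (mon w)
  from sg_word_supported[OF this] show ?case by (auto simp: supported_def)
qed (auto intro: supported_add supported_sc)

lemma sigma_q: "x \<in> supported Fw \<Longrightarrow> \<sigma> (M.q x) = M.q (sg x)"
proof -
  have hom: "\<sigma> \<in> ring_hom ((U \<chi> (I_max \<chi>))\<lparr>carrier := U_neg \<chi> (I_max \<chi>)\<rparr>) ((U \<chi> (I_max \<chi>))\<lparr>carrier := U_pos_H \<chi> (I_max \<chi>)\<rparr>)"
    and smult: "\<And>a x. x \<in> supported Fw \<Longrightarrow> \<sigma> (M.q (sc a x)) = a \<odot>\<^bsub>U \<chi> (I_max \<chi>)\<^esub> \<sigma> (M.q x)"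
    and gens: "\<And>i. \<sigma> (M.q (M.Fm i)) = M.q (sg (M.Fm i))"
    using sigma by (auto simp: is_sigma_bar_def alg_hom_def M.U_neg_eq M.q_simps gen_eq_mon)
  have add: "\<sigma> (M.q (x + y)) = \<sigma> (M.q x) \<oplus>\<^bsub>U \<chi> (I_max \<chi>)\<^esub> \<sigma> (M.q y)"
    and mult: "\<sigma> (M.q (x * y)) = \<sigma> (M.q x) \<otimes>\<^bsub>U \<chi> (I_max \<chi>)\<^esub> \<sigma> (M.q y)"
    if "x \<in> supported Fw" "y \<in> supported Fw" for x y
    using ring_hom_add[OF hom, of "M.q x" "M.q y"] ring_hom_mult[OF hom, of "M.q x" "M.q y"] that
    by (simp_all add: M.U_neg_eq M.q_simps)
  have one: "\<sigma> (M.q 1) = M.q 1"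
    using ring_hom_one[OF hom] by (simp add: M.q_simps)
  have words: "\<sigma> (M.q (mon w)) = M.q (sg (mon w))" if "w \<in> Fw" for w
    using that
  proof (induction rule: words_in_induct)
    case zero
    then show ?case using one by simp
  next
    case (Cons g w)
    then obtain l where "g = GF l" by auto
    with Cons gens[of l] show ?case by (simp add: mon_add mult M.q_simps)
  qed
  assume "x \<in> supported Fw"
  then have "x \<in> supported Fw \<and> \<sigma> (M.q x) = M.q (sg x)"
  proof (induction rule: supported_induct)
    case zero
    show ?case using smult[of 1 0] by (simp add: one M.q_simps)
  qed (simp_all add: add smult words M.q_simps supported_add supported_sc)
  then show ?thesis ..
qed

text \<open>By degrees \<open>F_i\<close> has to meet \<open>E_j\<close> with
  \<open>j = \<tau> l\<close> and not the group-like factor, which forces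
  \<open>l = \<tau> i\<close> and turns \<open>c (\<tau> l)\<close> into \<open>c i\<close>. The
  remaining scalar is the pairing of \<open>K_i^{-1}\<close>, from the coproduct of
  \<open>F_i\<close>, with \<open>K_l\<close>.\<close>

lemma pw_F_sg_letter:
  assumes "b \<in> negw"
  shows "pw (Word [GF i] + b) (sg (M.Fm l))
    = (if l = \<tau> i then c i * \<chi> (\<alpha> i) (\<alpha> l) * pw b (M.Km l) else 0)"
proof -
  have "pw (Word [GF i] + b) (M.Km l * M.Em (\<tau> l))
    = cop_sum b (\<lambda>u v. pw (Word [GF i] + u) (M.Em (\<tau> l)) * pw (Word [GL i] + v) (M.Km l))
      + cop_sum b (\<lambda>u v. pw u (M.Em (\<tau> l)) * pw (Word [GF i] + v) (M.Km l))"
    using assms by (simp add: pw_mult)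
  also have "cop_sum b (\<lambda>u v. pw u (M.Em (\<tau> l)) * pw (Word [GF i] + v) (M.Km l)) = cop_sum b (\<lambda>u v. 0)"
  proof (rule cop_sum_cong)
    fix u v assume "(u, v) \<in> set (cop b)"
    from cop_neg(2)[OF assms this] deg_zero_F[of v i]
    show "pw u (M.Em (\<tau> l)) * pw (Word [GF i] + v) (M.Km l) = 0"
      using pw_K[of "Word [GF i] + v" l] by simp
  qed
  also have "cop_sum b (\<lambda>u v. pw (Word [GF i] + u) (M.Em (\<tau> l)) * pw (Word [GL i] + v) (M.Km l))
    = cop_sum b (\<lambda>u v. cou u * ((if i = \<tau> l then 1 else 0) * (\<chi> (\<alpha> i) (\<alpha> l) * pw v (M.Km l))))"
  proof (rule cop_sum_cong)
    fix u v assume "(u, v) \<in> set (cop b)"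
    from cop_neg(1,2)[OF assms this]
    show "pw (Word [GF i] + u) (M.Em (\<tau> l)) * pw (Word [GL i] + v) (M.Km l)
      = cou u * ((if i = \<tau> l then 1 else 0) * (\<chi> (\<alpha> i) (\<alpha> l) * pw v (M.Km l)))"
      by (simp add: pw_add_left[of "Word [GF i]" u] pw_add_left[of "Word [GL i]" v])
  qed
  finally have "pw (Word [GF i] + b) (M.Km l * M.Em (\<tau> l)) = (if i = \<tau> l then 1 else 0) * (\<chi> (\<alpha> i) (\<alpha> l) * pw b (M.Km l))"
    by (simp only: cop_sum_counit_field cop_sum_0 add_0_right)
  moreover have "i = \<tau> l \<longleftrightarrow> l = \<tau> i" by auto
  ultimately show ?thesis by simp
qed

text \<open>
  How the map \<open>e \<mapsto> \<langle>F\<^sub>i, e\<^sub>1\<rangle> e\<^sub>2\<close> acts on the image of \<open>\<sigma>\<close>: it is the skew derivation \<open>dj (\<tau> i)\<close>.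
\<close>

lemma pw_F_sg_word:
  assumes "w \<in> Fw" "u \<in> negw"
  shows "pw (Word [GF i] + u) (sg (mon w))
    = c i * \<chi> (\<alpha> (\<tau> i)) (tv (- deg w)) * pw u (sg (dj (\<tau> i) (mon w)) * M.Km (\<tau> i))"
  using assms
proof (induction arbitrary: u rule: words_in_induct)
  case zero
  then show ?case by simp
next
  case (Cons g w)
  then obtain l where g: "g = GF l" by auto
  define j where "j = \<tau> i"
  define W where "W = sg (dj j (mon w)) * M.Km j"
  let ?s = "sg (M.Fm l)"
  let ?C = "c i * \<chi> (\<alpha> j) (tv (- deg w))"
  note u = Cons.prems
  have s: "?s \<in> supported posw" using sg_Fw_supported[of "M.Fm l"] by simp
  have Z: "sg (mon w) \<in> supported posw" using sg_Fw_supported[of "mon w"] Cons.hyps by simp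
  have W: "W \<in> supported posw"
    unfolding W_def using sg_Fw_supported[of "dj j (mon w)"] dj_supported_word[OF Cons.hyps(2), of j]
    by (intro supported_posw_mult) (auto simp: supported_def)
  \<comment> \<open>The letter \<open>K_i^{-1}\<close> sees the image of \<open>F_l\<close> through
    its total weight only.\<close>
  have Lb: "pw (Word [GL i] + b) ?s = \<chi> (\<alpha> i) (\<alpha> l + \<alpha> (\<tau> l)) * pw b ?s" if "b \<in> negw" for b
    using pw_K_word_supported[of ?s "\<alpha> l + \<alpha> (\<tau> l)" "Word [GL i]" b] that sg_supported_weaken(2)[of "M.Fm l" "\<alpha> l"]
    by (simp add: chi_minus_left)
  have "pw (Word [GF i] + u) (?s * sg (mon w))
    = cop_sum u (\<lambda>a b. pw (Word [GF i] + a) (sg (mon w)) * pw (Word [GL i] + b) ?s)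
      + cop_sum u (\<lambda>a b. pw a (sg (mon w)) * pw (Word [GF i] + b) ?s)"
    using pw_mult[of "Word [GF i] + u" ?s "sg (mon w)"] u s Z by simp
  also have "cop_sum u (\<lambda>a b. pw (Word [GF i] + a) (sg (mon w)) * pw (Word [GL i] + b) ?s)
    = cop_sum u (\<lambda>a b. (?C * \<chi> (\<alpha> i) (\<alpha> l + \<alpha> (\<tau> l))) * (pw a W * pw b ?s))"
  proof (rule cop_sum_cong)
    fix a b assume "(a, b) \<in> set (cop u)"
    from cop_neg(1,2)[OF u this]
    show "pw (Word [GF i] + a) (sg (mon w)) * pw (Word [GL i] + b) ?s = (?C * \<chi> (\<alpha> i) (\<alpha> l + \<alpha> (\<tau> l))) * (pw a W * pw b ?s)"
      unfolding Cons.IH[OF cop_neg(1)[OF u \<open>(a, b) \<in> set (cop u)\<close>]] Lb[OF cop_neg(2)[OF u \<open>(a, b) \<in> set (cop u)\<close>]] W_def j_def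
      by (simp only: mult_ac)
  qed
  also have "\<dots> = ?C * \<chi> (\<alpha> i) (\<alpha> l + \<alpha> (\<tau> l)) * pw u (?s * W)"
    unfolding pw_mult[OF u s W] by (simp only: cop_sum_mult_left)
  also have "cop_sum u (\<lambda>a b. pw a (sg (mon w)) * pw (Word [GF i] + b) ?s)
    = cop_sum u (\<lambda>a b. (if l = j then c i * \<chi> (\<alpha> i) (\<alpha> l) else 0) * (pw a (sg (mon w)) * pw b (M.Km l)))"
  proof (rule cop_sum_cong)
    fix a b assume "(a, b) \<in> set (cop u)"
    show "pw a (sg (mon w)) * pw (Word [GF i] + b) ?s
      = (if l = j then c i * \<chi> (\<alpha> i) (\<alpha> l) else 0) * (pw a (sg (mon w)) * pw b (M.Km l))"
      unfolding pw_F_sg_letter[OF cop_neg(2)[OF u \<open>(a, b) \<in> set (cop u)\<close>]] j_def by simp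
  qed
  also have "\<dots> = (if l = j then c i * \<chi> (\<alpha> i) (\<alpha> l) else 0) * pw u (M.Km l * sg (mon w))"
    unfolding pw_mult[OF u supported_mon[THEN iffD2] Z, of "Word [GK l]", simplified] by (simp only: cop_sum_mult_left)
  \<comment> \<open>This brings \<open>K_l\<close> to the right end, where the claim has it.\<close>
  also have "pw u (M.Km l * sg (mon w)) = \<chi> (\<alpha> l) (tv (- deg w)) * pw u (sg (mon w) * M.Km l)"
  proof -
    have "sg (mon w) \<in> supported (posw \<inter> {v. deg v = tv (- deg w)})"
      using sg_word_supported[OF Cons.hyps(2)] by (auto simp: supported_def)
    then have "M.q (M.Km l * sg (mon w)) = M.q (sc (\<chi> (\<alpha> l) (tv (- deg w))) (sg (mon w) * M.Km l))"
      by (rule M.q_linear_eqI) (auto simp: distrib_left distrib_right sc_add_right mult.commute M.K_commute)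
    from pw_cong_right[OF u _ _ this] Z show ?thesis
      by (simp add: supported_posw_mult supported_sc)
  qed
  finally have eq: "pw (Word [GF i] + u) (?s * sg (mon w)) = ?C * \<chi> (\<alpha> i) (\<alpha> l + \<alpha> (\<tau> l)) * pw u (?s * W)
    + (if l = j then c i * \<chi> (\<alpha> i) (\<alpha> l) else 0) * (\<chi> (\<alpha> l) (tv (- deg w)) * pw u (sg (mon w) * M.Km l))" .
  \<comment> \<open>What remains is a comparison of scalars. It rests on the \<tau>-invariance of
    \<chi>, which lets \<open>\<alpha> i\<close> be replaced by \<open>\<alpha> j\<close> at the
    cost of applying \<tau> to the other argument.\<close>
  define X where "X = \<chi> (\<alpha> j) (tv (- deg w))"
  define Y where "Y = \<chi> (\<alpha> j) (\<alpha> (\<tau> l))"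
  define P where "P = pw u (?s * W)"
  define R where "R = pw u (sg (mon w) * M.Km l)"
  have 1: "\<chi> (\<alpha> i) (\<alpha> l + \<alpha> (\<tau> l)) = Y * \<chi> (\<alpha> j) (\<alpha> l)"
    using chi_tv[of "\<alpha> i" "\<alpha> l"] chi_tv[of "\<alpha> i" "\<alpha> (\<tau> l)"] by (simp add: chi_add_right j_def Y_def)
  have 2: "\<chi> (\<alpha> j) (tv (- deg (Word [g] + w))) = X * Y"
    by (simp add: g chi_simps divide_inverse mult.commute X_def Y_def)
  have "sg (dj j (mon (Word [g] + w))) * M.Km j
      = (if l = j then sg (mon w) * M.Km l else 0) + sc (\<chi> (\<alpha> j) (\<alpha> l)) (?s * W)"
    by (simp add: g W_def distrib_right mult.assoc del: sg_simps(6))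
  then have 3: "pw u (sg (dj j (mon (Word [g] + w))) * M.Km j) = (if l = j then R else 0) + \<chi> (\<alpha> j) (\<alpha> l) * P"
    unfolding P_def R_def by (simp only: pw_simps if_distrib[of "pw u"])
  have 4: "pw (Word [GF i] + u) (sg (mon (Word [g] + w)))
    = c i * X * (Y * \<chi> (\<alpha> j) (\<alpha> l)) * P + (if l = j then c i * \<chi> (\<alpha> i) (\<alpha> l) else 0) * (\<chi> (\<alpha> l) (tv (- deg w)) * R)"
    using eq unfolding g mon_add sg_simps(5) 1 P_def R_def X_def .
  have 5: "\<chi> (\<alpha> i) (\<alpha> l) = Y \<and> \<chi> (\<alpha> l) (tv (- deg w)) = X" if "l = j"
    unfolding that Y_def X_def using chi_sym[of "\<alpha> i" "\<alpha> j"] by (simp add: j_def)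
  show ?case
  proof (cases "l = j")
    case True
    note 5 = 5[OF True]
    show ?thesis
      unfolding j_def[symmetric] 2 3 4 if_P[OF True] 5[THEN conjunct1] 5[THEN conjunct2]
      by (simp only: distrib_left mult_ac add.commute)
  next
    case False
    show ?thesis
      unfolding j_def[symmetric] 2 3 4 if_not_P[OF False] by (simp only: mult_ac mult_zero_left add_0_left add_0_right)
  qed
qed

lemma pw_F_sg:
  assumes "x \<in> supported (Fw \<inter> {w. deg w = - \<mu>})" "u \<in> negw"
  shows "pw (Word [GF i] + u) (sg x)
    = c i * \<chi> (\<alpha> (\<tau> i)) (tv \<mu>) * pw u (sg (dj (\<tau> i) x) * M.Km (\<tau> i))"
  using assms(1)
proof (induction rule: supported_induct)
  case (mon w)
  then show ?case using pw_F_sg_word[OF _ assms(2), of w i] by simp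
qed (simp_all add: distrib_left distrib_right mult.left_commute)

end

text \<open>One representative has the right letters, another has the right degree. As
  \<open>J\<close> is graded, the component of degree \<open>\<mu>\<close> of the first still
  represents \<open>A\<close>, and it has both properties.\<close>

lemma (in uq) component_rep:
  assumes "A \<in> q ` supported (words_in G)" "A \<in> U_component \<chi> I \<mu>"
  shows "\<exists>x\<in>supported (words_in G \<inter> {w. deg w = \<mu>}). q x = A"
proof -
  from assms(1) obtain x where x: "x \<in> supported (words_in G)" "A = q x" by blast
  from assms(2) obtain y where "y \<in> {y. \<forall>w\<in>Poly_Mapping.keys y. deg w = \<mu>}" and y': "A = q y"
    unfolding U_component_def by blast
  then have y: "y \<in> supported {w. deg w = \<mu>}" by (auto simp: supported_def)
  from x(2) y' have "q x = q y" by simp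
  then have "x - y \<in> J" by (simp only: q_eq_iff)
  from hcomp_J[OF this, of \<mu>] have "q (hcomp uq_degree \<mu> x) = q y"
    by (simp add: q_eq_iff hcomp_homogeneous[OF y])
  then show ?thesis using hcomp_supported[OF x(1)] y' by auto
qed

lemma (in uq) supported_component: "x \<in> supported (P \<inter> {w. deg w = \<mu>}) \<Longrightarrow> q x \<in> U_component \<chi> I \<mu>"
  by (auto simp: U_component_def supported_def)

context uq_pairing
begin

lemma lact_eqI: "x \<in> supported negw \<Longrightarrow> (\<And>u. u \<in> negw \<Longrightarrow> pw u y = pw u y') \<Longrightarrow> lact y x = lact y' x"
  unfolding lact_def by (rule T.lext_cong, assumption, rule cop_sum_cong) (metis cop_neg(1))

lemma ract_eqI: "x \<in> supported negw \<Longrightarrow> (\<And>u. u \<in> negw \<Longrightarrow> pw u y = pw u y') \<Longrightarrow> ract y x = ract y' x"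
  unfolding ract_def by (rule T.lext_cong, assumption, rule cop_sum_cong) (metis cop_neg(2))

lemma act_0_left [simp]: "lact 0 x = 0" "ract 0 x = 0"
  using act_linear_left(2)[of 0 0 x] act_linear_left(4)[of 0 0 x] by simp_all

lemma act_sum_left: "lact (sum f A) x = (\<Sum>i\<in>A. lact (f i) x)" "ract (sum f A) x = (\<Sum>i\<in>A. ract (f i) x)"
  by (induction A rule: infinite_finite_induct) (simp_all add: act_linear_left)

lemma PT_sum_right: "PT x (sum f A) = (\<Sum>i\<in>A. PT x (f i))"
  by (induction A rule: infinite_finite_induct) simp_all

lemma PT_sum_left: "PT (sum f A) y = (\<Sum>i\<in>A. PT (f i) y)"
  by (induction A rule: infinite_finite_induct) simp_all

end

section \<open>Dual bases on representatives\<close>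

context star_data
begin

abbreviation "Fdeg \<rho> \<equiv> supported (Fw \<inter> {w. deg w = - int_vec \<rho>}) :: ('i, 'k) free_uq set"
abbreviation "Edeg \<rho> \<equiv> supported (Ew \<inter> {w. deg w = int_vec \<rho>}) :: ('i, 'k) free_uq set"

text \<open>Homogeneous lifts of the given dual bases in the appropriate letters; this is guaranteed
  for \<open>m < d \<rho>\<close>.\<close>

definition fb :: "('i \<Rightarrow> nat) \<Rightarrow> nat \<Rightarrow> ('i, 'k) free_uq" where
  "fb \<rho> m = (SOME x. x \<in> Fdeg \<rho> \<and> M.q x = Fb \<rho> m)"

definition eb :: "('i \<Rightarrow> nat) \<Rightarrow> nat \<Rightarrow> ('i, 'k) free_uq" where
  "eb \<rho> m = (SOME x. x \<in> Edeg \<rho> \<and> M.q x = Eb \<rho> m)"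

lemma fb_eb:
  assumes "m < d \<rho>"
  shows "fb \<rho> m \<in> Fdeg \<rho>" "M.q (fb \<rho> m) = Fb \<rho> m" "eb \<rho> m \<in> Edeg \<rho>" "M.q (eb \<rho> m) = Eb \<rho> m"
proof -
  have "Fb \<rho> m \<in> U_neg \<chi> (I_max \<chi>) \<inter> U_component \<chi> (I_max \<chi>) (- int_vec \<rho>)"
    "Eb \<rho> m \<in> U_pos \<chi> (I_max \<chi>) \<inter> U_component \<chi> (I_max \<chi>) (int_vec \<rho>)"
    using dual assms by (auto simp: dual_bases_def is_basis_def)
  then have "\<exists>x. x \<in> Fdeg \<rho> \<and> M.q x = Fb \<rho> m" "\<exists>x. x \<in> Edeg \<rho> \<and> M.q x = Eb \<rho> m"
    using M.component_rep[of "Fb \<rho> m" "range GF" "- int_vec \<rho>"] M.component_rep[of "Eb \<rho> m" "range GE" "int_vec \<rho>"]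
    unfolding M.U_neg_eq M.U_pos_eq by blast+
  from someI_ex[OF this(1)] someI_ex[OF this(2)]
  show "fb \<rho> m \<in> Fdeg \<rho>" "M.q (fb \<rho> m) = Fb \<rho> m" "eb \<rho> m \<in> Edeg \<rho>" "M.q (eb \<rho> m) = Eb \<rho> m"
    by (simp_all add: fb_def eb_def)
qed

lemma fb_eb_supported:
  assumes "m < d \<rho>"
  shows "fb \<rho> m \<in> supported negw" "eb \<rho> m \<in> supported posw" "fb \<rho> m \<in> supported Fw" "eb \<rho> m \<in> supported Ew"
  using supported_words_subset(1)[OF fb_eb(1)[OF assms]] supported_words_subset(2)[OF fb_eb(3)[OF assms]]
    fb_eb(1,3)[OF assms] supported_mono[OF inf_le1] by blast+

lemma PT_fb_eb: "m < d \<rho> \<Longrightarrow> n < d \<rho> \<Longrightarrow> PT (fb \<rho> m) (eb \<rho> n) = (if m = n then 1 else 0)"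
  using dual fb_eb fb_eb_supported by (simp add: PT_eq dual_bases_def)

text \<open>The basis property gives some expansion, and pairing with the dual basis identifies its
  coefficients.\<close>

lemma dual_expand_E:
  assumes "y \<in> Edeg \<rho>"
  shows "M.q y = M.q (\<Sum>m<d \<rho>. sc (PT (fb \<rho> m) y) (eb \<rho> m))"
proof -
  have "M.q y \<in> U_pos \<chi> (I_max \<chi>) \<inter> U_component \<chi> (I_max \<chi>) (int_vec \<rho>)"
    using M.supported_component[OF assms] assms by (auto simp: M.U_pos_eq supported_def)
  moreover have "is_basis (U \<chi> (I_max \<chi>)) (U_pos \<chi> (I_max \<chi>) \<inter> U_component \<chi> (I_max \<chi>) (int_vec \<rho>)) (d \<rho>) (Eb \<rho>)"
    using dual by (simp add: dual_bases_def)
  ultimately obtain a where "M.q y = (\<Oplus>\<^bsub>U \<chi> (I_max \<chi>)\<^esub>j\<in>{..<d \<rho>}. a j \<odot>\<^bsub>U \<chi> (I_max \<chi>)\<^esub> Eb \<rho> j)"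
    unfolding is_basis_def by blast
  also have "\<dots> = (\<Oplus>\<^bsub>U \<chi> (I_max \<chi>)\<^esub>j\<in>{..<d \<rho>}. M.q (sc (a j) (eb \<rho> j)))"
  proof -
    interpret R: ring "U \<chi> (I_max \<chi>)" by (rule M.ring_U)
    show ?thesis by (rule R.finsum_cong') (auto simp: fb_eb M.q_simps simp flip: fb_eb(4))
  qed
  finally have y: "M.q y = M.q (\<Sum>m<d \<rho>. sc (a m) (eb \<rho> m))" by (simp add: M.finsum_U)
  have sum: "(\<Sum>m<d \<rho>. sc (a m) (eb \<rho> m)) \<in> supported posw"
    by (intro supported_sum supported_sc fb_eb_supported) auto
  have "PT (fb \<rho> m) y = a m" if "m < d \<rho>" for m
  proof -
    have "PT (fb \<rho> m) y = PT (fb \<rho> m) (\<Sum>m<d \<rho>. sc (a m) (eb \<rho> m))"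
      using fb_eb_supported[OF that] supported_words_subset(2)[OF assms] sum y by (simp add: PT_eq)
    also have "\<dots> = (\<Sum>n<d \<rho>. if m = n then a n else 0)"
      unfolding PT_sum_right by (rule sum.cong) (use that in \<open>auto simp: PT_fb_eb\<close>)
    finally show ?thesis using that by simp
  qed
  then show ?thesis using y by simp
qed

lemma dual_expand_F:
  assumes "x \<in> Fdeg \<rho>"
  shows "M.q x = M.q (\<Sum>m<d \<rho>. sc (PT x (eb \<rho> m)) (fb \<rho> m))"
proof -
  have "M.q x \<in> U_neg \<chi> (I_max \<chi>) \<inter> U_component \<chi> (I_max \<chi>) (- int_vec \<rho>)"
    using M.supported_component[OF assms] assms by (auto simp: M.U_neg_eq supported_def)
  moreover have "is_basis (U \<chi> (I_max \<chi>)) (U_neg \<chi> (I_max \<chi>) \<inter> U_component \<chi> (I_max \<chi>) (- int_vec \<rho>)) (d \<rho>) (Fb \<rho>)"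
    using dual by (simp add: dual_bases_def)
  ultimately obtain a where "M.q x = (\<Oplus>\<^bsub>U \<chi> (I_max \<chi>)\<^esub>j\<in>{..<d \<rho>}. a j \<odot>\<^bsub>U \<chi> (I_max \<chi>)\<^esub> Fb \<rho> j)"
    unfolding is_basis_def by blast
  also have "\<dots> = (\<Oplus>\<^bsub>U \<chi> (I_max \<chi>)\<^esub>j\<in>{..<d \<rho>}. M.q (sc (a j) (fb \<rho> j)))"
  proof -
    interpret R: ring "U \<chi> (I_max \<chi>)" by (rule M.ring_U)
    show ?thesis by (rule R.finsum_cong') (auto simp: fb_eb M.q_simps simp flip: fb_eb(2))
  qed
  finally have x: "M.q x = M.q (\<Sum>m<d \<rho>. sc (a m) (fb \<rho> m))" by (simp add: M.finsum_U)
  have sum: "(\<Sum>m<d \<rho>. sc (a m) (fb \<rho> m)) \<in> supported negw"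
    by (intro supported_sum supported_sc fb_eb_supported) auto
  have "PT x (eb \<rho> m) = a m" if "m < d \<rho>" for m
  proof -
    have "PT x (eb \<rho> m) = PT (\<Sum>m<d \<rho>. sc (a m) (fb \<rho> m)) (eb \<rho> m)"
      using fb_eb_supported[OF that] supported_words_subset(1)[OF assms] sum x by (simp add: PT_eq)
    also have "\<dots> = (\<Sum>n<d \<rho>. if n = m then a n else 0)"
      unfolding PT_sum_left by (rule sum.cong) (use that in \<open>auto simp: PT_fb_eb\<close>)
    finally show ?thesis using that by simp
  qed
  then show ?thesis using x by simp
qed

text \<open>This is an equality in the free algebra, not merely modulo \<open>J\<close>:
  \<open>lact\<close> depends on its first argument through the pairing, and the pairing factors
  through the quotient by the ideal of \<open>I_max\<close>.\<close>

lemma lact_sg_cong: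
  assumes "a \<in> supported Fw" "a' \<in> supported Fw" "M.q a = M.q a'" "x \<in> supported negw"
  shows "lact (sg a) x = lact (sg a') x"
  using assms by (intro lact_eqI) (auto simp: pw_eq sg_Fw_supported simp flip: sigma_q)

lemma twist_posw: "b \<in> Edeg \<rho> \<Longrightarrow> twist b \<in> supported posw"
  using twist_supported[of b "range GE" "int_vec \<rho>"] supported_words_subset(2) by blast

text \<open>\<open>twist\<close> is defined by a recursion on words. That it respects the defining
  ideal is seen by expressing it through the inverse of \<open>S\<close>, which is a map on the
  quotient.\<close>

lemma twist_cong:
  assumes "b \<in> Edeg \<rho>" "b' \<in> Edeg \<rho>" "M.q b = M.q b'"
  shows "M.q (twist b) = M.q (twist b')"
proof -
  have "b \<in> supported Ew" "b' \<in> supported Ew" using assms by (auto simp: supported_def)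
  then have "M.q (A.inv_anti b) = M.q (A.inv_anti b')"
    using assms(3) by (simp flip: A.S_inv_anti)
  then have "M.q (sc ((- 1) ^ (\<Sum>i\<in>UNIV. \<rho> i)) (A.inv_anti b * mon (kword (int_vec \<rho>))))
    = M.q (sc ((- 1) ^ (\<Sum>i\<in>UNIV. \<rho> i)) (A.inv_anti b' * mon (kword (int_vec \<rho>))))"
    by (intro M.q_sc M.q_mult_right)
  then show ?thesis by (simp add: A.inv_S_twist assms)
qed

lemma ract_twist_cong:
  assumes "b \<in> Edeg \<rho>" "b' \<in> Edeg \<rho>" "M.q b = M.q b'" "x \<in> supported negw"
  shows "ract (twist b) x = ract (twist b') x"
  using assms(4)
  by (rule ract_eqI) (simp add: pw_eq twist_posw[OF assms(1)] twist_posw[OF assms(2)] twist_cong[OF assms(1-3)])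

lemma sg_sum: "sg (sum f A) = (\<Sum>i\<in>A. sg (f i))"
  and twist_sum: "twist (sum f A) = (\<Sum>i\<in>A. twist (f i))"
  by (induction A rule: infinite_finite_induct) simp_all

text \<open>Dual bases turn \<open>dj j\<close> on the first tensor factor into left multiplication by \<open>E\<^sub>j\<close> on the second.\<close>

lemma dual_shift:
  assumes "int_vec \<rho>' = int_vec \<rho> + \<alpha> j" "x \<in> supported negw" "y \<in> supported negw"
  shows "(\<Sum>m<d \<rho>'. lact (sg (dj j (fb \<rho>' m))) x * k * ract (twist (eb \<rho>' m)) y)
    = (\<Sum>n<d \<rho>. lact (sg (fb \<rho> n)) x * k * ract (twist (M.Em j * eb \<rho> n)) y)"
proof -
  have L: "lact (sg (dj j (fb \<rho>' m))) x = (\<Sum>n<d \<rho>. sc (PT (fb \<rho>' m) (M.Em j * eb \<rho> n)) (lact (sg (fb \<rho> n)) x))" if "m < d \<rho>'" for m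
  proof -
    have dj: "dj j (fb \<rho>' m) \<in> Fdeg \<rho>"
      using dj_supported[OF fb_eb(1)[OF that], of j] by (simp add: assms(1))
    have sum: "(\<Sum>n<d \<rho>. sc (PT (dj j (fb \<rho>' m)) (eb \<rho> n)) (fb \<rho> n)) \<in> supported Fw"
      by (intro supported_sum supported_sc fb_eb_supported) auto
    have "lact (sg (dj j (fb \<rho>' m))) x = lact (sg (\<Sum>n<d \<rho>. sc (PT (dj j (fb \<rho>' m)) (eb \<rho> n)) (fb \<rho> n))) x"
      by (rule lact_sg_cong[OF _ sum dual_expand_F[OF dj] assms(2)]) (use dj in \<open>auto simp: supported_def\<close>)
    also have "\<dots> = (\<Sum>n<d \<rho>. sc (PT (dj j (fb \<rho>' m)) (eb \<rho> n)) (lact (sg (fb \<rho> n)) x))"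
      by (simp add: sg_sum act_sum_left act_linear_left)
    also have "\<dots> = (\<Sum>n<d \<rho>. sc (PT (fb \<rho>' m) (M.Em j * eb \<rho> n)) (lact (sg (fb \<rho> n)) x))"
      by (rule sum.cong) (use that fb_eb_supported in \<open>auto simp: dj_dual\<close>)
    finally show ?thesis .
  qed
  have R: "ract (twist (M.Em j * eb \<rho> n)) y = (\<Sum>m<d \<rho>'. sc (PT (fb \<rho>' m) (M.Em j * eb \<rho> n)) (ract (twist (eb \<rho>' m)) y))" if "n < d \<rho>" for n
  proof -
    have E: "M.Em j * eb \<rho> n \<in> Edeg \<rho>'"
      by (rule supported_mult[OF _ fb_eb(3)[OF that], of _ "{Word [GE j]}"]) (auto simp: assms(1) add.commute)
    have sum: "(\<Sum>m<d \<rho>'. sc (PT (fb \<rho>' m) (M.Em j * eb \<rho> n)) (eb \<rho>' m)) \<in> Edeg \<rho>'"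
      by (intro supported_sum supported_sc fb_eb) auto
    have "ract (twist (M.Em j * eb \<rho> n)) y = ract (twist (\<Sum>m<d \<rho>'. sc (PT (fb \<rho>' m) (M.Em j * eb \<rho> n)) (eb \<rho>' m))) y"
      by (rule ract_twist_cong[OF E sum dual_expand_E[OF E] assms(3)])
    then show ?thesis by (simp add: twist_sum act_sum_left act_linear_left)
  qed
  \<comment> \<open>By adjointness of \<open>dj\<close>, both \<open>L\<close> and \<open>R\<close>
    have the coefficients \<open>PT (fb \<rho>' m) (M.Em j * eb \<rho> n)\<close>, so an exchange of
    the two sums finishes the proof.\<close>
  have "(\<Sum>m<d \<rho>'. lact (sg (dj j (fb \<rho>' m))) x * k * ract (twist (eb \<rho>' m)) y)
    = (\<Sum>m<d \<rho>'. \<Sum>n<d \<rho>. sc (PT (fb \<rho>' m) (M.Em j * eb \<rho> n)) (lact (sg (fb \<rho> n)) x * k * ract (twist (eb \<rho>' m)) y))"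
    by (rule sum.cong) (simp_all add: L sum_distrib_right)
  also have "\<dots> = (\<Sum>n<d \<rho>. lact (sg (fb \<rho> n)) x * k * ract (twist (M.Em j * eb \<rho> n)) y)"
    by (subst sum.swap, rule sum.cong) (simp_all add: R sum_distrib_left)
  finally show ?thesis .
qed

section \<open>The star product on representatives\<close>

abbreviation KK :: "('i \<Rightarrow> nat) \<Rightarrow> ('i, 'k) free_uq" where
  "KK \<rho> \<equiv> mon (kword (int_vec \<rho>))"

text \<open>The sign, the inverse antipode and the factor \<open>K\<^sub>\<rho>\<close> inside the
  right action are absorbed into \<open>twist\<close>; \<open>star_term_q\<close> makes the
  comparison with the original summand.\<close>

definition tm :: "('i \<Rightarrow> nat) \<Rightarrow> ('i, 'k) free_uq \<Rightarrow> ('i, 'k) free_uq \<Rightarrow> ('i, 'k) free_uq" where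
  "tm \<rho> x y = (\<Sum>m<d \<rho>. lact (sg (fb \<rho> m)) x * KK \<rho> * ract (twist (eb \<rho> m)) y)"

text \<open>All terms of the star product of \<open>x\<close> with any element vanish outside of \<open>bnd x\<close>.\<close>

definition bnd :: "('i, 'k) free_uq \<Rightarrow> ('i \<Rightarrow> nat) set" where
  "bnd x = {\<rho>. \<exists>w\<in>Poly_Mapping.keys x. \<forall>i. int (\<rho> (\<tau> i)) \<le> - deg w i}"

definition sta :: "('i, 'k) free_uq \<Rightarrow> ('i, 'k) free_uq \<Rightarrow> ('i, 'k) free_uq" where
  "sta x y = (\<Sum>\<rho>\<in>bnd x. tm \<rho> x y)"

lemma finite_bnd: "finite (bnd x)"
proof -
  have "finite {\<rho>. \<forall>i. int (\<rho> (\<tau> i)) \<le> - deg w i}" for w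
  proof (rule finite_subset)
    show "{\<rho>. \<forall>i. int (\<rho> (\<tau> i)) \<le> - deg w i} \<subseteq> (\<Pi>\<^sub>E i\<in>UNIV. {..nat (- deg w (\<tau> i))})"
    proof (clarsimp simp: PiE_UNIV_domain)
      fix \<rho> i assume "\<forall>i. int (\<rho> (\<tau> i)) \<le> - deg w i"
      from spec[OF this, of "\<tau> i"] show "\<rho> i \<le> nat (- deg w (\<tau> i))" by simp
    qed
    show "finite (\<Pi>\<^sub>E i\<in>UNIV. {..nat (- deg w (\<tau> i))})" by (intro finite_PiE) auto
  qed
  moreover have "bnd x = (\<Union>w\<in>Poly_Mapping.keys x. {\<rho>. \<forall>i. int (\<rho> (\<tau> i)) \<le> - deg w i})"
    by (auto simp: bnd_def)
  ultimately show ?thesis by simp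
qed

text \<open>By degrees \<open>\<sigma>(F\<^sub>\<rho>)\<close> pairs only with a left leg of degree
  \<open>- \<tau>(\<rho>)\<close>, and no leg contains more \<open>F\<close> letters of a given kind
  than the word itself.\<close>

lemma lact_sg_eq_0:
  assumes "x \<in> supported negw" "\<rho> \<notin> bnd x" "a \<in> Fdeg \<rho>"
  shows "lact (sg a) x = 0"
proof -
  have "cop_sum w (\<lambda>u v. sc (pw u (sg a)) (mon v)) = cop_sum w (\<lambda>u v. 0)" if w: "w \<in> Poly_Mapping.keys x" for w
  proof (rule cop_sum_cong)
    fix u v assume uv: "(u, v) \<in> set (cop w)"
    have "w \<in> negw" using w assms(1) by (auto simp: supported_def)
    note uv' = cop_neg(1,2)[OF this uv]
    have "deg u + tv (int_vec \<rho>) \<noteq> 0"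
    proof
      assume "deg u + tv (int_vec \<rho>) = 0"
      then have u: "deg u i = - int (\<rho> (\<tau> i))" for i
        by (simp add: fun_eq_iff fun_apply_simps tau_vec_def int_vec_def eq_neg_iff_add_eq_0)
      have "int (\<rho> (\<tau> i)) \<le> - deg w i" for i
        using cop_deg[OF uv] neg_deg_le[OF uv'(2), of i] u[of i] by (auto simp: fun_apply_simps simp flip: cop_deg[OF uv])
      then show False using assms(2) w by (auto simp: bnd_def)
    qed
    then show "sc (pw u (sg a)) (mon v) = 0"
      using pw_degree_supported[OF sg_supported_weaken(1)[OF assms(3)] uv'(1)] by simp
  qed
  then show ?thesis by (simp add: lact_def lext_def)
qed

lemma tm_eq_0: "x \<in> supported negw \<Longrightarrow> \<rho> \<notin> bnd x \<Longrightarrow> tm \<rho> x y = 0"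
  by (simp add: tm_def lact_sg_eq_0[OF _ _ fb_eb(1)])

text \<open>The index set \<open>bnd x\<close> depends on the representative. Enlarging it freely
  makes sums for different arguments comparable.\<close>

lemma sta_eq: "x \<in> supported negw \<Longrightarrow> finite B \<Longrightarrow> bnd x \<subseteq> B \<Longrightarrow> sta x y = (\<Sum>\<rho>\<in>B. tm \<rho> x y)"
  unfolding sta_def by (rule sum.mono_neutral_left) (auto simp: tm_eq_0)

lemma tm_simps:
  "tm \<rho> (x + x') y = tm \<rho> x y + tm \<rho> x' y" "tm \<rho> (sc a x) y = sc a (tm \<rho> x y)"
  "tm \<rho> x (y + y') = tm \<rho> x y + tm \<rho> x y'" "tm \<rho> x (sc a y) = sc a (tm \<rho> x y)"
  by (simp_all add: tm_def distrib_left distrib_right sum.distrib T.scale_sum_right)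

lemma sta_add_left: "x \<in> supported negw \<Longrightarrow> x' \<in> supported negw \<Longrightarrow> sta (x + x') y = sta x y + sta x' y"
  using finite_bnd
  by (simp add: sta_eq[of _ "bnd x \<union> bnd x' \<union> bnd (x + x')"] supported_add tm_simps sum.distrib le_supI1 le_supI2)

lemma sta_sc_left: "x \<in> supported negw \<Longrightarrow> sta (sc a x) y = sc a (sta x y)"
  using finite_bnd
  by (simp add: sta_eq[of _ "bnd x \<union> bnd (sc a x)"] supported_sc tm_simps T.scale_sum_right)

lemma sta_right: "sta x (y + y') = sta x y + sta x y'" "sta x (sc a y) = sc a (sta x y)"
  by (simp_all add: sta_def tm_simps sum.distrib T.scale_sum_right)

lemma sta_0 [simp]: "sta 0 y = 0" "sta x 0 = 0"
  using sta_right(2)[of x 0 0] by (simp_all add: sta_def bnd_def)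

lemma sta_supported: "x \<in> supported negw \<Longrightarrow> y \<in> supported negw \<Longrightarrow> sta x y \<in> supported negw"
proof -
  have "u * v \<in> supported negw" if "u \<in> supported negw" "v \<in> supported negw" for u v :: "('i, 'k) free_uq"
    using that by (rule supported_mult) auto
  moreover have "KK \<rho> \<in> supported negw" for \<rho> using M.kword_in words_subset by auto
  ultimately show "x \<in> supported negw \<Longrightarrow> y \<in> supported negw \<Longrightarrow> sta x y \<in> supported negw"
    unfolding sta_def tm_def by (intro supported_sum) (simp add: act_neg)
qed

lemma sta_cong:
  assumes "x \<in> supported negw" "x' \<in> supported negw" "y \<in> supported negw" "y' \<in> supported negw" "q x = q x'" "q y = q y'"
  shows "q (sta x y) = q (sta x' y')"
proof -
  have "q (tm \<rho> x y) = q (tm \<rho> x' y')" for \<rho>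
    unfolding tm_def
  proof (rule q_sum)
    fix m assume "m \<in> {..<d \<rho>}"
    then have m: "m < d \<rho>" by simp
    show "q (lact (sg (fb \<rho> m)) x * KK \<rho> * ract (twist (eb \<rho> m)) y) = q (lact (sg (fb \<rho> m)) x' * KK \<rho> * ract (twist (eb \<rho> m)) y')"
      using assms sg_Fw_supported[OF fb_eb_supported(3)[OF m]] twist_posw[OF fb_eb(3)[OF m]]
      by (intro q_mult refl lact_cong ract_cong)
  qed
  then have "q (\<Sum>\<rho>\<in>bnd x \<union> bnd x'. tm \<rho> x y) = q (\<Sum>\<rho>\<in>bnd x \<union> bnd x'. tm \<rho> x' y')"
    by (intro q_sum)
  then show ?thesis
    using assms by (simp add: sta_eq[of _ "bnd x \<union> bnd x'"] finite_bnd)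
qed

text \<open>Left star multiplication by \<open>F\<^sub>i\<close>.\<close>

definition beta :: "'i \<Rightarrow> ('i, 'k) free_uq \<Rightarrow> ('i, 'k) free_uq" where
  "beta i x = Fm i * x + sc (c i * \<chi> (\<alpha> i) (\<alpha> (\<tau> i))) (Lm i * Km (\<tau> i) * ract (Em (\<tau> i)) x)"

definition inc :: "'i \<Rightarrow> ('i \<Rightarrow> nat) \<Rightarrow> ('i \<Rightarrow> nat)" where
  "inc j \<rho> = \<rho>(j := Suc (\<rho> j))"

lemma int_vec_inc: "int_vec (inc j \<rho>) = int_vec \<rho> + \<alpha> j"
  by (auto simp: int_vec_def inc_def \<alpha>_def fun_eq_iff fun_apply_simps)

text \<open>The \<open>j\<close>-th coordinate of its degree would be 1, but words in the
  \<open>F\<close> letters have degrees with nonpositive coordinates.\<close>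

lemma dj_fb_eq_0:
  assumes "m < d \<rho>" "\<rho> j = 0"
  shows "dj j (fb \<rho> m) = 0"
proof -
  have "dj j (fb \<rho> m) \<in> supported (Fw \<inter> {w. deg w = - int_vec \<rho> + \<alpha> j})"
    using dj_supported[OF fb_eb(1)[OF assms(1)]] .
  moreover have "Fw \<inter> {w. deg w = - int_vec \<rho> + \<alpha> j} = {}"
  proof -
    have False if "w \<in> Fw" "deg w = - int_vec \<rho> + \<alpha> j" for w
    proof -
      have "deg w j = 1" using assms(2) that(2) by (simp add: fun_apply_simps int_vec_def \<alpha>_def)
      moreover have "w \<in> negw" using that(1) words_subset by auto
      ultimately show False using neg_deg_le[of w j] by simp
    qed
    then show ?thesis by auto
  qed
  ultimately have "Poly_Mapping.keys (dj j (fb \<rho> m)) = {}" unfolding supported_def by blast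
  then show ?thesis using sum_mon[of "dj j (fb \<rho> m)"] by simp
qed

text \<open>The coproduct of \<open>F_i\<close> gives two terms. One keeps \<open>F_i\<close> in the
  right leg. In the other \<open>F_i\<close> is consumed by the pairing, which by
  \<open>pw_F_sg\<close> applies the skew derivation and leaves a factor \<open>K_j\<close>,
  \<open>j = \<tau> i\<close>, acting on \<open>f\<close> by a scalar.\<close>

lemma lact_F_mult:
  assumes "a \<in> Fdeg \<rho>" "f \<in> negw"
  shows "lact (sg a) (Fm i * mon f) = Fm i * lact (sg a) (mon f)
    + sc (c i * \<chi> (\<alpha> (\<tau> i)) (tv (int_vec \<rho>)) * inverse (\<chi> (kw f) (\<alpha> (\<tau> i)))) (Lm i * lact (sg (dj (\<tau> i) a)) (mon f))"
proof -
  let ?C = "c i * \<chi> (\<alpha> (\<tau> i)) (tv (int_vec \<rho>))"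
  have sgd: "sg (dj (\<tau> i) a) \<in> supported posw"
    using dj_supported[OF assms(1), of "\<tau> i"] by (intro sg_Fw_supported) (auto simp: supported_def)
  have "lact (sg a) (mon (Word [GF i] + f))
    = cop_sum f (\<lambda>u v. sc (pw (Word [GF i] + u) (sg a)) (mon (Word [GL i] + v))) + cop_sum f (\<lambda>u v. sc (pw u (sg a)) (mon (Word [GF i] + v)))"
    by (simp add: lact_mon)
  also have "cop_sum f (\<lambda>u v. sc (pw u (sg a)) (mon (Word [GF i] + v))) = Fm i * lact (sg a) (mon f)"
    unfolding lact_mon cop_sum_mult_left by (simp add: mon_add)
  also have "cop_sum f (\<lambda>u v. sc (pw (Word [GF i] + u) (sg a)) (mon (Word [GL i] + v)))
    = cop_sum f (\<lambda>u v. sc ?C (Lm i * sc (pw u (sg (dj (\<tau> i) a) * M.Km (\<tau> i))) (mon v)))"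
  proof (rule cop_sum_cong)
    fix u v assume "(u, v) \<in> set (cop f)"
    from pw_F_sg[OF assms(1) cop_neg(1)[OF assms(2) this], of i]
    show "sc (pw (Word [GF i] + u) (sg a)) (mon (Word [GL i] + v)) = sc ?C (Lm i * sc (pw u (sg (dj (\<tau> i) a) * M.Km (\<tau> i))) (mon v))"
      by (simp add: mon_add)
  qed
  also have "\<dots> = sc ?C (Lm i * lact (sg (dj (\<tau> i) a) * M.Km (\<tau> i)) (mon f))"
    unfolding lact_mon cop_sum_mult_left cop_sum_sc ..
  also have "lact (sg (dj (\<tau> i) a) * M.Km (\<tau> i)) (mon f) = lact (sg (dj (\<tau> i) a)) (lact (M.Km (\<tau> i)) (mon f))"
    using assms(2) sgd by (intro lact_lact[symmetric]) auto
  finally show ?thesis using assms(2) by (simp add: mon_add lact_Km)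
qed

text \<open>Only left legs of degree \<open>- \<tau>(\<rho>)\<close> contribute, and
  \<open>cop_neg\<close> then gives the K-weight of the right leg. Both data are needed to move
  \<open>K_j\<close> past the result and to evaluate the right action of \<open>K_j\<close> on
  it.\<close>

lemma lact_sg_supported_word:
  assumes "a \<in> Fdeg \<rho>" "f \<in> negw"
  shows "lact (sg a) (mon f) \<in> supported (negw \<inter> {v. kw v = kw f - tv (int_vec \<rho>) \<and> deg v = deg f + tv (int_vec \<rho>)})"
  unfolding lact_mon
proof (rule cop_sum_in)
  fix u v assume uv: "(u, v) \<in> set (cop f)"
  note uv' = cop_neg[OF assms(2) uv]
  show "sc (pw u (sg a)) (mon v) \<in> supported (negw \<inter> {v. kw v = kw f - tv (int_vec \<rho>) \<and> deg v = deg f + tv (int_vec \<rho>)})"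
  proof (cases "deg u + tv (int_vec \<rho>) = 0")
    case True
    then have "deg u = - tv (int_vec \<rho>)" by (simp add: eq_neg_iff_add_eq_0)
    moreover from this have "deg v = deg f + tv (int_vec \<rho>)"
      using cop_deg[OF uv] by (simp add: algebra_simps)
    ultimately show ?thesis using uv' by (auto intro!: supported_sc)
  next
    case False
    then show ?thesis
      using pw_degree_supported[OF sg_supported_weaken(1)[OF assms(1)] uv'(1)] by simp
  qed
qed (auto intro: supported_add)

text \<open>Moving \<open>k\<close> out of the left action costs the inverse of
  \<open>\<chi>\<close> at \<open>kw k\<close> and \<open>\<rho> + \<tau>(\<rho>)\<close>, which is
  1 on \<open>Z_theta\<close>. The other factors of a term stand to the right of it and are not
  affected.\<close>

lemma sta_K_left:
  assumes "k \<in> Kw" "kw k \<in> Z_theta \<tau>" "x \<in> supported negw"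
  shows "sta (mon k * x) y = mon k * sta x y"
proof -
  have "k \<in> negw" using assms(1) words_subset by auto
  then have kx: "mon k * x \<in> supported negw"
    using supported_mult[of "mon k" "{k}" x negw negw] assms(3) by simp
  have "tm \<rho> (mon k * x) y = mon k * tm \<rho> x y" for \<rho>
    unfolding tm_def sum_distrib_left
    by (rule sum.cong)
      (auto simp: act_K_word[OF sg_supported_weaken(2)[OF fb_eb(1)] assms(1,3)] Z_theta_chi[OF assms(2)] mult.assoc)
  then show ?thesis
    using kx assms(3) finite_bnd
    by (simp add: sta_eq[of _ "bnd x \<union> bnd (mon k * x)"] sum_distrib_left)
qed

lemma Z_theta_alpha: "\<alpha> (\<tau> i) - \<alpha> i \<in> Z_theta \<tau>"
proof -
  have "tv (\<alpha> (\<tau> i) - \<alpha> i) = - (\<alpha> (\<tau> i) - \<alpha> i)" by simp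
  then show ?thesis by (simp only: Z_theta_def tau_vec_def mem_Collect_eq)
qed

text \<open>The statement is for a single word because the scalars depend on its degree and
  K-weight; \<open>sta_beta\<close> extends it linearly. The sum for the product with
  \<open>F_i\<close> is transformed in the free algebra itself, whereas the other side requires
  moving \<open>K_j\<close> and so holds modulo \<open>J\<close> only.\<close>

theorem fundamental_identity:
  assumes f: "f \<in> negw" and y: "y \<in> supported negw"
  shows "q (sta (beta i (mon f)) y) = q (beta i (sta (mon f) y))"
proof -
  define j where "j = \<tau> i"
  define x where "x = (mon f :: ('i, 'k) free_uq)"
  have x: "x \<in> supported negw" using f by (simp add: x_def)
  define X where "X = (\<lambda>\<rho> m. lact (sg (fb \<rho> m)) x)"
  define Y where "Y = (\<lambda>\<rho> m. ract (twist (eb \<rho> m)) y)"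
  define B' where "B' = bnd x"
  \<comment> \<open>Large enough for all sums that occur: the shifted indices, those of
    \<open>Fm i * x\<close> and those of \<open>x\<close>. Additional indices contribute zero by
    \<open>tm_eq_0\<close>.\<close>
  define B where "B = inc j ` B' \<union> bnd (Fm i * x) \<union> B'"
  have fin: "finite B" "finite B'" by (simp_all add: B_def B'_def finite_bnd)
  have Fx: "Fm i * x \<in> supported negw" using f by (simp add: x_def flip: mon_add)
  define e where "e = (\<lambda>\<rho>. c i * \<chi> (\<alpha> j) (tv (int_vec \<rho>)) * inverse (\<chi> (kw f) (\<alpha> j)))"
  define s where "s = (\<lambda>\<rho>. \<Sum>m<d \<rho>. lact (sg (dj j (fb \<rho> m))) x * KK \<rho> * Y \<rho> m)"
  have tm: "tm \<rho> (Fm i * x) y = Fm i * tm \<rho> x y + sc (e \<rho>) (Lm i * s \<rho>)" for \<rho>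
  proof -
    have "tm \<rho> (Fm i * x) y = (\<Sum>m<d \<rho>. Fm i * (X \<rho> m * KK \<rho> * Y \<rho> m)
        + sc (e \<rho>) (Lm i * (lact (sg (dj j (fb \<rho> m))) x * KK \<rho> * Y \<rho> m)))"
      unfolding tm_def
    proof (rule sum.cong[OF refl])
      fix m assume "m \<in> {..<d \<rho>}"
      then have m: "m < d \<rho>" by simp
      show "lact (sg (fb \<rho> m)) (Fm i * x) * KK \<rho> * ract (twist (eb \<rho> m)) y = Fm i * (X \<rho> m * KK \<rho> * Y \<rho> m)
        + sc (e \<rho>) (Lm i * (lact (sg (dj j (fb \<rho> m))) x * KK \<rho> * Y \<rho> m))"
        unfolding x_def X_def Y_def e_def j_def lact_F_mult[OF fb_eb(1)[OF m] f]
        by (simp only: distrib_left distrib_right mult.assoc sc_mult_left sc_mult_right)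
    qed
    then show ?thesis
      by (simp add: sum.distrib tm_def s_def X_def Y_def T.scale_sum_right sum_distrib_left)
  qed
  have "sta (Fm i * x) y = (\<Sum>\<rho>\<in>B. Fm i * tm \<rho> x y + sc (e \<rho>) (Lm i * s \<rho>))"
    using fin by (subst sta_eq[OF Fx, of B]) (auto simp: B_def tm)
  also have "\<dots> = Fm i * sta x y + (\<Sum>\<rho>\<in>B. sc (e \<rho>) (Lm i * s \<rho>))"
    using fin by (subst sta_eq[OF x, of B]) (auto simp: B_def B'_def sum.distrib sum_distrib_left)
  \<comment> \<open>If \<open>\<rho> j = 0\<close> the skew derivative vanishes by degree. Otherwise
    \<open>dual_shift\<close> rewrites the term with the index lowered by one at \<open>j\<close>,
    and outside of the shifted set this index is not in \<open>bnd x\<close>.\<close>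
  also have "(\<Sum>\<rho>\<in>B. sc (e \<rho>) (Lm i * s \<rho>)) = (\<Sum>\<rho>\<in>inc j ` B'. sc (e \<rho>) (Lm i * s \<rho>))"
  proof (rule sum.mono_neutral_right)
    show "\<forall>\<rho>\<in>B - inc j ` B'. sc (e \<rho>) (Lm i * s \<rho>) = 0"
    proof
      fix \<rho> assume \<rho>: "\<rho> \<in> B - inc j ` B'"
      have "s \<rho> = 0"
      proof (cases "\<rho> j = 0")
        case True
        then show ?thesis by (simp add: s_def dj_fb_eq_0)
      next
        case False
        define \<rho>' where "\<rho>' = \<rho>(j := \<rho> j - 1)"
        have "\<rho> = inc j \<rho>'" using False by (auto simp: \<rho>'_def inc_def fun_eq_iff)
        with \<rho> have "\<rho>' \<notin> bnd x" by (auto simp: B'_def)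
        then show ?thesis
          unfolding s_def Y_def
          using dual_shift[of \<rho> \<rho>' j x y "KK \<rho>"] x y \<open>\<rho> = inc j \<rho>'\<close>
          by (simp add: int_vec_inc lact_sg_eq_0[OF x _ fb_eb(1)])
      qed
      then show "sc (e \<rho>) (Lm i * s \<rho>) = 0" by simp
    qed
  qed (use fin in \<open>auto simp: B_def\<close>)
  also have "\<dots> = (\<Sum>\<rho>\<in>B'. sc (e (inc j \<rho>)) (Lm i * s (inc j \<rho>)))"
  proof -
    have "inj (inc j)"
    proof (rule injI)
      fix \<rho> \<rho>' assume "inc j \<rho> = inc j \<rho>'"
      then have "(inc j \<rho>)(j := inc j \<rho> j - 1) = (inc j \<rho>')(j := inc j \<rho>' j - 1)" by simp
      then show "\<rho> = \<rho>'" by (simp add: inc_def)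
    qed
    then show ?thesis by (subst sum.reindex) (auto simp: inj_on_def)
  qed
  also have "\<dots> = (\<Sum>\<rho>\<in>B'. \<Sum>m<d \<rho>. sc (e (inc j \<rho>) * inverse (\<chi> (\<alpha> j) (int_vec \<rho>)))
      (Lm i * (X \<rho> m * KK (inc j \<rho>) * ract (M.Em j) (Y \<rho> m))))"
  proof (rule sum.cong[OF refl])
    fix \<rho> assume "\<rho> \<in> B'"
    have "s (inc j \<rho>) = (\<Sum>m<d \<rho>. X \<rho> m * KK (inc j \<rho>) * ract (twist (M.Em j * eb \<rho> m)) y)"
      unfolding s_def Y_def X_def using x y by (intro dual_shift int_vec_inc)
    also have "\<dots> = (\<Sum>m<d \<rho>. sc (inverse (\<chi> (\<alpha> j) (int_vec \<rho>))) (X \<rho> m * KK (inc j \<rho>) * ract (M.Em j) (Y \<rho> m)))"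
    proof (rule sum.cong[OF refl])
      fix m assume "m \<in> {..<d \<rho>}"
      then have m: "m < d \<rho>" by simp
      have "twist (M.Em j * eb \<rho> m) = sc (inverse (\<chi> (\<alpha> j) (int_vec \<rho>))) (twist (eb \<rho> m) * M.Em j)"
        using twist_mult_left[of "eb \<rho> m" "int_vec \<rho>" "GE j"] fb_eb(3)[OF m] by (auto simp: supported_def)
      moreover have "ract (twist (eb \<rho> m) * M.Em j) y = ract (M.Em j) (Y \<rho> m)"
        unfolding Y_def using y twist_posw[OF fb_eb(3)[OF m]] by (intro ract_ract[symmetric]) auto
      ultimately show "X \<rho> m * KK (inc j \<rho>) * ract (twist (M.Em j * eb \<rho> m)) y
        = sc (inverse (\<chi> (\<alpha> j) (int_vec \<rho>))) (X \<rho> m * KK (inc j \<rho>) * ract (M.Em j) (Y \<rho> m))"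
        by (simp add: act_linear_left)
    qed
    finally show "sc (e (inc j \<rho>)) (Lm i * s (inc j \<rho>))
      = (\<Sum>m<d \<rho>. sc (e (inc j \<rho>) * inverse (\<chi> (\<alpha> j) (int_vec \<rho>))) (Lm i * (X \<rho> m * KK (inc j \<rho>) * ract (M.Em j) (Y \<rho> m))))"
      by (simp add: sum_distrib_left T.scale_sum_right)
  qed
  finally have left: "sta (Fm i * x) y = Fm i * sta x y + (\<Sum>\<rho>\<in>B'. \<Sum>m<d \<rho>. sc (e (inc j \<rho>) * inverse (\<chi> (\<alpha> j) (int_vec \<rho>)))
      (Lm i * (X \<rho> m * KK (inc j \<rho>) * ract (M.Em j) (Y \<rho> m))))" .
  have Kneg: "KK \<rho> \<in> supported negw" for \<rho> using M.kword_in words_subset by auto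
  have neg: "X \<rho> m \<in> supported negw" "Y \<rho> m \<in> supported negw" for \<rho> m
    using x y by (simp_all add: X_def Y_def act_neg)
  \<comment> \<open>\<open>E_j\<close> acts on the three factors of a term as a skew derivation. On
    the first factor it commutes with the left action and gives the terms of
    \<open>sta (ract (M.Em j) x) y\<close>; on the middle factor it is zero; on the last it gives
    the terms that have to match the shifted sum in \<open>left\<close>.\<close>
  have right: "ract (M.Em j) (sta x y) = sta (ract (M.Em j) x) y
    + (\<Sum>\<rho>\<in>B'. \<Sum>m<d \<rho>. sc (inverse (\<chi> (kw f + deg f) (\<alpha> j)) * inverse (\<chi> (int_vec \<rho>) (\<alpha> j))) (X \<rho> m * KK \<rho> * ract (M.Em j) (Y \<rho> m)))"
  proof -
    have XK: "ract (M.Km j) (X \<rho> m) = sc (inverse (\<chi> (kw f + deg f) (\<alpha> j))) (X \<rho> m)" if "m < d \<rho>" for \<rho> m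
      using lact_sg_supported_word[OF fb_eb(1)[OF that] f] unfolding X_def x_def
      by (intro ract_Km_supported) (auto simp: supported_def)
    have KKm: "ract (M.Km j) (KK \<rho>) = sc (inverse (\<chi> (int_vec \<rho>) (\<alpha> j))) (KK \<rho>)" for \<rho>
      using ract_Km[of "kword (int_vec \<rho>)" j] Kneg[of \<rho>] by simp
    have "ract (M.Em j) (X \<rho> m * KK \<rho> * Y \<rho> m) = ract (M.Em j) (X \<rho> m) * KK \<rho> * Y \<rho> m
      + sc (inverse (\<chi> (kw f + deg f) (\<alpha> j)) * inverse (\<chi> (int_vec \<rho>) (\<alpha> j))) (X \<rho> m * KK \<rho> * ract (M.Em j) (Y \<rho> m))"
      if "m < d \<rho>" for \<rho> m
      using neg Kneg that
      by (simp add: mult.assoc ract_Em_mult supported_mult[where S = negw and S' = negw and S'' = negw] XK KKm ract_Em_K[OF M.kword_in] mult.commute[of "inverse (\<chi> (int_vec \<rho>) (\<alpha> j))"])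
    moreover have sta_XY: "sta x y = (\<Sum>\<rho>\<in>B'. \<Sum>m<d \<rho>. X \<rho> m * KK \<rho> * Y \<rho> m)"
      by (simp add: sta_def tm_def X_def Y_def B'_def)
    ultimately have "ract (M.Em j) (sta x y) = (\<Sum>\<rho>\<in>B'. \<Sum>m<d \<rho>. ract (M.Em j) (X \<rho> m) * KK \<rho> * Y \<rho> m)
      + (\<Sum>\<rho>\<in>B'. \<Sum>m<d \<rho>. sc (inverse (\<chi> (kw f + deg f) (\<alpha> j)) * inverse (\<chi> (int_vec \<rho>) (\<alpha> j))) (X \<rho> m * KK \<rho> * ract (M.Em j) (Y \<rho> m)))"
      by (simp add: sta_XY act_sum sum.distrib)
    also have "(\<Sum>\<rho>\<in>B'. \<Sum>m<d \<rho>. ract (M.Em j) (X \<rho> m) * KK \<rho> * Y \<rho> m) = (\<Sum>\<rho>\<in>B'. tm \<rho> (ract (M.Em j) x) y)"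
      unfolding tm_def X_def Y_def by (simp add: lact_ract)
    also have "\<dots> = (\<Sum>\<rho>\<in>B' \<union> bnd (ract (M.Em j) x). tm \<rho> (ract (M.Em j) x) y)"
    proof (rule sum.mono_neutral_left)
      show "\<forall>\<rho>\<in>B' \<union> bnd (ract (M.Em j) x) - B'. tm \<rho> (ract (M.Em j) x) y = 0"
        using x by (auto simp: tm_def B'_def lact_ract lact_sg_eq_0[OF x _ fb_eb(1)])
    qed (simp_all add: fin finite_bnd)
    also have "\<dots> = sta (ract (M.Em j) x) y"
      using x fin by (subst sta_eq[of "ract (M.Em j) x" "B' \<union> bnd (ract (M.Em j) x)"]) (auto simp: act_neg finite_bnd)
    finally show ?thesis .
  qed
  \<comment> \<open>Here \<open>K_j\<close> passes the left action, at the cost of a scalar, and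
    merges with \<open>K\<^sub>\<rho>\<close> into the group-like factor of the index
    \<open>inc j \<rho>\<close>.\<close>
  have move: "q (Lm i * Km j * (X \<rho> m * KK \<rho> * ract (M.Em j) (Y \<rho> m)))
    = q (sc (\<chi> (\<alpha> j) (deg f + tv (int_vec \<rho>))) (Lm i * (X \<rho> m * KK (inc j \<rho>) * ract (M.Em j) (Y \<rho> m))))" if "m < d \<rho>" for \<rho> m
  proof -
    have "q (Km j * X \<rho> m) = q (sc (\<chi> (\<alpha> j) (deg f + tv (int_vec \<rho>))) (X \<rho> m * Km j))"
      unfolding X_def x_def
      by (rule q_linear_eqI[OF lact_sg_supported_word[OF fb_eb(1)[OF that] f]])
        (auto simp: distrib_left distrib_right sc_add_right mult.commute K_commute)
    then have "q (Lm i * (Km j * X \<rho> m) * (KK \<rho> * ract (M.Em j) (Y \<rho> m)))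
      = q (Lm i * sc (\<chi> (\<alpha> j) (deg f + tv (int_vec \<rho>))) (X \<rho> m * Km j) * (KK \<rho> * ract (M.Em j) (Y \<rho> m)))"
      by (intro q_mult_left q_mult_right)
    also have "\<dots> = q (sc (\<chi> (\<alpha> j) (deg f + tv (int_vec \<rho>))) (Lm i * X \<rho> m * ((Km j * KK \<rho>) * ract (M.Em j) (Y \<rho> m))))"
      by (simp add: mult.assoc)
    also have "\<dots> = q (sc (\<chi> (\<alpha> j) (deg f + tv (int_vec \<rho>))) (Lm i * X \<rho> m * (KK (inc j \<rho>) * ract (M.Em j) (Y \<rho> m))))"
    proof -
      have "q (Km j * KK \<rho>) = q (KK (inc j \<rho>))"
        using K_commute[of j "kword (int_vec \<rho>)"] kword_add_alpha[of "int_vec \<rho>" j] by (simp add: int_vec_inc)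
      then show ?thesis by (intro q_sc q_mult_left q_mult_right)
    qed
    finally show ?thesis by (simp add: mult.assoc)
  qed
  let ?g = "c i * \<chi> (\<alpha> i) (\<alpha> j)"
  have "q (beta i (sta x y)) = q (Fm i * sta x y + (sc ?g (Lm i * Km j * sta (ract (M.Em j) x) y)
    + (\<Sum>\<rho>\<in>B'. \<Sum>m<d \<rho>. sc (?g * (inverse (\<chi> (kw f + deg f) (\<alpha> j)) * inverse (\<chi> (int_vec \<rho>) (\<alpha> j)))) (Lm i * Km j * (X \<rho> m * KK \<rho> * ract (M.Em j) (Y \<rho> m))))))"
    unfolding beta_def j_def[symmetric] right
    by (simp add: distrib_left sc_add_right sum_distrib_left T.scale_sum_right)
  also have "\<dots> = q (Fm i * sta x y + (sc ?g (Lm i * Km j * sta (ract (M.Em j) x) y)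
    + (\<Sum>\<rho>\<in>B'. \<Sum>m<d \<rho>. sc (?g * (inverse (\<chi> (kw f + deg f) (\<alpha> j)) * inverse (\<chi> (int_vec \<rho>) (\<alpha> j))))
      (sc (\<chi> (\<alpha> j) (deg f + tv (int_vec \<rho>))) (Lm i * (X \<rho> m * KK (inc j \<rho>) * ract (M.Em j) (Y \<rho> m)))))))"
    by (intro q_add refl q_sum q_sc move) auto
  \<comment> \<open>In the scalars \<open>deg f\<close> cancels by symmetry of \<chi>. The shift of
    the index contributes \<open>\<chi> (\<alpha> j) (\<alpha> i)\<close> because
    \<open>\<tau> j = i\<close>, which accounts for the constant in \<open>beta\<close>.\<close>
  also have "(\<Sum>\<rho>\<in>B'. \<Sum>m<d \<rho>. sc (?g * (inverse (\<chi> (kw f + deg f) (\<alpha> j)) * inverse (\<chi> (int_vec \<rho>) (\<alpha> j))))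
      (sc (\<chi> (\<alpha> j) (deg f + tv (int_vec \<rho>))) (Lm i * (X \<rho> m * KK (inc j \<rho>) * ract (M.Em j) (Y \<rho> m)))))
    = (\<Sum>\<rho>\<in>B'. \<Sum>m<d \<rho>. sc (e (inc j \<rho>) * inverse (\<chi> (\<alpha> j) (int_vec \<rho>)))
      (Lm i * (X \<rho> m * KK (inc j \<rho>) * ract (M.Em j) (Y \<rho> m))))"
  proof -
    have "?g * (inverse (\<chi> (kw f + deg f) (\<alpha> j)) * inverse (\<chi> (int_vec \<rho>) (\<alpha> j))) * \<chi> (\<alpha> j) (deg f + tv (int_vec \<rho>))
      = e (inc j \<rho>) * inverse (\<chi> (\<alpha> j) (int_vec \<rho>))" for \<rho>
    proof -
      have "\<tau> j = i" by (simp add: j_def)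
      then show ?thesis
        using chi_sym[of "int_vec \<rho>" "\<alpha> j"] chi_sym[of "deg f" "\<alpha> j"] chi_sym[of "\<alpha> i" "\<alpha> j"]
        by (simp add: e_def int_vec_inc chi_add_left chi_add_right)
    qed
    then show ?thesis by simp
  qed
  also have "Fm i * sta x y + (sc ?g (Lm i * Km j * sta (ract (M.Em j) x) y) + (\<Sum>\<rho>\<in>B'. \<Sum>m<d \<rho>. sc (e (inc j \<rho>) * inverse (\<chi> (\<alpha> j) (int_vec \<rho>)))
      (Lm i * (X \<rho> m * KK (inc j \<rho>) * ract (M.Em j) (Y \<rho> m)))))
    = sta (Fm i * x) y + sc ?g (Lm i * Km j * sta (ract (M.Em j) x) y)"
    unfolding left by (simp add: algebra_simps)
  \<comment> \<open>The weight \<open>\<alpha> j - \<alpha> i\<close> lies in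
    \<open>Z_theta\<close>, so the factor can be taken into the first argument.\<close>
  also have "Lm i * Km j * sta (ract (M.Em j) x) y = sta (Lm i * Km j * ract (M.Em j) x) y"
  proof -
    have "kw (Word [GL i] + Word [GK j]) \<in> Z_theta \<tau>"
      using Z_theta_alpha[of i] by (simp add: j_def)
    from sta_K_left[OF _ this act_neg(2)[OF x], of "M.Em j" y] show ?thesis
      by (simp add: mon_add)
  qed
  also have "sta (Fm i * x) y + sc ?g (sta (Lm i * Km j * ract (M.Em j) x) y) = sta (beta i x) y"
  proof -
    have "Lm i * Km j * ract (M.Em j) x \<in> supported negw"
      unfolding mon_add[symmetric]
      by (rule supported_mult[OF _ act_neg(2)[OF x], of _ "{Word [GL i] + Word [GK j]}"]) auto
    then show ?thesis
      unfolding beta_def j_def[symmetric] using Fx by (simp add: sta_add_left sta_sc_left supported_sc)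
  qed
  finally show ?thesis by (simp add: x_def)
qed

end

section \<open>The star product\<close>

lemma gen_subalg_mult:
  assumes "x \<in> gen_subalg R G" "y \<in> gen_subalg R G"
  shows "x \<otimes>\<^bsub>R\<^esub> y \<in> gen_subalg R G"
  using assms by (auto simp: gen_subalg_def dest: subringE(6))

lemma gen_subalg_one: "\<one>\<^bsub>R\<^esub> \<in> gen_subalg R G"
  by (auto simp: gen_subalg_def dest: subringE(3))

lemma gen_subalg_incl: "G \<subseteq> gen_subalg R G"
  by (auto simp: gen_subalg_def)

lemma lin_span_incl: "G \<subseteq> lin_span R G"
  by (auto simp: lin_span_def)

context uq
begin

lemma linear_subspace_U_imp: "linear_subspace (U \<chi> I) V \<Longrightarrow> T.subspace {x. q x \<in> V}"
  using linear_subspace_Q_imp unfolding cl_eq_q U_def .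

lemma lin_span_subset: "T.subspace V \<Longrightarrow> G \<subseteq> q ` V \<Longrightarrow> lin_span (U \<chi> I) G \<subseteq> q ` V"
  using linear_subspace_cl_image[of V] unfolding lin_span_def cl_eq_q U_def by blast

lemma gen_subalg_subset:
  assumes "T.subspace V" "1 \<in> V" "\<And>x y. x \<in> V \<Longrightarrow> y \<in> V \<Longrightarrow> x * y \<in> V" "G \<subseteq> q ` V"
  shows "gen_subalg (U \<chi> I) G \<subseteq> q ` V"
  using linear_subspace_cl_image[OF assms(1)] subring_cl_image[OF assms(1-3)] assms(4)
  unfolding gen_subalg_def cl_eq_q U_def by blast

lemma supported_subset_subspace: "T.subspace V \<Longrightarrow> (\<And>w. w \<in> W \<Longrightarrow> mon w \<in> V) \<Longrightarrow> supported W \<subseteq> V"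
  unfolding supported_eq_span by (rule T.span_minimal) auto

lemma subspace_lin_span: "T.subspace {x. q x \<in> lin_span (U \<chi> I) G}"
proof -
  have "{x. q x \<in> lin_span (U \<chi> I) G} = \<Inter>{{x. q x \<in> V} | V. linear_subspace (U \<chi> I) V \<and> G \<subseteq> V}"
    by (auto simp: lin_span_def)
  then show ?thesis using linear_subspace_U_imp by (auto intro!: T.subspace_Inter)
qed

lemma subspace_gen_subalg: "T.subspace {x. q x \<in> gen_subalg (U \<chi> I) G}"
proof -
  have "{x. q x \<in> gen_subalg (U \<chi> I) G}
    = \<Inter>{{x. q x \<in> V} | V. subring V (U \<chi> I) \<and> linear_subspace (U \<chi> I) V \<and> G \<subseteq> V}"
    by (auto simp: gen_subalg_def)
  then show ?thesis using linear_subspace_U_imp by (auto intro!: T.subspace_Inter)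
qed

lemma lin_span_supset: "(\<And>w. w \<in> W \<Longrightarrow> q (mon w) \<in> lin_span (U \<chi> I) G) \<Longrightarrow> q ` supported W \<subseteq> lin_span (U \<chi> I) G"
  using supported_subset_subspace[OF subspace_lin_span, of W G] by auto

lemma gen_subalg_supset: "(\<And>w. w \<in> W \<Longrightarrow> q (mon w) \<in> gen_subalg (U \<chi> I) G) \<Longrightarrow> q ` supported W \<subseteq> gen_subalg (U \<chi> I) G"
  using supported_subset_subspace[OF subspace_gen_subalg, of W G] by auto

text \<open>Moving the \<open>K\<close> letters to the front costs a scalar and changes neither the
  degree nor the total K-weight, so the group-like part is the \<open>kword\<close> of that
  weight.\<close>

lemma normal_form:
  assumes "w \<in> words_in neg_letters"
  shows "\<exists>s. \<exists>f\<in>words_in (range GF). deg f = deg w \<and> q (mon w) = q (sc s (mon (kword (kw w)) * mon f))"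
  using assms
proof (induction rule: words_in_induct)
  case zero
  show ?case by (intro exI[of _ 1] bexI[of _ 0]) auto
next
  case (Cons g w)
  then obtain s f where f: "f \<in> words_in (range GF)" "deg f = deg w" "q (mon w) = q (sc s (mon (kword (kw w)) * mon f))"
    by blast
  have eq: "q (mon (Word [g] + w)) = q (sc s (mon (Word [g]) * mon (kword (kw w)) * mon f))"
    using q_mult_left[OF f(3), of "mon (Word [g])"] by (simp add: mon_add mult.assoc)
  show ?case
  proof (cases "g \<in> K_letters")
    case True
    then have "Word [g] + kword (kw w) \<in> words_in K_letters" using kword_in by simp
    from K_word_eq_kword[OF this]
    have "q (mon (Word [g]) * mon (kword (kw w))) = q (mon (kword (kw (Word [g] + w))))"
      by (simp add: mon_add)
    from q_sc[OF q_mult_right[OF this, of "mon f"], of s] eq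
    have "q (mon (Word [g] + w)) = q (sc s (mon (kword (kw (Word [g] + w))) * mon f))" by simp
    moreover have "deg f = deg (Word [g] + w)" using f(2) True by auto
    ultimately show ?thesis using f(1) by blast
  next
    case False
    then obtain i where g: "g = GF i" using Cons.hyps(1) by (auto simp: neg_letters_def)
    define k where "k = (\<chi> (kw w) (deg (Word [g])))"
    have k: "k \<noteq> 0" by (simp add: k_def)
    have "q (mon (kword (kw w)) * mon (Word [g])) = q (sc k (mon (Word [g]) * mon (kword (kw w))))"
      using K_word_commute[OF kword_in, of "kw w" "Word [g]"] by (simp add: k_def)
    from q_sc[OF this, of "inverse k"] k
    have "q (mon (Word [g]) * mon (kword (kw w))) = q (sc (inverse k) (mon (kword (kw w)) * mon (Word [g])))" by simp
    from q_sc[OF q_mult_right[OF this, of "mon f"], of s] eq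
    have "q (mon (Word [g] + w)) = q (sc (s * inverse k) (mon (kword (kw (Word [g] + w))) * mon (Word [g] + f)))"
      by (simp add: g mon_add mult.assoc)
    moreover have "Word [g] + f \<in> words_in (range GF)" "deg (Word [g] + f) = deg (Word [g] + w)"
      using f g by auto
    ultimately show ?thesis by blast
  qed
qed

end

section \<open>Representatives and grading of \<open>H_theta_U_neg\<close>\<close>

context star_data
begin

lemma Z_theta_iff: "\<nu> \<in> Z_theta \<tau> \<longleftrightarrow> tv \<nu> = - \<nu>"
  by (simp add: Z_theta_def tau_vec_def)

lemma Z_theta_0: "0 \<in> Z_theta \<tau>"
  and Z_theta_add: "\<nu> \<in> Z_theta \<tau> \<Longrightarrow> \<mu> \<in> Z_theta \<tau> \<Longrightarrow> \<nu> + \<mu> \<in> Z_theta \<tau>"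
  and Z_theta_diff_tv: "\<nu> - tv \<nu> \<in> Z_theta \<tau>"
  by (simp_all add: Z_theta_iff)

text \<open>Such a \<open>\<nu>\<close> vanishes at the fixed points of \<tau> and takes opposite
  values on the other orbits. The order selects one member of each orbit, and \<open>n\<close> is
  \<open>\<nu>\<close> restricted to the selected indices. Hence every weight in
  \<open>Z_theta\<close> is reached by products of the generators
  \<open>K_i K_{\<tau>(i)}^{-1}\<close> of \<open>H_theta\<close>.\<close>

lemma Z_theta_eq:
  assumes "\<nu> \<in> Z_theta \<tau>"
  shows "\<exists>n. \<nu> = n - tv n"
proof
  have anti: "\<nu> (\<tau> i) = - \<nu> i" for i
    using assms unfolding Z_theta_iff tau_vec_def by (metis comp_apply uminus_apply)
  show "\<nu> = (\<lambda>i. if i < \<tau> i then \<nu> i else 0) - tv (\<lambda>i. if i < \<tau> i then \<nu> i else 0)"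
  proof
    fix i
    consider "i < \<tau> i" | "i = \<tau> i" | "\<tau> i < i" by fastforce
    then show "\<nu> i = ((\<lambda>i. if i < \<tau> i then \<nu> i else 0) - tv (\<lambda>i. if i < \<tau> i then \<nu> i else 0)) i"
      by cases (use anti[of i] in \<open>auto simp: fun_apply_simps tau_vec_def\<close>)
  qed
qed

text \<open>\<open>fl\<close> counts the letters \<open>GF\<close> of a word in \<open>negw\<close>.\<close>

definition fl :: "'i uq_gen word \<Rightarrow> int" where
  "fl w = - (\<Sum>i\<in>UNIV. deg w i)"

text \<open>Words representing elements of \<open>H_theta_U_neg\<close>. The condition is on the
  total K-weight, so the \<open>K\<close> letters may stand anywhere and need not come in
  pairs.\<close>

definition Zw :: "'i uq_gen word set" where
  "Zw = {w \<in> negw. kw w \<in> Z_theta \<tau>}"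

abbreviation "Zwm m \<equiv> Zw \<inter> {w. fl w = int m}"
abbreviation "Kt \<equiv> Kw \<inter> {w. kw w \<in> Z_theta \<tau>}"

lemma fl_simps [simp]: "fl 0 = 0" "fl (u + v) = fl u + fl v" "fl (Word [GF i]) = 1" "fl (Word [GK i]) = 0" "fl (Word [GL i]) = 0"
proof -
  have "(\<Sum>j\<in>UNIV. \<alpha> i j) = 1" by (simp add: \<alpha>_def)
  then show "fl (Word [GF i]) = 1" by (simp add: fl_def fun_apply_simps sum_negf)
qed (simp_all add: fl_def fun_apply_simps sum.distrib)

lemma fl_cong: "deg u = deg v \<Longrightarrow> fl u = fl v"
  by (simp add: fl_def)

lemma fl_nonneg: "w \<in> negw \<Longrightarrow> 0 \<le> fl w"
  unfolding fl_def using neg_deg_le[of w] by (simp add: sum_nonpos)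

lemma fl_Fw_eq_0: "f \<in> Fw \<Longrightarrow> fl f = 0 \<Longrightarrow> f = 0"
proof (induction rule: words_in_induct)
  case (Cons g w)
  then show ?case using fl_nonneg[of w] words_subset by auto
qed simp

lemma Zw_simps: "0 \<in> Zw" "u \<in> Zw \<Longrightarrow> v \<in> Zw \<Longrightarrow> u + v \<in> Zw"
  by (simp_all add: Zw_def Z_theta_0 Z_theta_add)

lemma kw_Fw: "f \<in> Fw \<Longrightarrow> kw f = 0"
  by (induction rule: words_in_induct) auto

lemma Fw_Zw: "Fw \<subseteq> Zw" and Kt_Zw: "Kt \<subseteq> Zw" and Zw_negw: "Zw \<subseteq> negw"
  using words_subset by (auto simp: Zw_def kw_Fw Z_theta_0)

lemma supported_Zw_mult: "x \<in> supported Zw \<Longrightarrow> y \<in> supported Zw \<Longrightarrow> x * y \<in> supported Zw"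
  by (rule supported_mult) (auto intro: Zw_simps)

lemma kword_Kt: "\<nu> \<in> Z_theta \<tau> \<Longrightarrow> kword \<nu> \<in> Kt"
  using M.kword_in by simp

lemma q_uKK_theta: "q (mon (kword (n - tv n))) \<in> H_theta \<chi> I \<tau>"
proof (rule int_fun_induct[of "\<lambda>n. q (mon (kword (n - tv n))) \<in> H_theta \<chi> I \<tau>" n])
  show "q (mon (kword (0 - tv 0))) \<in> H_theta \<chi> I \<tau>"
    using gen_subalg_one[of "U \<chi> I"] by (simp add: H_theta_def q_simps)
next
  fix n m assume "q (mon (kword (n - tv n))) \<in> H_theta \<chi> I \<tau>" "q (mon (kword (m - tv m))) \<in> H_theta \<chi> I \<tau>"
  then have "q (mon (kword (n - tv n)) * mon (kword (m - tv m))) \<in> H_theta \<chi> I \<tau>"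
    unfolding H_theta_def using gen_subalg_mult by (fastforce simp: q_simps(5)[symmetric])
  moreover have "n - tv n + (m - tv m) = (n + m) - tv (n + m)" by simp
  ultimately show "q (mon (kword (n + m - tv (n + m)))) \<in> H_theta \<chi> I \<tau>" by (simp only: kword_add)
next
  have gen: "q (mon (kword (\<alpha> i - \<alpha> (\<tau> i)))) \<in> H_theta \<chi> I \<tau>" for i
  proof -
    have "q (mon (kword (\<alpha> i - \<alpha> (\<tau> i)))) = q (Km i * Lm (\<tau> i))"
      using K_word_eq_kword[of "Word [GK i] + Word [GL (\<tau> i)]"] by (simp add: mon_add)
    also have "\<dots> \<in> KK_theta \<chi> I \<tau>" by (auto simp: KK_theta_def q_simps gen_eq_mon)
    finally show ?thesis unfolding H_theta_def using gen_subalg_incl by fast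
  qed
  fix i
  show "q (mon (kword (\<alpha> i - tv (\<alpha> i)))) \<in> H_theta \<chi> I \<tau>" using gen[of i] by simp
  show "q (mon (kword (- \<alpha> i - tv (- \<alpha> i)))) \<in> H_theta \<chi> I \<tau>" using gen[of "\<tau> i"] by simp
qed

lemma supported_Kt_mult: "x \<in> supported Kt \<Longrightarrow> y \<in> supported Kt \<Longrightarrow> x * y \<in> supported Kt"
  by (rule supported_mult) (auto intro: Z_theta_add)

lemma H_theta_eq: "H_theta \<chi> I \<tau> = q ` supported Kt"
proof
  show "q ` supported Kt \<subseteq> H_theta \<chi> I \<tau>"
    unfolding H_theta_def
  proof (rule gen_subalg_supset)
    fix k assume k: "k \<in> Kt"
    then obtain n where "kw k = n - tv n" using Z_theta_eq by auto
    with k q_uKK_theta[of n] K_word_eq_kword[of k]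
    show "q (mon k) \<in> gen_subalg (U \<chi> I) (KK_theta \<chi> I \<tau>)" by (simp add: H_theta_def)
  qed
  have "q (Km i * Lm (\<tau> i)) \<in> q ` supported Kt" for i
    using Z_theta_alpha[of "\<tau> i"] by (intro imageI) (simp flip: mon_add)
  then show "H_theta \<chi> I \<tau> \<subseteq> q ` supported Kt"
    unfolding H_theta_def
    by (intro gen_subalg_subset subspace_supported)
      (auto simp: one_supported_iff Z_theta_0 supported_Kt_mult KK_theta_def q_simps gen_eq_mon)
qed

lemma normal_form_Zw:
  assumes "w \<in> Zw"
  shows "\<exists>s. \<exists>k\<in>Kt. \<exists>f\<in>Fw. kw k = kw w \<and> k = kword (kw w) \<and> deg f = deg w \<and> q (mon w) = q (sc s (mon k * mon f))"
proof -
  from assms have w: "w \<in> negw" "kw w \<in> Z_theta \<tau>" by (auto simp: Zw_def)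
  from normal_form[OF w(1)] kword_Kt[OF w(2)] show ?thesis by auto
qed

lemma H_theta_U_neg_eq: "H_theta_U_neg \<chi> I \<tau> = q ` supported Zw"
proof
  have H: "H_theta \<chi> I \<tau> \<subseteq> H_theta_U_neg \<chi> I \<tau>" "U_neg \<chi> I \<subseteq> H_theta_U_neg \<chi> I \<tau>"
    unfolding H_theta_U_neg_def using gen_subalg_incl by fast+
  show "q ` supported Zw \<subseteq> H_theta_U_neg \<chi> I \<tau>"
    unfolding H_theta_U_neg_def
  proof (rule gen_subalg_supset)
    fix w assume "w \<in> Zw"
    from normal_form_Zw[OF this] obtain s k f where
      kf: "k \<in> Kt" "f \<in> Fw" and eq: "q (mon w) = q (sc s (mon k * mon f))" by blast
    have "q (mon k) \<in> H_theta_U_neg \<chi> I \<tau>" "q (mon f) \<in> H_theta_U_neg \<chi> I \<tau>"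
      using H kf by (auto simp: H_theta_eq U_neg_eq)
    then have "q (mon k) \<otimes>\<^bsub>U \<chi> I\<^esub> q (mon f) \<in> gen_subalg (U \<chi> I) (H_theta \<chi> I \<tau> \<union> U_neg \<chi> I)"
      unfolding H_theta_U_neg_def by (rule gen_subalg_mult)
    then have "mon k * mon f \<in> {x. q x \<in> gen_subalg (U \<chi> I) (H_theta \<chi> I \<tau> \<union> U_neg \<chi> I)}"
      by (simp add: q_simps)
    from T.subspace_scale[OF subspace_gen_subalg this, of s]
    show "q (mon w) \<in> gen_subalg (U \<chi> I) (H_theta \<chi> I \<tau> \<union> U_neg \<chi> I)"
      unfolding eq by simp
  qed
  have "(supported Kt :: ('i, 'k) free_uq set) \<subseteq> supported Zw" "(supported Fw :: ('i, 'k) free_uq set) \<subseteq> supported Zw"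
    by (rule supported_mono, rule Kt_Zw, rule supported_mono, rule Fw_Zw)
  then show "H_theta_U_neg \<chi> I \<tau> \<subseteq> q ` supported Zw"
    unfolding H_theta_U_neg_def H_theta_eq U_neg_eq
    by (intro gen_subalg_subset subspace_supported) (auto simp: one_supported_iff Zw_simps supported_Zw_mult)
qed

lemma graded_products_Zwm:
  "(m, A) \<in> graded_products (U \<chi> I) (H_theta \<chi> I \<tau>) (range (uF \<chi> I)) \<Longrightarrow> A \<in> q ` supported (Zwm m)"
proof (induction rule: graded_products.induct)
  case one
  show ?case by (auto simp: q_simps one_supported_iff Zw_simps)
next
  case (deg0 m x h)
  then obtain y z where yz: "y \<in> supported (Zwm m)" "x = q y" "z \<in> supported Kt" "h = q z" by (auto simp: H_theta_eq)
  have "y * z \<in> supported (Zwm m)"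
    using yz(1,3)
  proof (rule supported_mult)
    fix u v assume "u \<in> Zwm m" "v \<in> Kt"
    moreover have "fl v = 0" using \<open>v \<in> Kt\<close> by (simp add: fl_def M.deg_K_word fun_apply_simps)
    ultimately show "u + v \<in> Zwm m" using Kt_Zw Zw_simps(2) by auto
  qed
  then show ?case using yz by (auto simp: q_simps)
next
  case (deg1 m x g)
  then obtain y i where yz: "y \<in> supported (Zwm m)" "x = q y" "g = q (Fm i)" by (auto simp: gen_eq_mon)
  have "y * Fm i \<in> supported (Zwm (Suc m))"
    by (rule supported_mult[OF yz(1), of _ "{Word [GF i]}"]) (auto simp: Zw_def)
  then show ?case using yz by (auto simp: q_simps)
qed

lemma component_eq: "H_theta_U_neg_component \<chi> I \<tau> m = q ` supported (Zwm m)"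
proof
  show "H_theta_U_neg_component \<chi> I \<tau> m \<subseteq> q ` supported (Zwm m)"
    unfolding H_theta_U_neg_component_def gen_component_def
    by (rule lin_span_subset[OF subspace_supported]) (use graded_products_Zwm in auto)
  have prod: "(nat (fl f), q (mon k * mon f)) \<in> graded_products (U \<chi> I) (H_theta \<chi> I \<tau>) (range (uF \<chi> I))"
    if "f \<in> Fw" "k \<in> Kt" for f k
    using that(1)
  proof (induction rule: words_in_rev_induct)
    case zero
    have "q (mon k) \<in> H_theta \<chi> I \<tau>" using that(2) by (simp add: H_theta_eq)
    from graded_products.deg0[OF graded_products.one this, where R = "U \<chi> I" and G = "range (uF \<chi> I)"]
    show ?case by (simp add: q_simps)
  next
    case (snoc g w)
    then obtain i where g: "g = GF i" by auto
    have "0 \<le> fl w" using fl_nonneg snoc.hyps words_subset by auto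
    then have "nat (fl w + 1) = Suc (nat (fl w))" by simp
    moreover from graded_products.deg1[OF snoc.IH, of "uF \<chi> I i"]
    have "(Suc (nat (fl w)), q (mon k * mon w * Fm i)) \<in> graded_products (U \<chi> I) (H_theta \<chi> I \<tau>) (range (uF \<chi> I))"
      by (simp add: q_simps gen_eq_mon)
    ultimately show ?case by (simp add: g mon_add mult.assoc)
  qed
  show "q ` supported (Zwm m) \<subseteq> H_theta_U_neg_component \<chi> I \<tau> m"
    unfolding H_theta_U_neg_component_def gen_component_def
  proof (rule lin_span_supset)
    fix w assume "w \<in> Zwm m"
    then have w: "w \<in> Zw" "fl w = int m" by auto
    from normal_form_Zw[OF w(1)] obtain s k f where
      kf: "k \<in> Kt" "f \<in> Fw" "deg f = deg w" and eq: "q (mon w) = q (sc s (mon k * mon f))" by blast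
    have "nat (fl f) = m" using fl_cong[OF kf(3)] w by simp
    with prod[OF kf(2,1)] have "mon k * mon f \<in> {x. q x \<in> lin_span (U \<chi> I) {x. (m, x) \<in> graded_products (U \<chi> I) (H_theta \<chi> I \<tau>) (range (uF \<chi> I))}}"
      using lin_span_incl by fastforce
    from T.subspace_scale[OF subspace_lin_span this, of s]
    show "q (mon w) \<in> lin_span (U \<chi> I) {x. (m, x) \<in> graded_products (U \<chi> I) (H_theta \<chi> I \<tau>) (range (uF \<chi> I))}"
      unfolding eq by simp
  qed
qed

text \<open>The only word of degree 0 in the \<open>F\<close> letters is the empty one, so each
  \<open>fb\<close> is a multiple of 1 in this degree. The sum then collapses by the expansion of 1
  in the dual basis, without computing the dimension.\<close>

lemma tm_0:
  assumes "x \<in> supported negw" "y \<in> supported negw"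
  shows "tm (\<lambda>_. 0) x y = x * y"
proof -
  have iv: "int_vec (\<lambda>_. 0 :: nat) = (0 :: 'i \<Rightarrow> int)" by (simp add: int_vec_def zero_fun_def)
  have "w = 0" if "w \<in> Fw" "deg w = 0" for w :: "'i uq_gen word"
    using fl_Fw_eq_0[OF that(1)] fl_cong[of w 0] that(2) by simp
  then have "Fw \<inter> {w. deg w = 0} \<subseteq> {0 :: 'i uq_gen word}" by auto
  note sub = supported_mono[OF this]
  have fb: "\<exists>a. fb (\<lambda>_. 0) m = sc a 1" if "m < d (\<lambda>_. 0)" for m
  proof -
    from sub have "fb (\<lambda>_. 0) m \<in> supported {0}" using fb_eb(1)[OF that] by (auto simp: iv)
    then show ?thesis
      unfolding supported_eq_span by (auto simp: T.span_singleton)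
  qed
  have tm: "lact (sg (fb (\<lambda>_. 0) m)) x = sc (PT (fb (\<lambda>_. 0) m) 1) x" if m: "m < d (\<lambda>_. 0)" for m
  proof -
    obtain a where a: "fb (\<lambda>_. 0) m = sc a 1" using fb[OF m] by blast
    have "PT 1 1 = (1 :: 'k)" using PT_simps(4)[of 0 1] by simp
    then show ?thesis using assms(1) by (simp add: a act_linear_left act_1)
  qed
  have one: "1 \<in> Edeg (\<lambda>_. 0)" by (simp add: one_supported_iff iv)
  have sum: "(\<Sum>m<d (\<lambda>_. 0). sc (PT (fb (\<lambda>_. 0) m) 1) (eb (\<lambda>_. 0) m)) \<in> Edeg (\<lambda>_. 0)"
    by (intro supported_sum supported_sc fb_eb) auto
  have "tm (\<lambda>_. 0) x y = (\<Sum>m<d (\<lambda>_. 0). x * sc (PT (fb (\<lambda>_. 0) m) 1) (ract (twist (eb (\<lambda>_. 0) m)) y))"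
    unfolding tm_def by (rule sum.cong) (simp_all add: tm iv)
  also have "\<dots> = x * ract (twist (\<Sum>m<d (\<lambda>_. 0). sc (PT (fb (\<lambda>_. 0) m) 1) (eb (\<lambda>_. 0) m))) y"
    by (simp only: twist_sum twist_simps act_sum_left act_linear_left sum_distrib_left)
  also have "ract (twist (\<Sum>m<d (\<lambda>_. 0). sc (PT (fb (\<lambda>_. 0) m) 1) (eb (\<lambda>_. 0) m))) y = ract (twist 1) y"
    by (rule ract_twist_cong[OF sum one dual_expand_E[OF one, symmetric] assms(2)])
  also have "\<dots> = y" using assms(2) by (simp add: act_1)
  finally show ?thesis .
qed

end

section \<open>Unit, degrees and associativity of the star product\<close>

context star_data
begin

lemma bnd_1: "bnd 1 = {\<lambda>_. 0}"
proof -
  have "Poly_Mapping.keys (1 :: ('i, 'k) free_uq) = {0}" by simp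
  moreover have "\<rho> = (\<lambda>_. 0)" if "\<forall>i. \<rho> (\<tau> i) = 0" for \<rho> :: "'i \<Rightarrow> nat"
    using that tau_tau by (metis ext)
  ultimately show ?thesis by (auto simp: bnd_def fun_apply_simps)
qed

lemma sta_1_left: "y \<in> supported negw \<Longrightarrow> sta 1 y = y"
  by (simp add: sta_def bnd_1 tm_0)

text \<open>The legs of a \<open>K\<close> word have degree 0, so the right action of an element of
  nonzero degree kills it and only the term for \<open>\<rho> = 0\<close> remains.\<close>

lemma sta_1_right_K:
  assumes "x \<in> supported negw" "k \<in> Kw"
  shows "sta x (mon k) = x * mon k"
proof -
  have k: "k \<in> negw" "deg k = 0" using assms(2) words_subset M.deg_K_word by auto
  have "tm \<rho> x (mon k) = 0" if "\<rho> \<noteq> (\<lambda>_. 0)" for \<rho>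
  proof -
    have nz: "int_vec \<rho> \<noteq> 0" using that by (auto simp: int_vec_def fun_eq_iff zero_fun_apply)
    have "ract (twist (eb \<rho> m)) (mon k) = 0" if "m < d \<rho>" for m
    proof -
      have "twist (eb \<rho> m) \<in> supported (posw \<inter> {v. deg v = int_vec \<rho>})"
        using twist_supported[OF fb_eb(3)[OF that]] words_subset by (auto simp: supported_def)
      from pw_degree_supported[OF this k(1)] k nz show ?thesis
        by (simp add: ract_mon cop_sum_K_word[OF assms(2)])
    qed
    then show ?thesis by (simp add: tm_def)
  qed
  then have "(\<Sum>\<rho>\<in>insert (\<lambda>_. 0) (bnd x). tm \<rho> x (mon k)) = (\<Sum>\<rho>\<in>{\<lambda>_. 0}. tm \<rho> x (mon k))"
    by (intro sum.mono_neutral_right) (auto simp: finite_bnd)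
  moreover have "sta x (mon k) = (\<Sum>\<rho>\<in>insert (\<lambda>_. 0) (bnd x). tm \<rho> x (mon k))"
    using assms(1) finite_bnd by (intro sta_eq) auto
  ultimately show ?thesis using assms(1) k by (simp add: tm_0)
qed

lemma ract_twist_supported_word:
  assumes "a \<in> Edeg \<rho>" "g \<in> negw"
  shows "ract (twist a) (mon g) \<in> supported (negw \<inter> {v. kw v = kw g \<and> deg v = deg g + int_vec \<rho>})"
  unfolding ract_mon
proof (rule cop_sum_in)
  fix u v assume uv: "(u, v) \<in> set (cop g)"
  note uv' = cop_neg[OF assms(2) uv]
  show "sc (pw v (twist a)) (mon u) \<in> supported (negw \<inter> {v. kw v = kw g \<and> deg v = deg g + int_vec \<rho>})"
  proof (cases "deg v + int_vec \<rho> = 0")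
    case True
    then have "deg v = - int_vec \<rho>" by (simp add: eq_neg_iff_add_eq_0)
    moreover from this have "deg u = deg g + int_vec \<rho>"
      using cop_deg[OF uv] by (simp add: algebra_simps)
    ultimately show ?thesis using uv' by (auto intro!: supported_sc)
  next
    case False
    have "twist a \<in> supported (posw \<inter> {v. deg v = int_vec \<rho>})"
      using twist_supported[OF assms(1)] words_subset by (auto simp: supported_def)
    from pw_degree_supported[OF this uv'(2) False] show ?thesis by simp
  qed
qed (auto intro: supported_add)

text \<open>The K-weight changes by \<open>\<rho> - \<tau>(\<rho>)\<close>, which lies in
  \<open>Z_theta\<close>, so the star product stays in \<open>H_theta_U_neg\<close>. The degree
  changes by \<open>\<rho> + \<tau>(\<rho>)\<close>, so each nonzero \<open>\<rho>\<close> strictly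
  lowers the number of \<open>F\<close> letters.\<close>

lemma tm_supported_word:
  assumes "f \<in> negw" "g \<in> negw"
  shows "tm \<rho> (mon f) (mon g) \<in> supported (negw \<inter> {v. kw v = kw f + kw g + (int_vec \<rho> - tv (int_vec \<rho>))
    \<and> deg v = deg f + deg g + (int_vec \<rho> + tv (int_vec \<rho>))})"
  unfolding tm_def
proof (rule supported_sum)
  fix m assume "m \<in> {..<d \<rho>}"
  then have m: "m < d \<rho>" by simp
  have K: "kword (int_vec \<rho>) \<in> negw" using M.kword_in words_subset by blast
  have "lact (sg (fb \<rho> m)) (mon f) * KK \<rho>
    \<in> supported (negw \<inter> {v. kw v = kw f - tv (int_vec \<rho>) + int_vec \<rho> \<and> deg v = deg f + tv (int_vec \<rho>)})"
    by (rule supported_mult[OF lact_sg_supported_word[OF fb_eb(1)[OF m] assms(1)], of _ "{kword (int_vec \<rho>)}"])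
      (use K in auto)
  from supported_mult[OF this ract_twist_supported_word[OF fb_eb(3)[OF m] assms(2)]]
  show "lact (sg (fb \<rho> m)) (mon f) * KK \<rho> * ract (twist (eb \<rho> m)) (mon g)
    \<in> supported (negw \<inter> {v. kw v = kw f + kw g + (int_vec \<rho> - tv (int_vec \<rho>))
    \<and> deg v = deg f + deg g + (int_vec \<rho> + tv (int_vec \<rho>))})"
    by (rule meta_mp) (auto simp: algebra_simps)
qed

lemma fl_shift:
  assumes "deg v = deg f + deg g + (int_vec \<rho> + tv (int_vec \<rho>))" "\<rho> \<noteq> (\<lambda>_. 0)"
  shows "fl v < fl f + fl g"
proof -
  have "(\<Sum>i\<in>UNIV. int (\<rho> i)) > 0"
  proof -
    from assms(2) obtain i where "\<rho> i \<noteq> 0" by auto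
    then show ?thesis by (intro sum_pos2[of UNIV i]) auto
  qed
  moreover have "(\<Sum>i\<in>UNIV. int (\<rho> (\<tau> i))) \<ge> 0" by (simp add: sum_nonneg)
  ultimately show ?thesis
    unfolding fl_def assms(1) by (simp add: fun_apply_simps sum.distrib int_vec_def tau_vec_def)
qed

lemma supported2_induct:
  assumes "x \<in> supported W" "y \<in> supported W'"
    "\<And>w w'. w \<in> W \<Longrightarrow> w' \<in> W' \<Longrightarrow> b (mon w) (mon w') \<in> V" "T.subspace V"
    "\<And>x x' y. b (x + x') y = b x y + b x' y" "\<And>a x y. b (sc a x) y = sc a (b x y)" "\<And>y. b 0 y = 0"
    "\<And>x y y'. b x (y + y') = b x y + b x y'" "\<And>a x y. b x (sc a y) = sc a (b x y)" "\<And>x. b x 0 = 0"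
  shows "b x y \<in> V"
proof -
  note V = T.subspace_0[OF assms(4)] T.subspace_add[OF assms(4)] T.subspace_scale[OF assms(4)]
  have b: "b (mon w) y \<in> V" if "w \<in> W" for w
    using assms(2) by (induction rule: supported_induct) (simp_all add: assms(3)[OF that] assms(8-) V)
  show ?thesis
    using assms(1) by (induction rule: supported_induct) (simp_all add: assms(5-7) b V)
qed

lemma tm_0_arg [simp]: "tm \<rho> 0 y = 0" "tm \<rho> x 0 = 0"
  by (simp_all add: tm_def)

lemma tm_supported_Zw:
  assumes "x \<in> supported (Zwm m)" "y \<in> supported (Zwm l)" "\<rho> \<noteq> (\<lambda>_. 0)"
  shows "tm \<rho> x y \<in> supported (Zw \<inter> {w. fl w < int (m + l)})"
proof (rule supported2_induct[OF assms(1,2) _ subspace_supported])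
  fix f g assume fg: "f \<in> Zwm m" "g \<in> Zwm l"
  have "v \<in> Zw \<inter> {w. fl w < int (m + l)}"
    if "v \<in> negw" "kw v = kw f + kw g + (int_vec \<rho> - tv (int_vec \<rho>))" "deg v = deg f + deg g + (int_vec \<rho> + tv (int_vec \<rho>))" for v
    using fl_shift[OF that(3) assms(3)] that(1,2) fg by (auto simp: Zw_def intro!: Z_theta_add Z_theta_diff_tv simp del: tau_vec_simps)
  then show "tm \<rho> (mon f) (mon g) \<in> supported (Zw \<inter> {w. fl w < int (m + l)})"
    using tm_supported_word[of f g \<rho>] fg Zw_negw by (auto simp: supported_def)
qed (simp_all add: tm_simps)

lemma sta_supported_Zw:
  assumes "x \<in> supported Zw" "y \<in> supported Zw"
  shows "sta x y \<in> supported Zw"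
  unfolding sta_def
proof (rule supported_sum)
  fix \<rho>
  show "tm \<rho> x y \<in> supported Zw"
  proof (rule supported2_induct[OF assms _ subspace_supported])
    fix f g assume fg: "f \<in> Zw" "g \<in> Zw"
    then have "v \<in> Zw" if "v \<in> negw" "kw v = kw f + kw g + (int_vec \<rho> - tv (int_vec \<rho>))" for v
      using that by (auto simp: Zw_def intro!: Z_theta_add Z_theta_diff_tv simp del: tau_vec_simps)
    then show "tm \<rho> (mon f) (mon g) \<in> supported Zw"
      using tm_supported_word[of f g \<rho>] fg Zw_negw by (auto simp: supported_def)
  qed (simp_all add: tm_simps)
qed

lemma supported_Zw_negw: "x \<in> supported Zw \<Longrightarrow> x \<in> supported negw"
  using Zw_negw by (auto simp: supported_def)

lemma sta_lower:
  assumes "x \<in> supported (Zwm m)" "y \<in> supported (Zwm l)"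
  shows "sta x y - x * y \<in> supported (Zw \<inter> {w. fl w < int (m + l)})"
proof -
  have xy: "x \<in> supported negw" "y \<in> supported negw" using assms Zw_negw by (auto simp: supported_def)
  have "sta x y = (\<Sum>\<rho>\<in>insert (\<lambda>_. 0) (bnd x). tm \<rho> x y)"
    using xy finite_bnd by (intro sta_eq) auto
  also have "\<dots> = x * y + (\<Sum>\<rho>\<in>bnd x - {\<lambda>_. 0}. tm \<rho> x y)"
    using finite_bnd xy by (simp add: sum.insert_remove tm_0)
  finally show ?thesis using tm_supported_Zw[OF assms] by (auto intro: supported_sum)
qed

lemma beta_simps: "beta i (x + y) = beta i x + beta i y" "beta i (sc a x) = sc a (beta i x)" "beta i 0 = 0"
  by (simp_all add: beta_def distrib_left sc_add_right mult.left_commute)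

lemma beta_supported: "x \<in> supported negw \<Longrightarrow> beta i x \<in> supported negw"
proof -
  assume x: "x \<in> supported negw"
  have "Fm i * x \<in> supported negw"
    by (rule supported_mult[OF _ x, of _ "{Word [GF i]}"]) auto
  moreover have "Lm i * Km (\<tau> i) * ract (Em (\<tau> i)) x \<in> supported negw"
    unfolding mon_add[symmetric]
    by (rule supported_mult[OF _ act_neg(2)[OF x], of _ "{Word [GL i] + Word [GK (\<tau> i)]}"]) auto
  ultimately show ?thesis unfolding beta_def by (intro supported_add supported_sc)
qed

lemma beta_cong:
  "x \<in> supported negw \<Longrightarrow> x' \<in> supported negw \<Longrightarrow> q x = q x' \<Longrightarrow> q (beta i x) = q (beta i x')"
  unfolding beta_def by (intro q_add q_sc q_mult_left ract_cong) auto

lemma sta_beta: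
  assumes "x \<in> supported negw" "y \<in> supported negw"
  shows "q (sta (beta i x) y) = q (beta i (sta x y))"
  using assms(1)
proof -
  have "x \<in> supported negw \<and> q (sta (beta i x) y) = q (beta i (sta x y))"
    using assms(1)
  proof (induction rule: supported_induct)
    case (add x x')
    then show ?case
      by (auto simp: beta_simps sta_add_left beta_supported supported_add intro!: q_add)
  next
    case (scale a x)
    then show ?case
      by (auto simp: beta_simps sta_sc_left beta_supported supported_sc intro!: q_sc)
  qed (simp_all add: beta_simps fundamental_identity assms(2))
  then show ?thesis ..
qed

text \<open>The first argument is singled out because \<open>beta i\<close> and the elements of
  \<open>H_theta\<close> act on it from the left and commute with star multiplication from the
  right.\<close>

definition assoc_at :: "('i, 'k) free_uq \<Rightarrow> bool" where
  "assoc_at x \<longleftrightarrow> x \<in> supported negw \<and>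
    (\<forall>y\<in>supported negw. \<forall>z\<in>supported negw. q (sta (sta x y) z) = q (sta x (sta y z)))"

lemma assoc_at_cong:
  assumes "assoc_at x" "x' \<in> supported negw" "q x' = q x"
  shows "assoc_at x'"
proof -
  have "q (sta (sta x' y) z) = q (sta x' (sta y z))" if yz: "y \<in> supported negw" "z \<in> supported negw" for y z
  proof -
    have x: "x \<in> supported negw" using assms by (simp add: assoc_at_def)
    have "q (sta (sta x' y) z) = q (sta (sta x y) z)"
      using assms x yz by (intro sta_cong sta_supported) auto
    also have "\<dots> = q (sta x (sta y z))" using assms yz by (simp add: assoc_at_def)
    also have "\<dots> = q (sta x' (sta y z))"
      using assms x yz by (intro sta_cong sta_supported) auto
    finally show ?thesis .
  qed
  then show ?thesis using assms by (simp add: assoc_at_def)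
qed

lemma assoc_at_sc: "assoc_at x \<Longrightarrow> assoc_at (sc a x)"
  by (auto simp: assoc_at_def sta_sc_left supported_sc sta_supported intro!: q_sc)

lemma assoc_at_add: "assoc_at x \<Longrightarrow> assoc_at x' \<Longrightarrow> assoc_at (x + x')"
  by (auto simp: assoc_at_def sta_add_left supported_add sta_supported intro!: q_add)

lemma supported_negw_mult: "x \<in> supported negw \<Longrightarrow> y \<in> supported negw \<Longrightarrow> x * y \<in> supported negw"
  by (rule supported_mult) auto

lemma assoc_at_K: "k \<in> Kt \<Longrightarrow> assoc_at x \<Longrightarrow> assoc_at (mon k * x)"
  using words_subset
  by (auto simp: assoc_at_def sta_K_left sta_supported supported_negw_mult intro!: q_mult_left)

lemma assoc_at_beta:
  assumes "assoc_at x"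
  shows "assoc_at (beta i x)"
proof -
  have x: "x \<in> supported negw" using assms by (simp add: assoc_at_def)
  have "q (sta (sta (beta i x) y) z) = q (sta (beta i x) (sta y z))"
    if yz: "y \<in> supported negw" "z \<in> supported negw" for y z
  proof -
    have "q (sta (sta (beta i x) y) z) = q (sta (beta i (sta x y)) z)"
      using x yz by (intro sta_cong sta_supported beta_supported sta_beta) auto
    also have "\<dots> = q (beta i (sta (sta x y) z))"
      using x yz by (intro sta_beta sta_supported)
    also have "\<dots> = q (beta i (sta x (sta y z)))"
      using x yz assms by (intro beta_cong sta_supported) (auto simp: assoc_at_def)
    also have "\<dots> = q (sta (beta i x) (sta y z))"
      using x yz by (intro sta_beta[symmetric] sta_supported)
    finally show ?thesis .
  qed
  then show ?thesis using x by (simp add: assoc_at_def beta_supported)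
qed

lemma ract_Em_supported:
  assumes "w \<in> negw"
  shows "ract (Em j) (mon w) \<in> supported (negw \<inter> {v. kw v = kw w \<and> fl v = fl w - 1})"
  unfolding ract_mon
proof (rule cop_sum_in)
  fix u v assume uv: "(u, v) \<in> set (cop w)"
  note uv' = cop_neg[OF assms uv]
  show "sc (pw v (Em j)) (mon u) \<in> supported (negw \<inter> {v. kw v = kw w \<and> fl v = fl w - 1})"
  proof (cases "deg v = - \<alpha> j")
    case True
    then have "fl v = 1" using fl_cong[of v "Word [GF j]"] by simp
    moreover have "fl w = fl u + fl v"
      using cop_deg[OF uv] fl_cong[of w "u + v"] by simp
    ultimately show ?thesis using uv' by (auto intro!: supported_sc)
  next
    case False
    then show ?thesis using pw_E[OF uv'(2)] by simp
  qed
qed (auto intro: supported_add)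

text \<open>\<open>F_i f\<close> equals \<open>beta i f\<close> up to a term with fewer
  \<open>F\<close> letters, so by induction on their number all words are generated from 1. The case
  \<open>cong\<close> is there because a word equals its normal form only modulo
  \<open>J\<close>.\<close>

lemma beta_induct [consumes 1, case_names one add scale K beta cong]:
  assumes "x \<in> supported Zw" "P 1" "\<And>x y. P x \<Longrightarrow> P y \<Longrightarrow> P (x + y)" "\<And>a x. P x \<Longrightarrow> P (sc a x)"
    "\<And>k x. k \<in> Kt \<Longrightarrow> P x \<Longrightarrow> P (mon k * x)" "\<And>i x. P x \<Longrightarrow> P (beta i x)"
    "\<And>x x'. P x \<Longrightarrow> x' \<in> supported Zw \<Longrightarrow> q x' = q x \<Longrightarrow> P x'"
  shows "P x"
proof -
  have P0: "P 0" using assms(4)[OF assms(2), of 0] by simp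
  have word: "P (mon w)" if "w \<in> Zw" for w
    using that
  proof (induction "nat (fl w)" arbitrary: w rule: less_induct)
    case less
    from normal_form_Zw[OF less.prems] obtain s k f where
      kf: "k \<in> Kt" "f \<in> Fw" "deg f = deg w" and eq: "q (mon w) = q (sc s (mon k * mon f))" by blast
    have "P (mon f)"
    proof (cases "letters f")
      case Nil
      then have "f = 0" by (metis Word_Nil word.collapse)
      then show ?thesis by (simp add: assms(2))
    next
      case (Cons g gs)
      define f' where "f' = Word gs"
      have f: "f = Word [g] + f'" using Cons by (metis Word_Cons f'_def word.collapse)
      with kf obtain i where g: "g = GF i" and f': "f' \<in> Fw" by auto
      have neg: "f' \<in> negw" using f' words_subset by auto
      have fl: "fl w = 1 + fl f'" using fl_cong[OF kf(3)] f g by simp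
      have IH: "P (mon v)" if "v \<in> Zw" "fl v < fl w" for v
        using less.hyps[of v] fl_nonneg[of v] Zw_negw that by auto
      have IHs: "P x" if x: "x \<in> supported (Zw \<inter> {v. fl v < fl w})" for x
        using x by (induction rule: supported_induct) (auto intro: P0 assms(3,4) IH)
      have r: "ract (Em (\<tau> i)) (mon f') \<in> supported (Zw \<inter> {v. fl v < fl w})"
        using ract_Em_supported[OF neg, of "\<tau> i"] fl by (auto simp: supported_def Zw_def kw_Fw[OF f'] Z_theta_0)
      have K: "Word [GL i] + Word [GK (\<tau> i)] \<in> Kt" using Z_theta_alpha[of i] by simp
      \<comment> \<open>The correction term in \<open>beta\<close> is subtracted; it has fewer
        \<open>F\<close> letters and so is covered by the induction hypothesis and the case
        \<open>K\<close>.\<close>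
      have "P (beta i (mon f') + sc (- 1) (sc (c i * \<chi> (\<alpha> i) (\<alpha> (\<tau> i))) (Lm i * Km (\<tau> i) * ract (Em (\<tau> i)) (mon f'))))"
        using f' fl Fw_Zw by (intro assms(3,4,6) IH IHs r assms(5)[OF K, unfolded mon_add]) auto
      then show ?thesis by (simp add: beta_def f g mon_add flip: uminus_eq_sc)
    qed
    then have "P (sc s (mon k * mon f))" using kf by (intro assms(4,5)) auto
    then show ?case by (rule assms(7)) (use eq less.prems in auto)
  qed
  show ?thesis
    using assms(1) by (induction rule: supported_induct) (simp_all add: P0 assms(3,4) word)
qed

lemma sta_assoc:
  assumes "x \<in> supported Zw" "y \<in> supported negw" "z \<in> supported negw"
  shows "q (sta (sta x y) z) = q (sta x (sta y z))"
proof -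
  have "assoc_at x"
    using assms(1)
  proof (induction rule: beta_induct)
    case one
    show ?case by (simp add: assoc_at_def sta_1_left sta_supported)
  next
    case (cong x x')
    then show ?case by (intro assoc_at_cong[of x x']) (auto intro: supported_Zw_negw)
  qed (auto intro: assoc_at_add assoc_at_sc assoc_at_K assoc_at_beta)
  then show ?thesis using assms by (simp add: assoc_at_def)
qed

section \<open>Passage to cosets: the star product on \<open>H_theta_U_neg\<close>\<close>

definition rp :: "('i, 'k) free_uq set \<Rightarrow> ('i, 'k) free_uq" where
  "rp A = (SOME x. x \<in> supported Zw \<and> q x = A)"

definition star :: "('i, 'k) free_uq set \<Rightarrow> ('i, 'k) free_uq set \<Rightarrow> ('i, 'k) free_uq set" where
  "star A B = q (sta (rp A) (rp B))"

lemma star_q: "x \<in> supported Zw \<Longrightarrow> y \<in> supported Zw \<Longrightarrow> star (q x) (q y) = q (sta x y)"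
proof -
  have rp: "rp (q x) \<in> supported Zw \<and> q (rp (q x)) = q x" if "x \<in> supported Zw" for x
    unfolding rp_def by (rule someI[of _ x]) (simp add: that)
  assume "x \<in> supported Zw" "y \<in> supported Zw"
  with rp[of x] rp[of y] show ?thesis
    unfolding star_def by (intro sta_cong) (auto intro: supported_Zw_negw)
qed

lemma lower_span: "q ` supported (Zw \<inter> {w. fl w < int m}) \<subseteq> lin_span (U \<chi> I) (\<Union>j<m. H_theta_U_neg_component \<chi> I \<tau> j)"
proof (rule lin_span_supset)
  fix w assume w: "w \<in> Zw \<inter> {w. fl w < int m}"
  then have "0 \<le> fl w" using fl_nonneg Zw_negw by auto
  then have "q (mon w) \<in> H_theta_U_neg_component \<chi> I \<tau> (nat (fl w))" "nat (fl w) < m"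
    using w by (auto simp: component_eq)
  then show "q (mon w) \<in> lin_span (U \<chi> I) (\<Union>j<m. H_theta_U_neg_component \<chi> I \<tau> j)"
    using lin_span_incl by fast
qed

lemma bilinear_star: "bilinear_on (U \<chi> I) (H_theta_U_neg \<chi> I \<tau>) (U \<chi> I) (H_theta_U_neg \<chi> I \<tau>) (U \<chi> I) star"
  unfolding bilinear_on_def linear_on_def H_theta_U_neg_eq
  by (auto simp: star_q q_simps supported_add supported_sc sta_add_left sta_sc_left sta_right supported_Zw_negw)

theorem star_product_star:
  "star_product (U \<chi> I) (H_theta_U_neg \<chi> I \<tau>) (H_theta_U_neg_component \<chi> I \<tau>) star"
  unfolding star_product_def
proof (intro conjI bilinear_star allI)
  show "\<forall>a\<in>H_theta_U_neg \<chi> I \<tau>. \<forall>b\<in>H_theta_U_neg \<chi> I \<tau>. star a b \<in> H_theta_U_neg \<chi> I \<tau>"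
    by (auto simp: H_theta_U_neg_eq star_q sta_supported_Zw)
  show "\<forall>a\<in>H_theta_U_neg \<chi> I \<tau>. \<forall>b\<in>H_theta_U_neg \<chi> I \<tau>. \<forall>c\<in>H_theta_U_neg \<chi> I \<tau>. star (star a b) c = star a (star b c)"
    by (auto simp: H_theta_U_neg_eq star_q sta_supported_Zw sta_assoc supported_Zw_negw)
  fix m l
  show "\<forall>a\<in>H_theta_U_neg_component \<chi> I \<tau> m. \<forall>b\<in>H_theta_U_neg_component \<chi> I \<tau> l.
    star a b \<ominus>\<^bsub>U \<chi> I\<^esub> a \<otimes>\<^bsub>U \<chi> I\<^esub> b \<in> lin_span (U \<chi> I) (\<Union>j<m + l. H_theta_U_neg_component \<chi> I \<tau> j)"
  proof (intro ballI)
    fix a b assume "a \<in> H_theta_U_neg_component \<chi> I \<tau> m" "b \<in> H_theta_U_neg_component \<chi> I \<tau> l"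
    then obtain x y where xy: "x \<in> supported (Zwm m)" "a = q x" "y \<in> supported (Zwm l)" "b = q y"
      by (auto simp: component_eq)
    then have "x \<in> supported Zw" "y \<in> supported Zw" by (auto simp: supported_def)
    then have "star a b \<ominus>\<^bsub>U \<chi> I\<^esub> a \<otimes>\<^bsub>U \<chi> I\<^esub> b = q (sta x y - x * y)"
      by (simp add: xy star_q q_simps minus_U)
    then show "star a b \<ominus>\<^bsub>U \<chi> I\<^esub> a \<otimes>\<^bsub>U \<chi> I\<^esub> b \<in> lin_span (U \<chi> I) (\<Union>j<m + l. H_theta_U_neg_component \<chi> I \<tau> j)"
      using lower_span[of "m + l"] sta_lower[OF xy(1,3)] by auto
  qed
qed

lemma supported_Zwm_0: "x \<in> supported (Zwm 0) \<Longrightarrow> x \<in> supported Kt"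
proof -
  have "w \<in> Kt" if "w \<in> Zw" "fl w = 0" for w
  proof -
    have "w \<in> negw \<Longrightarrow> fl w = 0 \<Longrightarrow> w \<in> Kw" for w
    proof (induction rule: words_in_induct)
      case (Cons g w)
      then show ?case using fl_nonneg[of w] by (auto simp: neg_letters_def)
    qed simp
    then show ?thesis using that by (simp add: Zw_def)
  qed
  then show "x \<in> supported (Zwm 0) \<Longrightarrow> x \<in> supported Kt" by (auto simp: supported_def)
qed

lemma sta_Kt:
  assumes "x \<in> supported Kt" "y \<in> supported negw"
  shows "sta y x = y * x" "sta x y = x * y"
proof -
  have "x \<in> supported negw \<and> sta y x = y * x \<and> sta x y = x * y"
    using assms(1)
  proof (induction rule: supported_induct)
    case (mon k)
    have "sta (mon k * 1) y = mon k * sta 1 y" using mon by (intro sta_K_left) auto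
    then show ?case using mon assms(2) words_subset by (auto simp: sta_1_right_K sta_1_left)
  qed (simp_all add: sta_add_left sta_sc_left sta_right supported_add supported_sc distrib_left distrib_right)
  then show "sta y x = y * x" "sta x y = x * y" by simp_all
qed

theorem zero_equivariant_star:
  "zero_equivariant (U \<chi> I) (H_theta_U_neg \<chi> I \<tau>) (H_theta_U_neg_component \<chi> I \<tau>) star"
proof -
  have "supported (Zwm 0) \<subseteq> supported Zw" by (rule supported_mono) auto
  then show ?thesis
    unfolding zero_equivariant_def component_eq H_theta_U_neg_eq
    by (auto simp: star_q q_simps subset_iff supported_Zwm_0 supported_Zw_negw sta_Kt simp del: of_nat_0)
qed

end

section \<open>Comparison with the defining formula, and uniqueness\<close>

context star_data
begin

lemma inv_anti_supported: "x \<in> supported Ew \<Longrightarrow> A.inv_anti x \<in> supported posw"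
proof (induction rule: supported_induct)
  case (mon w)
  then show ?case
  proof (induction rule: words_in_induct)
    case (Cons g w)
    then obtain j where g: "g = GE j" by auto
    have "M.Em j * M.Lm j \<in> supported posw" unfolding mon_add[symmetric] by simp
    from supported_posw_mult[OF Cons.IH supported_sc[OF this, of "- 1"]]
    show ?case unfolding g mon_add rev_ext_mult rev_ext_simps uq_gen.case uminus_eq_sc[of "M.Em j * M.Lm j"] .
  qed simp
qed (auto intro: supported_add supported_sc)

text \<open>Each ingredient of the original summand is replaced by its lift. The sign is moved into
  the right action, where it combines with the inverse antipode and the group-like factor to
  \<open>twist\<close>.\<close>

lemma star_term_q:
  assumes x: "x \<in> supported negw" and y: "y \<in> supported negw"
  shows "star_term \<chi> I pr S \<sigma> d Fb Eb (q x) (q y) \<rho> = q (tm \<rho> x y)"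
proof -
  let ?s = "(- 1) ^ (\<Sum>i\<in>UNIV. \<rho> i) :: 'k"
  let ?e = "\<lambda>m. A.inv_anti (eb \<rho> m) * KK \<rho>"
  interpret R: ring "U \<chi> I" by (rule ring_U)
  have tq: "left_act \<chi> I pr (\<sigma> (Fb \<rho> m)) (q x) \<otimes>\<^bsub>U \<chi> I\<^esub> uKK \<chi> I (int_vec \<rho>) \<otimes>\<^bsub>U \<chi> I\<^esub>
      right_act \<chi> I pr (q y) (inv_into (carrier (U \<chi> (I_max \<chi>))) S (Eb \<rho> m) \<otimes>\<^bsub>U \<chi> (I_max \<chi>)\<^esub> uKK \<chi> (I_max \<chi>) (int_vec \<rho>))
    = q (lact (sg (fb \<rho> m)) x * KK \<rho> * ract (?e m) y)"
    and twist: "sc ?s (lact (sg (fb \<rho> m)) x * KK \<rho> * ract (?e m) y) = lact (sg (fb \<rho> m)) x * KK \<rho> * ract (twist (eb \<rho> m)) y"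
    if m: "m < d \<rho>" for m
  proof -
    note fe = fb_eb_supported[OF m]
    have e: "?e m \<in> supported posw"
      using inv_anti_supported[OF fe(4)] M.kword_in words_subset by (intro supported_posw_mult) auto
    have "left_act \<chi> I pr (\<sigma> (Fb \<rho> m)) (q x) = q (lact (sg (fb \<rho> m)) x)"
      using x sg_Fw_supported[OF fe(3)] by (simp add: sigma_q[OF fe(3)] left_act_q flip: fb_eb(2)[OF m])
    moreover have "right_act \<chi> I pr (q y) (inv_into (carrier (U \<chi> (I_max \<chi>))) S (Eb \<rho> m) \<otimes>\<^bsub>U \<chi> (I_max \<chi>)\<^esub> uKK \<chi> (I_max \<chi>) (int_vec \<rho>))
      = q (ract (?e m) y)"
      using right_act_q[OF y e] A.S_inv_anti[OF fe(4)] by (simp add: M.uKK_eq M.q_simps fb_eb(4)[OF m])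
    ultimately show "left_act \<chi> I pr (\<sigma> (Fb \<rho> m)) (q x) \<otimes>\<^bsub>U \<chi> I\<^esub> uKK \<chi> I (int_vec \<rho>) \<otimes>\<^bsub>U \<chi> I\<^esub>
      right_act \<chi> I pr (q y) (inv_into (carrier (U \<chi> (I_max \<chi>))) S (Eb \<rho> m) \<otimes>\<^bsub>U \<chi> (I_max \<chi>)\<^esub> uKK \<chi> (I_max \<chi>) (int_vec \<rho>))
      = q (lact (sg (fb \<rho> m)) x * KK \<rho> * ract (?e m) y)"
      by (simp add: uKK_eq q_simps)
    have eq: "ract (sc ?s (?e m)) y = ract (twist (eb \<rho> m)) y"
      using y
    proof (rule ract_eqI)
      fix u :: "'i uq_gen word" assume "u \<in> negw"
      then show "pw u (sc ?s (?e m)) = pw u (twist (eb \<rho> m))"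
        using e by (intro pw_cong_right A.inv_S_twist fb_eb(3) m twist_posw[OF fb_eb(3)[OF m]] supported_sc)
    qed
    show "sc ?s (lact (sg (fb \<rho> m)) x * KK \<rho> * ract (?e m) y) = lact (sg (fb \<rho> m)) x * KK \<rho> * ract (twist (eb \<rho> m)) y"
      by (simp only: eq[symmetric] act_linear_left sc_mult_right)
  qed
  have "star_term \<chi> I pr S \<sigma> d Fb Eb (q x) (q y) \<rho>
    = ?s \<odot>\<^bsub>U \<chi> I\<^esub> (\<Oplus>\<^bsub>U \<chi> I\<^esub>m\<in>{..<d \<rho>}. q (lact (sg (fb \<rho> m)) x * KK \<rho> * ract (?e m) y))"
    unfolding star_term_def
    by (rule arg_cong[of _ _ "smult (U \<chi> I) ?s"], rule R.finsum_cong') (auto simp: tq q_simps)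
  also have "\<dots> = q (\<Sum>m<d \<rho>. sc ?s (lact (sg (fb \<rho> m)) x * KK \<rho> * ract (?e m) y))"
    by (simp add: finsum_U q_simps T.scale_sum_right)
  also have "\<dots> = q (tm \<rho> x y)"
    unfolding tm_def by (rule arg_cong[of _ _ q], rule sum.cong) (simp_all only: twist lessThan_iff)
  finally show ?thesis .
qed

text \<open>The right action contributes the inverse of \<open>\<chi>\<close> at \<open>kw k\<close>
  and \<open>\<rho>\<close>, and moving \<open>k\<close> past the left action contributes
  \<open>\<chi>\<close> at \<open>kw k\<close> and \<open>a - \<tau>(\<rho>)\<close>. On
  \<open>Z_theta\<close> the part depending on \<open>\<rho>\<close> is trivial, which leaves
  \<open>\<chi> a (kw k)\<close>, the same for all terms.\<close>

lemma tm_K_right: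
  assumes "x \<in> supported (Fw \<inter> {w. deg w = - a})" "k \<in> Kt" "y \<in> supported negw"
  shows "q (tm \<rho> x (mon k * y)) = q (sc (\<chi> a (kw k)) (mon k * tm \<rho> x y))"
proof -
  have "q (lact (sg (fb \<rho> m)) x * KK \<rho> * ract (twist (eb \<rho> m)) (mon k * y))
    = q (sc (\<chi> a (kw k)) (mon k * (lact (sg (fb \<rho> m)) x * KK \<rho> * ract (twist (eb \<rho> m)) y)))"
    if m: "m < d \<rho>" for m
  proof -
    let ?l = "lact (sg (fb \<rho> m)) x" and ?r = "ract (twist (eb \<rho> m)) y" and ?v = "int_vec \<rho>"
    have kw_E: "kw w = 0" if "w \<in> Ew" for w using that by (induction rule: words_in_induct) auto
    then have "Ew \<inter> {w. deg w = ?v} \<subseteq> posw \<inter> {v. deg v + kw v = ?v}" using words_subset by auto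
    from supported_mono[OF this] have "twist (eb \<rho> m) \<in> supported (posw \<inter> {v. deg v + kw v = ?v})"
      using twist_supported[OF fb_eb(3)[OF m]] by blast
    then have r: "ract (twist (eb \<rho> m)) (mon k * y) = sc (inverse (\<chi> (kw k) ?v)) (mon k * ?r)"
      using assms by (intro act_K_word) auto
    have "?l \<in> supported {w. deg w = - a + tv ?v}"
      using assms(1)
    proof (induction rule: supported_induct)
      case (mon w)
      with lact_sg_supported_word[OF fb_eb(1)[OF m], of w] words_subset show ?case by (auto simp: supported_def)
    qed (auto intro: supported_add supported_sc)
    then have l: "q (mon k * ?l) = q (sc (\<chi> (kw k) (- a + tv ?v)) (?l * mon k))"
      using assms(2) by (elim q_linear_eqI) (auto simp: distrib_left distrib_right sc_add_right mult.commute K_word_commute)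
    have K: "q (KK \<rho> * mon k) = q (mon k * KK \<rho>)"
      using K_word_commute[of k "kword ?v"] assms(2) by simp
    define e where "e = \<chi> (kw k) (- a + tv ?v)"
    have "q (?l * KK \<rho> * (mon k * ?r)) = q (?l * (KK \<rho> * mon k) * ?r)" by (simp add: mult.assoc)
    also have "\<dots> = q (?l * (mon k * KK \<rho>) * ?r)" by (intro q_mult_left q_mult_right K)
    also have "\<dots> = q (sc (inverse e) (sc e (?l * mon k) * KK \<rho> * ?r))" by (simp add: mult.assoc e_def)
    also have "\<dots> = q (sc (inverse e) (mon k * ?l * KK \<rho> * ?r))"
      unfolding e_def by (intro q_sc q_mult_right l[symmetric])
    finally have "q (?l * KK \<rho> * (mon k * ?r)) = q (sc (inverse e) (mon k * (?l * KK \<rho> * ?r)))" by (simp add: mult.assoc)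
    from q_sc[OF this, of "inverse (\<chi> (kw k) ?v)"]
    have "q (?l * KK \<rho> * ract (twist (eb \<rho> m)) (mon k * y)) = q (sc (inverse (\<chi> (kw k) ?v) * inverse e) (mon k * (?l * KK \<rho> * ?r)))"
      by (simp add: r)
    moreover have "inverse (\<chi> (kw k) ?v) * inverse e = \<chi> a (kw k)"
    proof -
      have "\<chi> (kw k) ?v * e = \<chi> (kw k) (?v + tv ?v) * inverse (\<chi> (kw k) a)"
        by (simp only: e_def chi_add_right chi_minus_right mult_ac)
      also have "\<dots> = inverse (\<chi> a (kw k))"
        using Z_theta_chi[of "kw k" ?v] assms(2) by (simp add: chi_sym[of "kw k" a])
      finally show ?thesis by (metis inverse_inverse_eq inverse_mult_distrib)
    qed
    ultimately show ?thesis by simp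
  qed
  then have "q (tm \<rho> x (mon k * y)) = q (\<Sum>m<d \<rho>. sc (\<chi> a (kw k)) (mon k * (lact (sg (fb \<rho> m)) x * KK \<rho> * ract (twist (eb \<rho> m)) y)))"
    unfolding tm_def by (intro q_sum) auto
  then show ?thesis by (simp add: tm_def sum_distrib_left T.scale_sum_right)
qed

lemma star_uKK:
  assumes "\<nu> \<in> Z_theta \<tau>" "\<mu> \<in> Z_theta \<tau>" "x \<in> supported (Fw \<inter> {w. deg w = - a})" "y \<in> supported Fw"
  shows "star (uKK \<chi> I \<nu> \<otimes>\<^bsub>U \<chi> I\<^esub> q x) (uKK \<chi> I \<mu> \<otimes>\<^bsub>U \<chi> I\<^esub> q y)
    = \<chi> a \<mu> \<odot>\<^bsub>U \<chi> I\<^esub> (uKK \<chi> I (\<nu> + \<mu>) \<otimes>\<^bsub>U \<chi> I\<^esub> star (q x) (q y))"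
proof -
  let ?k = "mon (kword \<nu>) :: ('i, 'k) free_uq" and ?l = "mon (kword \<mu>) :: ('i, 'k) free_uq"
  have xy: "x \<in> supported Zw" "y \<in> supported Zw" using assms Fw_Zw by (auto simp: supported_def)
  have kl: "?k \<in> supported Zw" "?l \<in> supported Zw" using kword_Kt Kt_Zw assms by auto
  have "star (uKK \<chi> I \<nu> \<otimes>\<^bsub>U \<chi> I\<^esub> q x) (uKK \<chi> I \<mu> \<otimes>\<^bsub>U \<chi> I\<^esub> q y) = q (sta (?k * x) (?l * y))"
    using kl xy by (simp add: uKK_eq q_simps star_q supported_Zw_mult)
  also have "\<dots> = q (?k * sta x (?l * y))"
    using kword_Kt[OF assms(1)] xy by (simp add: sta_K_left supported_Zw_negw)
  also have "\<dots> = q (?k * sc (\<chi> a \<mu>) (?l * sta x y))"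
  proof (rule q_mult_left)
    have "q (\<Sum>\<rho>\<in>bnd x. tm \<rho> x (?l * y)) = q (\<Sum>\<rho>\<in>bnd x. sc (\<chi> a \<mu>) (?l * tm \<rho> x y))"
      using tm_K_right[OF assms(3) kword_Kt[OF assms(2)], of y] xy by (intro q_sum) (simp add: supported_Zw_negw)
    then show "q (sta x (?l * y)) = q (sc (\<chi> a \<mu>) (?l * sta x y))"
      by (simp add: sta_def sum_distrib_left T.scale_sum_right)
  qed
  also have "\<dots> = q (sc (\<chi> a \<mu>) ((?k * ?l) * sta x y))" by (simp add: mult.assoc)
  also have "\<dots> = q (sc (\<chi> a \<mu>) (mon (kword (\<nu> + \<mu>)) * sta x y))"
    by (intro q_sc q_mult_right kword_add)
  finally show ?thesis using xy by (simp add: uKK_eq q_simps star_q)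
qed

theorem determined_star_star: "determined_star \<chi> I \<tau> pr S \<sigma> d Fb Eb star"
  unfolding determined_star_def
proof (intro conjI bilinear_star ballI allI)
  fix A B assume "A \<in> U_neg \<chi> I" "B \<in> U_neg \<chi> I"
  then obtain x y where xy: "x \<in> supported Fw" "A = q x" "y \<in> supported Fw" "B = q y" by (auto simp: U_neg_eq)
  then have xy': "x \<in> supported Zw" "y \<in> supported Zw" using Fw_Zw by (auto simp: supported_def)
  then have neg: "x \<in> supported negw" "y \<in> supported negw" by (auto intro: supported_Zw_negw)
  let ?N = "{\<rho>. star_term \<chi> I pr S \<sigma> d Fb Eb A B \<rho> \<noteq> \<zero>\<^bsub>U \<chi> I\<^esub>}"
  have N: "?N = {\<rho>. q (tm \<rho> x y) \<noteq> q 0}" using neg by (simp add: xy star_term_q q_simps)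
  have sub: "?N \<subseteq> bnd x" using tm_eq_0[OF neg(1)] unfolding N by auto
  then show fin: "finite ?N" using finite_bnd finite_subset by blast
  \<comment> \<open>The definition sums over terms that are nonzero in the quotient,
    \<open>sta\<close> over \<open>bnd x\<close>. The terms in the difference lie in
    \<open>J\<close>.\<close>
  have split: "sta x y = (\<Sum>\<rho>\<in>?N. tm \<rho> x y) + (\<Sum>\<rho>\<in>bnd x - ?N. tm \<rho> x y)"
    unfolding sta_def using sum.subset_diff[OF sub finite_bnd, of "\<lambda>\<rho>. tm \<rho> x y"] by (simp add: add.commute)
  have "q (sta x y) = q ((\<Sum>\<rho>\<in>?N. tm \<rho> x y) + (\<Sum>\<rho>\<in>bnd x - ?N. 0))"
    unfolding split by (rule q_add[OF refl], rule q_sum) (simp add: N)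
  then have "star A B = q (\<Sum>\<rho>\<in>?N. tm \<rho> x y)" using xy' by (simp add: xy star_q)
  also have "\<dots> = (\<Oplus>\<^bsub>U \<chi> I\<^esub>\<rho>\<in>?N. star_term \<chi> I pr S \<sigma> d Fb Eb A B \<rho>)"
    using neg by (simp add: xy star_term_q finsum_U)
  finally show "star A B = (\<Oplus>\<^bsub>U \<chi> I\<^esub>\<rho>\<in>?N. star_term \<chi> I pr S \<sigma> d Fb Eb A B \<rho>)" .
next
  fix \<nu> \<mu> a A B
  assume "\<nu> \<in> Z_theta \<tau>" "\<mu> \<in> Z_theta \<tau>" "A \<in> U_neg \<chi> I \<inter> U_component \<chi> I (- a)" "B \<in> U_neg \<chi> I"
  moreover from this obtain x y where "x \<in> supported (Fw \<inter> {w. deg w = - a})" "A = q x" "y \<in> supported Fw" "B = q y"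
    using component_rep[of A "range GF" "- a"] unfolding U_neg_eq by auto
  ultimately show "star (uKK \<chi> I \<nu> \<otimes>\<^bsub>U \<chi> I\<^esub> A) (uKK \<chi> I \<mu> \<otimes>\<^bsub>U \<chi> I\<^esub> B)
    = \<chi> a \<mu> \<odot>\<^bsub>U \<chi> I\<^esub> (uKK \<chi> I (\<nu> + \<mu>) \<otimes>\<^bsub>U \<chi> I\<^esub> star A B)"
    by (simp add: star_uKK)
qed

lemma bilinear_on_q:
  assumes "bilinear_on (U \<chi> I) (H_theta_U_neg \<chi> I \<tau>) (U \<chi> I) (H_theta_U_neg \<chi> I \<tau>) (U \<chi> I) f"
  shows "x \<in> supported Zw \<Longrightarrow> x' \<in> supported Zw \<Longrightarrow> y \<in> supported Zw \<Longrightarrow>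
      f (q (x + x')) (q y) = f (q x) (q y) \<oplus>\<^bsub>U \<chi> I\<^esub> f (q x') (q y)"
    "x \<in> supported Zw \<Longrightarrow> y \<in> supported Zw \<Longrightarrow> f (q (sc e x)) (q y) = e \<odot>\<^bsub>U \<chi> I\<^esub> f (q x) (q y)"
    "x \<in> supported Zw \<Longrightarrow> y \<in> supported Zw \<Longrightarrow> y' \<in> supported Zw \<Longrightarrow>
      f (q x) (q (y + y')) = f (q x) (q y) \<oplus>\<^bsub>U \<chi> I\<^esub> f (q x) (q y')"
    "x \<in> supported Zw \<Longrightarrow> y \<in> supported Zw \<Longrightarrow> f (q x) (q (sc e y)) = e \<odot>\<^bsub>U \<chi> I\<^esub> f (q x) (q y)"
  using assms unfolding bilinear_on_def linear_on_def H_theta_U_neg_eq by (auto simp: q_simps)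

lemma bilinear_on_words:
  assumes "bilinear_on (U \<chi> I) (H_theta_U_neg \<chi> I \<tau>) (U \<chi> I) (H_theta_U_neg \<chi> I \<tau>) (U \<chi> I) st"
    "bilinear_on (U \<chi> I) (H_theta_U_neg \<chi> I \<tau>) (U \<chi> I) (H_theta_U_neg \<chi> I \<tau>) (U \<chi> I) st'"
    and words: "\<And>v w. v \<in> Zw \<Longrightarrow> w \<in> Zw \<Longrightarrow> st (q (mon v)) (q (mon w)) = st' (q (mon v)) (q (mon w))"
    and ab: "a \<in> H_theta_U_neg \<chi> I \<tau>" "b \<in> H_theta_U_neg \<chi> I \<tau>"
  shows "st a b = st' a b"
proof -
  note lin = bilinear_on_q[OF assms(1)] bilinear_on_q[OF assms(2)]
  have "x \<in> supported Zw \<and> st (q (mon v)) (q x) = st' (q (mon v)) (q x)" if x: "x \<in> supported Zw" and v: "v \<in> Zw" for x v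
    using x
  proof (induction rule: supported_induct)
    case zero
    show ?case using lin(4)[of "mon v" 0 0] lin(8)[of "mon v" 0 0] lin(4)[of "mon v" "mon 0" 0] lin(8)[of "mon v" "mon 0" 0] words[OF v, of 0] v Zw_simps(1) by (simp add: one_supported_iff)
  qed (use v words in \<open>simp_all add: lin supported_add supported_sc\<close>)
  then have left: "st (q (mon v)) (q y) = st' (q (mon v)) (q y)" if "v \<in> Zw" "y \<in> supported Zw" for v y
    using that by blast
  have "x \<in> supported Zw \<and> st (q x) (q y) = st' (q x) (q y)" if x: "x \<in> supported Zw" and y: "y \<in> supported Zw" for x y
    using x
  proof (induction rule: supported_induct)
    case zero
    show ?case using lin(2)[of "mon 0" y 0] lin(6)[of "mon 0" y 0] left[of 0 y] y Zw_simps(1) by (simp add: one_supported_iff)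
  qed (use y left in \<open>simp_all add: lin supported_add supported_sc\<close>)
  then show ?thesis using ab by (auto simp: H_theta_U_neg_eq)
qed

text \<open>By the normal form, \<open>H_theta_U_neg\<close> is spanned by products of a
  \<open>K\<^sub>\<nu>\<close> with a word in the \<open>F\<close> letters. On pairs of these the
  defining conditions give an explicit value, and bilinearity does the rest.\<close>

theorem determined_star_unique:
  assumes "determined_star \<chi> I \<tau> pr S \<sigma> d Fb Eb st" "determined_star \<chi> I \<tau> pr S \<sigma> d Fb Eb st'"
    "a \<in> H_theta_U_neg \<chi> I \<tau>" "b \<in> H_theta_U_neg \<chi> I \<tau>"
  shows "st a b = st' a b"
proof (rule bilinear_on_words[OF _ _ _ assms(3,4)])
  show bil: "bilinear_on (U \<chi> I) (H_theta_U_neg \<chi> I \<tau>) (U \<chi> I) (H_theta_U_neg \<chi> I \<tau>) (U \<chi> I) st"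
    "bilinear_on (U \<chi> I) (H_theta_U_neg \<chi> I \<tau>) (U \<chi> I) (H_theta_U_neg \<chi> I \<tau>) (U \<chi> I) st'"
    using assms(1,2) by (auto simp: determined_star_def)
  fix v w assume vw: "v \<in> Zw" "w \<in> Zw"
  obtain s f where f: "f \<in> Fw" "deg f = deg v" "q (mon v) = q (sc s (mon (kword (kw v)) * mon f))"
    using normal_form_Zw[OF vw(1)] by blast
  obtain s' g where g: "g \<in> Fw" "deg g = deg w" "q (mon w) = q (sc s' (mon (kword (kw w)) * mon g))"
    using normal_form_Zw[OF vw(2)] by blast
  have kw: "kw v \<in> Z_theta \<tau>" "kw w \<in> Z_theta \<tau>" using vw by (auto simp: Zw_def)
  have U: "q (mon f) \<in> U_neg \<chi> I \<inter> U_component \<chi> I (- (- deg f))" "q (mon g) \<in> U_neg \<chi> I"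
    using f g supported_component[of "mon f" Fw] by (auto simp: U_neg_eq)
  have k: "mon (kword (kw v)) * mon f \<in> supported Zw" "mon (kword (kw w)) * mon g \<in> supported Zw"
    using kword_Kt[OF kw(1)] kword_Kt[OF kw(2)] Kt_Zw Fw_Zw f g by (auto simp flip: mon_add intro!: Zw_simps)
  have eval: "r (q (mon v)) (q (mon w)) = s \<odot>\<^bsub>U \<chi> I\<^esub> (s' \<odot>\<^bsub>U \<chi> I\<^esub> (\<chi> (- deg f) (kw w) \<odot>\<^bsub>U \<chi> I\<^esub>
      (uKK \<chi> I (kw v + kw w) \<otimes>\<^bsub>U \<chi> I\<^esub> (\<Oplus>\<^bsub>U \<chi> I\<^esub>\<rho>\<in>{\<rho>. star_term \<chi> I pr S \<sigma> d Fb Eb (q (mon f)) (q (mon g)) \<rho> \<noteq> \<zero>\<^bsub>U \<chi> I\<^esub>}.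
        star_term \<chi> I pr S \<sigma> d Fb Eb (q (mon f)) (q (mon g)) \<rho>))))"
    if r: "determined_star \<chi> I \<tau> pr S \<sigma> d Fb Eb r" for r
  proof -
    have "bilinear_on (U \<chi> I) (H_theta_U_neg \<chi> I \<tau>) (U \<chi> I) (H_theta_U_neg \<chi> I \<tau>) (U \<chi> I) r"
      using r by (simp add: determined_star_def)
    note 1 = bilinear_on_q(2,4)[OF this]
    have 2: "r (uKK \<chi> I (kw v) \<otimes>\<^bsub>U \<chi> I\<^esub> q (mon f)) (uKK \<chi> I (kw w) \<otimes>\<^bsub>U \<chi> I\<^esub> q (mon g))
        = \<chi> (- deg f) (kw w) \<odot>\<^bsub>U \<chi> I\<^esub> (uKK \<chi> I (kw v + kw w) \<otimes>\<^bsub>U \<chi> I\<^esub> r (q (mon f)) (q (mon g)))"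
      using r kw U unfolding determined_star_def by blast
    have 3: "r (q (mon f)) (q (mon g)) = (\<Oplus>\<^bsub>U \<chi> I\<^esub>\<rho>\<in>{\<rho>. star_term \<chi> I pr S \<sigma> d Fb Eb (q (mon f)) (q (mon g)) \<rho> \<noteq> \<zero>\<^bsub>U \<chi> I\<^esub>}.
        star_term \<chi> I pr S \<sigma> d Fb Eb (q (mon f)) (q (mon g)) \<rho>)"
      using r U unfolding determined_star_def by blast
    have "r (q (mon v)) (q (mon w)) = s \<odot>\<^bsub>U \<chi> I\<^esub> (s' \<odot>\<^bsub>U \<chi> I\<^esub> r (q (mon (kword (kw v)) * mon f)) (q (mon (kword (kw w)) * mon g)))"
      unfolding f(3) g(3) using 1(1)[OF k(1) supported_sc[OF k(2)], of s s'] 1(2)[OF k, of s'] by simp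
    also have "r (q (mon (kword (kw v)) * mon f)) (q (mon (kword (kw w)) * mon g))
      = r (uKK \<chi> I (kw v) \<otimes>\<^bsub>U \<chi> I\<^esub> q (mon f)) (uKK \<chi> I (kw w) \<otimes>\<^bsub>U \<chi> I\<^esub> q (mon g))"
      by (simp add: uKK_eq q_simps)
    finally show ?thesis unfolding 2 3 .
  qed
  show "st (q (mon v)) (q (mon w)) = st' (q (mon v)) (q (mon w))"
    unfolding eval[OF assms(1)] eval[OF assms(2)] ..
qed

end

section \<open>The star product on \<open>B\<^sub>c\<close>\<close>

lemma gen_subalg_minimal: "G \<subseteq> gen_subalg R G' \<Longrightarrow> gen_subalg R G \<subseteq> gen_subalg R G'"
  unfolding gen_subalg_def by blast

section \<open>Reduction of \<open>B_alg\<close> modulo the kernel of \<open>\<psi>\<close>\<close>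

context star_data
begin

definition UpT :: "('i, 'k) free_uq set" where
  "UpT = {x. q x \<in> U_poly \<chi> I \<tau>}"

text \<open>The kernel of \<open>\<psi>\<close>, pulled back to the free algebra.\<close>

definition ZT :: "('i, 'k) free_uq set" where
  "ZT = {x. q x \<in> lin_span (U \<chi> I) {u \<otimes>\<^bsub>U \<chi> I\<^esub> v | u v.
     u \<in> U_poly \<chi> I \<tau> \<and> v \<in> range (E_tilde \<chi> I) \<union> range (uL \<chi> I)}}"

definition Bm :: "'i \<Rightarrow> ('i, 'k) free_uq" where
  "Bm i = Fm i + sc (c i) (Em (\<tau> i) * Lm i)"

text \<open>A span of products of chosen representatives and not the full preimage of
  \<open>B_alg\<close>, so that statements about \<open>B_alg\<close> can be proved by induction
  over lists of generators.\<close>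

definition Bs :: "('i, 'k) free_uq set" where
  "Bs = T.span (prod_list ` lists (supported Kt \<union> range Bm))"

lemma subspace_UpT: "T.subspace UpT"
  unfolding UpT_def U_poly_def by (rule subspace_gen_subalg)

lemmas UpT_add = T.subspace_add[OF subspace_UpT]
lemmas UpT_sc = T.subspace_scale[OF subspace_UpT]
lemmas UpT_diff = T.subspace_diff[OF subspace_UpT]

lemma UpT_mult: "x \<in> UpT \<Longrightarrow> y \<in> UpT \<Longrightarrow> x * y \<in> UpT"
  using gen_subalg_mult[of "q x" "U \<chi> I" _ "q y"] by (simp add: UpT_def U_poly_def q_simps)

lemma UpT_gens: "Fm i \<in> UpT" "Em i * Lm i \<in> UpT" "Lm i \<in> UpT" "1 \<in> UpT"
  using gen_subalg_incl[of "range (uF \<chi> I) \<union> range (E_tilde \<chi> I) \<union> range (uL \<chi> I) \<union> KK_theta \<chi> I \<tau>" "U \<chi> I"]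
    gen_subalg_one[of "U \<chi> I"]
  by (auto simp: UpT_def U_poly_def E_tilde_def q_simps gen_eq_mon)

lemma H_theta_U_neg_poly: "H_theta_U_neg \<chi> I \<tau> \<subseteq> U_poly \<chi> I \<tau>"
proof -
  let ?G = "range (uF \<chi> I) \<union> range (E_tilde \<chi> I) \<union> range (uL \<chi> I) \<union> KK_theta \<chi> I \<tau>"
  have "H_theta \<chi> I \<tau> \<subseteq> gen_subalg (U \<chi> I) ?G" "U_neg \<chi> I \<subseteq> gen_subalg (U \<chi> I) ?G"
    unfolding H_theta_def U_neg_def using gen_subalg_incl[of ?G "U \<chi> I"]
    by (intro gen_subalg_minimal; blast)+
  then show ?thesis unfolding H_theta_U_neg_def U_poly_def by (intro gen_subalg_minimal) blast
qed

lemma Zw_UpT: "x \<in> supported Zw \<Longrightarrow> x \<in> UpT"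
  using H_theta_U_neg_poly by (auto simp: UpT_def H_theta_U_neg_eq)

lemma Kt_UpT: "x \<in> supported Kt \<Longrightarrow> x \<in> UpT"
  using Kt_Zw by (intro Zw_UpT) (auto simp: supported_def)

lemma subspace_ZT: "T.subspace ZT"
  unfolding ZT_def by (rule subspace_lin_span)

lemmas ZT_0 = T.subspace_0[OF subspace_ZT]
lemmas ZT_add = T.subspace_add[OF subspace_ZT]
lemmas ZT_sc = T.subspace_scale[OF subspace_ZT]
lemmas ZT_diff = T.subspace_diff[OF subspace_ZT]

lemma ZT_cong: "x \<in> ZT \<Longrightarrow> q y = q x \<Longrightarrow> y \<in> ZT"
  by (simp add: ZT_def)

lemma ZT_gens:
  assumes "u \<in> UpT"
  shows "u * (Em j * Lm j) \<in> ZT" "u * Lm j \<in> ZT"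
proof -
  have "q u \<otimes>\<^bsub>U \<chi> I\<^esub> E_tilde \<chi> I j \<in> {u \<otimes>\<^bsub>U \<chi> I\<^esub> v | u v. u \<in> U_poly \<chi> I \<tau> \<and> v \<in> range (E_tilde \<chi> I) \<union> range (uL \<chi> I)}"
    "q u \<otimes>\<^bsub>U \<chi> I\<^esub> uL \<chi> I j \<in> {u \<otimes>\<^bsub>U \<chi> I\<^esub> v | u v. u \<in> U_poly \<chi> I \<tau> \<and> v \<in> range (E_tilde \<chi> I) \<union> range (uL \<chi> I)}"
    using assms unfolding UpT_def by blast+
  from this[THEN subsetD[OF lin_span_incl]] show "u * (Em j * Lm j) \<in> ZT" "u * Lm j \<in> ZT"
    by (simp_all add: ZT_def E_tilde_def q_simps gen_eq_mon)
qed

text \<open>The kernel is spanned by products whose left factor is an arbitrary element of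
  \<open>U_poly\<close>, hence it is stable under left multiplication. Reductions modulo the kernel
  are therefore made in the right factor of a product.\<close>

lemma ZT_left:
  assumes "p \<in> UpT" "x \<in> ZT"
  shows "p * x \<in> ZT"
proof -
  let ?V = "{x. p * x \<in> ZT}"
  have "T.subspace ?V"
    using subspace_ZT unfolding T.subspace_def by (auto simp: distrib_left)
  moreover have "{u \<otimes>\<^bsub>U \<chi> I\<^esub> v | u v. u \<in> U_poly \<chi> I \<tau> \<and> v \<in> range (E_tilde \<chi> I) \<union> range (uL \<chi> I)} \<subseteq> q ` ?V"
  proof clarify
    fix u v assume "u \<in> U_poly \<chi> I \<tau>" "v \<in> range (E_tilde \<chi> I) \<union> range (uL \<chi> I)"
    moreover have "U_poly \<chi> I \<tau> \<subseteq> carrier (U \<chi> I)"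
    proof -
      have "subring (carrier (U \<chi> I)) (U \<chi> I)" by (rule ring.carrier_is_subring[OF ring_U])
      moreover have "linear_subspace (U \<chi> I) (carrier (U \<chi> I))"
        using linear_subspace_cl_image[of UNIV] unfolding cl_eq_q U_def[symmetric] q_simps(1)[symmetric] by simp
      ultimately show ?thesis
        unfolding U_poly_def gen_subalg_def by (auto simp: q_simps KK_theta_def E_tilde_def)
    qed
    ultimately obtain x where x: "x \<in> UpT" "u = q x" by (auto simp: UpT_def q_simps)
    from \<open>v \<in> _\<close> obtain j where "v = q (Em j * Lm j) \<or> v = q (Lm j)"
      by (auto simp: E_tilde_def q_simps gen_eq_mon)
    then show "u \<otimes>\<^bsub>U \<chi> I\<^esub> v \<in> q ` ?V"
    proof
      assume v: "v = q (Em j * Lm j)"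
      have "p * x * (Em j * Lm j) \<in> ZT" by (intro ZT_gens UpT_mult assms x)
      then show ?thesis by (auto simp: x v q_simps mult.assoc)
    next
      assume v: "v = q (Lm j)"
      have "p * x * Lm j \<in> ZT" by (intro ZT_gens UpT_mult assms x)
      then show ?thesis by (auto simp: x v q_simps mult.assoc)
    qed
  qed
  ultimately have "lin_span (U \<chi> I) {u \<otimes>\<^bsub>U \<chi> I\<^esub> v | u v. u \<in> U_poly \<chi> I \<tau> \<and> v \<in> range (E_tilde \<chi> I) \<union> range (uL \<chi> I)} \<subseteq> q ` ?V"
    by (rule lin_span_subset)
  with assms(2) obtain y where "p * y \<in> ZT" "q x = q y" unfolding ZT_def by blast
  then show ?thesis using ZT_cong q_mult_left by blast
qed

text \<open>Moving \<open>E_j K_j^{-1}\<close> past \<open>F_l\<close> gives the scalar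
  \<open>e\<close> and, for \<open>l = j\<close>, an additional multiple of
  \<open>1 - K_j^{-2}\<close>. The part with \<open>K_j^{-2}\<close> falls into the kernel once one
  \<open>K_j^{-1}\<close> is moved to the right end. What remains is the recursion of the skew
  derivation \<open>ract (Em j)\<close>.\<close>

lemma E_tilde_word:
  "f \<in> Fw \<Longrightarrow> Em j * Lm j * mon f - sc (\<chi> (\<alpha> j) (\<alpha> j)) (ract (Em j) (mon f)) \<in> ZT"
proof (induction rule: words_in_induct)
  case zero
  have "ract (Em j) 1 = 0" using ract_Em_K[of 0 j] by simp
  then show ?case using ZT_gens(1)[OF UpT_gens(4)] by simp
next
  case (Cons g f)
  then obtain l where g: "g = GF l" by auto
  define e where "e = \<chi> (\<alpha> j) (\<alpha> l)"
  define D where "D = Em j * Lm j * mon f - sc (\<chi> (\<alpha> j) (\<alpha> j)) (ract (Em j) (mon f))"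
  have f: "f \<in> negw" using Cons.hyps words_subset by auto
  have FF: "ract (Em j) (Fm l) = (if j = l then 1 else 0)"
    by (simp add: ract_mon)
  have FK: "ract (M.Km j) (Fm l) = sc e (Fm l)"
    by (simp add: ract_Km chi_minus_left e_def chi_sym[of "\<alpha> j" "\<alpha> l"])
  have ract: "ract (Em j) (Fm l * mon f) = (if j = l then mon f else 0) + sc e (Fm l * ract (Em j) (mon f))"
    using f by (simp add: ract_Em_mult FF FK)
  have "q (Em j * Lm j * (Fm l * mon f)) = q (Em j * (Lm j * Fm l) * mon f)" by (simp add: mult.assoc)
  also have "\<dots> = q (Em j * sc e (Fm l * Lm j) * mon f)"
    using L_commute_word[of j "Word [GF l]"] by (intro q_mult_left q_mult_right) (simp add: chi_minus_right e_def)
  also have "\<dots> = q (sc e (Em j * Fm l * (Lm j * mon f)))" by (simp add: mult.assoc)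
  also have "\<dots> = q (sc e ((Fm l * Em j + (if j = l then Km j - Lm j else 0)) * (Lm j * mon f)))"
    by (intro q_sc q_mult_right rel_EF)
  also have "\<dots> = q (sc e (Fm l * (Em j * Lm j * mon f)) + (if j = l then sc e (Km j * (Lm j * mon f) - Lm j * (Lm j * mon f)) else 0))"
    by (simp add: distrib_right left_diff_distrib sc_add_right mult.assoc)
  also have "\<dots> = q (sc e (Fm l * (Em j * Lm j * mon f)) + (if j = l then sc e (mon f - Lm j * (Lm j * mon f)) else 0))"
    using K_cancel(1)[of j "mon f"] by (intro q_add refl) (auto intro!: q_sc q_diff)
  finally have 1: "q (Em j * Lm j * (Fm l * mon f))
    = q (sc e (Fm l * (Em j * Lm j * mon f)) + (if j = l then sc e (mon f - Lm j * (Lm j * mon f)) else 0))" .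
  have "q (Em j * Lm j * (Fm l * mon f) - sc (\<chi> (\<alpha> j) (\<alpha> j)) (ract (Em j) (Fm l * mon f)))
    = q (sc e (Fm l * (Em j * Lm j * mon f)) + (if j = l then sc e (mon f - Lm j * (Lm j * mon f)) else 0)
        - sc (\<chi> (\<alpha> j) (\<alpha> j)) ((if j = l then mon f else 0) + sc e (Fm l * ract (Em j) (mon f))))"
    unfolding ract by (rule q_diff[OF 1 refl])
  also have "sc e (Fm l * (Em j * Lm j * mon f)) + (if j = l then sc e (mon f - Lm j * (Lm j * mon f)) else 0)
        - sc (\<chi> (\<alpha> j) (\<alpha> j)) ((if j = l then mon f else 0) + sc e (Fm l * ract (Em j) (mon f)))
      = sc e (Fm l * D) + (if j = l then sc (- e) (Lm j * (Lm j * mon f)) else 0)"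
    by (simp add: D_def e_def right_diff_distrib T.scale_right_diff_distrib sc_add_right mult.commute)
  finally have 2: "q (Em j * Lm j * (Fm l * mon f) - sc (\<chi> (\<alpha> j) (\<alpha> j)) (ract (Em j) (Fm l * mon f)))
    = q (sc e (Fm l * D) + (if j = l then sc (- e) (Lm j * (Lm j * mon f)) else 0))" .
  have LL: "Lm j * (Lm j * mon f) \<in> ZT"
  proof (rule ZT_cong)
    have "mon f \<in> UpT" using Fw_Zw Cons.hyps by (intro Zw_UpT) auto
    then show "sc (inverse (\<chi> (\<alpha> j) (deg f))) (Lm j * mon f * Lm j) \<in> ZT"
      by (intro ZT_sc ZT_gens UpT_mult UpT_gens)
    show "q (Lm j * (Lm j * mon f)) = q (sc (inverse (\<chi> (\<alpha> j) (deg f))) (Lm j * mon f * Lm j))"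
      using q_mult_left[OF L_commute_word[of j f], of "Lm j"] by (simp add: mult.assoc)
  qed
  have "D \<in> ZT" using Cons.IH by (simp add: D_def)
  moreover have "(if b then sc (- e) (Lm j * (Lm j * mon f)) else 0) \<in> ZT" for b
    using ZT_sc[OF LL, of "- e"] ZT_0 by (cases b) (simp_all only: if_True if_False)
  ultimately have "sc e (Fm l * D) + (if j = l then sc (- e) (Lm j * (Lm j * mon f)) else 0) \<in> ZT"
    by (intro ZT_add ZT_sc[of "Fm l * D"] ZT_left UpT_gens)
  from ZT_cong[OF this 2] show ?case by (simp add: g mon_add)
qed

text \<open>When a \<open>K\<close> word is taken out in front, both expressions pick up the same
  scalar, which reduces the claim to words in the \<open>F\<close> letters.\<close>

lemma E_tilde_rep:
  assumes "x \<in> supported Zw"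
  shows "Em j * Lm j * x - sc (\<chi> (\<alpha> j) (\<alpha> j)) (ract (Em j) x) \<in> ZT"
  using assms
proof (induction rule: supported_induct)
  case zero
  show ?case using ZT_0 by simp
next
  case (add x y)
  from ZT_add[OF this] show ?case by (simp only: distrib_left act_simps sc_add_right add_diff_add)
next
  case (scale a x)
  from ZT_sc[OF this, of a] show ?case by (simp add: T.scale_right_diff_distrib mult.commute)
next
  case (mon w)
  let ?e = "\<chi> (\<alpha> j) (\<alpha> j)"
  obtain s k f where kf: "k \<in> Kt" "f \<in> Fw" and eq: "q (mon w) = q (sc s (mon k * mon f))"
    using normal_form_Zw[OF mon] by blast
  have kn: "mon k \<in> supported negw" "mon f \<in> supported negw" using kf words_subset by auto
  let ?i = "inverse (\<chi> (kw k) (\<alpha> j))"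
  have EL: "q (Em j * Lm j * mon k) = q (sc ?i (mon k * (Em j * Lm j)))"
    using q_sc[OF K_word_commute[of k "Word [GE j] + Word [GL j]"], of ?i] kf by (simp add: mon_add)
  have "ract (Em j) (mon k * mon f) = sc ?i (mon k * ract (Em j) (mon f))"
    using kf kn by (intro act_K_word) auto
  then have r: "q (ract (Em j) (mon w)) = q (sc (s * ?i) (mon k * ract (Em j) (mon f)))"
    using ract_cong[OF _ _ _ eq, of "Em j"] mon Zw_negw kn by (auto simp: supported_sc supported_negw_mult)
  have "q (Em j * Lm j * mon w) = q (sc s (Em j * Lm j * mon k * mon f))"
    using q_mult_left[OF eq, of "Em j * Lm j"] by (simp add: mult.assoc)
  also have "\<dots> = q (sc s (sc ?i (mon k * (Em j * Lm j)) * mon f))"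
    by (intro q_sc q_mult_right EL)
  finally have "q (Em j * Lm j * mon w - sc ?e (ract (Em j) (mon w)))
    = q (sc (s * ?i) (mon k * (Em j * Lm j * mon f)) - sc ?e (sc (s * ?i) (mon k * ract (Em j) (mon f))))"
    by (intro q_diff q_sc r) (simp add: mult.assoc)
  also have "sc (s * ?i) (mon k * (Em j * Lm j * mon f)) - sc ?e (sc (s * ?i) (mon k * ract (Em j) (mon f)))
    = sc (s * ?i) (mon k * (Em j * Lm j * mon f - sc ?e (ract (Em j) (mon f))))"
    by (simp only: right_diff_distrib T.scale_right_diff_distrib sc_mult_right sc_sc mult.commute[of ?e "s * ?i"])
  finally have "q (Em j * Lm j * mon w - sc ?e (ract (Em j) (mon w)))
    = q (sc (s * ?i) (mon k * (Em j * Lm j * mon f - sc ?e (ract (Em j) (mon f)))))" .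
  moreover have "sc (s * ?i) (mon k * (Em j * Lm j * mon f - sc ?e (ract (Em j) (mon f)))) \<in> ZT"
    using kf by (intro ZT_sc ZT_left Kt_UpT E_tilde_word) auto
  ultimately show ?case by (rule ZT_cong[rotated])
qed

text \<open>With \<open>j = \<tau> i\<close>, the factor \<open>K_i^{-1} K_j\<close> is taken out to
  the left because it lies in \<open>H_theta\<close>; what remains is the generator
  \<open>E_j K_j^{-1}\<close> of \<open>U_poly\<close>. Together with the factor
  \<open>\<chi> (\<alpha> j) (\<alpha> j)\<close> from \<open>E_tilde_rep\<close>, the scalar
  becomes the constant \<open>\<chi> (\<alpha> i) (\<alpha> j)\<close> of
  \<open>beta\<close>.\<close>

lemma E_L_eq:
  "q (Em (\<tau> i) * Lm i) = q (sc (\<chi> (\<alpha> i) (\<alpha> (\<tau> i)) / \<chi> (\<alpha> (\<tau> i)) (\<alpha> (\<tau> i))) (Lm i * Km (\<tau> i) * (Em (\<tau> i) * Lm (\<tau> i))))"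
proof -
  let ?j = "\<tau> i"
  have "q (Lm ?j * (Lm i * Km ?j)) = q (Lm i)"
    using K_word_eq_kword[of "Word [GL ?j] + (Word [GL i] + Word [GK ?j])"] K_word_eq_kword[of "Word [GL i]"]
    by (simp add: mon_add)
  then have "q (Em ?j * Lm i) = q (Em ?j * (Lm ?j * (Lm i * Km ?j)))"
    by (intro q_mult_left) simp
  also have "\<dots> = q (Em ?j * Lm ?j * (Lm i * Km ?j))" by (simp add: mult.assoc)
  also have "\<dots> = q (sc (inverse (\<chi> (\<alpha> ?j - \<alpha> i) (\<alpha> ?j))) (Lm i * Km ?j * (Em ?j * Lm ?j)))"
    using q_sc[OF K_word_commute[of "Word [GL i] + Word [GK ?j]" "Word [GE ?j] + Word [GL ?j]"], of "inverse (\<chi> (\<alpha> ?j - \<alpha> i) (\<alpha> ?j))"]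
    by (simp add: mon_add)
  finally show ?thesis by (simp add: chi_diff_left)
qed

lemma Bm_beta:
  assumes "x \<in> supported Zw"
  shows "Bm i * x - beta i x \<in> ZT"
proof -
  let ?j = "\<tau> i"
  let ?e = "\<chi> (\<alpha> i) (\<alpha> ?j) / \<chi> (\<alpha> ?j) (\<alpha> ?j)" and ?K = "Lm i * Km ?j"
  have "q (Bm i * x - beta i x) = q (sc (c i) ((Em ?j * Lm i) * x) - sc (c i * \<chi> (\<alpha> i) (\<alpha> ?j)) (?K * ract (Em ?j) x))"
    by (simp add: Bm_def beta_def distrib_right)
  also have "\<dots> = q (sc (c i) (sc ?e (?K * (Em ?j * Lm ?j)) * x) - sc (c i * \<chi> (\<alpha> i) (\<alpha> ?j)) (?K * ract (Em ?j) x))"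
    by (intro q_diff q_sc q_mult_right E_L_eq refl)
  also have "sc (c i) (sc ?e (?K * (Em ?j * Lm ?j)) * x) - sc (c i * \<chi> (\<alpha> i) (\<alpha> ?j)) (?K * ract (Em ?j) x)
    = sc (c i * ?e) (?K * (Em ?j * Lm ?j * x - sc (\<chi> (\<alpha> ?j) (\<alpha> ?j)) (ract (Em ?j) x)))"
  proof -
    have "c i * ?e * \<chi> (\<alpha> ?j) (\<alpha> ?j) = c i * \<chi> (\<alpha> i) (\<alpha> ?j)" by simp
    moreover have "?K * (Em ?j * Lm ?j) * x = ?K * (Em ?j * Lm ?j * x)" by (rule mult.assoc)
    ultimately show ?thesis
      by (simp only: right_diff_distrib T.scale_right_diff_distrib sc_mult_left sc_mult_right sc_sc)
  qed
  finally have "q (Bm i * x - beta i x)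
    = q (sc (c i * ?e) (?K * (Em ?j * Lm ?j * x - sc (\<chi> (\<alpha> ?j) (\<alpha> ?j)) (ract (Em ?j) x))))" .
  moreover have "?K \<in> UpT"
    unfolding mon_add[symmetric] using Z_theta_alpha[of i] by (intro Kt_UpT) simp
  then have "sc (c i * ?e) (?K * (Em ?j * Lm ?j * x - sc (\<chi> (\<alpha> ?j) (\<alpha> ?j)) (ract (Em ?j) x))) \<in> ZT"
    by (intro ZT_sc ZT_left E_tilde_rep assms)
  ultimately show ?thesis by (rule ZT_cong[rotated])
qed

lemma Bm_UpT: "Bm i \<in> UpT"
proof -
  let ?x = "Fm i + sc (c i) (sc (\<chi> (\<alpha> i) (\<alpha> (\<tau> i)) / \<chi> (\<alpha> (\<tau> i)) (\<alpha> (\<tau> i))) (Lm i * Km (\<tau> i) * (Em (\<tau> i) * Lm (\<tau> i))))"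
  have "Lm i * Km (\<tau> i) \<in> UpT"
    unfolding mon_add[symmetric] using Z_theta_alpha[of i] by (intro Kt_UpT) simp
  then have "?x \<in> UpT" by (intro UpT_add UpT_sc UpT_gens(1) UpT_mult[OF _ UpT_gens(2)])
  moreover have "q (Bm i) = q ?x" unfolding Bm_def by (intro q_add q_sc E_L_eq refl)
  ultimately show ?thesis by (simp add: UpT_def)
qed

lemma B_alg_eq: "B_alg \<chi> I \<tau> c = q ` Bs"
proof -
  have "range (B_gen \<chi> I \<tau> c) = q ` range Bm"
    by (auto simp: B_gen_def Bm_def q_simps gen_eq_mon image_iff)
  then have "H_theta \<chi> I \<tau> \<union> range (B_gen \<chi> I \<tau> c) = q ` (supported Kt \<union> range Bm)"
    by (simp add: H_theta_eq image_Un)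
  then show ?thesis unfolding B_alg_def Bs_def by (simp only: gen_subalg_U)
qed

lemma subspace_Bs: "T.subspace Bs"
  unfolding Bs_def by (rule T.subspace_span)

lemma Bs_gen: "g \<in> supported Kt \<union> range Bm \<Longrightarrow> g \<in> Bs" and Bs_1: "1 \<in> Bs"
proof -
  show "1 \<in> Bs" unfolding Bs_def by (rule T.span_base) (auto intro: image_eqI[of _ _ "[]"])
  assume "g \<in> supported Kt \<union> range Bm"
  then show "g \<in> Bs" unfolding Bs_def by (intro T.span_base) (auto intro!: image_eqI[of _ _ "[g]"])
qed

lemma Bs_mult:
  assumes "x \<in> Bs" "y \<in> Bs"
  shows "x * y \<in> Bs"
proof -
  let ?L = "lists (supported Kt \<union> range Bm)"
  have 1: "prod_list l * y \<in> Bs" if l: "l \<in> ?L" for l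
    using assms(2) unfolding Bs_def
  proof (induction rule: T.span_induct_alt)
    case base
    show ?case by (simp add: T.span_zero)
  next
    case (step a z y)
    then obtain l' where l': "l' \<in> ?L" "z = prod_list l'" by auto
    then have "prod_list (l @ l') \<in> T.span (prod_list ` ?L)"
      using l by (intro T.span_base imageI) (auto simp: lists_eq_set)
    then show ?case using step by (simp add: l' distrib_left T.span_add T.span_scale)
  qed
  from assms(1)[unfolded Bs_def] show ?thesis
  proof (induction rule: T.span_induct_alt)
    case base
    show ?case using T.subspace_0[OF subspace_Bs] by simp
  next
    case (step a z x)
    then show ?case
      using 1 by (auto simp: distrib_right intro!: T.subspace_add[OF subspace_Bs] T.subspace_scale[OF subspace_Bs])
  qed
qed

lemma beta_supported_Zw:
  assumes "x \<in> supported Zw"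
  shows "beta i x \<in> supported Zw"
proof -
  have "ract (Em (\<tau> i)) x \<in> supported Zw"
    using assms
  proof (induction rule: supported_induct)
    case (mon w)
    then show ?case using ract_Em_supported[of w "\<tau> i"] Zw_negw by (auto simp: supported_def Zw_def)
  qed (auto intro: supported_add supported_sc)
  then show ?thesis
    unfolding beta_def mon_add[symmetric] using assms Z_theta_alpha[of i] Fw_Zw Kt_Zw
    by (intro supported_add supported_sc supported_Zw_mult) (auto simp: Zw_def Z_theta_0)
qed

text \<open>The quantification over \<open>a\<close> is what later makes \<open>\<psi>\<close>
  multiplicative: modulo the kernel, \<open>X\<close> acts on representatives as left star
  multiplication by \<open>b\<close>. The case \<open>a = 1\<close> shows that \<open>b\<close>
  represents \<open>X\<close> itself.\<close>

lemma Bs_rep: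
  assumes "X \<in> Bs"
  shows "X \<in> UpT \<and> (\<exists>b\<in>supported Zw. \<forall>a\<in>supported Zw. X * a - sta b a \<in> ZT)"
  using assms unfolding Bs_def
proof (induction rule: T.span_induct_alt)
  case base
  show ?case using T.subspace_0[OF subspace_UpT] ZT_0 by (auto intro!: bexI[of _ 0])
next
  case (step e z x)
  then obtain l where l: "set l \<subseteq> supported Kt \<union> range Bm" "z = prod_list l" by (auto simp: lists_eq_set)
  from l(1) have "prod_list l \<in> UpT \<and> (\<exists>b\<in>supported Zw. \<forall>a\<in>supported Zw. prod_list l * a - sta b a \<in> ZT)"
  proof (induction l)
    case Nil
    show ?case using UpT_gens(4) ZT_0 by (auto intro!: bexI[of _ 1] simp: sta_1_left supported_Zw_negw one_supported_iff Zw_simps)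
  next
    case (Cons g l)
    then obtain b where X: "prod_list l \<in> UpT" and b: "b \<in> supported Zw"
      "\<And>a. a \<in> supported Zw \<Longrightarrow> prod_list l * a - sta b a \<in> ZT" by auto
    consider "g \<in> supported Kt" | i where "g = Bm i" using Cons.prems by auto
    then show ?case
    proof cases
      case 1
      have g: "g \<in> UpT" "g \<in> supported Zw" using 1 Kt_UpT Kt_Zw by (auto simp: supported_def)
      have K: "sta (g * b) a = g * sta b a" for a
      proof -
        have "g * b \<in> supported negw \<and> sta (g * b) a = g * sta b a"
          using 1
        proof (induction rule: supported_induct)
          case (mon k)
          then show ?case using supported_Zw_negw[OF b(1)] words_subset by (auto simp: sta_K_left intro!: supported_negw_mult)
        qed (simp_all add: distrib_right sta_add_left sta_sc_left supported_add supported_sc)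
        then show ?thesis ..
      qed
      have "prod_list (g # l) * a - sta (g * b) a \<in> ZT" if "a \<in> supported Zw" for a
        using ZT_left[OF g(1) b(2)[OF that]] by (simp add: K right_diff_distrib mult.assoc)
      moreover have "g * b \<in> supported Zw" "prod_list (g # l) \<in> UpT"
        using g X b by (simp_all add: supported_Zw_mult UpT_mult)
      ultimately show ?thesis by blast
    next
      case 2
      have "prod_list (g # l) * a - sta (beta i b) a \<in> ZT" if a: "a \<in> supported Zw" for a
      proof (rule ZT_cong)
        have s: "sta b a \<in> supported Zw" using a b by (intro sta_supported_Zw)
        \<comment> \<open>The first summand lies in the kernel by stability under left
          multiplication, the second by \<open>Bm_beta\<close>. Then \<open>sta_beta\<close> moves
          \<open>beta i\<close> into the first argument.\<close>
        show "Bm i * (prod_list l * a - sta b a) + (Bm i * sta b a - beta i (sta b a)) \<in> ZT"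
          by (intro ZT_add ZT_left Bm_UpT b a Bm_beta s)
        have "q (sta (beta i b) a) = q (beta i (sta b a))"
          using a b by (intro sta_beta supported_Zw_negw)
        then have "q (Bm i * prod_list l * a - sta (beta i b) a) = q (Bm i * prod_list l * a - beta i (sta b a))"
          by (rule q_diff[OF refl])
        then show "q (prod_list (g # l) * a - sta (beta i b) a)
          = q (Bm i * (prod_list l * a - sta b a) + (Bm i * sta b a - beta i (sta b a)))"
          by (simp add: 2 right_diff_distrib mult.assoc)
      qed
      moreover have "beta i b \<in> supported Zw" "prod_list (g # l) \<in> UpT"
        using 2 X b by (simp_all add: beta_supported_Zw UpT_mult Bm_UpT)
      ultimately show ?thesis by blast
    qed
  qed
  then obtain b where Z: "z \<in> UpT" and b: "b \<in> supported Zw"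
    "\<And>a. a \<in> supported Zw \<Longrightarrow> z * a - sta b a \<in> ZT" using l(2) by auto
  from step(2) obtain b' where X: "x \<in> UpT" and b': "b' \<in> supported Zw"
    "\<And>a. a \<in> supported Zw \<Longrightarrow> x * a - sta b' a \<in> ZT" by auto
  have "(sc e z + x) * a - sta (sc e b + b') a \<in> ZT" if "a \<in> supported Zw" for a
  proof -
    have "sta (sc e b + b') a = sc e (sta b a) + sta b' a"
      using b(1) b'(1) by (simp add: sta_add_left sta_sc_left supported_Zw_negw supported_sc)
    moreover have "sc e (z * a - sta b a) + (x * a - sta b' a) \<in> ZT"
      using that b b' by (intro ZT_add ZT_sc)
    ultimately show ?thesis by (simp add: distrib_right T.scale_right_diff_distrib algebra_simps)
  qed
  moreover have "sc e b + b' \<in> supported Zw" "sc e z + x \<in> UpT"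
    using b b' Z X by (simp_all add: supported_add supported_sc UpT_add UpT_sc)
  ultimately show ?case by blast
qed

end

section \<open>\<open>\<psi>\<close> on \<open>B_alg\<close>: multiplicativity and
  surjectivity\<close>

locale psi_data = star_data \<chi> I pr \<tau> c S \<sigma> d Fb Eb
  for \<chi> :: "('i::{finite,linorder} \<Rightarrow> int) \<Rightarrow> ('i \<Rightarrow> int) \<Rightarrow> 'k::field" and I pr \<tau> c S \<sigma> d Fb Eb +
  fixes \<psi>
  assumes psi: "is_psi \<chi> I \<tau> \<psi>"
begin

lemma psi_rep:
  assumes "x \<in> UpT" "b \<in> supported Zw" "x - b \<in> ZT"
  shows "\<psi> (q x) = q b"
proof -
  have "x - b \<in> UpT" using assms Zw_UpT by (intro UpT_diff) auto
  then have "\<psi> (q (b + (x - b))) = \<psi> (q b) \<oplus>\<^bsub>U \<chi> I\<^esub> \<psi> (q (x - b))"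
    using psi assms Zw_UpT[OF assms(2)] unfolding is_psi_def linear_on_def UpT_def q_simps(4)[symmetric] by simp
  moreover have "\<psi> (q b) = q b" using psi assms(2) by (simp add: is_psi_def H_theta_U_neg_eq)
  moreover have "\<psi> (q (x - b)) = q 0"
    using psi assms(3) unfolding is_psi_def ZT_def q_simps(2)[symmetric] by blast
  ultimately show ?thesis by (simp add: q_simps)
qed

lemma psi_Bs:
  assumes "X \<in> Bs"
  shows "\<exists>b\<in>supported Zw. \<psi> (q X) = q b \<and> (\<forall>a\<in>supported Zw. X * a - sta b a \<in> ZT)"
proof -
  from Bs_rep[OF assms] obtain b where X: "X \<in> UpT" and b: "b \<in> supported Zw"
    "\<And>a. a \<in> supported Zw \<Longrightarrow> X * a - sta b a \<in> ZT" by blast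
  have "sta b 1 = b" using sta_1_right_K[of b 0] b(1) by (simp add: supported_Zw_negw)
  then have "X - b \<in> ZT" using b(2)[of 1] by (simp add: one_supported_iff Zw_simps)
  then show ?thesis using psi_rep X b by blast
qed

lemma psi_diff_ZT:
  assumes "X \<in> Bs" "\<psi> (q X) = q b"
  shows "X - b \<in> ZT"
proof -
  from psi_Bs[OF assms(1)] obtain b' where b: "b' \<in> supported Zw" "\<psi> (q X) = q b'"
    "\<And>a. a \<in> supported Zw \<Longrightarrow> X * a - sta b' a \<in> ZT" by blast
  have "sta b' 1 = b'" using sta_1_right_K[of b' 0] b(1) by (simp add: supported_Zw_negw)
  then have "X - b' \<in> ZT" using b(3)[of 1] by (simp add: one_supported_iff Zw_simps)
  then show ?thesis by (rule ZT_cong) (use assms b in \<open>auto intro!: q_diff\<close>)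
qed

text \<open>Modulo the kernel \<open>Y\<close> may be replaced by \<open>a\<close> behind the left
  factor \<open>X\<close>, and then \<open>X * a\<close> by \<open>sta b a\<close>.\<close>

theorem psi_mult:
  assumes "X \<in> Bs" "Y \<in> Bs"
  shows "\<psi> (q (X * Y)) = star (\<psi> (q X)) (\<psi> (q Y))"
proof -
  from psi_Bs[OF assms(1)] obtain b where b: "b \<in> supported Zw" "\<psi> (q X) = q b"
    "\<And>a. a \<in> supported Zw \<Longrightarrow> X * a - sta b a \<in> ZT" by blast
  from psi_Bs[OF assms(2)] obtain a where a: "a \<in> supported Zw" "\<psi> (q Y) = q a" by blast
  have X: "X \<in> UpT" "Y \<in> UpT" using Bs_rep assms by auto
  have "X * (Y - a) + (X * a - sta b a) \<in> ZT"
    by (intro ZT_add ZT_left X psi_diff_ZT assms a b)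
  then have "X * Y - sta b a \<in> ZT" by (simp add: right_diff_distrib)
  then have "\<psi> (q (X * Y)) = q (sta b a)"
    using X a b by (intro psi_rep UpT_mult sta_supported_Zw)
  then show ?thesis using a b by (simp add: star_q)
qed

lemma psi_linear:
  assumes "X \<in> Bs" "Y \<in> Bs" "\<psi> (q X) = q a" "\<psi> (q Y) = q b" "a \<in> supported Zw" "b \<in> supported Zw"
  shows "\<psi> (q (X + Y)) = q (a + b)" "\<psi> (q (X - Y)) = q (a - b)" "\<psi> (q (sc s X)) = q (sc s a)"
proof -
  have X: "X \<in> UpT" "Y \<in> UpT" using Bs_rep assms by auto
  have Z: "X - a \<in> ZT" "Y - b \<in> ZT" using assms psi_diff_ZT by auto
  have "X + Y - (a + b) \<in> ZT" "X - Y - (a - b) \<in> ZT" "sc s X - sc s a \<in> ZT"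
    using ZT_add[OF Z] ZT_diff[OF Z] ZT_sc[OF Z(1), of s]
    by (simp_all add: algebra_simps T.scale_right_diff_distrib)
  then show "\<psi> (q (X + Y)) = q (a + b)" "\<psi> (q (X - Y)) = q (a - b)" "\<psi> (q (sc s X)) = q (sc s a)"
    using X assms by (intro psi_rep; simp add: UpT_add UpT_diff UpT_sc supported_add supported_diff supported_sc)+
qed

lemma psi_beta:
  assumes "X \<in> Bs" "\<psi> (q X) = q x" "x \<in> supported Zw"
  shows "\<psi> (q (Bm i * X)) = q (beta i x)"
proof -
  have "Bm i * (X - x) + (Bm i * x - beta i x) \<in> ZT"
    by (intro ZT_add ZT_left Bm_UpT psi_diff_ZT Bm_beta assms)
  then have "Bm i * X - beta i x \<in> ZT" by (simp add: right_diff_distrib)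
  then show ?thesis
    using Bs_rep assms by (intro psi_rep UpT_mult Bm_UpT beta_supported_Zw) auto
qed

lemma psi_K:
  assumes "k \<in> supported Kt"
  shows "\<psi> (q k) = q k"
proof -
  have "q k \<in> H_theta_U_neg \<chi> I \<tau>"
    unfolding H_theta_U_neg_eq using assms supported_mono[OF Kt_Zw] by blast
  then show ?thesis using psi by (simp add: is_psi_def)
qed

text \<open>The image contains 1 and is stable under all operations of \<open>beta_induct\<close>,
  since left multiplication by \<open>Bm i\<close> on \<open>B_alg\<close> corresponds to
  \<open>beta i\<close> on the image.\<close>

lemma psi_surj:
  assumes "x \<in> supported Zw"
  shows "\<exists>X\<in>Bs. \<psi> (q X) = q x"
proof -
  have "x \<in> supported Zw \<and> (\<exists>X\<in>Bs. \<psi> (q X) = q x)"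
    using assms
  proof (induction rule: beta_induct)
    case one
    show ?case using psi_K[of 1] Bs_1 by (auto simp: one_supported_iff Zw_simps Z_theta_0)
  next
    case (add x y)
    then obtain X Y where "X \<in> Bs" "Y \<in> Bs" "\<psi> (q X) = q x" "\<psi> (q Y) = q y" by blast
    with psi_linear(1)[of X Y x y] add show ?case
      by (auto intro!: supported_add T.subspace_add[OF subspace_Bs])
  next
    case (scale s x)
    then obtain X where "X \<in> Bs" "\<psi> (q X) = q x" by blast
    with psi_linear(3)[of X X x x s] scale show ?case
      by (auto intro!: supported_sc T.subspace_scale[OF subspace_Bs])
  next
    case (K k x)
    then obtain X where X: "X \<in> Bs" "\<psi> (q X) = q x" by blast
    have k: "mon k \<in> supported Kt" "mon k \<in> Bs" "mon k \<in> supported Zw"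
      using K Kt_Zw by (auto intro: Bs_gen)
    have "\<psi> (q (mon k * X)) = q (mon k * x)"
      using psi_mult[OF k(2) X(1)] K k by (simp add: X psi_K star_q sta_Kt supported_Zw_negw)
    then show ?case using K k X by (auto intro!: Bs_mult supported_Zw_mult)
  next
    case (beta i x)
    then obtain X where X: "X \<in> Bs" "\<psi> (q X) = q x" by blast
    have "Bm i \<in> Bs" by (rule Bs_gen) auto
    then show ?case using psi_beta[OF X, of i] beta X by (auto intro!: Bs_mult beta_supported_Zw)
  qed auto
  then show ?thesis ..
qed

end

section \<open>The associated graded algebra of \<open>B\<^sub>c\<close>\<close>

context star_data
begin

abbreviation "Fil \<equiv> B_filtration \<chi> I \<tau> c"
abbreviation "gp \<equiv> graded_products (U \<chi> I) (H_theta \<chi> I \<tau>) (range (B_gen \<chi> I \<tau> c))"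

definition FilT :: "nat \<Rightarrow> ('i, 'k) free_uq set" where
  "FilT m = {X. q X \<in> Fil m}"

text \<open>The preimage of \<open>fil_below\<close>. In degree 0 the space below is zero, and its
  preimage is \<open>J\<close>.\<close>

definition lowT :: "nat \<Rightarrow> ('i, 'k) free_uq set" where
  "lowT m = (case m of 0 \<Rightarrow> J | Suc l \<Rightarrow> FilT l)"

lemma B_gen_eq: "B_gen \<chi> I \<tau> c i = q (Bm i)"
  by (simp add: B_gen_def Bm_def q_simps gen_eq_mon)

lemma gp_Bs: "(m, A) \<in> gp \<Longrightarrow> A \<in> q ` Bs"
proof (induction rule: graded_products.induct)
  case one
  show ?case using Bs_1 by (simp add: q_simps)
next
  case (deg0 m x h)
  then obtain X k where "X \<in> Bs" "x = q X" "k \<in> supported Kt" "h = q k" by (auto simp: H_theta_eq)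
  then show ?case using Bs_mult[OF _ Bs_gen, of X k] by (simp add: q_simps)
next
  case (deg1 m x g)
  then obtain X i where "X \<in> Bs" "x = q X" "g = q (Bm i)" by (auto simp: B_gen_eq)
  then show ?case using Bs_mult[OF _ Bs_gen, of X "Bm i"] by (simp add: q_simps)
qed

lemma gp_mult: "(l, B) \<in> gp \<Longrightarrow> (m, A) \<in> gp \<Longrightarrow> (m + l, A \<otimes>\<^bsub>U \<chi> I\<^esub> B) \<in> gp"
proof (induction rule: graded_products.induct)
  case one
  then show ?case using gp_Bs[OF one] by (auto simp: q_simps)
next
  case (deg0 l x h)
  from gp_Bs[OF deg0.prems] gp_Bs[OF deg0.hyps(1)] obtain X Y k where "A = q X" "x = q Y" "h = q k"
    using deg0.hyps(2) by (auto simp: H_theta_eq)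
  then have "A \<otimes>\<^bsub>U \<chi> I\<^esub> (x \<otimes>\<^bsub>U \<chi> I\<^esub> h) = A \<otimes>\<^bsub>U \<chi> I\<^esub> x \<otimes>\<^bsub>U \<chi> I\<^esub> h" by (simp add: q_simps mult.assoc)
  then show ?case using graded_products.deg0[OF deg0.IH[OF deg0.prems] deg0.hyps(2)] by simp
next
  case (deg1 l x g)
  from gp_Bs[OF deg1.prems] gp_Bs[OF deg1.hyps(1)] obtain X Y i where "A = q X" "x = q Y" "g = q (Bm i)"
    using deg1.hyps(2) by (auto simp: B_gen_eq)
  then have "A \<otimes>\<^bsub>U \<chi> I\<^esub> (x \<otimes>\<^bsub>U \<chi> I\<^esub> g) = A \<otimes>\<^bsub>U \<chi> I\<^esub> x \<otimes>\<^bsub>U \<chi> I\<^esub> g" by (simp add: q_simps mult.assoc)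
  then show ?case using graded_products.deg1[OF deg1.IH[OF deg1.prems] deg1.hyps(2)] by simp
qed

lemma subspace_FilT: "T.subspace (FilT m)"
  unfolding FilT_def B_filtration_def gen_filtration_def by (rule subspace_lin_span)

lemma FilT_gp: "(j, q X) \<in> gp \<Longrightarrow> j \<le> m \<Longrightarrow> X \<in> FilT m"
  unfolding FilT_def B_filtration_def gen_filtration_def using lin_span_incl by fastforce

lemma Fil_subset:
  assumes "T.subspace V" "\<And>j X. j \<le> m \<Longrightarrow> X \<in> Bs \<Longrightarrow> (j, q X) \<in> gp \<Longrightarrow> q X \<in> q ` V"
  shows "Fil m \<subseteq> q ` V"
  unfolding B_filtration_def gen_filtration_def
proof (rule lin_span_subset[OF assms(1)], clarify)
  fix A j assume "j \<le> m" "(j, A) \<in> gp"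
  with gp_Bs[of j A] assms(2) show "A \<in> q ` V" by auto
qed

lemma Fil_eq: "Fil m = q ` FilT m"
  using Fil_subset[OF T.subspace_UNIV, of m] by (auto simp: FilT_def)

text \<open>The filtration lives in the quotient, so \<open>V\<close> has to be closed under a
  change of representative for a check on products of generators to suffice.\<close>

lemma FilT_subset:
  assumes "T.subspace V" "\<And>x y. x \<in> V \<Longrightarrow> q y = q x \<Longrightarrow> y \<in> V"
    "\<And>j X. j \<le> m \<Longrightarrow> X \<in> Bs \<Longrightarrow> (j, q X) \<in> gp \<Longrightarrow> X \<in> V"
  shows "FilT m \<subseteq> V"
proof
  fix X assume "X \<in> FilT m"
  with Fil_subset[OF assms(1), of m] assms(3) obtain Y where "Y \<in> V" "q X = q Y" unfolding FilT_def by blast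
  then show "X \<in> V" using assms(2) by blast
qed

lemma FilT_cong: "X \<in> FilT m \<Longrightarrow> q Y = q X \<Longrightarrow> Y \<in> FilT m"
  by (simp add: FilT_def)

lemma FilT_mono: "m \<le> n \<Longrightarrow> FilT m \<subseteq> FilT n"
  by (rule FilT_subset) (auto intro: FilT_cong FilT_gp subspace_FilT)

lemma FilT_mult:
  assumes "X \<in> FilT m" "Y \<in> FilT l"
  shows "X * Y \<in> FilT (m + l)"
proof -
  have sub: "T.subspace {Y. X * Y \<in> FilT (m + l)}" "T.subspace {X. X * Y \<in> FilT (m + l)}" for X Y
    using subspace_FilT[of "m + l"] unfolding T.subspace_def by (auto simp: distrib_left distrib_right)
  have "FilT l \<subseteq> {Y. X * Y \<in> FilT (m + l)}" if X: "(j, q X) \<in> gp" "j \<le> m" for X j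
  proof (rule FilT_subset[OF sub(1)])
    fix i Y assume "i \<le> l" "(i, q Y) \<in> gp"
    with gp_mult[OF this(2) X(1)] X(2) show "Y \<in> {Y. X * Y \<in> FilT (m + l)}"
      by (auto simp: q_simps intro!: FilT_gp[of "j + i"])
  qed (use FilT_cong q_mult_left in blast)
  then have "FilT m \<subseteq> {X. X * Y \<in> FilT (m + l)}"
    using assms(2) by (intro FilT_subset[OF sub(2)]) (use FilT_cong q_mult_right in blast)+
  then show ?thesis using assms(1) by auto
qed

lemma J_FilT: "x \<in> J \<Longrightarrow> x \<in> FilT m"
  using FilT_cong[OF T.subspace_0[OF subspace_FilT], of x m] q_eqI[of x 0] by simp

lemma subspace_lowT: "T.subspace (lowT m)"
  by (auto simp: lowT_def subspace_FilT subspace_J split: nat.split)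

lemma lowT_FilT: "x \<in> lowT m \<Longrightarrow> x \<in> FilT m"
  using FilT_mono[of "m - 1" m] by (auto simp: lowT_def J_FilT split: nat.splits)

lemma J_lowT: "x \<in> J \<Longrightarrow> x \<in> lowT m"
  by (auto simp: lowT_def J_FilT split: nat.split)

lemma FilT_lowT: "x \<in> FilT j \<Longrightarrow> j < m \<Longrightarrow> x \<in> lowT m"
  using FilT_mono[of j "m - 1"] by (auto simp: lowT_def split: nat.splits)

lemma lowT_mult:
  assumes "x \<in> lowT m" "y \<in> FilT l"
  shows "x * y \<in> lowT (m + l)" "y * x \<in> lowT (l + m)"
proof -
  consider "m = 0" "x \<in> J" | k where "m = Suc k" "x \<in> FilT k" using assms(1) by (auto simp: lowT_def split: nat.splits)
  then have "x * y \<in> lowT (m + l) \<and> y * x \<in> lowT (l + m)"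
  proof cases
    case 1
    then show ?thesis by (auto intro: J_lowT J_left J_right)
  next
    case 2
    then show ?thesis using FilT_mult[OF 2(2) assms(2)] FilT_mult[OF assms(2) 2(2)] by (auto simp: lowT_def)
  qed
  then show "x * y \<in> lowT (m + l)" "y * x \<in> lowT (l + m)" by auto
qed

lemma lowT_cong: "x \<in> lowT m \<Longrightarrow> q y = q x \<Longrightarrow> y \<in> lowT m"
  using T.subspace_add[OF subspace_lowT, of x m "y - x"] J_lowT[of "y - x" m] by (simp add: q_eq_iff)

lemma fil_below_eq: "fil_below (U \<chi> I) Fil m = q ` lowT m"
proof (cases m)
  case 0
  have "q x = q 0" if "x \<in> J" for x using that by (intro q_eqI) simp
  then have "q ` J \<subseteq> {q 0}" by (intro image_subsetI) (simp only: singleton_iff)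
  moreover have "q 0 \<in> q ` J" by (rule imageI[OF J_0])
  ultimately have "q ` J = {q 0}" by blast
  then show ?thesis by (simp add: 0 fil_below_def lowT_def q_simps)
next
  case (Suc l)
  then show ?thesis by (simp add: fil_below_def lowT_def Fil_eq)
qed

definition C :: "nat \<Rightarrow> ('i, 'k) free_uq \<Rightarrow> ('i, 'k) free_uq set set" where
  "C m X = fil_below (U \<chi> I) Fil m +>\<^bsub>U \<chi> I\<^esub> q X"

lemma C_mem: "A \<in> C m X \<longleftrightarrow> (\<exists>h\<in>lowT m. A = q (X + h))"
  by (auto simp: C_def fil_below_eq a_r_coset_def' q_simps add.commute)

lemma C_cong: "X - Y \<in> lowT m \<Longrightarrow> C m X = C m Y"
proof -
  have sub: "C m X \<subseteq> C m Y" if XY: "X - Y \<in> lowT m" for X Y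
  proof
    fix A assume "A \<in> C m X"
    then obtain h where h: "h \<in> lowT m" "A = q (X + h)" by (auto simp: C_mem)
    have "X - Y + h \<in> lowT m" "X + h = Y + (X - Y + h)"
      using T.subspace_add[OF subspace_lowT XY h(1)] by simp_all
    then show "A \<in> C m Y" unfolding C_mem h(2) by metis
  qed
  assume "X - Y \<in> lowT m"
  moreover from T.subspace_neg[OF subspace_lowT this] have "Y - X \<in> lowT m" by simp
  ultimately show "C m X = C m Y" using sub by blast
qed

lemma C_eq_iff: "C m X = C m Y \<longleftrightarrow> X - Y \<in> lowT m"
proof
  assume "C m X = C m Y"
  moreover have "q X \<in> C m X" unfolding C_mem using T.subspace_0[OF subspace_lowT] by (intro bexI[of _ 0]) auto
  ultimately obtain h where h: "h \<in> lowT m" "q X = q (Y + h)" by (auto simp: C_mem)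
  have "q (X - Y) = q (Y + h - Y)" by (intro q_diff h refl)
  then show "X - Y \<in> lowT m" using lowT_cong[OF h(1), of "X - Y"] by simp
qed (rule C_cong)

lemma C_0: "C m 0 = fil_below (U \<chi> I) Fil m"
  unfolding set_eq_iff C_mem fil_below_eq by auto

definition sy :: "nat \<Rightarrow> ('i, 'k) free_uq \<Rightarrow> nat \<Rightarrow> ('i, 'k) free_uq set set" where
  "sy m X = (\<lambda>j. C j (if j = m then X else 0))"

lemma gr_symbol_eq: "gr_symbol (U \<chi> I) Fil m (q X) = sy m X"
  by (auto simp: gr_symbol_def sy_def C_0 fun_eq_iff) (simp_all add: C_def)

lemma sy_eq_iff: "sy m X = sy m Y \<longleftrightarrow> X - Y \<in> lowT m"
  by (auto simp: sy_def fun_eq_iff C_eq_iff T.subspace_0[OF subspace_lowT])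

lemma sy_carrier: "X \<in> FilT m \<Longrightarrow> sy m X \<in> carrier (gr_B \<chi> I \<tau> c)"
proof -
  assume X: "X \<in> FilT m"
  have "\<exists>x\<in>Fil k. sy m X k = fil_below (U \<chi> I) Fil k +>\<^bsub>U \<chi> I\<^esub> x" for k
    using X T.subspace_0[OF subspace_FilT, of k]
    by (intro bexI[of _ "q (if k = m then X else 0)"]) (auto simp: sy_def C_def FilT_def)
  moreover have "{k. sy m X k \<noteq> fil_below (U \<chi> I) Fil k} \<subseteq> {m}" by (auto simp: sy_def C_0)
  ultimately show ?thesis by (auto simp: gr_B_def gr_alg_def intro: finite_subset)
qed

lemma sy_add: "sy m X \<oplus>\<^bsub>gr_B \<chi> I \<tau> c\<^esub> sy m Y = sy m (X + Y)"
proof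
  fix j
  have "C j X <+>\<^bsub>U \<chi> I\<^esub> C j Y = C j (X + Y)" for X Y
  proof (rule Set.set_eqI)
    fix A
    have "A \<in> C j X <+>\<^bsub>U \<chi> I\<^esub> C j Y \<longleftrightarrow> (\<exists>h\<in>lowT j. \<exists>k\<in>lowT j. A = q (X + Y + (h + k)))"
    proof -
      have "A \<in> C j X <+>\<^bsub>U \<chi> I\<^esub> C j Y \<longleftrightarrow> (\<exists>x\<in>C j X. \<exists>y\<in>C j Y. A = x \<oplus>\<^bsub>U \<chi> I\<^esub> y)"
        by (auto simp: set_add_def')
      also have "\<dots> \<longleftrightarrow> (\<exists>h\<in>lowT j. \<exists>k\<in>lowT j. A = q (X + h) \<oplus>\<^bsub>U \<chi> I\<^esub> q (Y + k))"
        unfolding Bex_def C_mem by blast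
      finally show ?thesis by (simp add: q_simps add_ac)
    qed
    also have "\<dots> \<longleftrightarrow> A \<in> C j (X + Y)"
      unfolding C_mem using T.subspace_add[OF subspace_lowT, of _ j] T.subspace_0[OF subspace_lowT, of j]
      by (metis add.right_neutral)
    finally show "A \<in> C j X <+>\<^bsub>U \<chi> I\<^esub> C j Y \<longleftrightarrow> A \<in> C j (X + Y)" .
  qed
  then show "(sy m X \<oplus>\<^bsub>gr_B \<chi> I \<tau> c\<^esub> sy m Y) j = sy m (X + Y) j"
    by (simp add: gr_B_def gr_alg_def sy_def)
qed

lemma C_nonempty: "q X \<in> C m X"
  unfolding C_mem using T.subspace_0[OF subspace_lowT] by (intro bexI[of _ 0]) auto

lemma sy_sc: "a \<odot>\<^bsub>gr_B \<chi> I \<tau> c\<^esub> sy m X = sy m (sc a X)"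
proof
  fix j
  have "(\<Union>x\<in>C j X. fil_below (U \<chi> I) Fil j +>\<^bsub>U \<chi> I\<^esub> (a \<odot>\<^bsub>U \<chi> I\<^esub> x)) = C j (sc a X)" for X
  proof -
    have "fil_below (U \<chi> I) Fil j +>\<^bsub>U \<chi> I\<^esub> (a \<odot>\<^bsub>U \<chi> I\<^esub> x) = C j (sc a X)" if "x \<in> C j X" for x
    proof -
      from that obtain h where h: "h \<in> lowT j" "x = q (X + h)" by (auto simp: C_mem)
      have "C j (sc a (X + h)) = C j (sc a X)"
        using T.subspace_scale[OF subspace_lowT h(1), of a] by (intro C_cong) (simp add: sc_add_right)
      then show ?thesis by (simp add: C_def h q_simps)
    qed
    then show ?thesis using C_nonempty[of X j] by blast
  qed
  from this[of "if j = m then X else 0"] show "(a \<odot>\<^bsub>gr_B \<chi> I \<tau> c\<^esub> sy m X) j = sy m (sc a X) j"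
    by (simp add: gr_B_def gr_alg_def sy_def if_distrib[of "sc a"])
qed

text \<open>The product in \<open>gr_alg\<close> is a union over all choices of representatives.
  Another choice alters the coefficient in degree \<open>n\<close> by an element of
  \<open>lowT n\<close>, so the union is a single coset; it is the zero coset unless
  \<open>n = m + l\<close>.\<close>

lemma sy_mult:
  assumes X: "X \<in> FilT m" and Y: "Y \<in> FilT l"
  shows "sy m X \<otimes>\<^bsub>gr_B \<chi> I \<tau> c\<^esub> sy l Y = sy (m + l) (X * Y)"
proof
  fix n
  let ?X = "\<lambda>i. if i = m then X else 0" and ?Y = "\<lambda>i. if i = l then Y else 0"
  let ?S = "\<lambda>x y. fil_below (U \<chi> I) Fil n +>\<^bsub>U \<chi> I\<^esub> (\<Oplus>\<^bsub>U \<chi> I\<^esub>i\<in>{..n}. x i \<otimes>\<^bsub>U \<chi> I\<^esub> y (n - i))"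
  have eq: "?S x y = C n (if n = m + l then X * Y else 0)"
    if x: "\<And>i. x i \<in> sy m X i" and y: "\<And>i. y i \<in> sy l Y i" for x y
  proof -
    from x have "\<forall>i. \<exists>h. h \<in> lowT i \<and> x i = q (?X i + h)" unfolding sy_def C_mem by blast
    then obtain f where f: "\<And>i. f i \<in> lowT i" "\<And>i. x i = q (?X i + f i)" by metis
    from y have "\<forall>i. \<exists>h. h \<in> lowT i \<and> y i = q (?Y i + h)" unfolding sy_def C_mem by blast
    then obtain g where g: "\<And>i. g i \<in> lowT i" "\<And>i. y i = q (?Y i + g i)" by metis
    have XY: "?X i \<in> FilT i" "?Y i \<in> FilT i" for i
      using X Y T.subspace_0[OF subspace_FilT] by auto
    have low: "(?X i + f i) * (?Y (n - i) + g (n - i)) - ?X i * ?Y (n - i) \<in> lowT n" if "i \<le> n" for i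
    proof -
      have "f i * (?Y (n - i) + g (n - i)) \<in> lowT (i + (n - i))"
        by (rule lowT_mult(1)[OF f(1) T.subspace_add[OF subspace_FilT XY(2) lowT_FilT[OF g(1)]]])
      moreover have "?X i * g (n - i) \<in> lowT (i + (n - i))"
        by (rule lowT_mult(2)[OF g(1) XY(1)])
      ultimately have "f i * (?Y (n - i) + g (n - i)) + ?X i * g (n - i) \<in> lowT n"
        using that T.subspace_add[OF subspace_lowT] by simp
      moreover have "(a + b) * (a' + b') - a * a' = b * (a' + b') + a * b'" for a b a' b' :: "('i, 'k) free_uq"
        by (simp add: distrib_left distrib_right)
      ultimately show ?thesis by (simp only:)
    qed
    have "(\<Sum>i\<le>n. (?X i + f i) * (?Y (n - i) + g (n - i))) - (\<Sum>i\<le>n. ?X i * ?Y (n - i)) \<in> lowT n"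
      unfolding sum_subtractf[symmetric] by (intro T.subspace_sum[OF subspace_lowT] low) auto
    moreover have "(\<Sum>i\<le>n. ?X i * ?Y (n - i)) = (if n = m + l then X * Y else 0)"
    proof -
      have "(\<Sum>i\<le>n. ?X i * ?Y (n - i)) = (\<Sum>i\<le>n. if i = m then (if n = m + l then X * Y else 0) else 0)"
        by (rule sum.cong) auto
      also have "\<dots> = (if n = m + l then X * Y else 0)" by (simp add: sum.delta)
      finally show ?thesis .
    qed
    ultimately have "C n (\<Sum>i\<le>n. (?X i + f i) * (?Y (n - i) + g (n - i))) = C n (if n = m + l then X * Y else 0)"
      by (intro C_cong) simp
    moreover have "(\<Oplus>\<^bsub>U \<chi> I\<^esub>i\<in>{..n}. x i \<otimes>\<^bsub>U \<chi> I\<^esub> y (n - i)) = q (\<Sum>i\<le>n. (?X i + f i) * (?Y (n - i) + g (n - i)))"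
      by (simp only: f(2) g(2) q_simps finsum_U)
    ultimately show ?thesis by (simp add: C_def)
  qed
  have "(\<Union>{?S x y | x y. \<forall>i. x i \<in> sy m X i \<and> y i \<in> sy l Y i}) = C n (if n = m + l then X * Y else 0)"
  proof -
    have mem: "\<forall>i. q (?X i) \<in> sy m X i \<and> q (?Y i) \<in> sy l Y i"
      unfolding sy_def by (intro allI conjI; rule C_nonempty)
    have "?S x y \<in> {?S x y | x y. \<forall>i. x i \<in> sy m X i \<and> y i \<in> sy l Y i}"
      if "\<forall>i. x i \<in> sy m X i \<and> y i \<in> sy l Y i" for x y
      using that by blast
    from this[of "\<lambda>i. q (?X i)" "\<lambda>i. q (?Y i)", OF mem]
    show ?thesis using eq by blast
  qed
  then show "(sy m X \<otimes>\<^bsub>gr_B \<chi> I \<tau> c\<^esub> sy l Y) n = sy (m + l) (X * Y) n"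
    by (simp add: gr_B_def gr_alg_def sy_def)
qed

lemma Bs_FilT: "X \<in> Bs \<Longrightarrow> \<exists>m. X \<in> FilT m"
proof -
  \<comment> \<open>Degree 1 is a coarse bound for the elements of \<open>supported Kt\<close>. It
    makes the length of a product of generators a bound for its filtration degree.\<close>
  have g1: "g \<in> FilT 1" if "g \<in> supported Kt \<union> range Bm" for g
  proof -
    have "(0, \<one>\<^bsub>U \<chi> I\<^esub> \<otimes>\<^bsub>U \<chi> I\<^esub> q k) \<in> gp" if "k \<in> supported Kt" for k
      using that by (intro graded_products.deg0[OF graded_products.one]) (simp add: H_theta_eq)
    moreover have "(Suc 0, \<one>\<^bsub>U \<chi> I\<^esub> \<otimes>\<^bsub>U \<chi> I\<^esub> q (Bm i)) \<in> gp" for i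
      by (intro graded_products.deg1[OF graded_products.one]) (simp flip: B_gen_eq)
    ultimately show ?thesis using that FilT_gp[of _ g 1] by (auto simp: q_simps)
  qed
  have one: "1 \<in> FilT 0" using FilT_gp[of 0 1 0] graded_products.one[of "U \<chi> I"] by (simp add: q_simps)
  assume "X \<in> Bs"
  then show ?thesis
    unfolding Bs_def
  proof (induction rule: T.span_induct_alt)
    case base
    show ?case using T.subspace_0[OF subspace_FilT] by blast
  next
    case (step a z x)
    then obtain l where l: "set l \<subseteq> supported Kt \<union> range Bm" "z = prod_list l" by (auto simp: lists_eq_set)
    from l(1) have "prod_list l \<in> FilT (length l)"
    proof (induction l)
      case (Cons g l)
      then show ?case using FilT_mult[OF g1, of g "prod_list l" "length l"] by auto
    qed (simp add: one)
    moreover obtain m where "x \<in> FilT m" using step by blast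
    ultimately have "z \<in> FilT (length l + m)" "x \<in> FilT (length l + m)"
      using FilT_mono[of "length l" "length l + m"] FilT_mono[of m "length l + m"] by (auto simp: l)
    then show ?case using T.subspace_add[OF subspace_FilT] T.subspace_scale[OF subspace_FilT] by blast
  qed
qed

abbreviation "Zlow m \<equiv> Zw \<inter> {w. fl w < int m}"

lemma sta_Zlow:
  assumes "x \<in> supported (Zlow m)" "y \<in> supported (Zwm l)"
  shows "sta x y \<in> supported (Zlow (m + l))"
proof -
  have word: "sta (mon w) y \<in> supported (Zlow (m + l))" if w: "w \<in> Zlow m" for w
  proof -
    have "0 \<le> fl w" using w fl_nonneg Zw_negw by auto
    then obtain n where n: "w \<in> Zwm n" "n < m" using w by (intro that[of "nat (fl w)"]) auto
    have "mon w * y \<in> supported (Zlow (m + l))"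
      by (rule supported_mult[OF _ assms(2), of _ "{w}"]) (use n in \<open>auto intro: Zw_simps\<close>)
    moreover have "Zlow (n + l) \<subseteq> Zlow (m + l)" using n(2) by auto
    from supported_mono[OF this] have "sta (mon w) y - mon w * y \<in> supported (Zlow (m + l))"
      using sta_lower[of "mon w" n y l] n assms(2) by auto
    ultimately show ?thesis using supported_add by fastforce
  qed
  have "x \<in> supported negw \<and> sta x y \<in> supported (Zlow (m + l))"
    using assms(1)
    by (induction rule: supported_induct)
      (use word Zw_negw in \<open>auto simp: sta_add_left sta_sc_left intro: supported_add supported_sc\<close>)
  then show ?thesis ..
qed

end

lemma supported_IntD1: "x \<in> supported (V \<inter> W) \<Longrightarrow> x \<in> supported V"
  by (simp add: supported_def)

text \<open>The degree of a word determines its number of \<open>F\<close> letters, and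
  \<open>J\<close> is graded. Hence parts with different numbers of \<open>F\<close> letters cannot
  cancel in the quotient.\<close>

lemma (in star_data) supported_lower_disjoint:
  assumes "y \<in> supported (Zwm m)" "z \<in> supported (Zlow m)" "q (y + z) = q 0"
  shows "q y = q 0"
proof -
  have yz: "y + z \<in> J" using assms(3) by (simp add: q_eq_iff)
  have "hcomp uq_degree \<mu> y \<in> J" if \<mu>: "\<mu> \<in> deg ` Poly_Mapping.keys y" for \<mu>
  proof -
    from \<mu> obtain w where w: "w \<in> Poly_Mapping.keys y" "deg w = \<mu>" by auto
    then have fl: "fl w = int m" using assms(1) by (auto simp: supported_def)
    have "v \<notin> Zlow m" if "deg v = \<mu>" for v using fl fl_cong[of v w] that w(2) by simp
    then have "Zlow m \<inter> {v. deg v = \<mu>} = {}" by blast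
    then have "Poly_Mapping.keys (hcomp uq_degree \<mu> z) = {}"
      using hcomp_supported[OF assms(2), of uq_degree \<mu>] by (simp add: supported_def)
    then have "hcomp uq_degree \<mu> z = 0" by simp
    then show ?thesis using hcomp_J[OF yz, of \<mu>] by simp
  qed
  then have "(\<Sum>\<mu>\<in>deg ` Poly_Mapping.keys y. hcomp uq_degree \<mu> y) \<in> J" by (intro J_sum)
  then have "y \<in> J" using hcomp_sum_keys[of y uq_degree] by simp
  then show ?thesis by (simp add: q_eq_iff)
qed

section \<open>Leading parts, and injectivity of \<open>\<psi>\<close>\<close>

locale phi_data = psi_data \<chi> I pr \<tau> c S \<sigma> d Fb Eb \<psi>
  for \<chi> :: "('i::{finite,linorder} \<Rightarrow> int) \<Rightarrow> ('i \<Rightarrow> int) \<Rightarrow> 'k::field" and I pr \<tau> c S \<sigma> d Fb Eb \<psi> +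
  fixes \<phi>
  assumes phi: "is_phi \<chi> I \<tau> c \<phi>"
begin

lemma phi_hom:
  assumes "X \<in> FilT m"
  shows "\<exists>y\<in>supported Zw. \<phi> (sy m X) = q y"
    and "Y \<in> FilT m \<Longrightarrow> \<phi> (sy m (X + Y)) = \<phi> (sy m X) \<oplus>\<^bsub>U \<chi> I\<^esub> \<phi> (sy m Y)"
    and "Y \<in> FilT l \<Longrightarrow> \<phi> (sy (m + l) (X * Y)) = \<phi> (sy m X) \<otimes>\<^bsub>U \<chi> I\<^esub> \<phi> (sy l Y)"
    and "\<phi> (sy m (sc a X)) = a \<odot>\<^bsub>U \<chi> I\<^esub> \<phi> (sy m X)"
proof -
  have hom: "\<phi> \<in> ring_hom (gr_B \<chi> I \<tau> c) ((U \<chi> I)\<lparr>carrier := H_theta_U_neg \<chi> I \<tau>\<rparr>)"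
    and smult: "\<And>a x. x \<in> carrier (gr_B \<chi> I \<tau> c) \<Longrightarrow> \<phi> (a \<odot>\<^bsub>gr_B \<chi> I \<tau> c\<^esub> x) = a \<odot>\<^bsub>U \<chi> I\<^esub> \<phi> x"
    using phi by (auto simp: is_phi_def alg_hom_def)
  note car = sy_carrier[OF assms]
  show "\<exists>y\<in>supported Zw. \<phi> (sy m X) = q y"
    using ring_hom_closed[OF hom car] by (auto simp: H_theta_U_neg_eq)
  show "\<phi> (sy m (X + Y)) = \<phi> (sy m X) \<oplus>\<^bsub>U \<chi> I\<^esub> \<phi> (sy m Y)" if "Y \<in> FilT m"
    using ring_hom_add[OF hom car sy_carrier[OF that]] by (simp add: sy_add)
  show "\<phi> (sy (m + l) (X * Y)) = \<phi> (sy m X) \<otimes>\<^bsub>U \<chi> I\<^esub> \<phi> (sy l Y)" if "Y \<in> FilT l"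
    using ring_hom_mult[OF hom car sy_carrier[OF that]] by (simp add: sy_mult[OF assms that])
  show "\<phi> (sy m (sc a X)) = a \<odot>\<^bsub>U \<chi> I\<^esub> \<phi> (sy m X)"
    using smult[OF car, of a] by (simp add: sy_sc)
qed

lemma phi_gens:
  "\<phi> (sy (Suc 0) (Bm i)) = q (Fm i)" "k \<in> supported Kt \<Longrightarrow> \<phi> (sy 0 k) = q k"
  using phi by (auto simp: is_phi_def B_gen_eq gen_eq_mon H_theta_eq simp flip: gr_symbol_eq)

lemma phi_0: "\<phi> (sy m 0) = q 0"
proof -
  obtain y where y: "\<phi> (sy m 0) = q y" using phi_hom(1)[OF T.subspace_0[OF subspace_FilT]] by blast
  show ?thesis using phi_hom(4)[OF T.subspace_0[OF subspace_FilT], of m 0] by (simp add: y q_simps)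
qed

lemma psi_Bm: "\<psi> (q (Bm i)) = q (Fm i)"
proof -
  have "beta i 1 = Fm i" using ract_Em_K[of 0 "\<tau> i"] by (simp add: beta_def)
  then show ?thesis
    using psi_beta[OF Bs_1 psi_K[of 1], of i] by (simp add: one_supported_iff Zw_simps Z_theta_0)
qed

text \<open>On symbols of products of generators, \<open>\<phi>\<close> takes the leading part of \<open>\<psi>\<close>.\<close>

lemma phi_psi_products:
  "(m, A) \<in> gp \<Longrightarrow> \<exists>X\<in>Bs. A = q X \<and> (m, q X) \<in> gp \<and>
    (\<exists>y\<in>supported (Zwm m). \<exists>z\<in>supported (Zlow m). \<phi> (sy m X) = q y \<and> \<psi> (q X) = q (y + z))"
proof (induction rule: graded_products.induct)
  case one
  have "(0, q 1) \<in> gp" using graded_products.one[of "U \<chi> I"] by (simp add: q_simps)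
  moreover have "(1 :: ('i, 'k) free_uq) \<in> supported Kt" by (simp add: one_supported_iff Z_theta_0)
  ultimately show ?case
    using Bs_1 phi_gens(2)[of 1] psi_K[of 1]
    by (intro bexI[of _ 1] conjI bexI[of _ 0]) (auto simp: q_simps one_supported_iff Zw_simps)
next
  case (deg0 m x h)
  then obtain X y z k where X: "X \<in> Bs" "x = q X" "(m, q X) \<in> gp"
    and y: "y \<in> supported (Zwm m)" and z: "z \<in> supported (Zlow m)"
    and eq: "\<phi> (sy m X) = q y" "\<psi> (q X) = q (y + z)" and k: "k \<in> supported Kt" "h = q k"
    by (auto simp: H_theta_eq)
  have fl0: "fl w = 0" if "w \<in> Kt" for w using that M.deg_K_word[of w] by (simp add: fl_def fun_apply_simps)
  have gp: "(0, q k) \<in> gp" "(m, q (X * k)) \<in> gp"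
    using graded_products.deg0[OF graded_products.one, of h _ "U \<chi> I"] graded_products.deg0[OF X(3) deg0.hyps(2)]
      deg0.hyps(2) k by (simp_all add: q_simps)
  have yz: "y + z \<in> supported Zw" "k \<in> supported Zw"
    using supported_add[OF y[THEN supported_IntD1] z[THEN supported_IntD1]] k(1) supported_mono[OF Kt_Zw] by auto
  have "\<phi> (sy m (X * k)) = q (y * k)"
    using phi_hom(3)[OF FilT_gp[OF X(3) order_refl] FilT_gp[OF gp(1) order_refl]] phi_gens(2)[OF k(1)]
    by (simp add: eq q_simps)
  moreover have "\<psi> (q (X * k)) = q (y * k + z * k)"
    using psi_mult[OF X(1) Bs_gen[of k]] k yz by (simp add: eq psi_K star_q sta_Kt supported_Zw_negw distrib_right)
  moreover have "y * k \<in> supported (Zwm m)" "z * k \<in> supported (Zlow m)"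
    using supported_mult[OF y k(1), of "Zwm m"] supported_mult[OF z k(1), of "Zlow m"] fl0 Kt_Zw
    by (auto intro!: Zw_simps(2))
  moreover have "X * k \<in> Bs" using k by (intro Bs_mult[OF X(1) Bs_gen]) auto
  moreover have "x \<otimes>\<^bsub>U \<chi> I\<^esub> h = q (X * k)" by (simp add: X k q_simps)
  ultimately show ?case using gp(2) by blast
next
  case (deg1 m x g)
  then obtain X y z i where X: "X \<in> Bs" "x = q X" "(m, q X) \<in> gp"
    and y: "y \<in> supported (Zwm m)" and z: "z \<in> supported (Zlow m)"
    and eq: "\<phi> (sy m X) = q y" "\<psi> (q X) = q (y + z)" and g: "g = q (Bm i)"
    by (auto simp: B_gen_eq)
  have gp: "(Suc 0, q (Bm i)) \<in> gp" "(Suc m, q (X * Bm i)) \<in> gp"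
    using graded_products.deg1[OF graded_products.one, of g _ "U \<chi> I"] graded_products.deg1[OF X(3) deg1.hyps(2)]
      deg1.hyps(2) g by (simp_all add: q_simps)
  have F: "Fm i \<in> supported (Zwm 1)" "Fm i \<in> supported Zw" using Fw_Zw by auto
  have yz: "y \<in> supported Zw" "z \<in> supported Zw" using y z by (auto simp: supported_def)
  have "\<phi> (sy (Suc m) (X * Bm i)) = q (y * Fm i)"
    using phi_hom(3)[OF FilT_gp[OF X(3) order_refl] FilT_gp[OF gp(1) order_refl]] phi_gens(1)[of i]
    by (simp add: eq q_simps)
  \<comment> \<open>Star multiplication by \<open>F_i\<close> is the ordinary product up to lower
    terms and keeps lower terms low, so the leading parts multiply like the values of
    \<open>\<phi>\<close>.\<close>
  moreover have "\<psi> (q (X * Bm i)) = q (y * Fm i + ((sta y (Fm i) - y * Fm i) + sta z (Fm i)))"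
    using psi_mult[OF X(1) Bs_gen[of "Bm i"]] yz F
    by (simp add: eq psi_Bm star_q supported_add sta_add_left supported_Zw_negw)
  moreover have "y * Fm i \<in> supported (Zwm (Suc m))"
    by (rule supported_mult[OF y F(1)]) (auto intro: Zw_simps)
  moreover have "(sta y (Fm i) - y * Fm i) + sta z (Fm i) \<in> supported (Zlow (Suc m))"
    using supported_add[OF sta_lower[OF y F(1)] sta_Zlow[OF z F(1)]] by simp
  moreover have "X * Bm i \<in> Bs" by (intro Bs_mult[OF X(1) Bs_gen]) auto
  moreover have "x \<otimes>\<^bsub>U \<chi> I\<^esub> g = q (X * Bm i)" by (simp add: X g q_simps)
  ultimately show ?case using gp(2) by blast
qed

lemma Zlow_subset: "supported (Zwm j) \<subseteq> supported (Zlow m)" "supported (Zlow j) \<subseteq> supported (Zlow m)" if "j < m"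
  using that by (auto intro!: supported_mono)

text \<open>The statement of \<open>phi_psi\<close> in a form that passes to linear combinations;
  membership in \<open>Bs\<close> is included for the use of \<open>psi_linear\<close>.\<close>

definition leading :: "nat \<Rightarrow> ('i, 'k) free_uq \<Rightarrow> bool" where
  "leading m X \<longleftrightarrow> X \<in> FilT m \<and> X \<in> Bs \<and>
    (\<exists>y\<in>supported (Zwm m). \<exists>z\<in>supported (Zlow m). \<phi> (sy m X) = q y \<and> \<psi> (q X) = q (y + z))"

lemma leading_add:
  assumes "leading m X" "leading m Y"
  shows "leading m (X + Y)"
proof -
  from assms obtain y z y' z' where X: "X \<in> FilT m" "X \<in> Bs" "y \<in> supported (Zwm m)" "z \<in> supported (Zlow m)"
      "\<phi> (sy m X) = q y" "\<psi> (q X) = q (y + z)"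
    and Y: "Y \<in> FilT m" "Y \<in> Bs" "y' \<in> supported (Zwm m)" "z' \<in> supported (Zlow m)"
      "\<phi> (sy m Y) = q y'" "\<psi> (q Y) = q (y' + z')"
    unfolding leading_def by blast
  have "y + z \<in> supported Zw" "y' + z' \<in> supported Zw"
    using supported_add[OF X(3)[THEN supported_IntD1] X(4)[THEN supported_IntD1]]
      supported_add[OF Y(3)[THEN supported_IntD1] Y(4)[THEN supported_IntD1]] by auto
  then have "\<psi> (q (X + Y)) = q ((y + y') + (z + z'))"
    using psi_linear(1)[OF X(2) Y(2) X(6) Y(6)] by (simp add: add_ac)
  moreover have "\<phi> (sy m (X + Y)) = q (y + y')" using phi_hom(2)[OF X(1) Y(1)] X Y by (simp add: q_simps)
  moreover have "X + Y \<in> FilT m" "X + Y \<in> Bs"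
    using X Y T.subspace_add[OF subspace_FilT] T.subspace_add[OF subspace_Bs] by auto
  moreover have "y + y' \<in> supported (Zwm m)" "z + z' \<in> supported (Zlow m)" using X Y by (auto intro: supported_add)
  ultimately show ?thesis unfolding leading_def by blast
qed

lemma leading_sc:
  assumes "leading m X"
  shows "leading m (sc a X)"
proof -
  from assms obtain y z where X: "X \<in> FilT m" "X \<in> Bs" "y \<in> supported (Zwm m)" "z \<in> supported (Zlow m)"
      "\<phi> (sy m X) = q y" "\<psi> (q X) = q (y + z)"
    unfolding leading_def by blast
  have "y + z \<in> supported Zw"
    using supported_add[OF X(3)[THEN supported_IntD1] X(4)[THEN supported_IntD1]] by auto
  then have "\<psi> (q (sc a X)) = q (sc a y + sc a z)"
    using psi_linear(3)[OF X(2,2,6,6)] by (simp add: sc_add_right)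
  moreover have "\<phi> (sy m (sc a X)) = q (sc a y)" using phi_hom(4)[OF X(1)] X by (simp add: q_simps)
  moreover have "sc a X \<in> FilT m" "sc a X \<in> Bs"
    using X T.subspace_scale[OF subspace_FilT] T.subspace_scale[OF subspace_Bs] by auto
  moreover have "sc a y \<in> supported (Zwm m)" "sc a z \<in> supported (Zlow m)" using X by (auto intro: supported_sc)
  ultimately show ?thesis unfolding leading_def by blast
qed

lemma leading_0: "leading m 0"
  using leading_sc[of m 0 0] phi_0[of m] psi_K[of 0] T.subspace_0[OF subspace_FilT] T.subspace_0[OF subspace_Bs]
  by (auto simp: leading_def intro!: bexI[of _ 0])

text \<open>By linearity, products of generators suffice. Those of degree \<open>j < m\<close> have
  zero symbol in degree \<open>m\<close>, so \<open>\<phi>\<close> gives 0 and their whole image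
  under \<open>\<psi>\<close> counts as lower part.\<close>

lemma phi_psi:
  assumes "X \<in> FilT m"
  shows "\<exists>y\<in>supported (Zwm m). \<exists>z\<in>supported (Zlow m). \<phi> (sy m X) = q y \<and> \<psi> (q X) = q (y + z)"
proof -
  have "Fil m \<subseteq> q ` {X. leading m X}"
  proof (rule Fil_subset)
    show "T.subspace {X. leading m X}" by (auto simp: T.subspace_def leading_0 leading_add leading_sc)
    fix j X assume j: "j \<le> m" "(j, q X) \<in> gp"
    from phi_psi_products[OF j(2)] obtain X' y z where X': "X' \<in> Bs" "q X = q X'" "(j, q X') \<in> gp"
      and y: "y \<in> supported (Zwm j)" and z: "z \<in> supported (Zlow j)" and eq: "\<phi> (sy j X') = q y" "\<psi> (q X') = q (y + z)"
      by blast
    have fil: "X' \<in> FilT m" "X' \<in> FilT j" using FilT_gp[OF X'(3)] j by auto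
    have "leading m X'"
    proof (cases "j = m")
      case True
      then show ?thesis using X' y z eq fil unfolding leading_def by blast
    next
      case False
      then have "j < m" using j by simp
      then have "sy m X' = sy m 0" using fil FilT_lowT by (simp add: sy_eq_iff)
      then have "\<phi> (sy m X') = q 0" using phi_0 by simp
      moreover have "y + z \<in> supported (Zlow m)"
        using Zlow_subset[OF \<open>j < m\<close>] y z by (intro supported_add) blast+
      moreover have "\<psi> (q X') = q (0 + (y + z))" using eq by simp
      ultimately show ?thesis using X'(1) fil(1) supported_0 unfolding leading_def by blast
    qed
    then show "q X \<in> q ` {X. leading m X}" using X'(2) by auto
  qed
  then obtain Y where Y: "leading m Y" "q X = q Y" using assms unfolding FilT_def by blast
  have "X - Y \<in> lowT m" using Y(2) by (intro J_lowT) (simp add: q_eq_iff)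
  then have "sy m X = sy m Y" by (simp add: sy_eq_iff)
  then show ?thesis using Y unfolding leading_def by simp
qed

text \<open>Let \<open>m\<close> be minimal such that \<open>X\<close> lies in step
  \<open>m\<close>. If \<open>\<psi>\<close> kills \<open>X\<close>, its leading part is zero in the
  quotient, so \<open>\<phi>\<close> kills the symbol and \<open>X\<close> lies in the space below
  step \<open>m\<close>. By minimality \<open>m\<close> is 0, where that space is zero.\<close>

lemma psi_inj:
  assumes inj: "inj_on \<phi> (carrier (gr_B \<chi> I \<tau> c))" and X: "X \<in> Bs" "\<psi> (q X) = q 0"
  shows "q X = q 0"
proof -
  define m where "m = (LEAST m. X \<in> FilT m)"
  have m: "X \<in> FilT m" unfolding m_def using Bs_FilT[OF X(1)] by (rule LeastI_ex)
  from phi_psi[OF m] obtain y z where yz: "y \<in> supported (Zwm m)" "z \<in> supported (Zlow m)"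
    "\<phi> (sy m X) = q y" "\<psi> (q X) = q (y + z)" by blast
  then have "q y = q 0" using X(2) by (intro supported_lower_disjoint[of y m z]) auto
  then have "\<phi> (sy m X) = \<phi> (sy m 0)" using yz(3) phi_0 by simp
  then have "sy m X = sy m 0"
    using inj m T.subspace_0[OF subspace_FilT] by (auto simp: inj_on_def sy_carrier)
  then have low: "X \<in> lowT m" by (simp add: sy_eq_iff)
  show ?thesis
  proof (cases m)
    case 0
    then show ?thesis using low by (simp add: lowT_def q_eq_iff)
  next
    case (Suc l)
    then have "X \<in> FilT l" using low by (simp add: lowT_def)
    then have "m \<le> l" unfolding m_def by (rule Least_le)
    then show ?thesis using Suc by simp
  qed
qed

theorem psi_bij:
  assumes "inj_on \<phi> (carrier (gr_B \<chi> I \<tau> c))"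
  shows "bij_betw \<psi> (B_alg \<chi> I \<tau> c) (H_theta_U_neg \<chi> I \<tau>)"
  unfolding bij_betw_def
proof
  show "inj_on \<psi> (B_alg \<chi> I \<tau> c)"
  proof (rule inj_onI)
    fix A B assume "A \<in> B_alg \<chi> I \<tau> c" "B \<in> B_alg \<chi> I \<tau> c" and eq: "\<psi> A = \<psi> B"
    then obtain X Y where XY: "X \<in> Bs" "A = q X" "Y \<in> Bs" "B = q Y" by (auto simp: B_alg_eq)
    obtain b where b: "b \<in> supported Zw" "\<psi> (q X) = q b" using psi_Bs[OF XY(1)] by blast
    have "\<psi> (q (X - Y)) = q (b - b)" using psi_linear(2)[OF XY(1,3), of b b] b eq XY by simp
    then have "q (X - Y) = q 0"
      using psi_inj[OF assms T.subspace_diff[OF subspace_Bs XY(1,3)]] by simp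
    then show "A = B" by (simp add: XY q_eq_iff)
  qed
  have "\<psi> A \<in> H_theta_U_neg \<chi> I \<tau>" if A: "A \<in> B_alg \<chi> I \<tau> c" for A
  proof -
    from A obtain X where "X \<in> Bs" "A = q X" by (auto simp: B_alg_eq)
    with psi_Bs[of X] show ?thesis by (auto simp: H_theta_U_neg_eq)
  qed
  moreover have "a \<in> \<psi> ` B_alg \<chi> I \<tau> c" if a: "a \<in> H_theta_U_neg \<chi> I \<tau>" for a
  proof -
    from a obtain x where x: "x \<in> supported Zw" "a = q x" by (auto simp: H_theta_U_neg_eq)
    from psi_surj[OF x(1)] obtain X where "X \<in> Bs" "\<psi> (q X) = q x" by blast
    then show ?thesis by (intro image_eqI[of _ _ "q X"]) (simp_all add: B_alg_eq x)
  qed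
  ultimately show "\<psi> ` B_alg \<chi> I \<tau> c = H_theta_U_neg \<chi> I \<tau>" by blast
qed

theorem star_eq_psi:
  assumes "bij_betw \<psi> (B_alg \<chi> I \<tau> c) (H_theta_U_neg \<chi> I \<tau>)"
    "a \<in> H_theta_U_neg \<chi> I \<tau>" "b \<in> H_theta_U_neg \<chi> I \<tau>"
  shows "star a b = \<psi> (inv_into (B_alg \<chi> I \<tau> c) \<psi> a \<otimes>\<^bsub>U \<chi> I\<^esub> inv_into (B_alg \<chi> I \<tau> c) \<psi> b)"
proof -
  have inv: "\<exists>X\<in>Bs. inv_into (B_alg \<chi> I \<tau> c) \<psi> a = q X \<and> \<psi> (q X) = a" if "a \<in> H_theta_U_neg \<chi> I \<tau>" for a
  proof -
    have im: "a \<in> \<psi> ` B_alg \<chi> I \<tau> c" using that assms(1) by (simp add: bij_betw_def)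
    then show ?thesis using inv_into_into[OF im] f_inv_into_f[OF im] by (auto simp: B_alg_eq)
  qed
  obtain X Y where "X \<in> Bs" "inv_into (B_alg \<chi> I \<tau> c) \<psi> a = q X" "\<psi> (q X) = a"
    "Y \<in> Bs" "inv_into (B_alg \<chi> I \<tau> c) \<psi> b = q Y" "\<psi> (q Y) = b"
    using inv[OF assms(2)] inv[OF assms(3)] by blast
  then show ?thesis using psi_mult[of X Y] by (simp add: q_simps)
qed

end

theorem theoremE:
  fixes \<chi> :: "('i::{finite,linorder} \<Rightarrow> int) \<Rightarrow> ('i \<Rightarrow> int) \<Rightarrow> 'k::field"
    and I :: "('i word \<Rightarrow>\<^sub>0 'k) set"
    and \<tau> :: "'i \<Rightarrow> 'i"
    and c :: "'i \<Rightarrow> 'k"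
    and pr :: "('i, 'k) free_uq set \<Rightarrow> ('i, 'k) free_uq set \<Rightarrow> 'k"
    and S \<sigma> :: "('i, 'k) free_uq set \<Rightarrow> ('i, 'k) free_uq set"
    and d :: "('i \<Rightarrow> nat) \<Rightarrow> nat"
    and Fb Eb :: "('i \<Rightarrow> nat) \<Rightarrow> nat \<Rightarrow> ('i, 'k) free_uq set"
  assumes "bicharacter \<chi>"
    and "\<And>i j. \<chi> (\<alpha> i) (\<alpha> j) = \<chi> (\<alpha> j) (\<alpha> i)"
    and "graded_biideal \<chi> I"
    and "diagram_automorphism \<chi> I \<tau>"
    and "is_antipode \<chi> (I_max \<chi>) S"
    and "is_pairing \<chi> (I_max \<chi>) pr"
    and "dual_bases \<chi> (I_max \<chi>) pr d Fb Eb"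
    and "is_sigma_bar \<chi> (I_max \<chi>) \<tau> c \<sigma>"
  shows "\<exists>star.
      determined_star \<chi> I \<tau> pr S \<sigma> d Fb Eb star \<and>
      (\<forall>star'. determined_star \<chi> I \<tau> pr S \<sigma> d Fb Eb star' \<longrightarrow>
         (\<forall>a\<in>H_theta_U_neg \<chi> I \<tau>. \<forall>b\<in>H_theta_U_neg \<chi> I \<tau>. star' a b = star a b)) \<and>
      star_product (U \<chi> I) (H_theta_U_neg \<chi> I \<tau>) (H_theta_U_neg_component \<chi> I \<tau>) star \<and>
      zero_equivariant (U \<chi> I) (H_theta_U_neg \<chi> I \<tau>) (H_theta_U_neg_component \<chi> I \<tau>) star \<and>
      (\<forall>\<phi> \<psi>. is_phi \<chi> I \<tau> c \<phi> \<and> is_psi \<chi> I \<tau> \<psi> \<and>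
         bij_betw \<phi> (carrier (gr_B \<chi> I \<tau> c)) (H_theta_U_neg \<chi> I \<tau>) \<longrightarrow>
         bij_betw \<psi> (B_alg \<chi> I \<tau> c) (H_theta_U_neg \<chi> I \<tau>) \<and>
         (\<forall>a\<in>H_theta_U_neg \<chi> I \<tau>. \<forall>b\<in>H_theta_U_neg \<chi> I \<tau>.
            star a b = \<psi> (inv_into (B_alg \<chi> I \<tau> c) \<psi> a
                           \<otimes>\<^bsub>U \<chi> I\<^esub> inv_into (B_alg \<chi> I \<tau> c) \<psi> b)))"
proof -
  interpret star_data \<chi> I pr \<tau> c S \<sigma> d Fb Eb
    by unfold_locales (fact assms)+
  show ?thesis
  proof (intro exI[of _ star] conjI allI impI ballI)
    fix star' a b assume "determined_star \<chi> I \<tau> pr S \<sigma> d Fb Eb star'" "a \<in> H_theta_U_neg \<chi> I \<tau>" "b \<in> H_theta_U_neg \<chi> I \<tau>"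
    then show "star' a b = star a b" by (intro determined_star_unique determined_star_star)
  next
    fix \<phi> \<psi> assume *: "is_phi \<chi> I \<tau> c \<phi> \<and> is_psi \<chi> I \<tau> \<psi> \<and>
         bij_betw \<phi> (carrier (gr_B \<chi> I \<tau> c)) (H_theta_U_neg \<chi> I \<tau>)"
    interpret phi_data \<chi> I pr \<tau> c S \<sigma> d Fb Eb \<psi> \<phi>
      by unfold_locales (use * in auto)
    show bij: "bij_betw \<psi> (B_alg \<chi> I \<tau> c) (H_theta_U_neg \<chi> I \<tau>)"
      using * by (intro psi_bij) (auto simp: bij_betw_def)
    fix a b assume "a \<in> H_theta_U_neg \<chi> I \<tau>" "b \<in> H_theta_U_neg \<chi> I \<tau>"
    with bij show "star a b = \<psi> (inv_into (B_alg \<chi> I \<tau> c) \<psi> a \<otimes>\<^bsub>U \<chi> I\<^esub> inv_into (B_alg \<chi> I \<tau> c) \<psi> b)"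
      by (rule star_eq_psi)
  qed (fact determined_star_star star_product_star zero_equivariant_star)+
qed

end
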